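(* Let $s\in(0,1)$ and let $(M_j,g_j)$, $j\in\{1,2\}$, be two smooth, closed, connected Riemannian manifolds of dimension $n\ge2$. Let $O_1\subset M_1$, $O_2\subset M_2$ be open sets such that $(O_1,g_1)=(O_2,g_2)=:(O,g)$ (identified as one and the same Riemannian manifold). Let $L^{g_j}_{1,O}$ and $L^{g_j}_{s,O}$, $j\in\{1,2\}$, be the local and nonlocal source-to-solution maps. Assume that uniqueness (up to the natural gauge) holds in the local problem, i.e. that the following implication is valid: if $L^{g_1}_{1,O}=L^{g_2}_{1,O}$, then there exists a smooth diffeomorphism $\Phi:M_1\to M_2$ such that $\Phi^*g_2=g_1$. Then uniqueness (up to the natural gauge) also holds in the nonlocal problem, i.e. if $L^{g_1}_{s,O}=L^{g_2}_{s,O}$, then there exists a smooth diffeomorphism $\Phi:M_1\to M_2$ such that $\Phi^*g_2=g_1$.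
   Context: For a smooth, closed, connected Riemannian manifold $(M,g)$ let $\{\phi_k\}_{k\ge0}$ be an $L^2(M)$-orthonormal basis of eigenfunctions of $-\Delta_g$ with eigenvalues $0=\lambda_0<\lambda_1\le\lambda_2\le\dots$. For $r\in\mathbb{R}$, $H^r(M)$ is the space of (generalized) functions with $\sum_k(1+\lambda_k)^r|(u,\phi_k)_{L^2(M)}|^2<\infty$; for $O\subset M$ open, $\tilde H^r(O)$ is the closure of $C_c^\infty(O)$ in $H^r(M)$ and $H^r(O)$ is the space of restrictions to $O$ of elements of $H^r(M)$. The spectral fractional Laplacian is $(-\Delta_g)^su=\sum_k\lambda_k^s(u,\phi_k)_{L^2(M)}\phi_k$. $L^{g}_{1,O}$ maps $f\in\tilde H^{-1}(O)$ with $(f,1)_{L^2(M)}=0$ to $v_f|_O\in H^1(O)$, where $(-\Delta_{g})v_f=f$ in $M$ and $(v_f,1)_{L^2(M)}=0$. $L^{g}_{s,O}$ maps $f\in\tilde H^{-s}(O)$ with $(f,1)_{L^2(M)}=0$ to $u_f|_O\in H^s(O)$, where $u_f\in H^s(M)$, $(-\Delta_{g})^su_f=f$ in $M$ and $(u_f,1)_{L^2(M)}=0$. The superscript $g_j$ refers to these maps on $(M_j,g_j)$. *)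

theory Defs
  imports "HOL-Analysis.Analysis"
begin

section \<open>Smooth functions on open subsets of Euclidean space\<close>

definition pderiv_at :: "'n::finite \<Rightarrow> (real^'n \<Rightarrow> 'b::real_normed_vector) \<Rightarrow> real^'n \<Rightarrow> 'b" where
  "pderiv_at i F x = frechet_derivative F (at x) (axis i 1)"

definition iter_pderiv :: "'n::finite list \<Rightarrow> (real^'n \<Rightarrow> 'b::real_normed_vector) \<Rightarrow> real^'n \<Rightarrow> 'b" where
  "iter_pderiv is F = foldr pderiv_at is F"

text \<open>Only used for open sets \<open>U\<close>.  Differentiability of all iterated partial derivatives makes
  them all continuous, so this is the usual \<open>C\<^sup>\<infinity>\<close> condition.\<close>

definition smooth_on :: "(real^'n::finite) set \<Rightarrow> (real^'n \<Rightarrow> 'b::real_normed_vector) \<Rightarrow> bool" where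
  "smooth_on U F \<longleftrightarrow> (\<forall>is. \<forall>x\<in>U. iter_pderiv is F differentiable (at x))"


section \<open>Closed Riemannian manifolds\<close>

text \<open>The underlying space is the whole type \<open>'a\<close> with its topology, the smooth structure is given by
  an atlas, and the metric tensor by its matrices: \<open>gram M c p\<close> is the matrix \<open>(g\<^sub>i\<^sub>j)\<close> at the point
  \<open>p\<close> in the coordinates of the chart \<open>c\<close>.  A chart is a pair of its domain and its coordinate map;
  values of coordinate maps and of \<open>gram M c\<close> outside of the domain of \<open>c\<close> are irrelevant.\<close>

type_synonym ('a, 'n) chart = "'a set \<times> ('a \<Rightarrow> real^'n)"

record ('a, 'n) riemannian =
  atlas :: "('a, 'n::finite) chart set"
  gram :: "('a, 'n::finite) chart \<Rightarrow> 'a \<Rightarrow> real^'n^'n"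

abbreviation cdom :: "('a, 'n::finite) chart \<Rightarrow> 'a set" where
  "cdom c \<equiv> fst c"

abbreviation coord :: "('a, 'n::finite) chart \<Rightarrow> 'a \<Rightarrow> real^'n" where
  "coord c \<equiv> snd c"

definition param :: "('a, 'n::finite) chart \<Rightarrow> real^'n \<Rightarrow> 'a" where
  "param c = the_inv_into (cdom c) (coord c)"

definition is_chart :: "('a::topological_space, 'n::finite) chart \<Rightarrow> bool" where
  "is_chart c \<longleftrightarrow> open (cdom c) \<and> open (coord c ` cdom c) \<and> inj_on (coord c) (cdom c) \<and>
     homeomorphism (cdom c) (coord c ` cdom c) (coord c) (param c)"

definition smooth_map_on ::
  "('a::topological_space, 'n::finite) riemannian \<Rightarrow> ('b::topological_space, 'm::finite) riemannian
    \<Rightarrow> 'a set \<Rightarrow> ('a \<Rightarrow> 'b) \<Rightarrow> bool" where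
  "smooth_map_on M N S F \<longleftrightarrow> continuous_on S F \<and>
     (\<forall>c\<in>atlas M. \<forall>d\<in>atlas N.
        smooth_on (coord c ` {p \<in> cdom c \<inter> S. F p \<in> cdom d}) (coord d \<circ> F \<circ> param c))"

text \<open>\<open>F\<^sup>*g\<^sub>N = g\<^sub>M\<close> at every point of the open set \<open>S\<close>, in all coordinates.\<close>

definition pulls_back_metric_on ::
  "('a, 'n::finite) riemannian \<Rightarrow> ('b, 'n) riemannian \<Rightarrow> 'a set \<Rightarrow> ('a \<Rightarrow> 'b) \<Rightarrow> bool" where
  "pulls_back_metric_on M N S F \<longleftrightarrow>
     (\<forall>c\<in>atlas M. \<forall>d\<in>atlas N. \<forall>p \<in> cdom c \<inter> S. F p \<in> cdom d \<longrightarrow>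
        (let J = jacobian (coord d \<circ> F \<circ> param c) (at (coord c p))
         in gram M c p = transpose J ** gram N d (F p) ** J))"

text \<open>The last two conditions, both for the identity map, are the smooth compatibility of the
  charts and the transformation law of covariant 2-tensors.  Second countability follows from
  compactness.\<close>

definition closed_riemannian_manifold :: "('a::t2_space, 'n::finite) riemannian \<Rightarrow> bool" where
  "closed_riemannian_manifold M \<longleftrightarrow>
     compact (UNIV :: 'a set) \<and> connected (UNIV :: 'a set) \<and>
     (\<forall>c\<in>atlas M. is_chart c) \<and> (\<Union>c\<in>atlas M. cdom c) = UNIV \<and>
     (\<forall>c\<in>atlas M. smooth_on (coord c ` cdom c) (gram M c \<circ> param c)) \<and>
     (\<forall>c\<in>atlas M. \<forall>p\<in>cdom c. transpose (gram M c p) = gram M c p \<and>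
        (\<forall>v. v \<noteq> 0 \<longrightarrow> v \<bullet> (gram M c p *v v) > 0)) \<and>
     smooth_map_on M M UNIV (\<lambda>p. p) \<and>
     pulls_back_metric_on M M UNIV (\<lambda>p. p)"

definition diffeo_on ::
  "('a::topological_space, 'n::finite) riemannian \<Rightarrow> ('b::topological_space, 'n) riemannian
    \<Rightarrow> 'a set \<Rightarrow> 'b set \<Rightarrow> ('a \<Rightarrow> 'b) \<Rightarrow> bool" where
  "diffeo_on M N S T F \<longleftrightarrow> bij_betw F S T \<and> smooth_map_on M N S F \<and>
     smooth_map_on N M T (the_inv_into S F)"

definition smooth_functions :: "('a::topological_space, 'n::finite) riemannian \<Rightarrow> ('a \<Rightarrow> real) set" where
  "smooth_functions M = {f. \<forall>c\<in>atlas M. smooth_on (coord c ` cdom c) (f \<circ> param c)}"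

text \<open>\<open>C\<^sub>c\<^sup>\<infinity>(O)\<close>, with functions extended by zero.  Closed supports are compact since \<open>M\<close> is.\<close>

definition test_functions ::
  "('a::topological_space, 'n::finite) riemannian \<Rightarrow> 'a set \<Rightarrow> ('a \<Rightarrow> real) set" where
  "test_functions M S = {f \<in> smooth_functions M. closure {p. f p \<noteq> 0} \<subseteq> S}"

text \<open>The Riemannian volume measure, with density \<open>(det g)\<^sup>1\<^sup>/\<^sup>2\<close> in every chart.\<close>

definition riem_volume :: "('a::topological_space, 'n::finite) riemannian \<Rightarrow> 'a measure" where
  "riem_volume M = (THE \<mu>. sets \<mu> = sets borel \<and>
     (\<forall>c\<in>atlas M. \<forall>B\<in>sets borel. B \<subseteq> cdom c \<longrightarrow>
        emeasure \<mu> B =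
          (\<integral>\<^sup>+x\<in>coord c ` B. ennreal (sqrt (det (gram M c (param c x)))) \<partial>lborel)))"

definition l2_inner ::
  "('a::topological_space, 'n::finite) riemannian \<Rightarrow> ('a \<Rightarrow> real) \<Rightarrow> ('a \<Rightarrow> real) \<Rightarrow> real" where
  "l2_inner M f h = (\<integral>p. f p * h p \<partial>riem_volume M)"

text \<open>\<open>\<Delta>\<^sub>g f = (det g)\<^sup>-\<^sup>1\<^sup>/\<^sup>2 \<Sum>\<^sub>i \<partial>\<^sub>i ((det g)\<^sup>1\<^sup>/\<^sup>2 \<Sum>\<^sub>j g\<^sup>i\<^sup>j \<partial>\<^sub>j f)\<close> in local coordinates; the value does not
  depend on the chart.\<close>

definition laplacian_in ::
  "('a, 'n::finite) riemannian \<Rightarrow> ('a, 'n) chart \<Rightarrow> ('a \<Rightarrow> real) \<Rightarrow> real^'n \<Rightarrow> real" where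
  "laplacian_in M c f x =
     (let G = (\<lambda>y. gram M c (param c y)) in
      1 / sqrt (det (G x)) *
      (\<Sum>i\<in>UNIV. pderiv_at i
         (\<lambda>y. sqrt (det (G y)) * (\<Sum>j\<in>UNIV. matrix_inv (G y) $ i $ j * pderiv_at j (f \<circ> param c) y)) x))"

definition laplacian ::
  "('a, 'n::finite) riemannian \<Rightarrow> ('a \<Rightarrow> real) \<Rightarrow> 'a \<Rightarrow> real" where
  "laplacian M f p = (let c = (SOME c. c \<in> atlas M \<and> p \<in> cdom c) in laplacian_in M c f (coord c p))"


section \<open>Distributions, Sobolev spaces and the fractional Laplacian\<close>

text \<open>A distribution is a linear functional on \<open>C\<^sup>\<infinity>(M)\<close> that is bounded by finitely many of the
  seminorms \<open>sup\<^sub>p\<^sub>\<in>\<^sub>K |\<partial>\<^sup>\<alpha>(\<psi> \<circ> c\<^sup>-\<^sup>1)(c p)|\<close>; as a function of the type of HOL it is normalised to be zero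
  outside of \<open>C\<^sup>\<infinity>(M)\<close>.\<close>

type_synonym 'a functional = "('a \<Rightarrow> real) \<Rightarrow> real"

definition distributions :: "('a::topological_space, 'n::finite) riemannian \<Rightarrow> 'a functional set" where
  "distributions M = {u.
     (\<forall>\<psi>. \<psi> \<notin> smooth_functions M \<longrightarrow> u \<psi> = 0) \<and>
     (\<forall>\<psi>\<in>smooth_functions M. \<forall>\<eta>\<in>smooth_functions M. u (\<lambda>p. \<psi> p + \<eta> p) = u \<psi> + u \<eta>) \<and>
     (\<forall>a. \<forall>\<psi>\<in>smooth_functions M. u (\<lambda>p. a * \<psi> p) = a * u \<psi>) \<and>
     (\<exists>\<K> N C. finite \<K> \<and> (\<forall>(c, K)\<in>\<K>. c \<in> atlas M \<and> compact K \<and> K \<subseteq> cdom c) \<and>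
        (\<forall>\<psi>\<in>smooth_functions M. \<forall>B\<ge>0.
           (\<forall>(c, K)\<in>\<K>. \<forall>p\<in>K. \<forall>is. length is \<le> N \<longrightarrow>
               \<bar>iter_pderiv is (\<psi> \<circ> param c) (coord c p)\<bar> \<le> B)
           \<longrightarrow> \<bar>u \<psi>\<bar> \<le> C * B))}"

definition dist_of ::
  "('a::topological_space, 'n::finite) riemannian \<Rightarrow> ('a \<Rightarrow> real) \<Rightarrow> 'a functional" where
  "dist_of M f = (\<lambda>\<psi>. if \<psi> \<in> smooth_functions M then l2_inner M f \<psi> else 0)"

text \<open>\<open>e k\<close> and \<open>l k\<close> are the eigenfunction \<open>\<phi>\<^sub>k\<close> and the eigenvalue \<open>\<lambda>\<^sub>k\<close> of \<open>-\<Delta>\<^sub>g\<close>.\<close>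

definition laplace_eigenbasis ::
  "('a::topological_space, 'n::finite) riemannian \<Rightarrow> (nat \<Rightarrow> 'a \<Rightarrow> real) \<Rightarrow> (nat \<Rightarrow> real) \<Rightarrow> bool" where
  "laplace_eigenbasis M e l \<longleftrightarrow>
     l 0 = 0 \<and> 0 < l 1 \<and> mono l \<and>
     (\<forall>k. e k \<in> smooth_functions M \<and> (\<forall>p. - laplacian M (e k) p = l k * e k p)) \<and>
     (\<forall>j k. l2_inner M (e j) (e k) = (if j = k then 1 else 0)) \<and>
     (\<forall>f\<in>borel_measurable (riem_volume M). integrable (riem_volume M) (\<lambda>p. (f p)\<^sup>2) \<longrightarrow>
        (\<lambda>n. \<integral>p. (f p - (\<Sum>k<n. l2_inner M f (e k) * e k p))\<^sup>2 \<partial>riem_volume M) \<longlonglongrightarrow> 0)"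

text \<open>\<open>H\<^sup>r(M)\<close> and its norm; for a distribution \<open>u\<close>, \<open>(u, \<phi>\<^sub>k)\<close> is the value \<open>u (e k)\<close>.\<close>

definition sobolev ::
  "('a::topological_space, 'n::finite) riemannian \<Rightarrow> (nat \<Rightarrow> 'a \<Rightarrow> real) \<Rightarrow> (nat \<Rightarrow> real) \<Rightarrow> real
    \<Rightarrow> 'a functional set" where
  "sobolev M e l r = {u \<in> distributions M. summable (\<lambda>k. (1 + l k) powr r * \<bar>u (e k)\<bar>\<^sup>2)}"

definition sobolev_norm ::
  "(nat \<Rightarrow> 'a \<Rightarrow> real) \<Rightarrow> (nat \<Rightarrow> real) \<Rightarrow> real \<Rightarrow> 'a functional \<Rightarrow> real" where
  "sobolev_norm e l r u = sqrt (\<Sum>k. (1 + l k) powr r * \<bar>u (e k)\<bar>\<^sup>2)"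

definition sobolev_tendsto ::
  "('a::topological_space, 'n::finite) riemannian \<Rightarrow> (nat \<Rightarrow> 'a \<Rightarrow> real) \<Rightarrow> (nat \<Rightarrow> real) \<Rightarrow> real
    \<Rightarrow> (nat \<Rightarrow> 'a \<Rightarrow> real) \<Rightarrow> 'a functional \<Rightarrow> bool" where
  "sobolev_tendsto M e l r h u \<longleftrightarrow>
     (\<lambda>m. sobolev_norm e l r (\<lambda>\<psi>. u \<psi> - dist_of M (h m) \<psi>)) \<longlonglongrightarrow> 0"

text \<open>The closure of \<open>C\<^sub>c\<^sup>\<infinity>(O)\<close> in \<open>H\<^sup>r(M)\<close>.\<close>

definition sobolev_tilde ::
  "('a::topological_space, 'n::finite) riemannian \<Rightarrow> (nat \<Rightarrow> 'a \<Rightarrow> real) \<Rightarrow> (nat \<Rightarrow> real) \<Rightarrow> real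
    \<Rightarrow> 'a set \<Rightarrow> 'a functional set" where
  "sobolev_tilde M e l r S = {u \<in> sobolev M e l r.
     \<exists>h. (\<forall>m. h m \<in> test_functions M S) \<and> sobolev_tendsto M e l r h u}"

definition restrict_dist ::
  "('a::topological_space, 'n::finite) riemannian \<Rightarrow> 'a set \<Rightarrow> 'a functional \<Rightarrow> 'a functional" where
  "restrict_dist M S u = (\<lambda>\<psi>. if \<psi> \<in> test_functions M S then u \<psi> else 0)"

text \<open>The operator \<open>-\<Delta>\<^sub>g\<close> on distributions, by symmetry.\<close>

definition neg_laplacian_dist ::
  "('a::topological_space, 'n::finite) riemannian \<Rightarrow> 'a functional \<Rightarrow> 'a functional" where
  "neg_laplacian_dist M u =
     (\<lambda>\<psi>. if \<psi> \<in> smooth_functions M then u (\<lambda>p. - laplacian M \<psi> p) else 0)"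

text \<open>\<open>\<Sum>\<^sub>k \<lambda>\<^sub>k\<^sup>s (u, \<phi>\<^sub>k) \<phi>\<^sub>k\<close>, as a distribution.  For \<open>k = 0\<close> note that \<open>0 powr s = 0\<close>.\<close>

definition frac_laplacian ::
  "('a::topological_space, 'n::finite) riemannian \<Rightarrow> (nat \<Rightarrow> 'a \<Rightarrow> real) \<Rightarrow> (nat \<Rightarrow> real) \<Rightarrow> real
    \<Rightarrow> 'a functional \<Rightarrow> 'a functional" where
  "frac_laplacian M e l s u =
     (\<lambda>\<psi>. if \<psi> \<in> smooth_functions M
          then (\<Sum>k. l k powr s * u (e k) * l2_inner M (e k) \<psi>) else 0)"


section \<open>Source-to-solution maps\<close>

definition mean_zero :: "'a functional \<Rightarrow> bool" where
  "mean_zero u \<longleftrightarrow> u (\<lambda>_. 1) = 0"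

definition local_source_to_solution ::
  "('a::topological_space, 'n::finite) riemannian \<Rightarrow> (nat \<Rightarrow> 'a \<Rightarrow> real) \<Rightarrow> (nat \<Rightarrow> real)
    \<Rightarrow> 'a set \<Rightarrow> 'a functional \<Rightarrow> 'a functional" where
  "local_source_to_solution M e l S f =
     restrict_dist M S (THE v. v \<in> sobolev M e l 1 \<and> neg_laplacian_dist M v = f \<and> mean_zero v)"

definition frac_source_to_solution ::
  "('a::topological_space, 'n::finite) riemannian \<Rightarrow> (nat \<Rightarrow> 'a \<Rightarrow> real) \<Rightarrow> (nat \<Rightarrow> real) \<Rightarrow> real
    \<Rightarrow> 'a set \<Rightarrow> 'a functional \<Rightarrow> 'a functional" where
  "frac_source_to_solution M e l s S f =
     restrict_dist M S (THE u. u \<in> sobolev M e l s \<and> frac_laplacian M e l s u = f \<and> mean_zero u)"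

text \<open>The identification of two open sets is an isometry \<open>i\<close> from \<open>S \<subseteq> M\<^sub>1\<close> onto \<open>T \<subseteq> M\<^sub>2\<close>.  It carries
  test functions on \<open>S\<close> to test functions on \<open>T\<close>, and hence distributions on \<open>T\<close> to distributions
  on \<open>S\<close>; since isometries preserve the volume measure, on functions the latter is composition
  with \<open>i\<close>.\<close>

definition transplant :: "('a \<Rightarrow> 'b) \<Rightarrow> 'a set \<Rightarrow> 'b set \<Rightarrow> ('a \<Rightarrow> real) \<Rightarrow> 'b \<Rightarrow> real" where
  "transplant i S T h = (\<lambda>y. if y \<in> T then h (the_inv_into S i y) else 0)"

definition pullback_dist ::
  "('a::topological_space, 'n::finite) riemannian \<Rightarrow> ('a \<Rightarrow> 'b) \<Rightarrow> 'a set \<Rightarrow> 'b set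
    \<Rightarrow> 'b functional \<Rightarrow> 'a functional" where
  "pullback_dist M i S T w =
     (\<lambda>\<psi>. if \<psi> \<in> test_functions M S then w (transplant i S T \<psi>) else 0)"

text \<open>Elements of the closure of \<open>C\<^sub>c\<^sup>\<infinity>(O)\<close> in \<open>H\<^sup>r(M\<^sub>1)\<close> and in \<open>H\<^sup>r(M\<^sub>2)\<close> are the same source on \<open>O\<close> if they
  are limits of the same sequence in \<open>C\<^sub>c\<^sup>\<infinity>(O)\<close>.  Comparing restrictions to \<open>O\<close> instead would not do:
  for \<open>r < 0\<close> the closure may contain nonzero elements supported in the boundary of \<open>O\<close>.\<close>

definition same_source ::
  "('a::topological_space, 'n::finite) riemannian \<Rightarrow> (nat \<Rightarrow> 'a \<Rightarrow> real) \<Rightarrow> (nat \<Rightarrow> real) \<Rightarrow> 'a set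
    \<Rightarrow> ('b::topological_space, 'n) riemannian \<Rightarrow> (nat \<Rightarrow> 'b \<Rightarrow> real) \<Rightarrow> (nat \<Rightarrow> real) \<Rightarrow> 'b set
    \<Rightarrow> ('a \<Rightarrow> 'b) \<Rightarrow> real \<Rightarrow> 'a functional \<Rightarrow> 'b functional \<Rightarrow> bool" where
  "same_source M1 e1 l1 S M2 e2 l2 T i r f1 f2 \<longleftrightarrow>
     (\<exists>h. (\<forall>m. h m \<in> test_functions M1 S) \<and>
        sobolev_tendsto M1 e1 l1 r h f1 \<and>
        sobolev_tendsto M2 e2 l2 r (\<lambda>m. transplant i S T (h m)) f2)"

text \<open>Equality of the source-to-solution maps as maps on mean zero sources of order \<open>-s\<close> on \<open>O\<close>.\<close>

definition local_maps_agree ::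
  "('a::topological_space, 'n::finite) riemannian \<Rightarrow> (nat \<Rightarrow> 'a \<Rightarrow> real) \<Rightarrow> (nat \<Rightarrow> real) \<Rightarrow> 'a set
    \<Rightarrow> ('b::topological_space, 'n) riemannian \<Rightarrow> (nat \<Rightarrow> 'b \<Rightarrow> real) \<Rightarrow> (nat \<Rightarrow> real) \<Rightarrow> 'b set
    \<Rightarrow> ('a \<Rightarrow> 'b) \<Rightarrow> bool" where
  "local_maps_agree M1 e1 l1 S M2 e2 l2 T i \<longleftrightarrow>
     (\<forall>f1 \<in> sobolev_tilde M1 e1 l1 (-1) S. \<forall>f2 \<in> sobolev_tilde M2 e2 l2 (-1) T.
        mean_zero f1 \<and> mean_zero f2 \<and> same_source M1 e1 l1 S M2 e2 l2 T i (-1) f1 f2 \<longrightarrow>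
        local_source_to_solution M1 e1 l1 S f1 =
          pullback_dist M1 i S T (local_source_to_solution M2 e2 l2 T f2))"

definition frac_maps_agree ::
  "('a::topological_space, 'n::finite) riemannian \<Rightarrow> (nat \<Rightarrow> 'a \<Rightarrow> real) \<Rightarrow> (nat \<Rightarrow> real) \<Rightarrow> 'a set
    \<Rightarrow> ('b::topological_space, 'n) riemannian \<Rightarrow> (nat \<Rightarrow> 'b \<Rightarrow> real) \<Rightarrow> (nat \<Rightarrow> real) \<Rightarrow> 'b set
    \<Rightarrow> ('a \<Rightarrow> 'b) \<Rightarrow> real \<Rightarrow> bool" where
  "frac_maps_agree M1 e1 l1 S M2 e2 l2 T i s \<longleftrightarrow>
     (\<forall>f1 \<in> sobolev_tilde M1 e1 l1 (-s) S. \<forall>f2 \<in> sobolev_tilde M2 e2 l2 (-s) T.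
        mean_zero f1 \<and> mean_zero f2 \<and> same_source M1 e1 l1 S M2 e2 l2 T i (-s) f1 f2 \<longrightarrow>
        frac_source_to_solution M1 e1 l1 s S f1 =
          pullback_dist M1 i S T (frac_source_to_solution M2 e2 l2 s T f2))"

end

theory Submission
 imports Defs "HOL-Probability.Probability"
begin

text \<open>
 Expanding in eigenfunctions, the local and the fractional source-to-solution maps are given by
 the sums \<open>\<Sum>\<^sub>k \<lambda>\<^sub>k\<^sup>-\<^sup>r f\<^sub>k h\<^sub>k\<close> with \<open>r = 1\<close> and \<open>r = s\<close>, for sources \<open>f\<close> of mean zero and test functions \<open>h\<close> on the
 common open set. It is enough to show that the sums with \<open>r = s\<close> determine those with \<open>r = 1\<close>: then
 equality of the fractional maps gives equality of the local ones, and the assumed implication applies.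

 Let \<open>f\<close> and \<open>h\<close> have disjoint supports. The wave \<open>W(t) = \<Sum>\<^sub>k cos (t \<lambda>\<^sub>k\<^sup>1\<^sup>/\<^sup>2) f\<^sub>k h\<^sub>k\<close> vanishes for small \<open>t\<close> by finite
 propagation speed (\<open>finite_speed\<close>), and \<open>\<Sum>\<^sub>k \<lambda>\<^sub>k\<^sup>n f\<^sub>k h\<^sub>k = 0\<close> for all \<open>n\<close>, because the Laplacian is local. Therefore
 the Mellin integrals of \<open>W\<close> against \<open>t\<^sup>2\<^sup>s\<^sup>-\<^sup>3\<^sup>-\<^sup>2\<^sup>n\<close> converge after subtraction of Taylor polynomials from the
 cosines, and they equal \<open>\<Sum>\<^sub>k \<lambda>\<^sub>k\<^sup>n\<^sup>+\<^sup>1\<^sup>-\<^sup>s f\<^sub>k h\<^sub>k\<close> up to universal factors (\<open>mellin_W\<close>). These sums are fractional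
 potentials of \<open>\<Delta>\<^sup>n\<^sup>+\<^sup>1 f\<close>, hence agree for both manifolds. In the variable \<open>t\<^sup>-\<^sup>2\<close> the difference of the two waves
 lives on a bounded interval and has vanishing moments, so that its Laplace transform vanishes by
 Weierstrass approximation; this transform is a resolvent sum, and its limit at \<open>0\<close> is the sum with
 \<open>r = 1\<close> (\<open>inverse_sums_agree\<close>). Supports that are not disjoint are treated in \<open>pot_agree\<close>.

 If the open set is all of the first manifold, then it is all of the second by compactness and
 connectedness, and the given isometry is the diffeomorphism. Otherwise it is not closed, which
 leaves room for a test function away from a given support.

 The analysis behind this is built from local coordinates. Green's formula gives symmetry of the
 Laplacian and energy estimates; interior elliptic estimates show that a distribution, being bounded
 by finitely many derivatives, is bounded by norms of powers of the Laplacian, and is thus given by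
 its coefficients (\<open>distribution_expansion\<close>). The distribution equations then reduce to equations
 between coefficients.
\<close>


section \<open>Calculus of smooth functions on open subsets of Euclidean space\<close>

lemma has_derivative_open_cong:
 assumes "open U" "x \<in> U" "!!y. y \<in> U ==> f y = g y"
 shows "(f has_derivative D) (at x) \<longleftrightarrow> (g has_derivative D) (at x)"
 using has_derivative_transform_within_open[of f D x UNIV U g]
  has_derivative_transform_within_open[of g D x UNIV U f] assms by auto

lemma pderiv_at_cong:
 assumes "open U" "x \<in> U" "!!y. y \<in> U ==> f y = g y"
 shows "pderiv_at i f x = pderiv_at i g x"
 unfolding pderiv_at_def frechet_derivative_def
 using has_derivative_open_cong[OF assms] by simp

lemma differentiable_open_cong:
 assumes "open U" "x \<in> U" "!!y. y \<in> U ==> f y = g y"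
 shows "f differentiable (at x) \<longleftrightarrow> g differentiable (at x)"
 unfolding differentiable_def using has_derivative_open_cong[OF assms] by simp

lemma iter_pderiv_simps [simp]:
 "iter_pderiv [] f = f"
 "iter_pderiv (i # is) f = pderiv_at i (iter_pderiv is f)"
 "iter_pderiv (is @ js) f = iter_pderiv is (iter_pderiv js f)"
 by (auto simp: iter_pderiv_def)

lemma iter_pderiv_cong:
 assumes "open U" "x \<in> U" "!!y. y \<in> U ==> f y = g y"
 shows "iter_pderiv is f x = iter_pderiv is g x"
 using assms(2)
proof (induction "is" arbitrary: x)
 case (Cons i "is")
 then show ?case using pderiv_at_cong[OF assms(1), of x "iter_pderiv is f" "iter_pderiv is g"] by simp
qed (use assms in auto)

lemma smooth_on_subset: "smooth_on U f ==> V \<subseteq> U ==> smooth_on V f"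
 by (auto simp: smooth_on_def)

lemma smooth_on_cong:
 assumes "open U" "!!y. y \<in> U ==> f y = g y" "smooth_on U f"
 shows "smooth_on U g"
 unfolding smooth_on_def
proof (intro allI ballI)
 fix "is" x assume x: "x \<in> U"
 have "iter_pderiv is f differentiable (at x)" using assms x by (auto simp: smooth_on_def)
 then show "iter_pderiv is g differentiable (at x)"
  using differentiable_open_cong[OF assms(1) x, of "iter_pderiv is f" "iter_pderiv is g"]
   iter_pderiv_cong[OF assms(1) _ assms(2), of _ "\<lambda>y. y"] by blast
qed

lemma smooth_on_local:
 assumes "!!x. x \<in> U ==> \<exists>V. x \<in> V \<and> smooth_on V f" shows "smooth_on U f"
 using assms unfolding smooth_on_def by blast

lemma smooth_on_UN: "(!!i. i \<in> I ==> smooth_on (U i) f) ==> smooth_on (\<Union>i\<in>I. U i) f"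
 unfolding smooth_on_def by blast

lemma smooth_on_empty [simp]: "smooth_on {} f"
 by (auto simp: smooth_on_def)

lemma smooth_on_iter_pderiv: "smooth_on U f ==> smooth_on U (iter_pderiv js f)"
 unfolding smooth_on_def by (metis iter_pderiv_simps(3))

lemma smooth_on_pderiv: "smooth_on U f ==> smooth_on U (pderiv_at i f)"
 using smooth_on_iter_pderiv[of U f "[i]"] by simp

lemma smooth_on_differentiable: "smooth_on U f ==> x \<in> U ==> f differentiable (at x)"
 unfolding smooth_on_def using iter_pderiv_simps(1) by metis

lemma smooth_on_continuous_on: "smooth_on U f ==> continuous_on U f"
 by (metis continuous_at_imp_continuous_on differentiable_imp_continuous_within smooth_on_differentiable)

lemma pderiv_atI: "(f has_derivative f') (at x) ==> pderiv_at i f x = f' (axis i 1)"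
 unfolding pderiv_at_def by (metis frechet_derivative_at)

lemma linear_axis_expansion:
 fixes L :: "real^'n => 'b::real_vector"
 assumes "linear L" shows "L v = (\<Sum>i\<in>UNIV. v $ i *\<^sub>R L (axis i 1))"
proof -
 have "v = (\<Sum>i\<in>UNIV. v $ i *\<^sub>R axis i 1)"
  using basis_expansion[of v] by (simp add: scalar_mult_eq_scaleR)
 then have "L v = L (\<Sum>i\<in>UNIV. v $ i *\<^sub>R axis i 1)" by simp
 also have "\<dots> = (\<Sum>i\<in>UNIV. v $ i *\<^sub>R L (axis i 1))"
  using assms by (simp add: linear_sum linear_cmul)
 finally show ?thesis .
qed

lemma has_derivative_pderiv:
 fixes f :: "real^'n => real"
 assumes "f differentiable (at x)"
 shows "(f has_derivative (\<lambda>v. \<Sum>i\<in>UNIV. v $ i * pderiv_at i f x)) (at x)"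
proof -
 obtain D where D: "(f has_derivative D) (at x)" using assms by (auto simp: differentiable_def)
 have "D v = (\<Sum>i\<in>UNIV. v $ i * pderiv_at i f x)" for v
  using linear_axis_expansion[OF has_derivative_linear[OF D], of v] pderiv_atI[OF D] by simp
 then have "D = (\<lambda>v. \<Sum>i\<in>UNIV. v $ i * pderiv_at i f x)" by auto
 with D show ?thesis by simp
qed

text \<open>The finite-order notion in which the usual inductive proofs of closure under products and
 compositions are run.\<close>

definition ck_on :: "nat => (real^'n::finite) set => (real^'n => real) => bool" where
 "ck_on k U f \<longleftrightarrow> (\<forall>is. length is \<le> k \<longrightarrow> (\<forall>x\<in>U. iter_pderiv is f differentiable (at x)))"

lemma smooth_on_iff_ck: "smooth_on U f \<longleftrightarrow> (\<forall>k. ck_on k U f)"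
 unfolding smooth_on_def ck_on_def by blast

lemma ck_on_0: "ck_on 0 U f \<longleftrightarrow> (\<forall>x\<in>U. f differentiable (at x))"
 unfolding ck_on_def by auto

lemma ck_on_Suc:
 "ck_on (Suc k) U f \<longleftrightarrow> (\<forall>x\<in>U. f differentiable (at x)) \<and> (\<forall>i. ck_on k U (pderiv_at i f))"
proof (intro iffI conjI allI ballI)
 assume L: "ck_on (Suc k) U f"
 show "f differentiable (at x)" if "x \<in> U" for x
  using L that unfolding ck_on_def by (metis iter_pderiv_simps(1) list.size(3) zero_le)
 show "ck_on k U (pderiv_at i f)" for i
  unfolding ck_on_def
 proof (intro allI impI ballI)
  fix "is" :: "'a list" and x assume "length is \<le> k" "x \<in> U"
  then show "iter_pderiv is (pderiv_at i f) differentiable (at x)"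
   using L[unfolded ck_on_def, rule_format, of "is @ [i]" x] by simp
 qed
next
 assume R: "(\<forall>x\<in>U. f differentiable (at x)) \<and> (\<forall>i. ck_on k U (pderiv_at i f))"
 show "ck_on (Suc k) U f"
  unfolding ck_on_def
 proof (intro allI impI ballI)
  fix "is" :: "'a list" and x assume l: "length is \<le> Suc k" and x: "x \<in> U"
  show "iter_pderiv is f differentiable (at x)"
  proof (cases "is" rule: rev_cases)
   case Nil then show ?thesis using R x by simp
  next
   case (snoc js j)
   then have "length js \<le> k" using l by simp
   then show ?thesis using R x snoc unfolding ck_on_def by simp
  qed
 qed
qed

lemma ck_on_Suc_imp: "ck_on (Suc k) U f ==> ck_on k U f"
 unfolding ck_on_def by auto

lemma ck_on_pderiv: "ck_on (Suc k) U f ==> ck_on k U (pderiv_at i f)"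
 by (simp add: ck_on_Suc)

lemma ck_on_differentiable: "ck_on k U f ==> x \<in> U ==> f differentiable (at x)"
 unfolding ck_on_def by (metis iter_pderiv_simps(1) list.size(3) zero_le)

lemma ck_on_cong:
 assumes "open U" "!!y. y \<in> U ==> f y = g y" "ck_on k U f"
 shows "ck_on k U g"
 unfolding ck_on_def
proof (intro allI ballI impI)
 fix "is" :: "'a list" and x assume x: "x \<in> U" and l: "length is \<le> k"
 have "iter_pderiv is f differentiable (at x)" using assms x l by (auto simp: ck_on_def)
 then show "iter_pderiv is g differentiable (at x)"
  using differentiable_open_cong[OF assms(1) x, of "iter_pderiv is f" "iter_pderiv is g"]
   iter_pderiv_cong[OF assms(1) _ assms(2), of _ "\<lambda>y. y"] by blast
qed

lemma pderiv_at_const [simp]: "pderiv_at i (\<lambda>x. c) x = 0"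
 by (rule pderiv_atI[OF has_derivative_const])

lemma pderiv_at_add:
 assumes "f differentiable (at x)" "g differentiable (at x)"
 shows "pderiv_at i (\<lambda>x. f x + g x) x = pderiv_at i f x + pderiv_at i g x"
proof -
 obtain F G where FG: "(f has_derivative F) (at x)" "(g has_derivative G) (at x)"
  using assms by (auto simp: differentiable_def)
 show ?thesis
  using pderiv_atI[OF has_derivative_add[OF FG], of i] pderiv_atI[OF FG(1), of i] pderiv_atI[OF FG(2), of i]
  by simp
qed

lemma pderiv_at_mult:
 fixes f g :: "real^'n => real"
 assumes "f differentiable (at x)" "g differentiable (at x)"
 shows "pderiv_at i (\<lambda>x. f x * g x) x = f x * pderiv_at i g x + pderiv_at i f x * g x"
proof -
 obtain F G where FG: "(f has_derivative F) (at x)" "(g has_derivative G) (at x)"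
  using assms by (auto simp: differentiable_def)
 show ?thesis using pderiv_atI[OF has_derivative_mult[OF FG], of i] pderiv_atI[OF FG(1), of i] pderiv_atI[OF FG(2), of i]
  by simp
qed

lemma pderiv_at_cmult:
 fixes f :: "real^'n => real"
 assumes "f differentiable (at x)"
 shows "pderiv_at i (\<lambda>x. c * f x) x = c * pderiv_at i f x"
 using pderiv_at_mult[OF _ assms, of "\<lambda>_. c" i] by simp

lemma pderiv_at_sum:
 fixes f :: "'a => real^'n => real"
 assumes "finite A" "!!a. a \<in> A ==> f a differentiable (at x)"
 shows "pderiv_at i (\<lambda>x. \<Sum>a\<in>A. f a x) x = (\<Sum>a\<in>A. pderiv_at i (f a) x)"
 using assms
proof (induction A rule: finite_induct)
 case (insert a A)
 have "(\<lambda>x. \<Sum>a\<in>A. f a x) differentiable (at x)" using insert by (intro differentiable_sum) auto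
 then show ?case using insert pderiv_at_add[of "f a" x "\<lambda>x. \<Sum>a\<in>A. f a x" i] by simp
qed simp

lemma pderiv_at_chain1:
 fixes f :: "real^'n => real"
 assumes "f differentiable (at x)" "(\<rho> has_real_derivative d) (at (f x))"
 shows "pderiv_at i (\<lambda>x. \<rho> (f x)) x = d * pderiv_at i f x"
proof -
 obtain F where F: "(f has_derivative F) (at x)" using assms by (auto simp: differentiable_def)
 have "((\<lambda>x. \<rho> (f x)) has_derivative (\<lambda>v. d * F v)) (at x)"
  using has_derivative_compose[OF F assms(2)[unfolded has_field_derivative_def]] by simp
 from pderiv_atI[OF this] pderiv_atI[OF F] show ?thesis by simp
qed

lemma pderiv_at_chain:
 fixes G :: "real^'m => real" and \<phi> :: "real^'n => real^'m"
 assumes "\<phi> differentiable (at x)" "G differentiable (at (\<phi> x))"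
 shows "pderiv_at i (\<lambda>x. G (\<phi> x)) x = (\<Sum>j\<in>UNIV. pderiv_at j G (\<phi> x) * pderiv_at i (\<lambda>y. \<phi> y $ j) x)"
proof -
 obtain P where P: "(\<phi> has_derivative P) (at x)" using assms by (auto simp: differentiable_def)
 have Pj: "((\<lambda>y. \<phi> y $ j) has_derivative (\<lambda>v. P v $ j)) (at x)" for j
  using bounded_linear.has_derivative[OF bounded_linear_vec_nth P] by simp
 have "((\<lambda>x. G (\<phi> x)) has_derivative (\<lambda>v. \<Sum>j\<in>UNIV. P v $ j * pderiv_at j G (\<phi> x))) (at x)"
  using has_derivative_compose[OF P has_derivative_pderiv[OF assms(2)]] .
 from pderiv_atI[OF this] pderiv_atI[OF Pj] show ?thesis by (simp add: mult.commute)
qed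

lemma ck_on_const [simp]: "ck_on k U (\<lambda>x. c)"
proof (induction k arbitrary: c)
 case (Suc k)
 have "pderiv_at i (\<lambda>x::real^'a. c) = (\<lambda>x. 0)" for i by auto
 then show ?case using Suc by (simp add: ck_on_Suc)
qed (simp add: ck_on_0)

lemma ck_on_add:
 assumes "open U" "ck_on k U f" "ck_on k U g"
 shows "ck_on k U (\<lambda>x. f x + g x)"
 using assms(2,3)
proof (induction k arbitrary: f g)
 case (Suc k)
 have d: "f differentiable (at x)" "g differentiable (at x)" if "x \<in> U" for x
  using that Suc.prems by (metis ck_on_differentiable)+
 have "ck_on k U (pderiv_at i (\<lambda>x. f x + g x))" for i
  by (rule ck_on_cong[OF assms(1) _ Suc.IH[of "pderiv_at i f" "pderiv_at i g"]])
   (use Suc.prems d in \<open>simp_all add: pderiv_at_add ck_on_pderiv\<close>)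
 then show ?case using d by (auto simp: ck_on_Suc)
qed (auto simp: ck_on_0)

lemma ck_on_mult:
 assumes "open U" "ck_on k U f" "ck_on k U g"
 shows "ck_on k U (\<lambda>x. f x * g x)"
 using assms(2,3)
proof (induction k arbitrary: f g)
 case (Suc k)
 have d: "f differentiable (at x)" "g differentiable (at x)" if "x \<in> U" for x
  using that Suc.prems by (metis ck_on_differentiable)+
 have "ck_on k U (pderiv_at i (\<lambda>x. f x * g x))" for i
  by (rule ck_on_cong[OF assms(1) _ ck_on_add[OF assms(1) Suc.IH[of f "pderiv_at i g"] Suc.IH[of "pderiv_at i f" g]]])
   (use Suc.prems d in \<open>simp_all add: pderiv_at_mult ck_on_pderiv ck_on_Suc_imp\<close>)
 then show ?case using d by (auto simp: ck_on_Suc)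
qed (auto simp: ck_on_0)

lemma ck_on_sum:
 assumes "open U" "finite A" "!!a. a \<in> A ==> ck_on k U (f a)"
 shows "ck_on k U (\<lambda>x. \<Sum>a\<in>A. f a x)"
 using assms(2,3) by (induction A rule: finite_induct) (auto intro: ck_on_add[OF assms(1)])

lemma ck_on_compose:
 fixes G :: "real^'m => real" and \<phi> :: "real^'n => real^'m"
 assumes "open U" "!!j. ck_on k U (\<lambda>x. \<phi> x $ j)" "!!x. x \<in> U ==> \<phi> differentiable (at x)"
  "\<phi> ` U \<subseteq> V" "ck_on k V G"
 shows "ck_on k U (\<lambda>x. G (\<phi> x))"
 using assms(2,5)
proof (induction k arbitrary: G)
 case 0
 then show ?case using assms by (auto simp: ck_on_0 intro!: differentiable_compose[of G \<phi>])
next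
 case (Suc k)
 have d: "G differentiable (at (\<phi> x))" if "x \<in> U" for x
  using Suc.prems that assms(4) by (metis ck_on_differentiable image_subset_iff)
 have *: "ck_on k U (\<lambda>x. \<Sum>j\<in>UNIV. pderiv_at j G (\<phi> x) * pderiv_at i (\<lambda>y. \<phi> y $ j) x)" for i
 proof (intro ck_on_sum ck_on_mult assms(1))
  fix j
  show "ck_on k U (\<lambda>x. pderiv_at j G (\<phi> x))"
   by (rule Suc.IH[OF ck_on_Suc_imp[OF Suc.prems(1)] ck_on_pderiv[OF Suc.prems(2)]])
  show "ck_on k U (pderiv_at i (\<lambda>y. \<phi> y $ j))"
   by (rule ck_on_pderiv[OF Suc.prems(1)])
 qed simp
 have "ck_on k U (pderiv_at i (\<lambda>x. G (\<phi> x)))" for i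
  by (rule ck_on_cong[OF assms(1) _ *[of i]]) (simp add: pderiv_at_chain[OF assms(3) d])
 then show ?case using d assms(3) by (auto simp: ck_on_Suc intro!: differentiable_compose[of G \<phi>])
qed

text \<open>Composition with a function of one variable: the derivatives of such a function are
 described by a family that is closed under differentiation up to linear combinations, because
 the functions needed below (powers and \<open>exp (- 1/t)\<close>) come in such families.\<close>

lemma ck_on_compose1:
 fixes \<rho> :: "nat => real => real"
 assumes "open U" "ck_on k U f" "f ` U \<subseteq> I"
  "!!n t. t \<in> I ==> (\<rho> n has_real_derivative (\<Sum>m\<in>A n. a n m * \<rho> m t)) (at t)"
  "!!n. finite (A n)"
 shows "ck_on k U (\<lambda>x. \<rho> n (f x))"
 using assms(2)
proof (induction k arbitrary: n)
 case 0
 have "(\<lambda>x. \<rho> n (f x)) differentiable (at x)" if "x \<in> U" for x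
 proof (rule differentiable_compose[of "\<rho> n" f])
  have "f x \<in> I" using that assms(3) by auto
  from assms(4)[OF this] show "\<rho> n differentiable (at (f x))"
   unfolding differentiable_def has_field_derivative_def by blast
  show "f differentiable (at x)" using 0 that by (simp add: ck_on_0)
 qed
 then show ?case by (simp add: ck_on_0)
next
 case (Suc k)
 have d: "f differentiable (at x)" if "x \<in> U" for x
  using Suc.prems that by (metis ck_on_differentiable)
 have *: "ck_on k U (\<lambda>x. (\<Sum>m\<in>A n. a n m * \<rho> m (f x)) * pderiv_at i f x)" for i
 proof (intro ck_on_sum ck_on_mult assms(1) assms(5) ck_on_const)
  show "ck_on k U (\<lambda>x. \<rho> m (f x))" for m
   by (rule Suc.IH[OF ck_on_Suc_imp[OF Suc.prems]])
  show "ck_on k U (pderiv_at i f)"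
   by (rule ck_on_pderiv[OF Suc.prems])
 qed
 have "ck_on k U (pderiv_at i (\<lambda>x. \<rho> n (f x)))" for i
  by (rule ck_on_cong[OF assms(1) _ *[of i]]) (use assms(3) in \<open>auto intro!: pderiv_at_chain1[OF d assms(4), symmetric]\<close>)
 moreover have "(\<lambda>x. \<rho> n (f x)) differentiable (at x)" if "x \<in> U" for x
  using Suc.IH[of n] Suc.prems ck_on_Suc_imp ck_on_differentiable that by blast
 ultimately show ?case by (auto simp: ck_on_Suc)
qed

lemma smooth_on_const [simp]: "smooth_on U (\<lambda>x. c::real)"
 by (simp add: smooth_on_iff_ck)

lemma smooth_on_add: "open U ==> smooth_on U f ==> smooth_on U g ==> smooth_on U (\<lambda>x. f x + g x :: real)"
 by (simp add: smooth_on_iff_ck ck_on_add)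

lemma smooth_on_mult: "open U ==> smooth_on U f ==> smooth_on U g ==> smooth_on U (\<lambda>x. f x * g x :: real)"
 by (simp add: smooth_on_iff_ck ck_on_mult)

lemma smooth_on_cmult: "open U ==> smooth_on U f ==> smooth_on U (\<lambda>x. c * f x :: real)"
 by (simp add: smooth_on_mult)

lemma smooth_on_minus: "open U ==> smooth_on U f ==> smooth_on U (\<lambda>x. - f x :: real)"
 using smooth_on_cmult[of U f "-1"] by simp

lemma smooth_on_diff: "open U ==> smooth_on U f ==> smooth_on U g ==> smooth_on U (\<lambda>x. f x - g x :: real)"
 using smooth_on_add[OF _ _ smooth_on_minus, of U f g] by simp

lemma smooth_on_sum:
 "open U ==> finite A ==> (!!a. a \<in> A ==> smooth_on U (f a)) ==> smooth_on U (\<lambda>x. \<Sum>a\<in>A. f a x :: real)"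
 by (simp add: smooth_on_iff_ck ck_on_sum)

lemma smooth_on_prod:
 assumes "open U" "finite A" "!!a. a \<in> A ==> smooth_on U (f a)"
 shows "smooth_on U (\<lambda>x. \<Prod>a\<in>A. f a x :: real)"
 using assms(2,3) by (induction A rule: finite_induct) (auto intro: smooth_on_mult[OF assms(1)])

lemma smooth_on_compose1:
 fixes \<rho> :: "nat => real => real"
 assumes "open U" "smooth_on U f" "f ` U \<subseteq> I"
  "!!n t. t \<in> I ==> (\<rho> n has_real_derivative (\<Sum>m\<in>A n. a n m * \<rho> m t)) (at t)"
  "!!n. finite (A n)"
 shows "smooth_on U (\<lambda>x. \<rho> n (f x))"
 using ck_on_compose1[OF assms(1) _ assms(3-5)] assms(2) by (simp add: smooth_on_iff_ck)

lemma smooth_on_linear_image: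
 fixes F :: "real^'n => 'b::real_normed_vector" and L :: "'b => 'c::real_normed_vector"
 assumes "open U" "bounded_linear L" "smooth_on U F"
 shows "smooth_on U (\<lambda>x. L (F x))"
proof -
 have eq: "x \<in> U ==> iter_pderiv is (\<lambda>x. L (F x)) x = L (iter_pderiv is F x)" for "is" x
 proof (induction "is" arbitrary: x)
  case (Cons i "is")
  obtain D where D: "(iter_pderiv is F has_derivative D) (at x)"
   using assms(3) Cons(2) by (auto simp: smooth_on_def differentiable_def)
  have "pderiv_at i (iter_pderiv is (\<lambda>x. L (F x))) x = pderiv_at i (\<lambda>x. L (iter_pderiv is F x)) x"
   by (rule pderiv_at_cong[OF assms(1) Cons(2)]) (simp add: Cons.IH)
  also have "\<dots> = L (D (axis i 1))"
   by (rule pderiv_atI[OF bounded_linear.has_derivative[OF assms(2) D]])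
  finally show ?case using pderiv_atI[OF D] by simp
 qed simp
 show ?thesis unfolding smooth_on_def
 proof (intro allI ballI)
  fix "is" x assume x: "x \<in> U"
  obtain D where D: "(iter_pderiv is F has_derivative D) (at x)"
   using assms(3) x by (auto simp: smooth_on_def differentiable_def)
  have "(\<lambda>x. L (iter_pderiv is F x)) differentiable (at x)"
   using bounded_linear.has_derivative[OF assms(2) D] by (auto simp: differentiable_def)
  then show "iter_pderiv is (\<lambda>x. L (F x)) differentiable (at x)"
   using differentiable_open_cong[OF assms(1) x eq] by simp
 qed
qed

lemma smooth_on_component:
 "open U ==> smooth_on U F ==> smooth_on U (\<lambda>x. F x $ j)" for F :: "real^'n => 'b::real_normed_vector^'m"
 by (rule smooth_on_linear_image[OF _ bounded_linear_vec_nth])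

lemma smooth_on_compose:
 fixes G :: "real^'m => real" and \<phi> :: "real^'n => real^'m"
 assumes "open U" "smooth_on U \<phi>" "\<phi> ` U \<subseteq> V" "smooth_on V G"
 shows "smooth_on U (\<lambda>x. G (\<phi> x))"
 using ck_on_compose[OF assms(1) _ _ assms(3)] smooth_on_component[OF assms(1,2)]
  smooth_on_differentiable[OF assms(2)] assms(4) by (simp add: smooth_on_iff_ck)

lemma smooth_on_coordinate: "smooth_on U (\<lambda>x::real^'n. x $ j)"
proof -
 have d: "((\<lambda>x::real^'n. x $ j) has_derivative (\<lambda>v. v $ j)) (at x)" for x
  by (rule bounded_linear_imp_has_derivative[OF bounded_linear_vec_nth])
 have "pderiv_at i (\<lambda>x::real^'n. x $ j) = (\<lambda>x. axis i 1 $ j)" for i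
  using pderiv_atI[OF d] by auto
 then have "ck_on (Suc k) U (\<lambda>x::real^'n. x $ j)" for k
  using d by (auto simp: ck_on_Suc differentiable_def)
 then show ?thesis by (metis smooth_on_iff_ck ck_on_Suc_imp)
qed

lemma smooth_on_inverse:
 assumes "open U" "smooth_on U f" "!!x. x \<in> U ==> f x \<noteq> (0::real)"
 shows "smooth_on U (\<lambda>x. inverse (f x))"
proof -
 have "smooth_on U (\<lambda>x. (\<lambda>n t::real. inverse t ^ (n + 1)) 0 (f x))"
 proof (rule smooth_on_compose1[where \<rho> = "\<lambda>n t::real. inverse t ^ (n + 1)" and I = "-{0}" and A = "\<lambda>n. {n + 1}" and a = "\<lambda>n m. - (real n + 1)"])
  show "((\<lambda>t. inverse t ^ (n + 1)) has_real_derivative (\<Sum>m\<in>{n + 1}. - (real n + 1) * inverse t ^ (m + 1))) (at t)"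
   if "t \<in> - {0}" for n and t :: real
  proof -
   have "t \<noteq> 0" using that by simp
   from DERIV_power[OF DERIV_inverse[OF this], of "n + 1"] show ?thesis
    by (simp add: algebra_simps numeral_2_eq_2)
  qed
 qed (use assms in auto)
 then show ?thesis by simp
qed

lemma smooth_on_sqrt:
 assumes "open U" "smooth_on U f" "!!x. x \<in> U ==> f x > (0::real)"
 shows "smooth_on U (\<lambda>x. sqrt (f x))"
proof -
 have "smooth_on U (\<lambda>x. (\<lambda>n t::real. t powr (1/2 - real n)) 0 (f x))"
 proof (rule smooth_on_compose1[where \<rho> = "\<lambda>n t::real. t powr (1/2 - real n)" and I = "{0<..}" and A = "\<lambda>n. {n + 1}" and a = "\<lambda>n m. 1/2 - real n"])
  show "((\<lambda>t. t powr (1/2 - real n)) has_real_derivative (\<Sum>m\<in>{n + 1}. (1/2 - real n) * t powr (1/2 - real m))) (at t)"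
   if "t \<in> {0<..}" for n and t :: real
  proof -
   have "1/2 - real n - 1 = 1/2 - real (n + 1)" by simp
   then show ?thesis using that has_real_derivative_powr[of t "1/2 - real n"] by auto
  qed
 qed (use assms in auto)
 then have "smooth_on U (\<lambda>x. f x powr (1/2))" by simp
 then show ?thesis
  by (rule smooth_on_cong[OF assms(1), rotated]) (use assms(3) in \<open>auto simp: powr_half_sqrt less_imp_le\<close>)
qed

lemma smooth_on_exp:
 assumes "open U" "smooth_on U f"
 shows "smooth_on U (\<lambda>x. exp (f x :: real))"
 using smooth_on_compose1[OF assms, where I = UNIV and \<rho> = "\<lambda>n. exp" and A = "\<lambda>n. {0}" and a = "\<lambda>n m. 1" and n = 0]
 by (auto simp: DERIV_exp)

lemma differentiable_has_line_derivative:
 fixes f :: "real^'n => real"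
 assumes "f differentiable (at (x + t *\<^sub>R axis i 1))"
 shows "((\<lambda>t. f (x + t *\<^sub>R axis i 1)) has_real_derivative pderiv_at i f (x + t *\<^sub>R axis i 1)) (at t)"
proof -
 obtain D where D: "(f has_derivative D) (at (x + t *\<^sub>R axis i 1))" using assms by (auto simp: differentiable_def)
 have l: "((\<lambda>t. x + t *\<^sub>R axis i 1) has_derivative (\<lambda>h. h *\<^sub>R axis i 1)) (at t)"
  by (auto intro!: derivative_eq_intros)
 have "((\<lambda>t. f (x + t *\<^sub>R axis i 1)) has_derivative (\<lambda>h. D (h *\<^sub>R axis i 1))) (at t)"
  by (rule has_derivative_compose[OF l D])
 moreover have "D (h *\<^sub>R axis i 1) = pderiv_at i f (x + t *\<^sub>R axis i 1) * h" for h
  using pderiv_atI[OF D, of i] linear_cmul[OF has_derivative_linear[OF D], of h "axis i 1"] by simp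
 ultimately show ?thesis by (simp add: has_field_derivative_def)
qed

text \<open>Both mixed derivatives are limits of the same second difference quotient: two applications of
 the mean value theorem express it by one of them at a point nearby, in either order.\<close>

lemma second_difference_mvt:
 fixes f :: "real^'n => real"
 assumes U: "smooth_on U f" and h: "h > 0"
  and sub: "!!a b. 0 \<le> a ==> a \<le> h ==> 0 \<le> b ==> b \<le> h ==> x + a *\<^sub>R axis i 1 + b *\<^sub>R axis j 1 \<in> U"
 shows "\<exists>a b. 0 \<le> a \<and> a \<le> h \<and> 0 \<le> b \<and> b \<le> h \<and>
  f (x + h *\<^sub>R axis i 1 + h *\<^sub>R axis j 1) - f (x + h *\<^sub>R axis i 1) - f (x + h *\<^sub>R axis j 1) + f x =
  h * h * pderiv_at j (pderiv_at i f) (x + a *\<^sub>R axis i 1 + b *\<^sub>R axis j 1)"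
proof -
 let ?e = "axis i 1 :: real^'n" and ?d = "axis j 1 :: real^'n"
 define u where "u t = f ((x + h *\<^sub>R ?d) + t *\<^sub>R ?e) - f (x + t *\<^sub>R ?e)" for t
 have du: "(u has_real_derivative pderiv_at i f ((x + h *\<^sub>R ?d) + t *\<^sub>R ?e) - pderiv_at i f (x + t *\<^sub>R ?e)) (at t)"
  if "0 \<le> t" "t \<le> h" for t
 proof -
  have "(x + h *\<^sub>R ?d) + t *\<^sub>R ?e \<in> U" "x + t *\<^sub>R ?e \<in> U"
   using sub[of t h] sub[of t 0] that h by (simp_all add: algebra_simps)
  then show ?thesis unfolding u_def
   by (intro DERIV_diff differentiable_has_line_derivative smooth_on_differentiable[OF U])
 qed
 obtain a where a: "0 < a" "a < h"
  and ua: "u h - u 0 = (h - 0) * (pderiv_at i f ((x + h *\<^sub>R ?d) + a *\<^sub>R ?e) - pderiv_at i f (x + a *\<^sub>R ?e))"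
  using MVT2[OF h, of u "\<lambda>t. pderiv_at i f ((x + h *\<^sub>R ?d) + t *\<^sub>R ?e) - pderiv_at i f (x + t *\<^sub>R ?e)"] du by auto
 define v where "v t = pderiv_at i f ((x + a *\<^sub>R ?e) + t *\<^sub>R ?d)" for t
 have dv: "(v has_real_derivative pderiv_at j (pderiv_at i f) ((x + a *\<^sub>R ?e) + t *\<^sub>R ?d)) (at t)"
  if "0 \<le> t" "t \<le> h" for t
  unfolding v_def
  by (intro differentiable_has_line_derivative smooth_on_differentiable[OF smooth_on_pderiv[OF U]] sub)
   (use that a in auto)
 obtain b where b: "0 < b" "b < h"
  and vb: "v h - v 0 = (h - 0) * pderiv_at j (pderiv_at i f) ((x + a *\<^sub>R ?e) + b *\<^sub>R ?d)"
  using MVT2[OF h, of v "\<lambda>t. pderiv_at j (pderiv_at i f) ((x + a *\<^sub>R ?e) + t *\<^sub>R ?d)"] dv by auto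
 have "u h - u 0 = h * (v h - v 0)" using ua by (simp add: v_def algebra_simps)
 then have "u h - u 0 = h * h * pderiv_at j (pderiv_at i f) (x + a *\<^sub>R ?e + b *\<^sub>R ?d)"
  using vb by simp
 moreover have "u h - u 0 = f (x + h *\<^sub>R ?e + h *\<^sub>R ?d) - f (x + h *\<^sub>R ?e) - f (x + h *\<^sub>R ?d) + f x"
  by (simp add: u_def algebra_simps)
 ultimately show ?thesis using a b by (intro exI[of _ a] exI[of _ b]) simp
qed

lemma pderiv_at_commute:
 fixes f :: "real^'n => real"
 assumes "open U" "smooth_on U f" "x \<in> U"
 shows "pderiv_at i (pderiv_at j f) x = pderiv_at j (pderiv_at i f) x"
proof -
 have cont: "isCont (pderiv_at k (pderiv_at l f)) x" for k l
  using smooth_on_continuous_on[OF smooth_on_pderiv[OF smooth_on_pderiv[OF assms(2)]]]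
   assms(1,3) continuous_on_eq_continuous_at by blast
 have small: "\<bar>pderiv_at i (pderiv_at j f) x - pderiv_at j (pderiv_at i f) x\<bar> \<le> e" if "e > 0" for e
 proof -
  have "e/2 > 0" using that by simp
  obtain d1 where d1: "d1 > 0" "!!y. dist y x < d1 ==> dist (pderiv_at i (pderiv_at j f) y) (pderiv_at i (pderiv_at j f) x) < e/2"
   using cont[of i j] \<open>e/2 > 0\<close> unfolding continuous_at_eps_delta by blast
  obtain d2 where d2: "d2 > 0" "!!y. dist y x < d2 ==> dist (pderiv_at j (pderiv_at i f) y) (pderiv_at j (pderiv_at i f) x) < e/2"
   using cont[of j i] \<open>e/2 > 0\<close> unfolding continuous_at_eps_delta by blast
  obtain d3 where d3: "d3 > 0" "ball x d3 \<subseteq> U" using assms by (meson open_contains_ball)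
  define h where "h = min d1 (min d2 d3) / 3"
  have h: "h > 0" using d1 d2 d3 by (simp add: h_def)
  have near: "dist (x + a *\<^sub>R axis k 1 + b *\<^sub>R axis l 1) x < min d1 (min d2 d3)"
   if "0 \<le> a" "a \<le> h" "0 \<le> b" "b \<le> h" for a b and k l :: 'n
  proof -
   have "dist (x + a *\<^sub>R axis k 1 + b *\<^sub>R axis l 1) x = norm (a *\<^sub>R axis k 1 + b *\<^sub>R axis l (1::real))"
    by (simp add: dist_norm algebra_simps)
   also have "\<dots> \<le> a + b" using norm_triangle_ineq[of "a *\<^sub>R axis k (1::real)" "b *\<^sub>R axis l 1"] that by simp
   finally show ?thesis using that h by (simp add: h_def)
  qed
  then have sub: "x + a *\<^sub>R axis k 1 + b *\<^sub>R axis l 1 \<in> U"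
   if "0 \<le> a" "a \<le> h" "0 \<le> b" "b \<le> h" for a b and k l :: 'n
   using d3 that near[of a b k l] by (auto simp: dist_commute)
  obtain a b where 1: "0 \<le> a" "a \<le> h" "0 \<le> b" "b \<le> h"
   "f (x + h *\<^sub>R axis i 1 + h *\<^sub>R axis j 1) - f (x + h *\<^sub>R axis i 1) - f (x + h *\<^sub>R axis j 1) + f x =
    h * h * pderiv_at j (pderiv_at i f) (x + a *\<^sub>R axis i 1 + b *\<^sub>R axis j 1)"
   using second_difference_mvt[OF assms(2) h, of x i j] sub by blast
  obtain a' b' where 2: "0 \<le> a'" "a' \<le> h" "0 \<le> b'" "b' \<le> h"
   "f (x + h *\<^sub>R axis j 1 + h *\<^sub>R axis i 1) - f (x + h *\<^sub>R axis j 1) - f (x + h *\<^sub>R axis i 1) + f x =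
    h * h * pderiv_at i (pderiv_at j f) (x + a' *\<^sub>R axis j 1 + b' *\<^sub>R axis i 1)"
   using second_difference_mvt[OF assms(2) h, of x j i] sub by blast
  have "h * h * pderiv_at i (pderiv_at j f) (x + a' *\<^sub>R axis j 1 + b' *\<^sub>R axis i 1) =
   h * h * pderiv_at j (pderiv_at i f) (x + a *\<^sub>R axis i 1 + b *\<^sub>R axis j 1)"
  proof -
   have e: "x + h *\<^sub>R axis j 1 + h *\<^sub>R axis i 1 = x + h *\<^sub>R axis i 1 + h *\<^sub>R axis j 1"
    by (simp add: algebra_simps)
   show ?thesis using 1(5) 2(5)[unfolded e] by linarith
  qed
  then have "pderiv_at i (pderiv_at j f) (x + a' *\<^sub>R axis j 1 + b' *\<^sub>R axis i 1) =
   pderiv_at j (pderiv_at i f) (x + a *\<^sub>R axis i 1 + b *\<^sub>R axis j 1)" using h by simp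
  moreover have "dist (pderiv_at i (pderiv_at j f) (x + a' *\<^sub>R axis j 1 + b' *\<^sub>R axis i 1)) (pderiv_at i (pderiv_at j f) x) < e/2"
   using d1(2) near[OF 2(1-4), of j i] by simp
  moreover have "dist (pderiv_at j (pderiv_at i f) (x + a *\<^sub>R axis i 1 + b *\<^sub>R axis j 1)) (pderiv_at j (pderiv_at i f) x) < e/2"
   using d2(2) near[OF 1(1-4), of i j] by simp
  ultimately show ?thesis unfolding dist_real_def by linarith
 qed
 show ?thesis
 proof (rule ccontr)
  assume "\<not> ?thesis"
  then show False
   using small[of "\<bar>pderiv_at i (pderiv_at j f) x - pderiv_at j (pderiv_at i f) x\<bar> / 2"] by simp
 qed
qed

text \<open>The standard flat function: \<open>flatfn n t = t\<^sup>-\<^sup>n exp (- 1/t)\<close> for \<open>t > 0\<close>.\<close>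

definition flatfn :: "nat => real => real" where
 "flatfn n t = (if t \<le> 0 then 0 else inverse t ^ n * exp (- inverse t))"

lemma power_le_fact_exp: "0 \<le> y ==> y ^ k \<le> fact k * exp (y::real)"
proof -
 assume y: "0 \<le> y"
 have "(\<Sum>m\<in>{k}. y ^ m /\<^sub>R fact m) \<le> exp y"
  unfolding exp_def by (rule sum_le_suminf[OF summable_exp_generic]) (use y in auto)
 then show ?thesis by (simp add: field_simps)
qed

lemma flatfn_le: assumes "t > 0" shows "flatfn n t \<le> fact (n + 2) * t\<^sup>2"
proof -
 define y where "y = inverse t"
 have y: "y > 0" "t = inverse y" using assms by (auto simp: y_def)
 have "y ^ n * y\<^sup>2 \<le> fact (n + 2) * exp y"
  using power_le_fact_exp[of y "n + 2"] y(1) unfolding power_add by simp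
 then have "y ^ n * exp (- y) \<le> fact (n + 2) * (inverse y)\<^sup>2"
  using y(1) unfolding exp_minus by (simp add: field_simps)
 then show ?thesis using assms by (simp add: flatfn_def y_def)
qed

lemma flatfn_nonneg: "0 \<le> flatfn n t" by (simp add: flatfn_def)

lemma flatfn_DERIV: "(flatfn n has_real_derivative (\<Sum>m\<in>{n+1, n+2}. (if m = n + 1 then - real n else 1) * flatfn m t)) (at t)"
proof -
 consider "t < 0" | "t > 0" | "t = 0" by linarith
 then show ?thesis
 proof cases
  case 1
  have "((\<lambda>t. 0) has_real_derivative 0) (at t)" by simp
  then have "(flatfn n has_real_derivative 0) (at t)"
   by (rule has_field_derivative_transform_within_open[of _ _ _ "{..<0}"]) (use 1 in \<open>auto simp: flatfn_def\<close>)
  then show ?thesis using 1 by (simp add: flatfn_def)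
 next
  case 2
  have i: "(inverse has_real_derivative - (inverse t * inverse t)) (at t)"
   using DERIV_inverse[of t UNIV] 2 by (simp add: numeral_2_eq_2)
  have "((\<lambda>t. inverse t ^ n * exp (- inverse t)) has_real_derivative
    (inverse t ^ n * (exp (- inverse t) * (- (- (inverse t * inverse t)))) +
     real n * (- (inverse t * inverse t) * inverse t ^ (n - Suc 0)) * exp (- inverse t))) (at t)"
   using DERIV_mult[OF DERIV_power[OF i, of n] DERIV_chain2[OF DERIV_exp DERIV_minus[OF i]]]
   by (simp add: algebra_simps)
  then have "(flatfn n has_real_derivative
    (inverse t ^ n * (exp (- inverse t) * (- (- (inverse t * inverse t)))) +
     real n * (- (inverse t * inverse t) * inverse t ^ (n - Suc 0)) * exp (- inverse t))) (at t)"
   by (rule has_field_derivative_transform_within_open[of _ _ _ "{0<..}"]) (use 2 in \<open>auto simp: flatfn_def\<close>)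
  moreover have "(inverse t ^ n * (exp (- inverse t) * (- (- (inverse t * inverse t)))) +
     real n * (- (inverse t * inverse t) * inverse t ^ (n - Suc 0)) * exp (- inverse t)) =
    (\<Sum>m\<in>{n+1, n+2}. (if m = n + 1 then - real n else 1) * flatfn m t)"
   using 2 by (cases n) (simp_all add: flatfn_def algebra_simps)
  ultimately show ?thesis by simp
 next
  case 3
  have "((\<lambda>h::real. flatfn n h / h) \<longlongrightarrow> 0) (at 0)"
  proof (rule Lim_null_comparison)
   show "\<forall>\<^sub>F h::real in at 0. norm (flatfn n h / h) \<le> fact (n + 2) * \<bar>h\<bar>"
   proof (intro always_eventually allI)
    fix h :: real
    show "norm (flatfn n h / h) \<le> fact (n + 2) * \<bar>h\<bar>"
    proof (cases "h > 0")
     case True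
     have "flatfn n h / h \<le> (fact (n + 2) * h\<^sup>2) / h" using flatfn_le[OF True] True by (intro divide_right_mono) auto
     then show ?thesis using True flatfn_nonneg[of n h] by (simp add: power2_eq_square)
    next
     case False
     then have "flatfn n h = 0" by (simp add: flatfn_def)
     then show ?thesis by simp
    qed
   qed
   show "((\<lambda>h::real. fact (n + 2) * \<bar>h\<bar>) \<longlongrightarrow> 0) (at 0)"
    using tendsto_mult_right_zero[OF tendsto_rabs_zero[OF tendsto_ident_at]] by fastforce
  qed
  then have "(flatfn n has_real_derivative 0) (at 0)" by (simp add: DERIV_def flatfn_def)
  then show ?thesis using 3 by (simp add: flatfn_def)
 qed
qed

lemma smooth_on_flatfn: assumes "open U" "smooth_on U f" shows "smooth_on U (\<lambda>x. flatfn n (f x))"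
 by (rule smooth_on_compose1[OF assms, where I = UNIV, OF _ flatfn_DERIV]) auto

lemma smooth_bump:
 fixes x0 :: "real^'n"
 assumes "open U" "x0 \<in> U"
 obtains b :: "real^'n => real" and r where "r > 0" "smooth_on UNIV b" "!!x. 0 \<le> b x" "!!x. b x \<le> 1"
  "!!x. x \<in> ball x0 r ==> b x = 1" "!!x. x \<notin> cball x0 (2*r) ==> b x = 0" "cball x0 (2*r) \<subseteq> U"
proof -
 obtain R where R: "R > 0" "cball x0 R \<subseteq> U" using assms by (meson open_contains_cball)
 define r where "r = R/2"
 have r: "r > 0" "cball x0 (2*r) \<subseteq> U" using R by (auto simp: r_def)
 define q where "q x = (\<Sum>i\<in>UNIV. (x $ i - x0 $ i) * (x $ i - x0 $ i))" for x
 have q: "q x = (dist x0 x)\<^sup>2" for x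
  unfolding dist_commute[of x0] by (simp add: q_def dist_norm norm_vec_def L2_set_def power2_eq_square sum_nonneg)
 have sq: "smooth_on UNIV q" unfolding q_def
  by (intro smooth_on_sum smooth_on_mult smooth_on_diff smooth_on_coordinate smooth_on_const) auto
 define u where "u x = flatfn 0 (4*r\<^sup>2 - q x)" for x
 define v where "v x = flatfn 0 (q x - r\<^sup>2)" for x
 have pos: "u x + v x > 0" for x
 proof -
  have "4*r\<^sup>2 - q x > 0 \<or> q x - r\<^sup>2 > 0"
   using r zero_less_power2[of r] by linarith
  then show ?thesis by (auto simp: u_def v_def flatfn_def add_pos_pos add_pos_nonneg add_nonneg_pos)
 qed
 have nn: "u x \<ge> 0" "v x \<ge> 0" for x by (auto simp: u_def v_def flatfn_nonneg)
 define b where "b x = u x * inverse (u x + v x)" for x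
 have su: "smooth_on UNIV u" unfolding u_def
  by (rule smooth_on_flatfn[OF open_UNIV smooth_on_diff[OF open_UNIV smooth_on_const sq]])
 have sv: "smooth_on UNIV v" unfolding v_def
  by (rule smooth_on_flatfn[OF open_UNIV smooth_on_diff[OF open_UNIV sq smooth_on_const]])
 have "u x + v x \<noteq> 0" for x using pos[of x] by simp
 then have "smooth_on UNIV b" unfolding b_def
  by (rule smooth_on_mult[OF open_UNIV su smooth_on_inverse[OF open_UNIV smooth_on_add[OF open_UNIV su sv]]])
 moreover have "0 \<le> b x" "b x \<le> 1" for x
  using nn[of x] pos[of x] by (auto simp: b_def field_simps)
 moreover have "b x = 1" if "x \<in> ball x0 r" for x
 proof -
  have "q x < r\<^sup>2" using that by (simp add: q power_strict_mono)
  then have "v x = 0" by (simp add: v_def flatfn_def)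
  then show ?thesis using pos[of x] by (simp add: b_def)
 qed
 moreover have "b x = 0" if "x \<notin> cball x0 (2*r)" for x
 proof -
  have "(2*r)\<^sup>2 \<le> q x" unfolding q using that r by (intro power_mono) auto
  then have "u x = 0" by (simp add: u_def flatfn_def power_mult_distrib)
  then show ?thesis by (simp add: b_def)
 qed
 ultimately show ?thesis using that[OF r(1), of b] r(2) by blast
qed

section \<open>Change of variables for measures\<close>

text \<open>The change of variables theorem is available for \<open>\<real>\<^sup>n\<close> indexed by a well-ordered type.  A copy of
 the index type that carries some well-order transfers it to every finite index type.\<close>

typedef 'a idx = "UNIV :: 'a set" morphisms of_idx to_idx by simp

lemma of_to_idx [simp]: "of_idx (to_idx a) = a" by (simp add: to_idx_inverse)
lemma to_of_idx [simp]: "to_idx (of_idx a) = a" by (simp add: of_idx_inverse)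
lemma of_idx_eq_iff [simp]: "of_idx a = of_idx b \<longleftrightarrow> a = b" by (simp add: of_idx_inject)

lemma bij_of_idx: "bij of_idx"
 by (rule bijI) (auto simp: inj_def intro!: surjI[of _ to_idx])

instance idx :: (finite) finite
proof
 have "range to_idx = (UNIV :: 'a::finite idx set)" by (metis surj_def to_of_idx)
 moreover have "finite (range (to_idx :: 'a => 'a idx))" by (rule finite_imageI[OF finite])
 ultimately show "finite (UNIV :: 'a idx set)" by simp
qed

instantiation idx :: (finite) wellorder
begin

definition less_eq_idx :: "'a idx => 'a idx => bool" where
 "less_eq_idx a b \<longleftrightarrow> to_nat (of_idx a) \<le> to_nat (of_idx b)"

definition less_idx :: "'a idx => 'a idx => bool" where
 "less_idx a b \<longleftrightarrow> to_nat (of_idx a) < to_nat (of_idx b)"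

instance
proof
 fix P :: "'a idx => bool" and a
 assume step: "!!x. (!!y. y < x ==> P y) ==> P x"
 show "P a"
  by (induction a rule: measure_induct_rule[of "\<lambda>a. to_nat (of_idx a)"]) (rule step, simp add: less_idx_def)
qed (auto simp: less_eq_idx_def less_idx_def)

end

lemma det_reindex:
 fixes A :: "real^'n^'n" and f :: "'m::finite => 'n"
 assumes "bij f"
 shows "det (\<chi> i j. A $ f i $ f j) = det A"
proof -
 let ?M = "map_permutation UNIV f"
 have bf: "bij_betw f UNIV UNIV" using assms .
 have inj: "inj f" using assms by (rule bij_is_inj)
 have bi: "bij_betw (inv f) UNIV UNIV" using assms by (rule bij_imp_bij_inv)
 have bij: "bij_betw ?M {p. p permutes UNIV} {p. p permutes UNIV}"
 proof (rule bij_betw_byWitness[of _ "map_permutation UNIV (inv f)"])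
  show "\<forall>p\<in>{p. p permutes UNIV}. map_permutation UNIV (inv f) (?M p) = p"
   using map_permutation_compose_inv[OF bf, of _ "inv f"] inj by auto
  show "\<forall>p\<in>{p. p permutes UNIV}. ?M (map_permutation UNIV (inv f) p) = p"
   using map_permutation_compose_inv[OF bi, of _ f] assms by (auto simp: surj_f_inv_f bij_is_surj)
  show "?M ` {p. p permutes UNIV} \<subseteq> {p. p permutes UNIV}"
   using map_permutation_permutes[OF bf] by auto
  show "map_permutation UNIV (inv f) ` {p. p permutes UNIV} \<subseteq> {p. p permutes UNIV}"
   using map_permutation_permutes[OF bi] by auto
 qed
 have "det A = (\<Sum>p\<in>{p. p permutes UNIV}. of_int (sign (?M p)) * (\<Prod>k\<in>UNIV. A $ k $ ?M p k))"
  unfolding det_def by (rule sum.reindex_bij_betw[OF bij, symmetric])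
 also have "\<dots> = (\<Sum>p\<in>{p. p permutes UNIV}. of_int (sign p) * (\<Prod>i\<in>UNIV. A $ f i $ f (p i)))"
 proof (rule sum.cong[OF refl])
  fix p :: "'m => 'm" assume p: "p \<in> {p. p permutes UNIV}"
  have "(\<Prod>k\<in>UNIV. A $ k $ ?M p k) = (\<Prod>i\<in>UNIV. A $ f i $ ?M p (f i))"
   by (rule prod.reindex_bij_betw[OF bf, symmetric])
  then show "of_int (sign (?M p)) * (\<Prod>k\<in>UNIV. A $ k $ ?M p k) = of_int (sign p) * (\<Prod>i\<in>UNIV. A $ f i $ f (p i))"
   using sign_map_permutation[OF inj, of p] p by (simp add: map_permutation_apply inj)
 qed
 finally show ?thesis by (simp add: det_def)
qed

definition reidx :: "real^'n => real^('n::finite idx)" where "reidx v = (\<chi> k. v $ of_idx k)"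
definition unidx :: "real^('n::finite idx) => real^'n" where "unidx w = (\<chi> i. w $ to_idx i)"

lemma reidx_unidx [simp]: "reidx (unidx w) = w" "unidx (reidx v) = v"
 by (simp_all add: reidx_def unidx_def vec_eq_iff)

lemma linear_reidx: "linear reidx" "linear unidx"
 by (auto intro!: linearI simp: reidx_def unidx_def vec_eq_iff)

lemma bounded_linear_reidx: "bounded_linear reidx" "bounded_linear unidx"
 using linear_reidx by (simp_all add: linear_conv_bounded_linear)

lemma borel_measurable_reidx [measurable]: "reidx \<in> borel \<rightarrow>\<^sub>M borel" "unidx \<in> borel \<rightarrow>\<^sub>M borel"
 using bounded_linear_reidx by (auto intro!: borel_measurable_continuous_onI linear_continuous_on)

lemma prod_Basis_vec: "(\<Prod>b\<in>(Basis :: (real^'n) set). f b) = (\<Prod>i\<in>UNIV. f (axis i 1))"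
proof -
 have B: "(Basis :: (real^'n) set) = (\<lambda>i. axis i 1) ` UNIV" by (auto simp: Basis_vec_def)
 have "inj (\<lambda>i::'n. axis i (1::real))" by (auto simp: inj_def axis_eq_axis)
 then show ?thesis unfolding B by (simp add: prod.reindex)
qed

lemma lborel_distr_reidx: "distr lborel borel reidx = (lborel :: (real^('n::finite idx)) measure)"
proof (rule sym, rule lborel_eqI)
 fix l u :: "real^('n idx)" assume lu: "!!b. b \<in> Basis ==> l \<bullet> b \<le> u \<bullet> b"
 have lu': "l $ k \<le> u $ k" for k using lu[of "axis k 1"] by (simp add: inner_axis axis_in_Basis_iff)
 have "reidx -` box l u = box (unidx l) (unidx u)"
  by (auto simp: mem_box_cart reidx_def unidx_def) (metis of_to_idx, metis of_to_idx, (metis to_of_idx)+)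
 then have "emeasure (distr lborel borel reidx) (box l u) = emeasure lborel (box (unidx l) (unidx u))"
  by (simp add: emeasure_distr)
 also have "\<dots> = (\<Prod>b\<in>Basis. (unidx u - unidx l) \<bullet> b)"
  by (rule emeasure_lborel_box) (auto simp: Basis_vec_def inner_axis unidx_def lu')
 also have "(\<Prod>b\<in>Basis. (unidx u - unidx l) \<bullet> b) = (\<Prod>i\<in>UNIV. (u - l) $ to_idx i)"
  by (simp add: prod_Basis_vec inner_axis unidx_def)
 also have "\<dots> = (\<Prod>k\<in>UNIV. (u - l) $ k)"
 proof -
  have "bij (to_idx :: 'n => _)" by (rule bijI) (auto simp: inj_def to_idx_inject intro!: surjI[of _ of_idx])
  then show ?thesis by (rule prod.reindex_bij_betw)
 qed
 also have "\<dots> = (\<Prod>b\<in>Basis. (u - l) \<bullet> b)"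
  by (simp add: prod_Basis_vec inner_axis)
 finally show "emeasure (distr lborel borel reidx) (box l u) = ennreal (\<Prod>b\<in>Basis. (u - l) \<bullet> b)" .
qed simp

lemma emeasure_differentiable_image_wellorder:
 fixes f :: "real^'n::{finite,wellorder} => real^'n::_"
 assumes S: "S \<in> sets borel" "f ` S \<in> sets borel"
  and der: "!!x. x \<in> S ==> (f has_derivative f' x) (at x)"
  and inj: "inj_on f S"
  and meas: "(\<lambda>x. indicator S x * \<bar>det (matrix (f' x))\<bar>) \<in> borel_measurable borel"
 shows "emeasure lborel (f ` S) = (\<integral>\<^sup>+x. ennreal (indicator S x * \<bar>det (matrix (f' x))\<bar>) \<partial>lborel)"
proof -
 let ?g = "\<lambda>x. indicator S x * \<bar>det (matrix (f' x))\<bar>"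
 have SL: "S \<in> sets lebesgue" using S by auto
 have der': "!!x. x \<in> S ==> (f has_derivative f' x) (at x within S)"
  using der has_derivative_at_withinI by blast
 have res: "(\<lambda>x. if x \<in> S then \<bar>det (matrix (f' x))\<bar> else 0) = ?g" by (auto simp: indicator_def)
 show ?thesis
 proof (cases "(\<integral>\<^sup>+x. ennreal (?g x) \<partial>lborel) < \<infinity>")
  case True
  then have int: "integrable lborel ?g"
   using meas by (intro integrableI_nonneg) auto
  then have "(?g has_integral integral\<^sup>L lborel ?g) UNIV" by (rule has_integral_integral_lborel)
  then have "((\<lambda>x. \<bar>det (matrix (f' x))\<bar>) has_integral integral\<^sup>L lborel ?g) S"
   by (subst has_integral_restrict_UNIV[symmetric]) (simp add: res)
  with has_measure_differentiable_image[OF SL der' inj]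
  have "f ` S \<in> lmeasurable" and m: "measure lebesgue (f ` S) = integral\<^sup>L lborel ?g" by auto
  then have "emeasure lebesgue (f ` S) = ennreal (integral\<^sup>L lborel ?g)"
   by (simp add: emeasure_eq_measure2)
  also have "emeasure lebesgue (f ` S) = emeasure lborel (f ` S)"
   using S by simp
  also have "ennreal (integral\<^sup>L lborel ?g) = (\<integral>\<^sup>+x. ennreal (?g x) \<partial>lborel)"
   by (rule nn_integral_eq_integral[symmetric, OF int]) auto
  finally show ?thesis .
 next
  case False
  have "emeasure lborel (f ` S) = \<infinity>"
  proof (rule ccontr)
   assume "\<not> ?thesis"
   then have "f ` S \<in> lmeasurable"
    using S by (intro fmeasurableI) (auto simp: less_top)
   then have "((\<lambda>x. \<bar>det (matrix (f' x))\<bar>) has_integral measure lebesgue (f ` S)) S"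
    using has_measure_differentiable_image[OF SL der' inj] by blast
   then have "(?g has_integral measure lebesgue (f ` S)) UNIV"
    by (subst (asm) has_integral_restrict_UNIV[symmetric]) (simp add: res)
   then have "(\<integral>\<^sup>+x. ennreal (?g x) \<partial>lborel) = ennreal (measure lebesgue (f ` S))"
    using meas by (intro nn_integral_has_integral_lborel) auto
   with False show False by simp
  qed
  with False show ?thesis by (simp add: less_top[symmetric])
 qed
qed

lemma emeasure_differentiable_image:
 fixes f :: "real^'n => real^'n"
 assumes S: "S \<in> sets borel" "f ` S \<in> sets borel"
  and der: "!!x. x \<in> S ==> (f has_derivative f' x) (at x)"
  and inj: "inj_on f S"
  and meas: "(\<lambda>x. indicator S x * \<bar>det (matrix (f' x))\<bar>) \<in> borel_measurable borel"
 shows "emeasure lborel (f ` S) = (\<integral>\<^sup>+x. ennreal (indicator S x * \<bar>det (matrix (f' x))\<bar>) \<partial>lborel)"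
proof -
 define F where "F w = reidx (f (unidx w))" for w
 define F' where "F' w v = reidx (f' (unidx w) (unidx v))" for w v
 have im: "reidx ` T = unidx -` T" for T :: "(real^'n) set"
  by (auto simp: image_iff) (metis reidx_unidx(1))
 have em: "emeasure lborel (reidx ` T) = emeasure lborel T" if "T \<in> sets borel" for T :: "(real^'n) set"
 proof -
  have "reidx ` T \<in> sets borel" using that unfolding im by (metis borel_measurable_reidx(2) measurable_sets_borel)
  then have "emeasure (distr lborel borel reidx) (reidx ` T) = emeasure lborel (reidx -` reidx ` T)"
   by (simp add: emeasure_distr)
  moreover have "reidx -` reidx ` T = T" using reidx_unidx(2) by (metis inj_on_inverseI inj_vimage_image_eq)
  ultimately show ?thesis by (simp add: lborel_distr_reidx)
 qed
 have bor: "reidx ` T \<in> sets borel" if "T \<in> sets borel" for T :: "(real^'n) set"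
  using that unfolding im by (metis borel_measurable_reidx(2) measurable_sets_borel)
 have FS: "F ` (reidx ` S) = reidx ` (f ` S)" by (auto simp: F_def image_image)
 have dF: "(F has_derivative F' w) (at w)" if "w \<in> reidx ` S" for w
 proof -
  have "unidx w \<in> S" using that by auto
  then have "((\<lambda>w. f (unidx w)) has_derivative (\<lambda>v. f' (unidx w) (unidx v))) (at w)"
   by (intro has_derivative_compose[OF bounded_linear_imp_has_derivative[OF bounded_linear_reidx(2)] der])
  then show ?thesis unfolding F_def F'_def
   by (rule bounded_linear.has_derivative[OF bounded_linear_reidx(1)])
 qed
 have det: "det (matrix (F' w)) = det (matrix (f' (unidx w)))" for w
 proof -
  have ax: "unidx (axis k 1) = axis (of_idx k) (1::real)" for k :: "'n idx"
   by (auto simp: unidx_def vec_eq_iff axis_def)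
  have "matrix (F' w) = (\<chi> i j. matrix (f' (unidx w)) $ of_idx i $ of_idx j)"
   unfolding matrix_def F'_def ax by (simp add: vec_eq_iff reidx_def)
  then show ?thesis using det_reindex[OF bij_of_idx] by simp
 qed
 have ind: "indicator (reidx ` S) w = indicator S (unidx w)" for w :: "real^('n idx)"
  unfolding im by (simp add: indicator_def)
 have m2: "(\<lambda>w. indicator (reidx ` S) w * \<bar>det (matrix (F' w))\<bar>) \<in> borel_measurable borel"
  unfolding ind det by (rule measurable_compose[OF borel_measurable_reidx(2) meas])
 have injF: "inj_on F (reidx ` S)"
  using inj by (auto simp: inj_on_def F_def) (metis reidx_unidx(2))
 have "emeasure lborel (f ` S) = emeasure lborel (F ` (reidx ` S))"
  unfolding FS using em S by simp
 also have "\<dots> = (\<integral>\<^sup>+w. ennreal (indicator (reidx ` S) w * \<bar>det (matrix (F' w))\<bar>) \<partial>lborel)"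
  by (rule emeasure_differentiable_image_wellorder[OF _ _ dF injF m2])
   (use S bor in \<open>auto simp: FS\<close>)
 also have "\<dots> = (\<integral>\<^sup>+w. ennreal (indicator S (unidx w) * \<bar>det (matrix (f' (unidx w)))\<bar>) \<partial>distr lborel borel reidx)"
  unfolding ind det lborel_distr_reidx ..
 also have "\<dots> = (\<integral>\<^sup>+x. ennreal (indicator S x * \<bar>det (matrix (f' x))\<bar>) \<partial>lborel)"
  using measurable_compose[OF borel_measurable_reidx(2) meas]
  by (subst nn_integral_distr) (auto)
 finally show ?thesis .
qed

section \<open>The Laplacian of a metric on an open subset of Euclidean space\<close>

definition test_on :: "(real^'n::finite) set => (real^'n => real) => bool" where
 "test_on U h \<longleftrightarrow> smooth_on UNIV h \<and> (\<exists>K. compact K \<and> K \<subseteq> U \<and> (\<forall>x. x \<notin> K \<longrightarrow> h x = 0))"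

lemma pderiv_at_zero_outside:
 fixes f :: "real^'n => real"
 assumes "closed K" "!!x. x \<notin> K ==> f x = 0" "x \<notin> K"
 shows "pderiv_at i f x = 0"
 using pderiv_at_cong[of "-K" x f "\<lambda>_. 0" i] assms by auto

lemma test_on_subset: "test_on U h ==> U \<subseteq> V ==> test_on V h"
 unfolding test_on_def by blast

lemma smooth_on_mult_cutoff:
 fixes f h :: "real^'n => real"
 assumes "open U" "smooth_on U f" "smooth_on UNIV h" "compact K" "K \<subseteq> U" "!!x. x \<notin> K ==> h x = 0"
 shows "smooth_on UNIV (\<lambda>x. f x * h x)"
proof (rule smooth_on_local)
 fix x :: "real^'n"
 show "\<exists>V. x \<in> V \<and> smooth_on V (\<lambda>x. f x * h x)"
 proof (cases "x \<in> U")
  case True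
  then show ?thesis using smooth_on_mult[OF assms(1,2) smooth_on_subset[OF assms(3)]] by blast
 next
  case False
  have "smooth_on (-K) (\<lambda>x. f x * h x)"
   by (rule smooth_on_cong[of _ "\<lambda>_. 0"]) (use assms compact_imp_closed in \<open>auto\<close>)
  then show ?thesis using False assms by blast
 qed
qed

lemma test_on_mult: "open U ==> smooth_on U f ==> test_on U h ==> test_on U (\<lambda>x. f x * h x)"
proof -
 assume a: "open U" "smooth_on U f" "test_on U h"
 then obtain K where K: "smooth_on UNIV h" "compact K" "K \<subseteq> U" "!!x. x \<notin> K ==> h x = 0"
  unfolding test_on_def by blast
 from smooth_on_mult_cutoff[OF a(1,2) K] K show ?thesis
  unfolding test_on_def by (intro conjI exI[of _ K]) auto
qed

lemma test_on_pderiv: "test_on U h ==> test_on U (pderiv_at i h)"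
proof -
 assume "test_on U h"
 then obtain K where K: "smooth_on UNIV h" "compact K" "K \<subseteq> U" "!!x. x \<notin> K ==> h x = 0"
  unfolding test_on_def by blast
 from pderiv_at_zero_outside[OF compact_imp_closed[OF K(2)] K(4)] K smooth_on_pderiv[OF K(1)] show ?thesis
  unfolding test_on_def by (intro conjI exI[of _ K]) auto
qed

lemma test_on_smooth: "test_on U h ==> smooth_on V h"
 unfolding test_on_def using smooth_on_subset by blast

lemma test_on_zero: "test_on U h ==> x \<notin> U ==> h x = 0"
 unfolding test_on_def by blast

lemma test_on_add: "test_on U f ==> test_on U h ==> test_on U (\<lambda>x. f x + h x)"
proof -
 assume "test_on U f" "test_on U h"
 then obtain K L where KL: "smooth_on UNIV f" "compact K" "K \<subseteq> U" "\<forall>x. x \<notin> K \<longrightarrow> f x = 0"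
  "smooth_on UNIV h" "compact L" "L \<subseteq> U" "\<forall>x. x \<notin> L \<longrightarrow> h x = 0"
  unfolding test_on_def by blast
 then have "compact (K \<union> L)" "K \<union> L \<subseteq> U" "\<forall>x. x \<notin> K \<union> L \<longrightarrow> f x + h x = 0" by auto
 with KL show ?thesis unfolding test_on_def using smooth_on_add[OF open_UNIV] by blast
qed

lemma integrable_compact_support:
 fixes f :: "real^'n => real"
 assumes "continuous_on K f" "compact K" "!!x. x \<notin> K ==> f x = 0"
 shows "integrable lborel f"
proof -
 have "integrable lborel (\<lambda>x. indicator K x *\<^sub>R f x)" by (rule borel_integrable_compact[OF assms(2,1)])
 moreover have "(\<lambda>x. indicator K x *\<^sub>R f x) = f" 
 proof (rule ext)
  fix x show "indicator K x *\<^sub>R f x = f x" by (cases "x \<in> K") (simp_all add: assms(3))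
 qed
 ultimately show ?thesis by simp
qed

lemma test_on_integrable: "test_on U h ==> integrable lborel h"
proof -
 assume "test_on U h"
 then obtain K where K: "smooth_on UNIV h" "compact K" "!!x. x \<notin> K ==> h x = 0"
  unfolding test_on_def by blast
 show ?thesis
  by (rule integrable_compact_support[OF smooth_on_continuous_on[OF smooth_on_subset[OF K(1)]] K(2,3)]) auto
qed

lemma test_on_measurable [measurable_dest]: "test_on U h ==> h \<in> borel_measurable borel"
 using test_on_integrable borel_measurable_integrable by fastforce

lemma test_on_bounded: assumes "test_on U h" obtains B where "B \<ge> 0" "!!x. \<bar>h x\<bar> \<le> B"
proof -
 obtain K where K: "smooth_on UNIV h" "compact K" "\<forall>x. x \<notin> K \<longrightarrow> h x = 0"
  using assms unfolding test_on_def by blast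
 have "compact (h ` K)"
  using K by (intro compact_continuous_image) (auto intro: continuous_on_subset[OF smooth_on_continuous_on])
 then obtain B where "B > 0" "\<forall>y\<in>h ` K. norm y \<le> B" using compact_imp_bounded bounded_pos by blast
 then have "B \<ge> 0" "\<bar>h x\<bar> \<le> B" for x using K(3) by (cases "x \<in> K"; force)+
 then show ?thesis using that by blast
qed

text \<open>Translation invariance of Lebesgue measure makes the integrals of the difference quotients
 vanish; no iterated integration is involved.\<close>

lemma integral_pderiv_zero:
 fixes F :: "real^'n => real"
 assumes F: "test_on UNIV F"
 shows "(\<integral>x. pderiv_at i F x \<partial>lborel) = 0"
proof -
 let ?e = "axis i 1 :: real^'n"
 obtain K where K: "compact K" "!!x. x \<notin> K ==> F x = 0" using F unfolding test_on_def by blast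
 have sm: "smooth_on UNIV F" using F by (rule test_on_smooth)
 obtain B where B: "B \<ge> 0" "!!x. \<bar>pderiv_at i F x\<bar> \<le> B" using test_on_bounded[OF test_on_pderiv[OF F]] by blast
 define K' where "K' = {x + y |x y. x \<in> K \<and> y \<in> cball 0 1}"
 have K': "compact K'" unfolding K'_def using K(1) by (intro compact_sums) auto
 define h where "h n = inverse (real (Suc n))" for n
 have h: "0 < h n" "h n \<le> 1" for n by (auto simp: h_def inverse_le_1_iff)
 define q where "q n x = (F (x + h n *\<^sub>R ?e) - F x) / h n" for n x
 have ld: "((\<lambda>t. F (x + t *\<^sub>R ?e)) has_real_derivative pderiv_at i F (x + t *\<^sub>R ?e)) (at t)" for x t
  by (rule differentiable_has_line_derivative) (rule smooth_on_differentiable[OF sm], simp)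
 have Fm[measurable]: "F \<in> borel_measurable borel" using F by (rule test_on_measurable)
 have dm[measurable]: "pderiv_at i F \<in> borel_measurable borel" using test_on_pderiv[OF F] by (rule test_on_measurable)
 have Fi: "integrable lborel F" using F by (rule test_on_integrable)
 have "(\<lambda>n. \<integral>x. q n x \<partial>lborel) \<longlonglongrightarrow> (\<integral>x. pderiv_at i F x \<partial>lborel)"
 proof (rule integral_dominated_convergence[where w = "\<lambda>x. indicator K' x * B"])
  show "integrable lborel (\<lambda>x. indicator K' x * B)"
   using borel_integrable_compact[OF K', of "\<lambda>_. B"] by simp
  show "AE x in lborel. (\<lambda>n. q n x) \<longlonglongrightarrow> pderiv_at i F x"
  proof (rule AE_I2)
   fix x
   have L: "((\<lambda>t. (F (x + t *\<^sub>R ?e) - F x) / t) \<longlongrightarrow> pderiv_at i F x) (at 0)"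
    using ld[of x 0] by (simp add: DERIV_def)
   have h0: "filterlim h (at 0) sequentially"
   proof (rule filterlim_atI)
    show "h \<longlonglongrightarrow> 0" using LIMSEQ_inverse_real_of_nat unfolding h_def[abs_def] .
    show "\<forall>\<^sub>F n in sequentially. h n \<noteq> 0" using h(1) by (intro always_eventually allI) (metis less_irrefl)
   qed
   show "(\<lambda>n. q n x) \<longlonglongrightarrow> pderiv_at i F x"
    unfolding q_def by (rule filterlim_compose[OF L h0])
  qed
  show "AE x in lborel. norm (q n x) \<le> indicator K' x * B" for n
  proof (rule AE_I2)
   fix x
   obtain z where z: "F (x + h n *\<^sub>R ?e) - F (x + 0 *\<^sub>R ?e) = (h n - 0) * pderiv_at i F (x + z *\<^sub>R ?e)"
    using MVT2[OF h(1)[of n], of "\<lambda>t. F (x + t *\<^sub>R ?e)" "\<lambda>t. pderiv_at i F (x + t *\<^sub>R ?e)"] ld by blast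
   have qz: "q n x = pderiv_at i F (x + z *\<^sub>R ?e)" using z h(1)[of n] by (simp add: q_def)
   show "norm (q n x) \<le> indicator K' x * B"
   proof (cases "x \<in> K'")
    case True then show ?thesis using qz B by simp
   next
    case False
    have "x \<notin> K"
    proof
     assume "x \<in> K"
     then have "x + 0 \<in> K'" unfolding K'_def by fastforce
     with False show False by simp
    qed
    moreover have "x + h n *\<^sub>R ?e \<notin> K"
    proof
     assume a: "x + h n *\<^sub>R ?e \<in> K"
     have "- (h n *\<^sub>R ?e) \<in> cball 0 1" using h[of n] by simp
     with a have "(x + h n *\<^sub>R ?e) + (- (h n *\<^sub>R ?e)) \<in> K'" unfolding K'_def by blast
     with False show False by simp
    qed
    ultimately show ?thesis using K(2) False by (simp add: q_def)
   qed
  qed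
 qed (auto simp: q_def)
 moreover have "(\<integral>x. q n x \<partial>lborel) = 0" for n
 proof -
  let ?T = "(+) (h n *\<^sub>R ?e)"
  have T: "?T \<in> borel_measurable lborel" by simp
  have t1: "integrable lborel (\<lambda>x. F (?T x))"
   using Fi integrable_distr_eq[OF T Fm] unfolding lborel_distr_plus by simp
  have t2: "(\<integral>x. F (?T x) \<partial>lborel) = (\<integral>x. F x \<partial>lborel)"
   using integral_distr[OF T Fm] unfolding lborel_distr_plus by simp
  have "(\<integral>x. q n x \<partial>lborel) = (\<integral>x. F (h n *\<^sub>R ?e + x) - F x \<partial>lborel) / h n"
   by (simp add: q_def add.commute)
  then show ?thesis using t1 t2 Fi by simp
 qed
 ultimately have "(\<lambda>n. 0) \<longlonglongrightarrow> (\<integral>x. pderiv_at i F x \<partial>lborel)" by simp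
 then show ?thesis by (simp add: LIMSEQ_const_iff)
qed

lemma integral_by_parts_pderiv:
 fixes f h :: "real^'n => real"
 assumes "open U" "smooth_on U f" "test_on U h"
 shows "(\<integral>x. pderiv_at i f x * h x \<partial>lborel) = - (\<integral>x. f x * pderiv_at i h x \<partial>lborel)"
proof -
 have t: "test_on U (\<lambda>x. f x * h x)" by (rule test_on_mult[OF assms])
 have eq: "pderiv_at i (\<lambda>x. f x * h x) x = f x * pderiv_at i h x + pderiv_at i f x * h x" for x
 proof (cases "x \<in> U")
  case True
  then show ?thesis
   using pderiv_at_mult[OF smooth_on_differentiable[OF assms(2) True]] test_on_smooth[OF assms(3)] smooth_on_differentiable
   by blast
 next
  case False
  then show ?thesis using test_on_zero[OF test_on_pderiv[OF t] False] test_on_zero[OF test_on_pderiv[OF assms(3)] False]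
   test_on_zero[OF assms(3) False] by simp
 qed
 have i1: "integrable lborel (\<lambda>x. f x * pderiv_at i h x)"
  by (rule test_on_integrable[OF test_on_mult[OF assms(1,2) test_on_pderiv[OF assms(3)]]])
 have i2: "integrable lborel (\<lambda>x. pderiv_at i f x * h x)"
  by (rule test_on_integrable[OF test_on_mult[OF assms(1) smooth_on_pderiv[OF assms(2)] assms(3)]])
 have "(\<integral>x. f x * pderiv_at i h x + pderiv_at i f x * h x \<partial>lborel) = 0"
  using integral_pderiv_zero[OF test_on_subset[OF t subset_UNIV], of i] unfolding eq .
 then show ?thesis using i1 i2 by simp
qed

subsection \<open>Linear algebra of positive definite matrices\<close>

lemma det_zero_kernel:
 fixes A :: "real^'n^'n"
 assumes "det A = 0" obtains v where "v \<noteq> 0" "A *v v = 0"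
proof -
 have "\<not> invertible A" using assms by (simp add: invertible_det_nz)
 then have "\<not> inj ((*v) A)" by (simp add: invertible_left_inverse matrix_left_invertible_injective)
 then obtain x y where "x \<noteq> y" "A *v x = A *v y" by (auto simp: inj_def)
 then show ?thesis using that[of "x - y"] by (simp add: matrix_vector_mult_diff_distrib)
qed

lemma det_pos_of_posdef:
 fixes A :: "real^'n^'n"
 assumes pos: "!!v. v \<noteq> 0 ==> v \<bullet> (A *v v) > 0"
 shows "det A > 0"
proof (rule ccontr)
 assume neg: "\<not> det A > 0"
 define P where "P t = (\<chi> i j. (1 - t) * (mat 1 :: real^'n^'n) $ i $ j + t * A $ i $ j)" for t :: real
 have "continuous_on {0..1} (\<lambda>t. det (P t))" unfolding det_def P_def by (simp, intro continuous_intros)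
 moreover have "P 0 = mat 1" "P 1 = A" by (simp_all add: P_def vec_eq_iff)
 ultimately obtain t where t: "0 \<le> t" "t \<le> 1" "det (P t) = 0"
  using IVT2'[of "\<lambda>t. det (P t)" 1 0 0] neg by auto
 obtain v where v: "v \<noteq> 0" "P t *v v = 0" using det_zero_kernel[OF t(3)] .
 have "P t *v v = (1 - t) *\<^sub>R v + t *\<^sub>R (A *v v)"
 proof -
  have "P t = (1 - t) *\<^sub>R mat 1 + t *\<^sub>R A" by (simp add: P_def vec_eq_iff)
  then show ?thesis by (simp add: matrix_vector_mult_add_rdistrib scaleR_matrix_vector_assoc[symmetric])
 qed
 then have "v \<bullet> (P t *v v) = (1 - t) * (v \<bullet> v) + t * (v \<bullet> (A *v v))"
  by (simp add: inner_add_right)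
 moreover have "\<dots> > 0"
 proof (cases "t = 1")
  case False
  then have "(1 - t) * (v \<bullet> v) > 0" using t v by simp
  moreover have "t * (v \<bullet> (A *v v)) \<ge> 0" using t pos[OF v(1)] by simp
  ultimately show ?thesis by simp
 qed (use pos v in auto)
 ultimately show False using v by simp
qed

lemma matrix_inv_works:
 fixes A :: "real^'n^'n"
 assumes "det A \<noteq> 0"
 shows "A ** matrix_inv A = mat 1" "matrix_inv A ** A = mat 1"
proof -
 have "\<exists>B. A ** B = mat 1 \<and> B ** A = mat 1" using assms by (simp add: invertible_det_nz[symmetric] invertible_def)
 from someI_ex[OF this] show "A ** matrix_inv A = mat 1" "matrix_inv A ** A = mat 1"
  by (auto simp: matrix_inv_def)
qed

lemma matrix_inv_unique_right:
 fixes A :: "real^'n^'n"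
 assumes "A ** B = mat 1" shows "matrix_inv A = B"
proof -
 have "det A * det B = 1" using arg_cong[OF assms, of det] by (simp add: det_mul)
 then have "det A \<noteq> 0" by auto
 from matrix_inv_works(2)[OF this] have "(matrix_inv A ** A) ** B = B" by simp
 then show ?thesis by (simp add: assms flip: matrix_mul_assoc)
qed

lemma matrix_inv_symmetric:
 fixes A :: "real^'n^'n"
 assumes "det A \<noteq> 0" "transpose A = A" shows "transpose (matrix_inv A) = matrix_inv A"
proof -
 have "transpose (matrix_inv A ** A) = mat 1" using matrix_inv_works[OF assms(1)] by simp
 then have "A ** transpose (matrix_inv A) = mat 1" by (simp add: matrix_transpose_mul assms(2))
 then show ?thesis using matrix_inv_unique_right by metis
qed

lemma matrix_inv_posdef:
 fixes A :: "real^'n^'n"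
 assumes pos: "!!v. v \<noteq> 0 ==> v \<bullet> (A *v v) > 0" and "v \<noteq> 0"
 shows "v \<bullet> (matrix_inv A *v v) > 0"
proof -
 have d: "det A \<noteq> 0" using det_pos_of_posdef[OF pos] by simp
 let ?w = "matrix_inv A *v v"
 have v: "A *v ?w = v" by (simp add: matrix_vector_mul_assoc matrix_inv_works[OF d])
 then have "?w \<noteq> 0" using assms(2) by auto
 from pos[OF this] show ?thesis by (simp add: v inner_commute)
qed

subsection \<open>Metrics, their Laplacian and gradient product\<close>

definition metric_on :: "(real^'n::finite) set => (real^'n => real^'n^'n) => bool" where
 "metric_on U G \<longleftrightarrow> open U \<and> smooth_on U G \<and>
   (\<forall>x\<in>U. transpose (G x) = G x \<and> (\<forall>v. v \<noteq> 0 \<longrightarrow> v \<bullet> (G x *v v) > 0))"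

definition grad :: "(real^'n::finite => real) => real^'n => real^'n" where
 "grad f x = (\<chi> i. pderiv_at i f x)"

definition gam :: "(real^'n::finite => real^'n^'n) => (real^'n => real) => (real^'n => real) => real^'n => real" where
 "gam G f h x = grad h x \<bullet> (matrix_inv (G x) *v grad f x)"

definition lap :: "(real^'n::finite => real^'n^'n) => (real^'n => real) => real^'n => real" where
 "lap G f x = 1 / sqrt (det (G x)) *
   (\<Sum>i\<in>UNIV. pderiv_at i
     (\<lambda>y. sqrt (det (G y)) * (\<Sum>j\<in>UNIV. matrix_inv (G y) $ i $ j * pderiv_at j f y)) x)"

definition vol :: "(real^'n::finite) set => (real^'n => real^'n^'n) => (real^'n) measure" where
 "vol U G = density lborel (\<lambda>x. ennreal (indicator U x * sqrt (det (G x))))"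

context
 fixes U :: "(real^'n) set" and G :: "real^'n => real^'n^'n"
 assumes G: "metric_on U G"
begin

lemma metric_open: "open U" using G by (simp add: metric_on_def)

lemma metric_det_pos: "x \<in> U ==> det (G x) > 0"
 using G det_pos_of_posdef by (metis metric_on_def)

lemma smooth_on_metric_entry: "smooth_on U (\<lambda>x. G x $ i $ j)"
 using G smooth_on_component[OF metric_open smooth_on_component[OF metric_open]] by (metis metric_on_def)

lemma smooth_on_det:
 fixes M :: "real^'n => real^'n^'n"
 assumes "!!i j. smooth_on U (\<lambda>x. M x $ i $ j)"
 shows "smooth_on U (\<lambda>x. det (M x))"
 unfolding det_def
 by (intro smooth_on_sum smooth_on_mult smooth_on_const smooth_on_prod metric_open assms)
  (auto simp: finite_permutations)

lemma smooth_on_rho: "smooth_on U (\<lambda>x. sqrt (det (G x)))"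
 by (intro smooth_on_sqrt smooth_on_det smooth_on_metric_entry metric_det_pos metric_open)

lemma smooth_on_ginv: "smooth_on U (\<lambda>x. matrix_inv (G x) $ k $ j)"
proof -
 have eq: "det (\<chi> i l. if l = k then axis j 1 $ i else G x $ i $ l) * inverse (det (G x)) = matrix_inv (G x) $ k $ j"
  if "x \<in> U" for x
 proof -
  have d: "det (G x) \<noteq> 0" using metric_det_pos[OF that] by simp
  have "G x *v (matrix_inv (G x) *v axis j 1) = axis j 1"
   by (simp add: matrix_vector_mul_assoc matrix_inv_works[OF d])
  then have "matrix_inv (G x) *v axis j 1 =
   (\<chi> k. det (\<chi> i l. if l = k then axis j 1 $ i else G x $ i $ l) / det (G x))"
   using cramer[OF d] by blast
  moreover have "(matrix_inv (G x) *v axis j 1) $ k = matrix_inv (G x) $ k $ j"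
   by (simp add: matrix_vector_mult_basis column_def)
  ultimately show ?thesis by (simp add: divide_inverse)
 qed
 have entry: "smooth_on U (\<lambda>x. (\<chi> i l. if l = k then axis j 1 $ i else G x $ i $ l) $ a $ b)" for a b
  using smooth_on_metric_entry[of a b] by (cases "b = k") auto
 have "det (G x) \<noteq> 0" if "x \<in> U" for x using metric_det_pos[OF that] by simp
 then have "smooth_on U (\<lambda>x. det (\<chi> i l. if l = k then axis j 1 $ i else G x $ i $ l) * inverse (det (G x)))"
  by (intro smooth_on_mult smooth_on_inverse smooth_on_det[OF entry] smooth_on_det[OF smooth_on_metric_entry] metric_open)
 then show ?thesis by (rule smooth_on_cong[OF metric_open eq, rotated])
qed

lemma smooth_on_flux:
 "smooth_on U f ==> smooth_on U (\<lambda>y. sqrt (det (G y)) * (\<Sum>j\<in>UNIV. matrix_inv (G y) $ i $ j * pderiv_at j f y))"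
 by (intro smooth_on_mult smooth_on_sum smooth_on_rho smooth_on_ginv smooth_on_pderiv metric_open) auto

lemma smooth_on_lap: assumes "smooth_on U f" shows "smooth_on U (lap G f)"
proof -
 have "sqrt (det (G x)) \<noteq> 0" if "x \<in> U" for x using metric_det_pos[OF that] by simp
 then have "smooth_on U (\<lambda>x. inverse (sqrt (det (G x))) * (\<Sum>i\<in>UNIV. pderiv_at i
     (\<lambda>y. sqrt (det (G y)) * (\<Sum>j\<in>UNIV. matrix_inv (G y) $ i $ j * pderiv_at j f y)) x))"
  by (intro smooth_on_mult smooth_on_sum smooth_on_inverse smooth_on_rho smooth_on_pderiv smooth_on_flux assms metric_open) auto
 then show ?thesis by (simp add: lap_def[abs_def] divide_inverse)
qed

lemma gam_sum: "gam G f h x = (\<Sum>i\<in>UNIV. \<Sum>j\<in>UNIV. matrix_inv (G x) $ i $ j * pderiv_at j f x * pderiv_at i h x)"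
 by (simp add: gam_def grad_def inner_vec_def matrix_vector_mult_def sum_distrib_left algebra_simps)

lemma smooth_on_gam: "smooth_on U f ==> smooth_on U h ==> smooth_on U (gam G f h)"
 unfolding gam_sum[abs_def]
 by (intro smooth_on_mult smooth_on_sum smooth_on_ginv smooth_on_pderiv metric_open) auto

lemma gam_sym: assumes "x \<in> U" shows "gam G f h x = gam G h f x"
proof -
 have d: "det (G x) \<noteq> 0" "transpose (G x) = G x" using metric_det_pos[OF assms] G assms by (auto simp: metric_on_def)
 have "grad h x \<bullet> (matrix_inv (G x) *v grad f x) = (transpose (matrix_inv (G x)) *v grad h x) \<bullet> grad f x"
  by (simp add: transpose_matrix_vector dot_lmul_matrix)
 then show ?thesis by (simp add: gam_def matrix_inv_symmetric[OF d] inner_commute)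
qed

lemma gam_nonneg: assumes "x \<in> U" shows "gam G f f x \<ge> 0"
proof (cases "grad f x = 0")
 case False
 then show ?thesis using matrix_inv_posdef[of "G x" "grad f x"] G assms by (auto simp: gam_def metric_on_def less_imp_le)
qed (simp add: gam_def)

lemma lap_flux: "x \<in> U ==> sqrt (det (G x)) * lap G f x = (\<Sum>i\<in>UNIV. pderiv_at i
     (\<lambda>y. sqrt (det (G y)) * (\<Sum>j\<in>UNIV. matrix_inv (G y) $ i $ j * pderiv_at j f y)) x)"
 using metric_det_pos[of x] by (simp add: lap_def)

lemma integral_lap_lborel:
 assumes f: "smooth_on U f" and h: "test_on U h"
 shows "(\<integral>x. sqrt (det (G x)) * (lap G f x * h x) \<partial>lborel) = - (\<integral>x. sqrt (det (G x)) * gam G f h x \<partial>lborel)"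
proof -
 let ?F = "\<lambda>i y. sqrt (det (G y)) * (\<Sum>j\<in>UNIV. matrix_inv (G y) $ i $ j * pderiv_at j f y)"
 have 1: "sqrt (det (G x)) * (lap G f x * h x) = (\<Sum>i\<in>UNIV. pderiv_at i (?F i) x * h x)" for x
 proof (cases "x \<in> U")
  case True
  have "sqrt (det (G x)) * (lap G f x * h x) = (sqrt (det (G x)) * lap G f x) * h x" by (rule mult.assoc[symmetric])
  also have "\<dots> = (\<Sum>i\<in>UNIV. pderiv_at i (?F i) x * h x)" unfolding lap_flux[OF True] by (rule sum_distrib_right)
  finally show ?thesis .
 next
  case False
  show ?thesis unfolding test_on_zero[OF h False] by simp
 qed
 have 2: "(\<Sum>i\<in>UNIV. ?F i x * pderiv_at i h x) = sqrt (det (G x)) * gam G f h x" for x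
  unfolding gam_sum sum_distrib_left by (intro sum.cong refl) (simp add: sum_distrib_right sum_distrib_left mult.assoc)
 have "(\<integral>x. sqrt (det (G x)) * (lap G f x * h x) \<partial>lborel) = (\<Sum>i\<in>UNIV. \<integral>x. pderiv_at i (?F i) x * h x \<partial>lborel)"
  unfolding 1
  by (intro Bochner_Integration.integral_sum test_on_integrable[OF test_on_mult[OF metric_open smooth_on_pderiv[OF smooth_on_flux[OF f]] h]])
 also have "\<dots> = (\<Sum>i\<in>UNIV. - (\<integral>x. ?F i x * pderiv_at i h x \<partial>lborel))"
  by (simp only: integral_by_parts_pderiv[OF metric_open smooth_on_flux[OF f] h])
 also have "\<dots> = - (\<integral>x. (\<Sum>i\<in>UNIV. ?F i x * pderiv_at i h x) \<partial>lborel)"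
  unfolding sum_negf
  by (subst Bochner_Integration.integral_sum)
   (auto intro!: test_on_integrable[OF test_on_mult[OF metric_open smooth_on_flux[OF f] test_on_pderiv[OF h]]])
 finally show ?thesis unfolding 2 .
qed

lemma borel_measurable_rho: "(\<lambda>x. indicator U x * sqrt (det (G x))) \<in> borel_measurable borel"
 using borel_measurable_continuous_on_indicator[OF borel_open[OF metric_open] smooth_on_continuous_on[OF smooth_on_rho]]
 by simp

lemma sets_vol [simp]: "sets (vol U G) = sets borel" "space (vol U G) = UNIV"
 by (simp_all add: vol_def)

lemma nn_integral_vol:
 "f \<in> borel_measurable borel ==>
  (\<integral>\<^sup>+x. f x \<partial>vol U G) = (\<integral>\<^sup>+x. ennreal (indicator U x * sqrt (det (G x))) * f x \<partial>lborel)"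
 unfolding vol_def using borel_measurable_rho by (subst nn_integral_density) auto

lemma integral_vol:
 assumes [measurable]: "f \<in> borel_measurable borel"
 shows "(\<integral>x. f x \<partial>vol U G) = (\<integral>x. (indicator U x * sqrt (det (G x))) * f x \<partial>lborel)"
  "integrable (vol U G) f \<longleftrightarrow> integrable lborel (\<lambda>x. (indicator U x * sqrt (det (G x))) * f x)"
proof -
 have nn: "AE x in lborel. 0 \<le> indicator U x * sqrt (det (G x))"
  using metric_det_pos by (intro AE_I2) (auto simp: indicator_def less_imp_le)
 show "(\<integral>x. f x \<partial>vol U G) = (\<integral>x. (indicator U x * sqrt (det (G x))) * f x \<partial>lborel)"
  "integrable (vol U G) f \<longleftrightarrow> integrable lborel (\<lambda>x. (indicator U x * sqrt (det (G x))) * f x)"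
  unfolding vol_def using borel_measurable_rho nn
  by (simp_all add: integral_density integrable_density)
qed

lemma AE_vol: "AE x in vol U G. x \<in> U"
 unfolding vol_def using borel_measurable_rho by (subst AE_density) (auto intro!: AE_I2 simp: indicator_def)

lemma integral_vol_test:
 assumes "test_on U f"
 shows "(\<integral>x. f x \<partial>vol U G) = (\<integral>x. sqrt (det (G x)) * f x \<partial>lborel)" "integrable (vol U G) f"
proof -
 have eq: "(indicator U x * sqrt (det (G x))) * f x = sqrt (det (G x)) * f x" for x
  using test_on_zero[OF assms] by (cases "x \<in> U") auto
 show "(\<integral>x. f x \<partial>vol U G) = (\<integral>x. sqrt (det (G x)) * f x \<partial>lborel)"
  by (simp only: integral_vol(1)[OF test_on_measurable[OF assms]] eq)
 show "integrable (vol U G) f"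
  using test_on_integrable[OF test_on_mult[OF metric_open smooth_on_rho assms]]
  by (simp only: integral_vol(2)[OF test_on_measurable[OF assms]] eq)
qed

lemma test_on_gam: assumes "smooth_on U f" "test_on U h" shows "test_on U (gam G f h)"
proof -
 obtain K where K: "smooth_on UNIV h" "compact K" "K \<subseteq> U" "!!x. x \<notin> K ==> h x = 0"
  using assms(2) unfolding test_on_def by blast
 have z: "gam G f h x = 0" if "x \<notin> K" for x
  using pderiv_at_zero_outside[OF compact_imp_closed[OF K(2)] K(4) that] by (simp add: gam_sum)
 have "smooth_on UNIV (gam G f h)"
 proof (rule smooth_on_local)
  fix x
  have "smooth_on (-K) (gam G f h)"
   by (rule smooth_on_cong[of _ "\<lambda>_. 0"]) (use z open_Compl[OF compact_imp_closed[OF K(2)]] in auto)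
  then show "\<exists>V. x \<in> V \<and> smooth_on V (gam G f h)"
   using smooth_on_gam[OF assms(1) smooth_on_subset[OF K(1)]] K by blast
 qed
 then show ?thesis using K z unfolding test_on_def by blast
qed

lemma integral_lap_vol:
 assumes f: "smooth_on U f" and h: "test_on U h"
 shows "(\<integral>x. lap G f x * h x \<partial>vol U G) = - (\<integral>x. gam G f h x \<partial>vol U G)"
 using integral_lap_lborel[OF assms]
 by (simp add: integral_vol_test[OF test_on_mult[OF metric_open smooth_on_lap[OF f] h]] integral_vol_test[OF test_on_gam[OF f h]])

end

lemma test_on_separates:
 fixes f :: "real^'n => real"
 assumes U: "open U" and f: "continuous_on U f"
  and zero: "!!h. test_on U h ==> (\<integral>x. f x * h x \<partial>lborel) = 0" and x: "x \<in> U"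
 shows "f x = 0"
proof -
 have pos: "\<not> c * f x > 0" if c: "c = 1 \<or> c = -1" for c :: real
 proof
  assume p: "c * f x > 0"
  let ?a = "c * f x / 2"
  have "open {y \<in> U. c * f y > ?a}"
  proof -
   have "continuous_on U (\<lambda>y. c * f y)" using f by (intro continuous_intros)
   then have "open (U \<inter> (\<lambda>y. c * f y) -` {?a<..})"
    using U open_greaterThan continuous_on_open_vimage[OF U] by (metis Int_commute)
   moreover have "U \<inter> (\<lambda>y. c * f y) -` {?a<..} = {y \<in> U. c * f y > ?a}" by auto
   ultimately show ?thesis by simp
  qed
  moreover have "x \<in> {y \<in> U. c * f y > ?a}" using x p by simp
  ultimately obtain b :: "real^'n => real" and r where b: "r > 0" "smooth_on UNIV b" "!!y. 0 \<le> b y" "!!y. b y \<le> 1"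
   "!!y. y \<in> ball x r ==> b y = 1" "!!y. y \<notin> cball x (2*r) ==> b y = 0" "cball x (2*r) \<subseteq> {y \<in> U. c * f y > ?a}"
   by (rule smooth_bump) (rule that)
  have t: "test_on U b" unfolding test_on_def using b by (intro conjI exI[of _ "cball x (2*r)"]) auto
  have fb: "integrable lborel (\<lambda>y. f y * b y)"
  proof (rule integrable_compact_support[of "cball x (2*r)"])
   show "continuous_on (cball x (2*r)) (\<lambda>y. f y * b y)"
    by (intro continuous_on_mult continuous_on_subset[OF f] continuous_on_subset[OF smooth_on_continuous_on[OF b(2)]])
     (use b in auto)
  qed (use b in auto)
  have "0 < ?a * measure lborel (ball x r)"
   using p content_ball_pos[OF b(1)] by (intro mult_pos_pos) auto
  also have "\<dots> = (\<integral>y. ?a * indicator (ball x r) y \<partial>lborel)" by simp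
  also have "\<dots> \<le> (\<integral>y. c * (f y * b y) \<partial>lborel)"
  proof (rule integral_mono)
   show "integrable lborel (\<lambda>y. ?a * indicator (ball x r) y)"
    using emeasure_lborel_ball_finite[of x r] by (intro integrable_mult_right integrable_real_indicator) auto
   show "integrable lborel (\<lambda>y. c * (f y * b y))" using fb by simp
   show "?a * indicator (ball x r) y \<le> c * (f y * b y)" for y
   proof (cases "y \<in> cball x (2*r)")
    case True
    then have gt: "c * f y > ?a" using b(7) by auto
    have "?a * indicator (ball x r) y \<le> ?a * b y"
     using b(3)[of y] b(5)[of y] p by (intro mult_left_mono) (auto simp: indicator_def)
    also have "\<dots> \<le> (c * f y) * b y" using gt b(3) by (intro mult_right_mono) auto
    finally show ?thesis by (simp add: mult.assoc)
   next
    case False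
    then have "y \<notin> ball x r" using b(1) by auto
    then show ?thesis using b(6)[OF False] by simp
   qed
  qed
  also have "\<dots> = c * (\<integral>y. f y * b y \<partial>lborel)" by simp
  finally show False using zero[OF t] by simp
 qed
 show ?thesis using pos[of 1] pos[of "-1"] by simp
qed

subsection \<open>Isometries of domains\<close>

definition domain_isometry ::
 "(real^'n::finite) set => (real^'n => real^'n^'n) => (real^'n) set => (real^'n => real^'n^'n)
  => (real^'n => real^'n) => (real^'n => real^'n) => bool" where
 "domain_isometry U G V H \<phi> \<psi> \<longleftrightarrow> metric_on U G \<and> metric_on V H \<and> smooth_on U \<phi> \<and> smooth_on V \<psi> \<and>
   (\<forall>x\<in>U. \<phi> x \<in> V \<and> \<psi> (\<phi> x) = x) \<and> (\<forall>y\<in>V. \<psi> y \<in> U \<and> \<phi> (\<psi> y) = y) \<and>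
   (\<forall>x\<in>U. G x = transpose (jacobian \<phi> (at x)) ** H (\<phi> x) ** jacobian \<phi> (at x))"

context
 fixes U V :: "(real^'n) set" and G H :: "real^'n => real^'n^'n" and \<phi> \<psi> :: "real^'n => real^'n"
 assumes iso: "domain_isometry U G V H \<phi> \<psi>"
begin

lemma iso_metric: "metric_on U G" "metric_on V H" using iso by (auto simp: domain_isometry_def)
lemma iso_open: "open U" "open V" using iso_metric metric_open by auto
lemma iso_smooth: "smooth_on U \<phi>" "smooth_on V \<psi>" using iso by (auto simp: domain_isometry_def)
lemma iso_maps: "x \<in> U ==> \<phi> x \<in> V" "x \<in> U ==> \<psi> (\<phi> x) = x" "y \<in> V ==> \<psi> y \<in> U" "y \<in> V ==> \<phi> (\<psi> y) = y"
 using iso by (auto simp: domain_isometry_def)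

abbreviation "Jac x \<equiv> jacobian \<phi> (at x)"

lemma iso_pull: "x \<in> U ==> G x = transpose (Jac x) ** H (\<phi> x) ** Jac x"
 using iso by (auto simp: domain_isometry_def)

lemma jacobian_entry: assumes "x \<in> U" shows "Jac x $ j $ i = pderiv_at i (\<lambda>y. \<phi> y $ j) x"
proof -
 obtain D where D: "(\<phi> has_derivative D) (at x)"
  using smooth_on_differentiable[OF iso_smooth(1) assms] by (auto simp: differentiable_def)
 have "((\<lambda>y. \<phi> y $ j) has_derivative (\<lambda>v. D v $ j)) (at x)"
  using bounded_linear.has_derivative[OF bounded_linear_vec_nth D] by simp
 moreover have "Jac x = matrix D" using frechet_derivative_at[OF D] by (simp add: jacobian_def)
 ultimately show ?thesis using pderiv_atI[of "\<lambda>y. \<phi> y $ j" "\<lambda>v. D v $ j" x i] by (simp add: matrix_def)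
qed

lemma smooth_on_jacobian: "smooth_on U (\<lambda>x. Jac x $ j $ i)"
 by (rule smooth_on_cong[OF iso_open(1) _ smooth_on_pderiv[OF smooth_on_component[OF iso_open(1) iso_smooth(1)]]])
  (simp add: jacobian_entry)

lemma iso_rho: assumes "x \<in> U" shows "\<bar>det (Jac x)\<bar> * sqrt (det (H (\<phi> x))) = sqrt (det (G x))"
proof -
 have "det (G x) = (det (Jac x))\<^sup>2 * det (H (\<phi> x))"
  by (simp add: iso_pull[OF assms] det_mul det_transpose power2_eq_square)
 then show ?thesis by (simp add: real_sqrt_mult)
qed

lemma iso_det_J: assumes "x \<in> U" shows "det (Jac x) \<noteq> 0"
 using iso_rho[OF assms] metric_det_pos[OF iso_metric(1) assms] by auto

lemma grad_compose:
 fixes f :: "real^'n => real"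
 assumes "x \<in> U" "f differentiable (at (\<phi> x))"
 shows "grad (\<lambda>x. f (\<phi> x)) x = transpose (Jac x) *v grad f (\<phi> x)"
 using pderiv_at_chain[OF smooth_on_differentiable[OF iso_smooth(1) assms(1)] assms(2)]
 by (simp add: grad_def vec_eq_iff matrix_vector_mult_def transpose_def jacobian_entry[OF assms(1)] mult.commute)

lemma gam_compose:
 assumes "x \<in> U" "f differentiable (at (\<phi> x))" "h differentiable (at (\<phi> x))"
 shows "gam G (\<lambda>x. f (\<phi> x)) (\<lambda>x. h (\<phi> x)) x = gam H f h (\<phi> x)"
proof -
 let ?J = "Jac x" and ?Ji = "matrix_inv (Jac x)" and ?H = "H (\<phi> x)" and ?Hi = "matrix_inv (H (\<phi> x))"
 have dJ: "det ?J \<noteq> 0" by (rule iso_det_J[OF assms(1)])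
 have dH: "det ?H \<noteq> 0" using metric_det_pos[OF iso_metric(2) iso_maps(1)[OF assms(1)]] by simp
 have JiT: "transpose ?J ** transpose ?Ji = mat 1"
  using arg_cong[OF matrix_inv_works(2)[OF dJ], of transpose] by (simp add: matrix_transpose_mul)
 have JiT': "transpose ?Ji ** transpose ?J = mat 1"
  using arg_cong[OF matrix_inv_works(1)[OF dJ], of transpose] by (simp add: matrix_transpose_mul)
 have "(transpose ?J ** ?H ** ?J) ** (?Ji ** ?Hi ** transpose ?Ji)
   = transpose ?J ** (?H ** ((?J ** ?Ji) ** ?Hi)) ** transpose ?Ji"
  by (simp only: matrix_mul_assoc)
 also have "\<dots> = mat 1" by (simp add: matrix_inv_works[OF dJ] matrix_inv_works[OF dH] JiT)
 finally have inv: "matrix_inv (G x) = ?Ji ** ?Hi ** transpose ?Ji"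
  unfolding iso_pull[OF assms(1)] by (rule matrix_inv_unique_right)
 have "matrix_inv (G x) *v (transpose ?J *v grad f (\<phi> x)) = (?Ji ** ?Hi ** (transpose ?Ji ** transpose ?J)) *v grad f (\<phi> x)"
  by (simp only: inv matrix_vector_mul_assoc matrix_mul_assoc)
 then have 1: "matrix_inv (G x) *v (transpose ?J *v grad f (\<phi> x)) = (?Ji ** ?Hi) *v grad f (\<phi> x)"
  by (simp add: JiT')
 have "(transpose ?J *v a) \<bullet> b = a \<bullet> (?J *v b)" for a b
  by (simp add: transpose_matrix_vector dot_lmul_matrix)
 then have "gam G (\<lambda>x. f (\<phi> x)) (\<lambda>x. h (\<phi> x)) x = grad h (\<phi> x) \<bullet> (?J *v ((?Ji ** ?Hi) *v grad f (\<phi> x)))"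
  by (simp only: gam_def grad_compose[OF assms(1,2)] grad_compose[OF assms(1,3)] 1)
 also have "?J *v ((?Ji ** ?Hi) *v grad f (\<phi> x)) = ((?J ** ?Ji) ** ?Hi) *v grad f (\<phi> x)"
  by (simp only: matrix_vector_mul_assoc matrix_mul_assoc)
 finally show ?thesis by (simp add: matrix_inv_works[OF dJ] gam_def)
qed

definition "phi0 x = (if x \<in> U then \<phi> x else 0)"

lemma phi0_measurable [measurable]: "phi0 \<in> borel_measurable borel"
proof -
 have "(\<lambda>x. indicator U x *\<^sub>R \<phi> x) \<in> borel_measurable borel"
  by (rule borel_measurable_continuous_on_indicator[OF borel_open[OF iso_open(1)] smooth_on_continuous_on[OF iso_smooth(1)]])
 moreover have "(\<lambda>x. indicator U x *\<^sub>R \<phi> x) = phi0" by (auto simp: phi0_def)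
 ultimately show ?thesis by simp
qed

lemma jac_measurable: "(\<lambda>x. indicator U x * \<bar>det (Jac x)\<bar>) \<in> borel_measurable borel"
proof -
 have "continuous_on U (\<lambda>x. \<bar>det (Jac x)\<bar>)"
  by (intro continuous_intros smooth_on_continuous_on smooth_on_det[OF iso_metric(1)] smooth_on_jacobian)
 from borel_measurable_continuous_on_indicator[OF borel_open[OF iso_open(1)] this] show ?thesis by simp
qed

lemma emeasure_iso_image:
 assumes B: "B \<in> sets borel"
 shows "emeasure lborel (B \<inter> V) = (\<integral>\<^sup>+x. ennreal (indicator U x * \<bar>det (Jac x)\<bar>) * indicator B (phi0 x) \<partial>lborel)"
proof -
 let ?S = "U \<inter> phi0 -` B"
 have S: "?S \<in> sets borel"
  using borel_open[OF iso_open(1)] measurable_sets_borel[OF phi0_measurable B] by auto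
 have im: "\<phi> ` ?S = B \<inter> V"
 proof
  show "\<phi> ` ?S \<subseteq> B \<inter> V" using iso_maps by (auto simp: phi0_def)
  show "B \<inter> V \<subseteq> \<phi> ` ?S"
  proof
   fix y assume "y \<in> B \<inter> V"
   then show "y \<in> \<phi> ` ?S" using iso_maps[of y] by (intro image_eqI[of _ _ "\<psi> y"]) (auto simp: phi0_def iso_maps)
  qed
 qed
 have der: "(\<phi> has_derivative frechet_derivative \<phi> (at x)) (at x)" if "x \<in> ?S" for x
  using smooth_on_differentiable[OF iso_smooth(1), of x] that by (simp add: frechet_derivative_works[symmetric])
 have inj: "inj_on \<phi> ?S" by (rule inj_on_inverseI[of _ \<psi>]) (use iso_maps in auto)
 have eq: "indicator ?S x * \<bar>det (Jac x)\<bar> = indicator U x * \<bar>det (Jac x)\<bar> * indicator B (phi0 x)" for x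
  by (auto simp: indicator_def)
 have m: "(\<lambda>x. indicator ?S x * \<bar>det (Jac x)\<bar>) \<in> borel_measurable borel"
  unfolding eq using jac_measurable B by measurable
 have "emeasure lborel (\<phi> ` ?S) = (\<integral>\<^sup>+x. ennreal (indicator ?S x * \<bar>det (matrix (frechet_derivative \<phi> (at x)))\<bar>) \<partial>lborel)"
  by (rule emeasure_differentiable_image[OF S _ der inj])
   (use im B iso_open(2) m in \<open>auto simp: jacobian_def\<close>)
 also have "\<dots> = (\<integral>\<^sup>+x. ennreal (indicator U x * \<bar>det (Jac x)\<bar>) * indicator B (phi0 x) \<partial>lborel)"
  by (intro nn_integral_cong) (auto simp: jacobian_def indicator_def)
 finally show ?thesis by (simp only: im)
qed

lemma iso_vol: "distr (vol U G) borel phi0 = vol V H"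
proof -
 let ?L = "density lborel (\<lambda>x. ennreal (indicator U x * \<bar>det (Jac x)\<bar>))"
 have 1: "distr ?L borel phi0 = density lborel (\<lambda>y. ennreal (indicator V y))"
 proof (rule measure_eqI)
  fix B assume "B \<in> sets (distr ?L borel phi0)"
  then have B: "B \<in> sets borel" by simp
  have "emeasure (distr ?L borel phi0) B = emeasure ?L (phi0 -` B)"
   using B by (subst emeasure_distr) auto
  also have "\<dots> = (\<integral>\<^sup>+x. ennreal (indicator U x * \<bar>det (Jac x)\<bar>) * indicator (phi0 -` B) x \<partial>lborel)"
   using measurable_sets_borel[OF phi0_measurable B] jac_measurable by (subst emeasure_density) auto
  also have "\<dots> = emeasure lborel (B \<inter> V)"
   unfolding emeasure_iso_image[OF B] by (intro nn_integral_cong) (auto simp: indicator_def)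
  also have "\<dots> = (\<integral>\<^sup>+y. indicator (B \<inter> V) y \<partial>lborel)"
   using B iso_open(2) by (subst nn_integral_indicator) auto
  also have "\<dots> = (\<integral>\<^sup>+y. ennreal (indicator V y) * indicator B y \<partial>lborel)"
   by (intro nn_integral_cong) (auto simp: indicator_def)
  also have "\<dots> = emeasure (density lborel (\<lambda>y. ennreal (indicator V y))) B"
   using B iso_open(2) by (subst emeasure_density) auto
  finally show "emeasure (distr ?L borel phi0) B = emeasure (density lborel (\<lambda>y. ennreal (indicator V y))) B" .
 qed simp
 show ?thesis
 proof (rule measure_eqI)
  fix B assume "B \<in> sets (distr (vol U G) borel phi0)"
  then have B[measurable]: "B \<in> sets borel" by simp
  note [measurable] = borel_measurable_rho[OF iso_metric(1)] borel_measurable_rho[OF iso_metric(2)] jac_measurable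
   borel_open[OF iso_open(1)] borel_open[OF iso_open(2)]
  let ?r = "\<lambda>y. ennreal (indicator V y * sqrt (det (H y)))"
  have "emeasure (vol V H) B = (\<integral>\<^sup>+y. ?r y * indicator B y \<partial>lborel)"
   unfolding vol_def by (subst emeasure_density) auto
  also have "\<dots> = (\<integral>\<^sup>+y. ennreal (indicator V y) * (?r y * indicator B y) \<partial>lborel)"
   by (intro nn_integral_cong) (auto simp: indicator_def)
  also have "\<dots> = (\<integral>\<^sup>+y. ?r y * indicator B y \<partial>distr ?L borel phi0)"
   unfolding 1 by (subst nn_integral_density) auto
  also have "\<dots> = (\<integral>\<^sup>+x. ?r (phi0 x) * indicator B (phi0 x) \<partial>?L)"
   by (subst nn_integral_distr) auto
  also have "\<dots> = (\<integral>\<^sup>+x. ennreal (indicator U x * \<bar>det (Jac x)\<bar>) * (?r (phi0 x) * indicator B (phi0 x)) \<partial>lborel)"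
   by (subst nn_integral_density) auto
  also have "\<dots> = (\<integral>\<^sup>+x. ennreal (indicator U x * sqrt (det (G x))) * indicator (phi0 -` B) x \<partial>lborel)"
  proof (intro nn_integral_cong)
   fix x
   show "ennreal (indicator U x * \<bar>det (Jac x)\<bar>) * (?r (phi0 x) * indicator B (phi0 x)) =
    ennreal (indicator U x * sqrt (det (G x))) * indicator (phi0 -` B) x"
   proof (cases "x \<in> U")
    case True
    have "ennreal \<bar>det (Jac x)\<bar> * ennreal (sqrt (det (H (\<phi> x)))) = ennreal (sqrt (det (G x)))"
     using metric_det_pos[OF iso_metric(2) iso_maps(1)[OF True]]
     by (simp add: ennreal_mult[symmetric] iso_rho[OF True] del: ennreal_mult')
    then show ?thesis using True iso_maps(1)[OF True] by (simp add: phi0_def mult.assoc[symmetric] indicator_def)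
   qed simp
  qed
  also have "\<dots> = emeasure (vol U G) (phi0 -` B)"
   unfolding vol_def using measurable_sets_borel[OF phi0_measurable B] by (subst emeasure_density) auto
  also have "\<dots> = emeasure (distr (vol U G) borel phi0) B"
   using phi0_measurable by (subst emeasure_distr) (auto simp: measurable_def sets_vol[OF iso_metric(1)])
  finally show "emeasure (distr (vol U G) borel phi0) B = emeasure (vol V H) B" ..
 qed (simp add: sets_vol[OF iso_metric(2)])
qed

lemma iso_integral:
 fixes w :: "real^'n => real"
 assumes "w \<in> borel_measurable borel"
 shows "(\<integral>y. w y \<partial>vol V H) = (\<integral>x. w (phi0 x) \<partial>vol U G)"
proof -
 have "phi0 \<in> vol U G \<rightarrow>\<^sub>M borel" using phi0_measurable by (simp add: measurable_def sets_vol[OF iso_metric(1)])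
 from integral_distr[OF this assms] show ?thesis unfolding iso_vol .
qed

lemma test_on_transfer:
 assumes k: "test_on U k"
 obtains h where "test_on V h" "!!x. x \<in> U ==> h (\<phi> x) = k x"
proof -
 obtain K where K: "smooth_on UNIV k" "compact K" "K \<subseteq> U" "!!x. x \<notin> K ==> k x = 0"
  using k unfolding test_on_def by blast
 define h where "h y = (if y \<in> V then k (\<psi> y) else 0)" for y
 let ?L = "\<phi> ` K"
 have L: "compact ?L" using K
  by (intro compact_continuous_image continuous_on_subset[OF smooth_on_continuous_on[OF iso_smooth(1)]])
 have LV: "?L \<subseteq> V" using K iso_maps by auto
 have z: "h y = 0" if "y \<notin> ?L" for y
 proof (cases "y \<in> V")
  case True
  then have "\<psi> y \<notin> K" using that iso_maps by force
  then show ?thesis using K by (simp add: h_def)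
 qed (simp add: h_def)
 have "smooth_on UNIV h"
 proof (rule smooth_on_local)
  fix y
  have "smooth_on V (\<lambda>y. k (\<psi> y))" by (rule smooth_on_compose[OF iso_open(2) iso_smooth(2) subset_UNIV K(1)])
  then have "smooth_on V h" by (rule smooth_on_cong[OF iso_open(2), rotated]) (simp add: h_def)
  moreover have "smooth_on (-?L) h"
   by (rule smooth_on_cong[of _ "\<lambda>_. 0"]) (use z open_Compl[OF compact_imp_closed[OF L]] in auto)
  ultimately show "\<exists>W. y \<in> W \<and> smooth_on W h" using LV by blast
 qed
 then have "test_on V h" using L LV z unfolding test_on_def by blast
 moreover have "h (\<phi> x) = k x" if "x \<in> U" for x using iso_maps that by (simp add: h_def)
 ultimately show ?thesis using that by blast
qed

text \<open>The Laplacian is determined weakly by the gradient product and the volume, which are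
 manifestly invariant; this replaces the computation with second derivatives of \<open>\<phi>\<close>.\<close>

lemma lap_compose:
 assumes f: "smooth_on V f" and x: "x \<in> U"
 shows "lap G (\<lambda>x. f (\<phi> x)) x = lap H f (\<phi> x)"
proof -
 let ?F = "\<lambda>x. f (\<phi> x)"
 have F: "smooth_on U ?F" using smooth_on_compose[OF iso_open(1) iso_smooth(1) _ f] iso_maps by blast
 have L: "smooth_on U (\<lambda>x. lap H f (\<phi> x))"
  using smooth_on_compose[OF iso_open(1) iso_smooth(1) _ smooth_on_lap[OF iso_metric(2) f]] iso_maps by blast
 let ?d = "\<lambda>x. sqrt (det (G x)) * (lap G ?F x - lap H f (\<phi> x))"
 have d: "smooth_on U ?d"
  by (intro smooth_on_mult smooth_on_diff smooth_on_rho smooth_on_lap L F iso_open iso_metric)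
 have "(\<integral>x. ?d x * k x \<partial>lborel) = 0" if k: "test_on U k" for k
 proof -
  obtain h where h: "test_on V h" "!!x. x \<in> U ==> h (\<phi> x) = k x" using test_on_transfer[OF k] by blast
  have t1: "test_on U (\<lambda>x. lap G ?F x * k x)" by (rule test_on_mult[OF iso_open(1) smooth_on_lap[OF iso_metric(1) F] k])
  have t2: "test_on U (\<lambda>x. lap H f (\<phi> x) * k x)" by (rule test_on_mult[OF iso_open(1) L k])
  have t3: "test_on V (\<lambda>y. lap H f y * h y)" by (rule test_on_mult[OF iso_open(2) smooth_on_lap[OF iso_metric(2) f] h(1)])
  have t4: "test_on V (gam H f h)" by (rule test_on_gam[OF iso_metric(2) f h(1)])
  have g: "gam G ?F k x = gam H f h (phi0 x)" if "x \<in> U" for x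
  proof -
   have "grad k x = grad (\<lambda>x. h (\<phi> x)) x"
    unfolding grad_def using pderiv_at_cong[OF iso_open(1) that, of k "\<lambda>x. h (\<phi> x)"] h(2) by simp
   then have "gam G ?F k x = gam G ?F (\<lambda>x. h (\<phi> x)) x" by (simp add: gam_def)
   also have "\<dots> = gam H f h (\<phi> x)"
    using smooth_on_differentiable[OF f iso_maps(1)[OF that]] smooth_on_differentiable[OF test_on_smooth[OF h(1)] iso_maps(1)[OF that]]
    by (rule gam_compose[OF that])
   finally show ?thesis using that by (simp add: phi0_def)
  qed
  have m: "(\<lambda>x. gam H f h (phi0 x)) \<in> borel_measurable (vol U G)" "(\<lambda>x. lap H f (phi0 x) * h (phi0 x)) \<in> borel_measurable (vol U G)"
   "gam G ?F k \<in> borel_measurable (vol U G)" "(\<lambda>x. lap H f (\<phi> x) * k x) \<in> borel_measurable (vol U G)"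
   using measurable_compose[OF phi0_measurable test_on_measurable[OF t4]] measurable_compose[OF phi0_measurable test_on_measurable[OF t3]]
    test_on_measurable[OF test_on_gam[OF iso_metric(1) F k]] test_on_measurable[OF t2]
   by (simp_all add: measurable_def sets_vol[OF iso_metric(1)])
  have "(\<integral>x. lap G ?F x * k x \<partial>vol U G) = - (\<integral>x. gam G ?F k x \<partial>vol U G)"
   by (rule integral_lap_vol[OF iso_metric(1) F k])
  also have "(\<integral>x. gam G ?F k x \<partial>vol U G) = (\<integral>x. gam H f h (phi0 x) \<partial>vol U G)"
   by (rule integral_cong_AE[OF m(3,1)]) (use AE_vol[OF iso_metric(1)] g in \<open>auto elim: eventually_mono\<close>)
  also have "\<dots> = (\<integral>y. gam H f h y \<partial>vol V H)"
   by (rule iso_integral[symmetric, OF test_on_measurable[OF t4]])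
  also have "- \<dots> = (\<integral>y. lap H f y * h y \<partial>vol V H)"
   by (rule integral_lap_vol[OF iso_metric(2) f h(1), symmetric])
  also have "\<dots> = (\<integral>x. lap H f (phi0 x) * h (phi0 x) \<partial>vol U G)"
   by (rule iso_integral[OF test_on_measurable[OF t3]])
  also have "\<dots> = (\<integral>x. lap H f (\<phi> x) * k x \<partial>vol U G)"
   by (rule integral_cong_AE[OF m(2,4)]) (use AE_vol[OF iso_metric(1)] h(2) in \<open>auto elim!: eventually_mono simp: phi0_def\<close>)
  finally have eq: "(\<integral>x. sqrt (det (G x)) * (lap G ?F x * k x) \<partial>lborel) = (\<integral>x. sqrt (det (G x)) * (lap H f (\<phi> x) * k x) \<partial>lborel)"
   unfolding integral_vol_test[OF iso_metric(1) t1] integral_vol_test[OF iso_metric(1) t2] .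
  have i: "integrable lborel (\<lambda>x. sqrt (det (G x)) * (lap G ?F x * k x))" "integrable lborel (\<lambda>x. sqrt (det (G x)) * (lap H f (\<phi> x) * k x))"
   using test_on_integrable[OF test_on_mult[OF iso_open(1) smooth_on_rho[OF iso_metric(1)] t1]]
    test_on_integrable[OF test_on_mult[OF iso_open(1) smooth_on_rho[OF iso_metric(1)] t2]] .
  have "(\<integral>x. ?d x * k x \<partial>lborel) = (\<integral>x. sqrt (det (G x)) * (lap G ?F x * k x) - sqrt (det (G x)) * (lap H f (\<phi> x) * k x) \<partial>lborel)"
   by (simp add: algebra_simps)
  then show ?thesis using eq i by simp
 qed
 then have "?d x = 0" by (rule test_on_separates[OF iso_open(1) smooth_on_continuous_on[OF d] _ x])
 then show ?thesis using metric_det_pos[OF iso_metric(1) x] by simp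
qed

end

section \<open>Interior elliptic regularity\<close>

lemma smooth_cutoff:
 fixes K :: "(real^'n) set"
 assumes "open U" "compact K" "K \<subseteq> U"
 obtains c where "test_on U c" "!!x. x \<in> K ==> c x = 1" "!!x. 0 \<le> c x" "!!x. c x \<le> 1"
proof -
 have "\<exists>b r. r > 0 \<and> test_on U b \<and> (\<forall>y. 0 \<le> b y \<and> b y \<le> 1) \<and> (\<forall>y\<in>ball x r. b y = (1::real))" if "x \<in> K" for x
 proof -
  have "x \<in> U" using that assms by auto
  then obtain b :: "real^'n => real" and r where b: "r > 0" "smooth_on UNIV b" "!!y. 0 \<le> b y" "!!y. b y \<le> 1"
   "!!y. y \<in> ball x r ==> b y = 1" "!!y. y \<notin> cball x (2*r) ==> b y = 0" "cball x (2*r) \<subseteq> U"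
   by (rule smooth_bump[OF assms(1)]) (rule that)
  have "test_on U b" unfolding test_on_def using b by (intro conjI exI[of _ "cball x (2*r)"]) auto
  then show ?thesis using b by (intro exI[of _ b] exI[of _ r]) auto
 qed
 then obtain b r where b: "!!x. x \<in> K ==> r x > 0 \<and> test_on U (b x) \<and> (\<forall>y. 0 \<le> b x y \<and> b x y \<le> 1) \<and> (\<forall>y\<in>ball x (r x). b x y = (1::real))"
  by metis
 have "K \<subseteq> (\<Union>x\<in>K. ball x (r x))" using b by force
 then obtain D where D: "D \<subseteq> K" "finite D" "K \<subseteq> (\<Union>x\<in>D. ball x (r x))"
  using compactE_image[OF assms(2), of K "\<lambda>x. ball x (r x)"] by auto
 define c where "c y = 1 - (\<Prod>x\<in>D. 1 - b x y)" for y
 have sm: "smooth_on UNIV c" unfolding c_def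
 proof (intro smooth_on_diff[OF open_UNIV] smooth_on_const smooth_on_prod[OF open_UNIV D(2)])
  fix x assume "x \<in> D"
  then show "smooth_on UNIV (b x)" using b[of x] D test_on_smooth by blast
 qed
 have "\<forall>x\<in>D. \<exists>L. compact L \<and> L \<subseteq> U \<and> (\<forall>y. y \<notin> L \<longrightarrow> b x y = 0)" using b D unfolding test_on_def by blast
 then obtain L where L: "!!x. x \<in> D ==> compact (L x) \<and> L x \<subseteq> U \<and> (\<forall>y. y \<notin> L x \<longrightarrow> b x y = 0)" by metis
 have "test_on U c" unfolding test_on_def
 proof (intro conjI sm exI[of _ "\<Union>x\<in>D. L x"] allI impI)
  show "compact (\<Union>x\<in>D. L x)" using L D by (intro compact_UN) auto
  show "(\<Union>x\<in>D. L x) \<subseteq> U" using L by auto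
  fix y assume "y \<notin> (\<Union>x\<in>D. L x)"
  then have "(\<Prod>x\<in>D. 1 - b x y) = (\<Prod>x\<in>D. 1)" by (intro prod.cong refl) (use L in auto)
  then show "c y = 0" by (simp add: c_def)
 qed
 moreover have "c y = 1" if y: "y \<in> K" for y
 proof -
  obtain x where x: "x \<in> D" "y \<in> ball x (r x)" using D(3) y by auto
  then have "b x y = 1" using b[of x] D by auto
  then have "(\<Prod>x\<in>D. 1 - b x y) = 0" using x D(2) by (intro prod_zero) auto
  then show ?thesis by (simp add: c_def)
 qed
 moreover have "0 \<le> c y" "c y \<le> 1" for y
  unfolding c_def using b D by (auto intro!: prod_le_1 prod_nonneg)
 ultimately show ?thesis using that by blast
qed

definition sqint :: "(real^'n::finite) set => (real^'n => real) => real" where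
 "sqint K f = (\<integral>x. indicator K x * (f x)\<^sup>2 \<partial>lborel)"

lemma sqint_nonneg: "0 \<le> sqint K f" by (simp add: sqint_def)

lemma sqint_integrable:
 fixes f :: "real^'n => real"
 assumes "compact K" "continuous_on K f" shows "integrable lborel (\<lambda>x. indicator K x * (f x)\<^sup>2)"
 using borel_integrable_compact[OF assms(1), of "\<lambda>x. (f x)\<^sup>2"] assms(2) by (simp add: continuous_on_power)

lemma sqint_le:
 assumes "compact K" "continuous_on K f" "compact L" "K \<subseteq> L" "continuous_on L g" "!!x. x \<in> K ==> (f x)\<^sup>2 \<le> c * (g x)\<^sup>2" "c \<ge> 0"
 shows "sqint K f \<le> c * sqint L g"
proof -
 have "sqint K f \<le> (\<integral>x. c * (indicator L x * (g x)\<^sup>2) \<partial>lborel)" unfolding sqint_def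
 proof (rule integral_mono)
  show "integrable lborel (\<lambda>x. indicator K x * (f x)\<^sup>2)" by (rule sqint_integrable[OF assms(1,2)])
  show "integrable lborel (\<lambda>x. c * (indicator L x * (g x)\<^sup>2))"
   by (intro integrable_mult_right sqint_integrable assms)
  show "indicator K x * (f x)\<^sup>2 \<le> c * (indicator L x * (g x)\<^sup>2)" for x
   using assms(4,6,7) by (cases "x \<in> K") auto
 qed
 then show ?thesis by (simp add: sqint_def)
qed

lemma sqint_add_le:
 assumes "compact K" "continuous_on K f" "continuous_on K g"
 shows "sqint K (\<lambda>x. f x + g x) \<le> 2 * sqint K f + 2 * sqint K g"
proof -
 have "sqint K (\<lambda>x. f x + g x) \<le> (\<integral>x. 2 * (indicator K x * (f x)\<^sup>2) + 2 * (indicator K x * (g x)\<^sup>2) \<partial>lborel)"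
  unfolding sqint_def
 proof (rule integral_mono)
  show "integrable lborel (\<lambda>x. indicator K x * (f x + g x)\<^sup>2)"
   by (rule sqint_integrable[OF assms(1)]) (intro continuous_intros assms)
  show "integrable lborel (\<lambda>x. 2 * (indicator K x * (f x)\<^sup>2) + 2 * (indicator K x * (g x)\<^sup>2))"
   by (intro Bochner_Integration.integrable_add integrable_mult_right sqint_integrable assms)
  show "indicator K x * (f x + g x)\<^sup>2 \<le> 2 * (indicator K x * (f x)\<^sup>2) + 2 * (indicator K x * (g x)\<^sup>2)" for x
   using sum_squares_ge_zero[of "f x - g x" 0] by (auto simp: indicator_def power2_eq_square algebra_simps)
 qed
 also have "\<dots> = 2 * sqint K f + 2 * sqint K g"
  using sqint_integrable[OF assms(1,2)] sqint_integrable[OF assms(1,3)] by (simp add: sqint_def)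
 finally show ?thesis .
qed

text \<open>The algebra of the Caccioppoli inequality: Young's inequality absorbs the terms that are linear
 in the gradient \<open>a\<close> into the coercive one.\<close>

lemma caccioppoli_pointwise:
 fixes a b f Aa :: "'v::real_inner"
 assumes c: "c > 0" and coer: "c * (a \<bullet> a) \<le> a \<bullet> Aa" and M: "norm Aa \<le> M * norm a"
 shows "c/2 * (a \<bullet> a) \<le> (Aa - f) \<bullet> (a + 2 *\<^sub>R b) + g * w + (4 * M\<^sup>2 / c + 1 / c + 1) * (b \<bullet> b + f \<bullet> f + g\<^sup>2 + w\<^sup>2)"
proof -
 have young: "2 * (x * y) \<le> d * x\<^sup>2 + y\<^sup>2 / d" if "d > 0" for x y d :: real
 proof -
  have "0 \<le> (d * x - y)\<^sup>2 / d" using that by simp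
  also have "\<dots> = d * x\<^sup>2 + y\<^sup>2 / d - 2 * (x * y)" using that by (simp add: power2_eq_square field_simps)
  finally show ?thesis by simp
 qed
 let ?N = "norm a"
 have aa: "a \<bullet> a = ?N\<^sup>2" "b \<bullet> b = (norm b)\<^sup>2" "f \<bullet> f = (norm f)\<^sup>2" by (simp_all add: dot_square_norm)
 have M0: "M * ?N \<ge> 0" using M norm_ge_zero[of Aa] by linarith
 have 1: "- (2 * (Aa \<bullet> b)) \<le> c/4 * ?N\<^sup>2 + 4 * M\<^sup>2 / c * (norm b)\<^sup>2"
 proof -
  have "- (Aa \<bullet> b) \<le> norm Aa * norm b" using Cauchy_Schwarz_ineq2[of Aa b] by linarith
  also have "\<dots> \<le> M * ?N * norm b" using M by (intro mult_right_mono) auto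
  finally have "- (2 * (Aa \<bullet> b)) \<le> 2 * (?N * (M * norm b))" by (simp add: algebra_simps)
  also have "\<dots> \<le> c/4 * ?N\<^sup>2 + (M * norm b)\<^sup>2 / (c/4)" by (rule young) (use c in simp)
  finally show ?thesis by (simp add: power_mult_distrib)
 qed
 have 2: "f \<bullet> a \<le> c/4 * ?N\<^sup>2 + 1/c * (norm f)\<^sup>2"
 proof -
  have "f \<bullet> a \<le> ?N * norm f" using norm_cauchy_schwarz[of f a] by (simp add: mult.commute)
  moreover have "2 * (?N * norm f) \<le> c/2 * ?N\<^sup>2 + (norm f)\<^sup>2 / (c/2)" by (rule young) (use c in simp)
  ultimately show ?thesis by (simp add: field_simps)
 qed
 have 3: "2 * (f \<bullet> b) \<le> (norm f)\<^sup>2 + (norm b)\<^sup>2"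
 proof -
  have "0 \<le> f \<bullet> f - 2 * (f \<bullet> b) + b \<bullet> b"
   using inner_ge_zero[of "f - b"] by (simp add: inner_diff_left inner_diff_right inner_commute)
  then show ?thesis unfolding aa by linarith
 qed
 have 4: "- (g * w) \<le> g\<^sup>2 + w\<^sup>2"
 proof -
  have "0 \<le> (g + w)\<^sup>2 + g\<^sup>2 + w\<^sup>2" by simp
  then show ?thesis by (simp add: power2_sum)
 qed
 have ex: "(Aa - f) \<bullet> (a + 2 *\<^sub>R b) = a \<bullet> Aa + 2 * (Aa \<bullet> b) - f \<bullet> a - 2 * (f \<bullet> b)"
  by (simp add: inner_diff_left inner_diff_right inner_add_left inner_add_right inner_commute)
 let ?P = "4 * M\<^sup>2 / c" let ?Q = "1/c"
 have nn: "0 \<le> ?P" "0 \<le> ?Q" using c by auto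
 have "(?P + ?Q + 1) * ((norm b)\<^sup>2 + (norm f)\<^sup>2 + g\<^sup>2 + w\<^sup>2)
   = (?P * (norm b)\<^sup>2 + ?Q * (norm f)\<^sup>2 + ((norm f)\<^sup>2 + (norm b)\<^sup>2) + (g\<^sup>2 + w\<^sup>2))
    + (?P * ((norm f)\<^sup>2 + g\<^sup>2 + w\<^sup>2) + ?Q * ((norm b)\<^sup>2 + g\<^sup>2 + w\<^sup>2))"
  by (simp only: distrib_left distrib_right mult_1 add_ac)
 moreover have "0 \<le> ?P * ((norm f)\<^sup>2 + g\<^sup>2 + w\<^sup>2) + ?Q * ((norm b)\<^sup>2 + g\<^sup>2 + w\<^sup>2)"
  using nn by (intro add_nonneg_nonneg mult_nonneg_nonneg) auto
 ultimately show ?thesis using 1 2 3 4 coer unfolding ex aa by linarith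
qed

context
 fixes U :: "(real^'n) set" and G :: "real^'n => real^'n^'n"
 assumes G: "metric_on U G"
begin

lemma U_open: "open U" by (rule metric_open[OF G])

definition Aco :: "'n => 'n => real^'n => real" where
 "Aco p q x = sqrt (det (G x)) * matrix_inv (G x) $ p $ q"

definition Lop :: "(real^'n => real) => real^'n => real" where
 "Lop w x = (\<Sum>p\<in>UNIV. pderiv_at p (\<lambda>y. \<Sum>q\<in>UNIV. Aco p q y * pderiv_at q w y) x)"

lemma smooth_Aco: "smooth_on U (Aco p q)"
 unfolding Aco_def[abs_def] by (rule smooth_on_mult[OF U_open smooth_on_rho[OF G] smooth_on_ginv[OF G]])

lemma smooth_Aflux: "smooth_on U w ==> smooth_on U (\<lambda>y. \<Sum>q\<in>UNIV. Aco p q y * pderiv_at q w y)"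
 by (rule smooth_on_sum[OF U_open finite smooth_on_mult[OF U_open smooth_Aco smooth_on_pderiv]])

lemma Lop_lap: "x \<in> U ==> Lop u x = sqrt (det (G x)) * lap G u x"
 unfolding lap_flux[OF G] Lop_def Aco_def by (simp add: sum_distrib_left mult.assoc)

lemma smooth_bounded_compact:
 assumes "smooth_on U f" "compact K" "K \<subseteq> U" obtains B where "B \<ge> 0" "!!x. x \<in> K ==> \<bar>f x\<bar> \<le> (B::real)"
proof -
 have "compact (f ` K)" by (intro compact_continuous_image continuous_on_subset[OF smooth_on_continuous_on[OF assms(1)]] assms)
 then obtain B where "B > 0" "\<forall>y\<in>f ` K. norm y \<le> B" using compact_imp_bounded bounded_pos by blast
 then show ?thesis using that[of B] by auto
qed

definition Amat :: "real^'n => real^'n^'n" where "Amat x = (\<chi> p q. Aco p q x)"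

lemma elliptic_constants:
 assumes K: "compact K" "K \<subseteq> U"
 obtains c M where "c > 0" "M \<ge> 0" "!!x v. x \<in> K ==> c * (v \<bullet> v) \<le> v \<bullet> (Amat x *v v)"
  "!!x v. x \<in> K ==> norm (Amat x *v v) \<le> M * norm v"
proof (cases "K = {}")
 case True then show ?thesis using that[of 1 0] by auto
next
 case False
 let ?S = "sphere (0::real^'n) 1"
 have Asm: "Amat x = sqrt (det (G x)) *\<^sub>R matrix_inv (G x)" for x by (simp add: Amat_def Aco_def vec_eq_iff)
 have cA: "continuous_on (K \<times> ?S) (\<lambda>z. Amat (fst z) *v snd z)"
 proof -
  have "continuous_on (K \<times> ?S) (\<lambda>z. Aco p q (fst z))" for p q
   by (rule continuous_on_compose2[OF smooth_on_continuous_on[OF smooth_Aco] continuous_on_fst[OF continuous_on_id]]) (use K in auto)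
  then show ?thesis unfolding matrix_vector_mult_def Amat_def
   by (auto intro!: continuous_intros)
 qed
 have cmp: "compact (K \<times> ?S)" using K by (intro compact_Times) auto
 have "axis undefined 1 \<in> ?S" by simp
 then have ne: "K \<times> ?S \<noteq> {}" using False by blast
 have "continuous_on (K \<times> ?S) (\<lambda>z. snd z \<bullet> (Amat (fst z) *v snd z))" by (intro continuous_intros cA)
 then obtain z where z: "z \<in> K \<times> ?S" "!!y. y \<in> K \<times> ?S ==> snd z \<bullet> (Amat (fst z) *v snd z) \<le> snd y \<bullet> (Amat (fst y) *v snd y)"
  using continuous_attains_inf[OF cmp ne] by blast
 have "continuous_on (K \<times> ?S) (\<lambda>z. norm (Amat (fst z) *v snd z))" by (intro continuous_intros cA)
 then obtain y where y: "y \<in> K \<times> ?S" "!!x. x \<in> K \<times> ?S ==> norm (Amat (fst x) *v snd x) \<le> norm (Amat (fst y) *v snd y)"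
  using continuous_attains_sup[OF cmp ne] by blast
 define c where "c = snd z \<bullet> (Amat (fst z) *v snd z)"
 define M where "M = norm (Amat (fst y) *v snd y)"
 have "c > 0"
 proof -
  have zU: "fst z \<in> U" "snd z \<noteq> 0" using z(1) K by auto
  then have "0 < snd z \<bullet> (matrix_inv (G (fst z)) *v snd z)"
   using matrix_inv_posdef G unfolding metric_on_def by blast
  then show ?thesis unfolding c_def Asm using metric_det_pos[OF G zU(1)]
   by (simp add: scaleR_matrix_vector_assoc[symmetric])
 qed
 moreover have "M \<ge> 0" by (simp add: M_def)
 moreover have "c * (v \<bullet> v) \<le> v \<bullet> (Amat x *v v)" "norm (Amat x *v v) \<le> M * norm v" if x: "x \<in> K" for x v
 proof -
  define e where "e = (if v = 0 then axis undefined 1 else v /\<^sub>R norm v)"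
  have ve: "v = norm v *\<^sub>R e" by (simp add: e_def)
  have e: "(x, e) \<in> K \<times> ?S" using x by (simp add: e_def)
  have Ae: "Amat x *v v = norm v *\<^sub>R (Amat x *v e)" by (subst ve) (simp add: matrix_vector_mult_scaleR)
  have "c \<le> e \<bullet> (Amat x *v e)" using z(2)[OF e] by (simp add: c_def)
  then have "(norm v)\<^sup>2 * c \<le> (norm v)\<^sup>2 * (e \<bullet> (Amat x *v e))" by (rule mult_left_mono) simp
  also have "\<dots> = (norm v *\<^sub>R e) \<bullet> (norm v *\<^sub>R (Amat x *v e))" by (simp add: power2_eq_square mult.assoc)
  also have "\<dots> = v \<bullet> (Amat x *v v)" by (rule arg_cong2[where f = "(\<bullet>)", OF ve Ae, symmetric])
  finally show "c * (v \<bullet> v) \<le> v \<bullet> (Amat x *v v)" by (simp add: dot_square_norm mult.commute)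
  have "norm (Amat x *v e) \<le> M" using y(2)[OF e] by (simp add: M_def)
  then have "norm v * norm (Amat x *v e) \<le> norm v * M" by (rule mult_left_mono) simp
  then show "norm (Amat x *v v) \<le> M * norm v" unfolding Ae by (simp add: mult.commute)
 qed
 ultimately show ?thesis using that by blast
qed

lemma integral_divergence_test:
 assumes F: "!!p. smooth_on U (F p)" and h: "test_on U h"
 shows "(\<integral>x. (\<Sum>p\<in>UNIV. pderiv_at p (F p) x) * h x \<partial>lborel) = - (\<integral>x. (\<Sum>p\<in>UNIV. F p x * pderiv_at p h x) \<partial>lborel)"
  "integrable lborel (\<lambda>x. (\<Sum>p\<in>UNIV. F p x * pderiv_at p h x))"
proof -
 have i1: "integrable lborel (\<lambda>x. pderiv_at p (F p) x * h x)" for p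
  by (rule test_on_integrable[OF test_on_mult[OF U_open smooth_on_pderiv[OF F] h]])
 have i2: "integrable lborel (\<lambda>x. F p x * pderiv_at p h x)" for p
  by (rule test_on_integrable[OF test_on_mult[OF U_open F test_on_pderiv[OF h]]])
 show "integrable lborel (\<lambda>x. (\<Sum>p\<in>UNIV. F p x * pderiv_at p h x))" using i2 by simp
 show "(\<integral>x. (\<Sum>p\<in>UNIV. pderiv_at p (F p) x) * h x \<partial>lborel) = - (\<integral>x. (\<Sum>p\<in>UNIV. F p x * pderiv_at p h x) \<partial>lborel)"
  unfolding sum_distrib_right using i1 i2 integral_by_parts_pderiv[OF U_open F h]
  by (simp add: sum_negf)
qed

lemma caccioppoli:
 assumes K: "compact K" "K \<subseteq> U"
 shows "\<exists>C K'. C \<ge> 0 \<and> compact K' \<and> K' \<subseteq> U \<and>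
  (\<forall>w F g q. smooth_on U w \<longrightarrow> (\<forall>p. smooth_on U (F p)) \<longrightarrow> smooth_on U g \<longrightarrow>
   (\<forall>x\<in>U. Lop w x = (\<Sum>p\<in>UNIV. pderiv_at p (F p) x) + g x) \<longrightarrow>
   sqint K (pderiv_at q w) \<le> C * (sqint K' w + (\<Sum>p\<in>UNIV. sqint K' (F p)) + sqint K' g))"
proof -
 obtain ct where chi: "test_on U ct" "!!x. x \<in> K ==> ct x = 1" "!!x. 0 \<le> ct x" "!!x. ct x \<le> 1"
  using smooth_cutoff[OF U_open K] by blast
 obtain K' where K': "compact K'" "K' \<subseteq> U" "!!x. x \<notin> K' ==> ct x = 0" using chi(1) unfolding test_on_def by blast
 obtain c M where cM: "c > 0" "M \<ge> 0" "!!x v. x \<in> K' ==> c * (v \<bullet> v) \<le> v \<bullet> (Amat x *v v)"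
  "!!x v. x \<in> K' ==> norm (Amat x *v v) \<le> M * norm v"
  using elliptic_constants[OF K'(1,2)] by blast
 have gsm: "smooth_on U (\<lambda>x. \<Sum>p\<in>UNIV. pderiv_at p ct x * pderiv_at p ct x)"
  by (intro smooth_on_sum smooth_on_mult smooth_on_pderiv test_on_smooth[OF chi(1)] U_open) auto
 obtain B where B: "B \<ge> 0" "!!x. x \<in> K' ==> \<bar>\<Sum>p\<in>UNIV. pderiv_at p ct x * pderiv_at p ct x\<bar> \<le> B"
  using smooth_bounded_compact[OF gsm K'(1,2)] by blast
 define C1 where "C1 = 4 * M\<^sup>2 / c + 1 / c + 1"
 define C where "C = 2 * C1 * (B + 1) / c"
 have C1: "C1 \<ge> 1" using cM by (simp add: C1_def)
 have dchi: "pderiv_at p ct x = 0" if "x \<notin> K'" for p x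
  by (rule pderiv_at_zero_outside[OF compact_imp_closed[OF K'(1)] K'(3) that])
 have main: "sqint K (pderiv_at q w) \<le> C * (sqint K' w + (\<Sum>p\<in>UNIV. sqint K' (F p)) + sqint K' g)"
  if w: "smooth_on U w" and F: "!!p. smooth_on U (F p)" and g: "smooth_on U g"
   and eq: "!!x. x \<in> U ==> Lop w x = (\<Sum>p\<in>UNIV. pderiv_at p (F p) x) + g x" for w F g q
 proof -
  have cont: "continuous_on K' f" if "smooth_on U f" for f :: "real^'n => real"
   by (rule continuous_on_subset[OF smooth_on_continuous_on[OF that] K'(2)])
  define h where "h x = w x * ct x * ct x" for x
  have wchi: "test_on U (\<lambda>x. w x * ct x)" by (rule test_on_mult[OF U_open w chi(1)])
  have h: "test_on U h" unfolding h_def[abs_def]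
   by (rule test_on_mult[OF U_open smooth_on_mult[OF U_open w test_on_smooth[OF chi(1)]] chi(1)])
  define H where "H p x = (\<Sum>q\<in>UNIV. Aco p q x * pderiv_at q w x) - F p x" for p x
  have H: "smooth_on U (H p)" for p unfolding H_def[abs_def]
   by (rule smooth_on_diff[OF U_open smooth_Aflux[OF w] F])
  have divH: "(\<Sum>p\<in>UNIV. pderiv_at p (H p) x) = g x" if "x \<in> U" for x
  proof -
   have "pderiv_at p (H p) x = pderiv_at p (\<lambda>y. \<Sum>q\<in>UNIV. Aco p q y * pderiv_at q w y) x - pderiv_at p (F p) x" for p
   proof -
    have d1: "(\<lambda>y. \<Sum>q\<in>UNIV. Aco p q y * pderiv_at q w y) differentiable (at x)"
     by (rule smooth_on_differentiable[OF smooth_Aflux[OF w] that])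
    have d2: "(\<lambda>y. -1 * F p y) differentiable (at x)"
     by (rule smooth_on_differentiable[OF smooth_on_cmult[OF U_open F] that])
    have "pderiv_at p (\<lambda>y. (\<Sum>q\<in>UNIV. Aco p q y * pderiv_at q w y) + (-1 * F p y)) x
     = pderiv_at p (\<lambda>y. \<Sum>q\<in>UNIV. Aco p q y * pderiv_at q w y) x + pderiv_at p (\<lambda>y. -1 * F p y) x"
     by (rule pderiv_at_add[OF d1 d2])
    then show ?thesis
     using pderiv_at_cmult[OF smooth_on_differentiable[OF F that], of p "-1" p] by (simp add: H_def[abs_def])
   qed
   then show ?thesis using eq[OF that] by (simp add: Lop_def sum_subtractf)
  qed
  have "(\<integral>x. (\<Sum>p\<in>UNIV. pderiv_at p (H p) x) * h x \<partial>lborel) = (\<integral>x. g x * h x \<partial>lborel)"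
   by (rule Bochner_Integration.integral_cong[OF refl]) (metis divH test_on_zero[OF h] mult_zero_right)
  then have zero: "(\<integral>x. (\<Sum>p\<in>UNIV. H p x * pderiv_at p h x) + g x * h x \<partial>lborel) = 0"
   using integral_divergence_test[OF H h] test_on_integrable[OF test_on_mult[OF U_open g h]] by simp
  define Q where "Q x = (\<Sum>p\<in>UNIV. H p x * pderiv_at p h x) + g x * h x" for x
  define R where "R x = indicator K' x * (w x)\<^sup>2 + (\<Sum>p\<in>UNIV. indicator K' x * (F p x)\<^sup>2) + indicator K' x * (g x)\<^sup>2" for x
  have Ri: "integrable lborel R" unfolding R_def
   by (intro Bochner_Integration.integrable_add Bochner_Integration.integrable_sum sqint_integrable K' cont w F g)
  have Qi: "integrable lborel Q" unfolding Q_def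
   using integral_divergence_test(2)[OF H h] test_on_integrable[OF test_on_mult[OF U_open g h]] by simp
  have pw: "c/2 * (indicator K x * (pderiv_at q w x)\<^sup>2) \<le> Q x + C1 * (B + 1) * R x" for x
  proof (cases "x \<in> K'")
   case False
   then have "h x = 0" "x \<notin> K" using K'(3) chi(2)[of x] by (auto simp: h_def)
   moreover have "pderiv_at p h x = 0" for p
    by (rule pderiv_at_zero_outside[OF compact_imp_closed[OF K'(1)] _ False]) (simp add: h_def K'(3))
   ultimately show ?thesis using False by (simp add: Q_def R_def)
  next
   case True
   then have xU: "x \<in> U" using K' by auto
   define a where "a = ct x *\<^sub>R grad w x"
   define b where "b = w x *\<^sub>R grad ct x"
   define f where "f = ct x *\<^sub>R (\<chi> p. F p x)"
   have dh: "pderiv_at p h x = ct x * (a + 2 *\<^sub>R b) $ p" for p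
   proof -
    have dw: "w differentiable (at x)" "ct differentiable (at x)" "(\<lambda>x. w x * ct x) differentiable (at x)"
     using smooth_on_differentiable[OF w xU] smooth_on_differentiable[OF test_on_smooth[OF chi(1)] xU]
      smooth_on_differentiable[OF test_on_smooth[OF wchi] xU] by auto
    show ?thesis unfolding h_def[abs_def] pderiv_at_mult[OF dw(3,2)] pderiv_at_mult[OF dw(1,2)]
     by (simp add: a_def b_def grad_def algebra_simps)
   qed
   have Hx: "ct x * H p x = (Amat x *v a - f) $ p" for p
    by (simp add: H_def a_def f_def matrix_vector_mult_def Amat_def grad_def algebra_simps sum_distrib_left)
   have "(\<Sum>p\<in>UNIV. H p x * pderiv_at p h x) = (\<Sum>p\<in>UNIV. (ct x * H p x) * (a + 2 *\<^sub>R b) $ p)"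
    unfolding dh by (intro sum.cong refl) (simp only: mult_ac)
   also have "\<dots> = (Amat x *v a - f) \<bullet> (a + 2 *\<^sub>R b)" unfolding Hx by (simp only: inner_vec_def inner_real_def)
   finally have Qx: "Q x = (Amat x *v a - f) \<bullet> (a + 2 *\<^sub>R b) + (ct x * g x) * (ct x * w x)"
    unfolding Q_def h_def by (simp add: mult_ac)
   have chi2: "(ct x)\<^sup>2 \<le> 1" using chi(3,4)[of x] by (simp add: power_le_one)
   have ff: "f \<bullet> f \<le> (\<Sum>p\<in>UNIV. (F p x)\<^sup>2)"
   proof -
    have "f \<bullet> f = (ct x)\<^sup>2 * (\<Sum>p\<in>UNIV. (F p x)\<^sup>2)"
     by (simp add: f_def inner_vec_def power2_eq_square sum_distrib_left mult_ac)
    then show ?thesis using chi2 by (simp add: mult_left_le_one_le sum_nonneg)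
   qed
   have gg: "(ct x * g x)\<^sup>2 \<le> (g x)\<^sup>2" and ww: "(ct x * w x)\<^sup>2 \<le> (w x)\<^sup>2"
    using chi2 by (simp_all add: power_mult_distrib mult_left_le_one_le)
   have bb: "b \<bullet> b \<le> B * (w x)\<^sup>2"
   proof -
    have "b \<bullet> b = (w x)\<^sup>2 * (\<Sum>p\<in>UNIV. pderiv_at p ct x * pderiv_at p ct x)"
     by (simp add: b_def grad_def inner_vec_def power2_eq_square sum_distrib_left mult_ac)
    also have "\<dots> \<le> (w x)\<^sup>2 * B" using B(2)[OF True] by (intro mult_left_mono) auto
    finally show ?thesis by (simp add: mult.commute)
   qed
   have Rx: "R x = (w x)\<^sup>2 + (\<Sum>p\<in>UNIV. (F p x)\<^sup>2) + (g x)\<^sup>2" using True by (simp add: R_def)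
   have nnF: "0 \<le> (\<Sum>p\<in>UNIV. (F p x)\<^sup>2)" by (simp add: sum_nonneg)
   have "b \<bullet> b + f \<bullet> f + (ct x * g x)\<^sup>2 + (ct x * w x)\<^sup>2 \<le> (B + 1) * (w x)\<^sup>2 + ((\<Sum>p\<in>UNIV. (F p x)\<^sup>2) + (g x)\<^sup>2)"
    using bb ff gg ww by (simp add: algebra_simps)
   also have "\<dots> \<le> (B + 1) * (w x)\<^sup>2 + (B + 1) * ((\<Sum>p\<in>UNIV. (F p x)\<^sup>2) + (g x)\<^sup>2)"
    using mult_right_mono[of 1 "B + 1" "(\<Sum>p\<in>UNIV. (F p x)\<^sup>2) + (g x)\<^sup>2"] B(1) nnF by simp
   also have "\<dots> = (B + 1) * R x" unfolding Rx by (simp add: algebra_simps)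
   finally have "C1 * (b \<bullet> b + f \<bullet> f + (ct x * g x)\<^sup>2 + (ct x * w x)\<^sup>2) \<le> C1 * ((B + 1) * R x)"
    using C1 by (intro mult_left_mono) auto
   moreover have "c/2 * (a \<bullet> a) \<le> Q x + C1 * (b \<bullet> b + f \<bullet> f + (ct x * g x)\<^sup>2 + (ct x * w x)\<^sup>2)"
    unfolding Qx C1_def by (rule caccioppoli_pointwise[OF cM(1) cM(3)[OF True] cM(4)[OF True]])
   moreover have "indicator K x * (pderiv_at q w x)\<^sup>2 \<le> a \<bullet> a"
   proof (cases "x \<in> K")
    case True
    then have "a = grad w x" using chi(2) by (simp add: a_def)
    moreover have "(pderiv_at q w x)\<^sup>2 \<le> (\<Sum>p\<in>UNIV. (pderiv_at p w x)\<^sup>2)"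
     by (rule member_le_sum) auto
    ultimately show ?thesis using True by (simp add: grad_def inner_vec_def power2_eq_square)
   qed simp
   then have "c/2 * (indicator K x * (pderiv_at q w x)\<^sup>2) \<le> c/2 * (a \<bullet> a)" using cM(1) by (intro mult_left_mono) auto
   ultimately show ?thesis unfolding mult.assoc by linarith
  qed
  have dwi: "integrable lborel (\<lambda>x. indicator K x * (pderiv_at q w x)\<^sup>2)"
   by (rule sqint_integrable[OF K(1) continuous_on_subset[OF smooth_on_continuous_on[OF smooth_on_pderiv[OF w]] K(2)]])
  have "c/2 * sqint K (pderiv_at q w) = (\<integral>x. c/2 * (indicator K x * (pderiv_at q w x)\<^sup>2) \<partial>lborel)"
   by (simp add: sqint_def)
  also have "\<dots> \<le> (\<integral>x. Q x + C1 * (B + 1) * R x \<partial>lborel)"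
   by (rule integral_mono) (use dwi Qi Ri pw in auto)
  also have "\<dots> = C1 * (B + 1) * (\<integral>x. R x \<partial>lborel)"
   using Qi Ri zero[folded Q_def] by simp
  also have "(\<integral>x. R x \<partial>lborel) = sqint K' w + (\<Sum>p\<in>UNIV. sqint K' (F p)) + sqint K' g"
  proof -
   note i = sqint_integrable[OF K'(1) cont]
   have "(\<integral>x. R x \<partial>lborel) = (\<integral>x. indicator K' x * (w x)\<^sup>2 + (\<Sum>p\<in>UNIV. indicator K' x * (F p x)\<^sup>2) \<partial>lborel) + sqint K' g"
    unfolding R_def sqint_def
    by (rule Bochner_Integration.integral_add)
     (intro Bochner_Integration.integrable_add Bochner_Integration.integrable_sum i w F g)+
   also have "(\<integral>x. indicator K' x * (w x)\<^sup>2 + (\<Sum>p\<in>UNIV. indicator K' x * (F p x)\<^sup>2) \<partial>lborel)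
     = sqint K' w + (\<integral>x. (\<Sum>p\<in>UNIV. indicator K' x * (F p x)\<^sup>2) \<partial>lborel)"
    unfolding sqint_def
    by (rule Bochner_Integration.integral_add) (intro Bochner_Integration.integrable_sum i w F)+
   also have "(\<integral>x. (\<Sum>p\<in>UNIV. indicator K' x * (F p x)\<^sup>2) \<partial>lborel) = (\<Sum>p\<in>UNIV. sqint K' (F p))"
    unfolding sqint_def by (rule Bochner_Integration.integral_sum) (intro i F)
   finally show ?thesis .
  qed
  finally show ?thesis using cM(1) by (simp add: C_def field_simps)
 qed
 have "C \<ge> 0" using C1 B(1) cM(1) by (simp add: C_def)
 with K'(1,2) main show ?thesis by (intro exI[of _ C] exI[of _ K']) (simp only: simp_thms, blast)
qed

end

text \<open>Linear differential operators of order at most \<open>k\<close> applied to \<open>u\<close> or to its Laplacian.\<close>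

inductive ops :: "(real^'n::finite) set => (real^'n => real^'n^'n) => nat =>
  ((real^'n => real) => real^'n => real) => bool" for U G k where
 word: "length \<beta> \<le> k ==> smooth_on U a ==> ops U G k (\<lambda>u x. a x * iter_pderiv \<beta> u x)"
| word_lap: "length \<beta> \<le> k ==> smooth_on U a ==> ops U G k (\<lambda>u x. a x * iter_pderiv \<beta> (lap G u) x)"
| add: "ops U G k S ==> ops U G k T ==> ops U G k (\<lambda>u x. S u x + T u x)"
| cong: "ops U G k S ==> (!!u x. smooth_on U u ==> x \<in> U ==> S u x = T u x) ==> ops U G k T"

context
 fixes U :: "(real^'n) set" and G :: "real^'n => real^'n^'n"
 assumes G: "metric_on U G"
begin

lemmas Uo = U_open[OF G]

lemma ops_smooth: "ops U G k T ==> smooth_on U u ==> smooth_on U (T u)"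
proof (induction rule: ops.induct)
 case (cong S T)
 show ?case by (rule smooth_on_cong[OF Uo _ cong.IH[OF cong.prems]]) (simp add: cong.hyps cong.prems)
qed (auto intro!: smooth_on_mult[OF Uo] smooth_on_add[OF Uo] smooth_on_iter_pderiv smooth_on_lap[OF G])

lemma ops_mult: "ops U G k T ==> smooth_on U b ==> ops U G k (\<lambda>u x. b x * T u x)"
proof (induction rule: ops.induct)
 case (word \<beta> a)
 show ?case by (rule ops.cong[OF ops.word[OF word(1) smooth_on_mult[OF Uo word(3,2)]]]) (simp add: mult.assoc)
next
 case (word_lap \<beta> a)
 show ?case by (rule ops.cong[OF ops.word_lap[OF word_lap(1) smooth_on_mult[OF Uo word_lap(3,2)]]]) (simp add: mult.assoc)
next
 case (add S T)
 show ?case by (rule ops.cong[OF ops.add[OF add.IH(1)[OF add.prems] add.IH(2)[OF add.prems]]]) (simp add: algebra_simps)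
next
 case (cong S T)
 show ?case by (rule ops.cong[OF cong.IH[OF cong.prems]]) (simp add: cong.hyps)
qed

lemma ops_cmult: "ops U G k T ==> ops U G k (\<lambda>u x. c * T u x)"
 by (rule ops_mult) simp_all

lemma ops_diff: "ops U G k S ==> ops U G k T ==> ops U G k (\<lambda>u x. S u x - T u x)"
 by (rule ops.cong[OF ops.add[OF _ ops_cmult[of k T "-1"]]]) auto

lemma ops_zero: "ops U G k (\<lambda>u x. 0)"
 by (rule ops.cong[OF ops.word[of "[]" k U "\<lambda>_. 0"]]) auto

lemma ops_sum:
 assumes "finite I" "!!i. i \<in> I ==> ops U G k (T i)" shows "ops U G k (\<lambda>u x. \<Sum>i\<in>I. T i u x)"
 using assms
proof (induction I rule: finite_induct)
 case (insert i I)
 then have "ops U G k (\<lambda>u x. T i u x + (\<Sum>i\<in>I. T i u x))" by (intro ops.add) auto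
 then show ?case using insert by simp
qed (simp add: ops_zero)

lemma ops_word1: "length \<beta> \<le> k ==> ops U G k (iter_pderiv \<beta>)"
 by (rule ops.cong[OF ops.word[of \<beta> k U "\<lambda>_. 1"]]) auto

lemma ops_Suc: "ops U G k T ==> ops U G (Suc k) T"
proof (induction rule: ops.induct)
 case (cong S T) show ?case by (rule ops.cong[OF cong.IH cong.hyps(2)])
qed (auto intro: ops.intros(1-3))

lemma ops_pderiv: "ops U G k T ==> ops U G (Suc k) (\<lambda>u. pderiv_at i (T u))"
proof (induction rule: ops.induct)
 case (word \<beta> a)
 show ?case
 proof (rule ops.cong[OF ops.add[OF ops.word[of "i # \<beta>" "Suc k" U a] ops.word[of \<beta> "Suc k" U "pderiv_at i a"]]])
  fix u :: "real^'n => real" and x assume u: "smooth_on U u" and x: "x \<in> U"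
  show "a x * iter_pderiv (i # \<beta>) u x + pderiv_at i a x * iter_pderiv \<beta> u x = pderiv_at i (\<lambda>x. a x * iter_pderiv \<beta> u x) x"
   using pderiv_at_mult[OF smooth_on_differentiable[OF word(2) x] smooth_on_differentiable[OF smooth_on_iter_pderiv[OF u] x]] by simp
 qed (use word smooth_on_pderiv in auto)
next
 case (word_lap \<beta> a)
 show ?case
 proof (rule ops.cong[OF ops.add[OF ops.word_lap[of "i # \<beta>" "Suc k" U a] ops.word_lap[of \<beta> "Suc k" U "pderiv_at i a"]]])
  fix u :: "real^'n => real" and x assume u: "smooth_on U u" and x: "x \<in> U"
  show "a x * iter_pderiv (i # \<beta>) (lap G u) x + pderiv_at i a x * iter_pderiv \<beta> (lap G u) x = pderiv_at i (\<lambda>x. a x * iter_pderiv \<beta> (lap G u) x) x"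
   using pderiv_at_mult[OF smooth_on_differentiable[OF word_lap(2) x] smooth_on_differentiable[OF smooth_on_iter_pderiv[OF smooth_on_lap[OF G u]] x]] by simp
 qed (use word_lap smooth_on_pderiv in auto)
next
 case (add S T)
 show ?case
 proof (rule ops.cong[OF ops.add[OF add.IH]])
  fix u :: "real^'n => real" and x assume u: "smooth_on U u" and x: "x \<in> U"
  show "pderiv_at i (S u) x + pderiv_at i (T u) x = pderiv_at i (\<lambda>x. S u x + T u x) x"
   by (rule pderiv_at_add[symmetric, OF smooth_on_differentiable[OF ops_smooth[OF add.hyps(1) u] x]
      smooth_on_differentiable[OF ops_smooth[OF add.hyps(2) u] x]])
 qed
next
 case (cong S T)
 show ?case
 proof (rule ops.cong[OF cong.IH])
  fix u :: "real^'n => real" and x assume "smooth_on U u" "x \<in> U"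
  then show "pderiv_at i (S u) x = pderiv_at i (T u) x" using pderiv_at_cong[OF Uo, of x "S u" "T u"] cong.hyps by blast
 qed
qed

abbreviation "AA \<equiv> Aco G"
abbreviation "LL \<equiv> Lop G"

text \<open>Differentiating the equation in divergence form: only derivatives of \<open>u\<close> of the order of \<open>\<alpha>\<close>
 enter the fluxes \<open>F p\<close>.\<close>

lemma Lop_word:
 "\<exists>F g. (\<forall>p. ops U G (length \<alpha>) (F p)) \<and> ops U G (length \<alpha>) g \<and>
   (\<forall>u. smooth_on U u \<longrightarrow> (\<forall>x\<in>U. LL (iter_pderiv \<alpha> u) x = (\<Sum>p\<in>UNIV. pderiv_at p (F p u) x) + g u x))"
proof (induction \<alpha>)
 case Nil
 show ?case
 proof (intro exI conjI allI impI ballI)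
  show "ops U G (length []) (\<lambda>u x. 0)" for p :: 'n by (rule ops_zero)
  show "ops U G (length []) (\<lambda>u x. sqrt (det (G x)) * iter_pderiv [] (lap G u) x)"
   by (rule ops.word_lap[OF _ smooth_on_rho[OF G]]) simp
  fix u :: "real^'n => real" and x assume "smooth_on U u" "x \<in> U"
  then show "LL (iter_pderiv [] u) x = (\<Sum>p\<in>UNIV. pderiv_at p (\<lambda>x. 0) x) + sqrt (det (G x)) * iter_pderiv [] (lap G u) x"
   using Lop_lap[OF G] by simp
 qed
next
 case (Cons i \<alpha>)
 then obtain F g where Fg: "(\<forall>p. ops U G (length \<alpha>) (F p)) \<and> ops U G (length \<alpha>) g \<and>
   (\<forall>u. smooth_on U u \<longrightarrow> (\<forall>x\<in>U. LL (iter_pderiv \<alpha> u) x = (\<Sum>p\<in>UNIV. pderiv_at p (F p u) x) + g u x))"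
  by (elim exE)
 have F: "ops U G (length \<alpha>) (F p)" for p using Fg by simp
 have g: "ops U G (length \<alpha>) g" using Fg by simp
 have eq: "LL (iter_pderiv \<alpha> u) x = (\<Sum>p\<in>UNIV. pderiv_at p (F p u) x) + g u x" if "smooth_on U u" "x \<in> U" for u x
  using Fg that by simp
 define F' where "F' p u x = pderiv_at i (F p u) x - (\<Sum>q\<in>UNIV. pderiv_at i (AA p q) x * iter_pderiv (q # \<alpha>) u x)" for p u x
 have F': "ops U G (length (i # \<alpha>)) (F' p)" for p
 proof -
  have "ops U G (Suc (length \<alpha>)) (\<lambda>u x. pderiv_at i (F p u) x - (\<Sum>q\<in>UNIV. pderiv_at i (AA p q) x * iter_pderiv (q # \<alpha>) u x))"
   by (rule ops_diff[OF ops_pderiv[OF F] ops_sum[OF finite ops_mult[OF ops_word1 smooth_on_pderiv[OF smooth_Aco[OF G]]]]]) simp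
  then show ?thesis by (simp add: F'_def[abs_def])
 qed
 have g': "ops U G (length (i # \<alpha>)) (\<lambda>u. pderiv_at i (g u))" using ops_pderiv[OF g] by simp
 have "LL (iter_pderiv (i # \<alpha>) u) x = (\<Sum>p\<in>UNIV. pderiv_at p (F' p u) x) + pderiv_at i (g u) x"
  if u: "smooth_on U u" and x: "x \<in> U" for u x
 proof -
  let ?w = "iter_pderiv \<alpha> u"
  have w: "smooth_on U ?w" by (rule smooth_on_iter_pderiv[OF u])
  have Fu: "smooth_on U (F p u)" for p by (rule ops_smooth[OF F u])
  have gu: "smooth_on U (g u)" by (rule ops_smooth[OF g u])
  define S where "S p y = (\<Sum>q\<in>UNIV. pderiv_at i (AA p q) y * pderiv_at q ?w y)" for p y
  define R where "R p y = (\<Sum>q\<in>UNIV. AA p q y * pderiv_at q (pderiv_at i ?w) y)" for p y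
  define Q where "Q p y = (\<Sum>q\<in>UNIV. AA p q y * pderiv_at q ?w y)" for p y
  have Ssm: "smooth_on U (S p)" for p unfolding S_def[abs_def]
   by (rule smooth_on_sum[OF Uo finite smooth_on_mult[OF Uo smooth_on_pderiv[OF smooth_Aco[OF G]] smooth_on_pderiv[OF w]]])
  have Qsm: "smooth_on U (Q p)" for p unfolding Q_def[abs_def] by (rule smooth_Aflux[OF G w])
  have Rsm: "smooth_on U (R p)" for p unfolding R_def[abs_def] by (rule smooth_Aflux[OF G smooth_on_pderiv[OF w]])
  have dQ: "pderiv_at i (Q p) y = R p y + S p y" if y: "y \<in> U" for p y
  proof -
   have "pderiv_at i (Q p) y = (\<Sum>q\<in>UNIV. pderiv_at i (\<lambda>y. AA p q y * pderiv_at q ?w y) y)"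
    unfolding Q_def[abs_def]
    by (rule pderiv_at_sum[OF finite smooth_on_differentiable[OF smooth_on_mult[OF Uo smooth_Aco[OF G] smooth_on_pderiv[OF w]] y]])
   also have "\<dots> = (\<Sum>q\<in>UNIV. AA p q y * pderiv_at q (pderiv_at i ?w) y + pderiv_at i (AA p q) y * pderiv_at q ?w y)"
    by (rule sum.cong[OF refl])
     (simp only: pderiv_at_mult[OF smooth_on_differentiable[OF smooth_Aco[OF G] y] smooth_on_differentiable[OF smooth_on_pderiv[OF w] y]]
      pderiv_at_commute[OF Uo w y, of i])
   finally show ?thesis by (simp add: sum.distrib R_def S_def)
  qed
  have "LL ?w y = (\<Sum>p\<in>UNIV. pderiv_at p (Q p) y)" for y by (simp add: Lop_def[OF G] Q_def[abs_def])
  then have "(\<Sum>p\<in>UNIV. pderiv_at p (Q p) y) = (\<Sum>p\<in>UNIV. pderiv_at p (F p u) y) + g u y" if "y \<in> U" for y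
   using eq[OF u that] by simp
  then have "pderiv_at i (\<lambda>y. \<Sum>p\<in>UNIV. pderiv_at p (Q p) y) x = pderiv_at i (\<lambda>y. (\<Sum>p\<in>UNIV. pderiv_at p (F p u) y) + g u y) x"
   by (rule pderiv_at_cong[OF Uo x])
  moreover have "pderiv_at i (\<lambda>y. \<Sum>p\<in>UNIV. pderiv_at p (Q p) y) x = (\<Sum>p\<in>UNIV. pderiv_at p (R p) x + pderiv_at p (S p) x)"
  proof -
   have "pderiv_at i (\<lambda>y. \<Sum>p\<in>UNIV. pderiv_at p (Q p) y) x = (\<Sum>p\<in>UNIV. pderiv_at i (pderiv_at p (Q p)) x)"
    by (rule pderiv_at_sum[OF finite smooth_on_differentiable[OF smooth_on_pderiv[OF Qsm] x]])
   also have "\<dots> = (\<Sum>p\<in>UNIV. pderiv_at p (\<lambda>y. R p y + S p y) x)"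
   proof (rule sum.cong[OF refl])
    fix p
    have "pderiv_at i (pderiv_at p (Q p)) x = pderiv_at p (pderiv_at i (Q p)) x" by (rule pderiv_at_commute[OF Uo Qsm x])
    also have "\<dots> = pderiv_at p (\<lambda>y. R p y + S p y) x" by (rule pderiv_at_cong[OF Uo x dQ])
    finally show "pderiv_at i (pderiv_at p (Q p)) x = pderiv_at p (\<lambda>y. R p y + S p y) x" .
   qed
   also have "\<dots> = (\<Sum>p\<in>UNIV. pderiv_at p (R p) x + pderiv_at p (S p) x)"
    by (rule sum.cong[OF refl]) (rule pderiv_at_add[OF smooth_on_differentiable[OF Rsm x] smooth_on_differentiable[OF Ssm x]])
   finally show ?thesis .
  qed
  moreover have "pderiv_at i (\<lambda>y. (\<Sum>p\<in>UNIV. pderiv_at p (F p u) y) + g u y) x = (\<Sum>p\<in>UNIV. pderiv_at p (pderiv_at i (F p u)) x) + pderiv_at i (g u) x"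
  proof -
   have "pderiv_at i (\<lambda>y. (\<Sum>p\<in>UNIV. pderiv_at p (F p u) y) + g u y) x = pderiv_at i (\<lambda>y. \<Sum>p\<in>UNIV. pderiv_at p (F p u) y) x + pderiv_at i (g u) x"
    by (rule pderiv_at_add[OF smooth_on_differentiable[OF smooth_on_sum[OF Uo finite smooth_on_pderiv[OF Fu]] x] smooth_on_differentiable[OF gu x]])
   also have "pderiv_at i (\<lambda>y. \<Sum>p\<in>UNIV. pderiv_at p (F p u) y) x = (\<Sum>p\<in>UNIV. pderiv_at i (pderiv_at p (F p u)) x)"
    by (rule pderiv_at_sum[OF finite smooth_on_differentiable[OF smooth_on_pderiv[OF Fu] x]])
   also have "\<dots> = (\<Sum>p\<in>UNIV. pderiv_at p (pderiv_at i (F p u)) x)"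
    by (rule sum.cong[OF refl]) (rule pderiv_at_commute[OF Uo Fu x])
   finally show ?thesis .
  qed
  moreover have "LL (iter_pderiv (i # \<alpha>) u) x = (\<Sum>p\<in>UNIV. pderiv_at p (R p) x)"
   by (simp add: Lop_def[OF G] R_def[abs_def])
  moreover have "pderiv_at p (F' p u) x = pderiv_at p (pderiv_at i (F p u)) x - pderiv_at p (S p) x" for p
  proof -
   have e: "F' p u = (\<lambda>y. pderiv_at i (F p u) y + (-1) * S p y)" by (simp add: F'_def S_def fun_eq_iff)
   show ?thesis unfolding e
    using pderiv_at_add[OF smooth_on_differentiable[OF smooth_on_pderiv[OF Fu] x] smooth_on_differentiable[OF smooth_on_cmult[OF Uo Ssm] x], of p i p "-1" p]
     pderiv_at_cmult[OF smooth_on_differentiable[OF Ssm x], of p "-1" p] by simp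
  qed
  ultimately show ?thesis by (simp add: sum.distrib sum_subtractf)
 qed
 with F' g' show ?case by blast
qed

text \<open>Functionals of \<open>u\<close> that are bounded by the \<open>L\<^sup>2\<close> norms of iterated Laplacians of \<open>u\<close> on compact subsets.\<close>

definition lap_bounded :: "((real^'n => real) => real) => bool" where
 "lap_bounded Q \<longleftrightarrow> (\<exists>C m K'. C \<ge> 0 \<and> compact K' \<and> K' \<subseteq> U \<and>
   (\<forall>u. smooth_on U u \<longrightarrow> Q u \<le> C * (\<Sum>j\<le>m. sqint K' ((lap G ^^ j) u))))"

lemma smooth_lap_pow: "smooth_on U u ==> smooth_on U ((lap G ^^ j) u)"
 by (induction j) (auto intro: smooth_on_lap[OF G])

lemma U_cont: "smooth_on U (f :: _ => real) ==> K \<subseteq> U ==> continuous_on K f"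
 by (rule continuous_on_subset[OF smooth_on_continuous_on])

lemma lap_bounded_le: "lap_bounded Q ==> (!!u. smooth_on U u ==> P u \<le> Q u) ==> lap_bounded P"
proof -
 assume "lap_bounded Q" and PQ: "!!u. smooth_on U u ==> P u \<le> Q u"
 then obtain C m K' where Q: "C \<ge> 0" "compact K'" "K' \<subseteq> U" "!!u. smooth_on U u ==> Q u \<le> C * (\<Sum>j\<le>m. sqint K' ((lap G ^^ j) u))"
  unfolding lap_bounded_def by (elim exE conjE) (rule that, auto)
 have "P u \<le> C * (\<Sum>j\<le>m. sqint K' ((lap G ^^ j) u))" if "smooth_on U u" for u
  by (rule order_trans[OF PQ[OF that] Q(4)[OF that]])
 with Q show ?thesis unfolding lap_bounded_def
  by (intro exI[of _ C] exI[of _ m] exI[of _ K']) simp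
qed

lemma lap_bounded_cmult: "lap_bounded Q ==> c \<ge> 0 ==> lap_bounded (\<lambda>u. c * Q u)"
proof -
 assume "lap_bounded Q" and c: "c \<ge> 0"
 then obtain C m K' where Q: "C \<ge> 0" "compact K'" "K' \<subseteq> U" "!!u. smooth_on U u ==> Q u \<le> C * (\<Sum>j\<le>m. sqint K' ((lap G ^^ j) u))"
  unfolding lap_bounded_def by blast
 then have "c * Q u \<le> (c * C) * (\<Sum>j\<le>m. sqint K' ((lap G ^^ j) u))" if "smooth_on U u" for u
  using mult_left_mono[OF Q(4)[OF that] c] by (simp add: mult.assoc)
 with Q c show ?thesis unfolding lap_bounded_def
  by (intro exI[of _ "c * C"] exI[of _ m] exI[of _ K']) simp
qed

lemma lap_bounded_add: assumes "lap_bounded P" "lap_bounded Q" shows "lap_bounded (\<lambda>u. P u + Q u)"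
proof -
 obtain C m K where P: "C \<ge> 0" "compact K" "K \<subseteq> U" "!!u. smooth_on U u ==> P u \<le> C * (\<Sum>j\<le>m. sqint K ((lap G ^^ j) u))"
  using assms(1) unfolding lap_bounded_def by (elim exE conjE) (rule that, auto)
 obtain D n L where Q: "D \<ge> 0" "compact L" "L \<subseteq> U" "!!u. smooth_on U u ==> Q u \<le> D * (\<Sum>j\<le>n. sqint L ((lap G ^^ j) u))"
  using assms(2) unfolding lap_bounded_def by (elim exE conjE) (rule that, auto)
 have sub: "(\<Sum>j\<le>m'. sqint K' ((lap G ^^ j) u)) \<le> (\<Sum>j\<le>max m n. sqint (K \<union> L) ((lap G ^^ j) u))"
  if u: "smooth_on U u" and "K' = K \<or> K' = L" "m' \<le> max m n" for u K' m'
 proof -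
  have "(\<Sum>j\<le>m'. sqint K' ((lap G ^^ j) u)) \<le> (\<Sum>j\<le>max m n. sqint K' ((lap G ^^ j) u))"
   using that(3) by (intro sum_mono2) (auto simp: sqint_nonneg)
  also have "\<dots> \<le> (\<Sum>j\<le>max m n. 1 * sqint (K \<union> L) ((lap G ^^ j) u))"
   by (intro sum_mono sqint_le U_cont smooth_lap_pow u) (use that(2) P Q in auto)
  finally show ?thesis by simp
 qed
 have "P u + Q u \<le> (C + D) * (\<Sum>j\<le>max m n. sqint (K \<union> L) ((lap G ^^ j) u))" if u: "smooth_on U u" for u
 proof -
  have "P u \<le> C * (\<Sum>j\<le>max m n. sqint (K \<union> L) ((lap G ^^ j) u))"
   using P(4)[OF u] mult_left_mono[OF sub[OF u, of K m] P(1)] by simp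
  moreover have "Q u \<le> D * (\<Sum>j\<le>max m n. sqint (K \<union> L) ((lap G ^^ j) u))"
   using Q(4)[OF u] mult_left_mono[OF sub[OF u, of L n] Q(1)] by simp
  ultimately show ?thesis by (simp add: algebra_simps)
 qed
 moreover have "compact (K \<union> L)" "K \<union> L \<subseteq> U" "C + D \<ge> 0" using P Q by auto
 ultimately show ?thesis unfolding lap_bounded_def
  by (intro exI[of _ "C + D"] exI[of _ "max m n"] exI[of _ "K \<union> L"]) simp
qed

lemma lap_bounded_zero: "lap_bounded (\<lambda>u. 0)"
 unfolding lap_bounded_def by (rule exI[of _ 0], rule exI[of _ 0], rule exI[of _ "{}"]) simp

lemma lap_bounded_sum:
 "finite I ==> (!!i. i \<in> I ==> lap_bounded (Q i)) ==> lap_bounded (\<lambda>u. \<Sum>i\<in>I. Q i u)"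
 by (induction I rule: finite_induct) (simp_all add: lap_bounded_zero lap_bounded_add)

lemma lap_bounded_lap: "lap_bounded Q ==> lap_bounded (\<lambda>u. Q (lap G u))"
proof -
 assume "lap_bounded Q"
 then obtain C m K' where Q: "C \<ge> 0" "compact K'" "K' \<subseteq> U" "!!u. smooth_on U u ==> Q u \<le> C * (\<Sum>j\<le>m. sqint K' ((lap G ^^ j) u))"
  unfolding lap_bounded_def by (elim exE conjE) (rule that, auto)
 have "Q (lap G u) \<le> C * (\<Sum>j\<le>Suc m. sqint K' ((lap G ^^ j) u))" if u: "smooth_on U u" for u
 proof -
  have "(\<Sum>j\<le>m. sqint K' ((lap G ^^ j) (lap G u))) = (\<Sum>j\<le>m. sqint K' ((lap G ^^ Suc j) u))"
   by (simp only: funpow_Suc_right o_apply)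
  also have "\<dots> \<le> (\<Sum>j\<le>Suc m. sqint K' ((lap G ^^ j) u))"
   unfolding sum.atMost_Suc_shift[of _ m] using sqint_nonneg by simp
  finally show ?thesis by (rule order_trans[OF Q(4)[OF smooth_on_lap[OF G u]] mult_left_mono[OF _ Q(1)]])
 qed
 with Q show ?thesis unfolding lap_bounded_def
  by (intro exI[of _ C] exI[of _ "Suc m"] exI[of _ K']) simp
qed

lemma lap_bounded_ops:
 assumes T: "ops U G k T"
  and words: "!!\<beta> L. length \<beta> \<le> k ==> compact L ==> L \<subseteq> U ==> lap_bounded (\<lambda>u. sqint L (iter_pderiv \<beta> u))"
  and L: "compact L" "L \<subseteq> U"
 shows "lap_bounded (\<lambda>u. sqint L (T u))"
 using T
proof (induction rule: ops.induct)
 case (word \<beta> a)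
 obtain B where B: "B \<ge> 0" "!!x. x \<in> L ==> \<bar>a x\<bar> \<le> B" using smooth_bounded_compact[OF G word(2) L] by blast
 have Bs: "(a x)\<^sup>2 \<le> B\<^sup>2" if "x \<in> L" for x using abs_le_square_iff[of "a x" B] B that by auto
 show ?case
 proof (rule lap_bounded_le[OF lap_bounded_cmult[OF words[OF word(1) L], of "B\<^sup>2"]])
  fix u :: "real^'n => real" assume u: "smooth_on U u"
  show "sqint L (\<lambda>x. a x * iter_pderiv \<beta> u x) \<le> B\<^sup>2 * sqint L (iter_pderiv \<beta> u)"
   by (rule sqint_le[OF L(1) U_cont[OF smooth_on_mult[OF Uo word(2) smooth_on_iter_pderiv[OF u]] L(2)] L(1) _ U_cont[OF smooth_on_iter_pderiv[OF u] L(2)]])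
    (use Bs in \<open>auto simp: power_mult_distrib intro!: mult_right_mono\<close>)
 qed simp
next
 case (word_lap \<beta> a)
 obtain B where B: "B \<ge> 0" "!!x. x \<in> L ==> \<bar>a x\<bar> \<le> B" using smooth_bounded_compact[OF G word_lap(2) L] by blast
 have Bs: "(a x)\<^sup>2 \<le> B\<^sup>2" if "x \<in> L" for x using abs_le_square_iff[of "a x" B] B that by auto
 show ?case
 proof (rule lap_bounded_le[OF lap_bounded_cmult[OF lap_bounded_lap[OF words[OF word_lap(1) L]], of "B\<^sup>2"]])
  fix u :: "real^'n => real" assume u': "smooth_on U u"
  have u: "smooth_on U (lap G u)" by (rule smooth_on_lap[OF G u'])
  show "sqint L (\<lambda>x. a x * iter_pderiv \<beta> (lap G u) x) \<le> B\<^sup>2 * sqint L (iter_pderiv \<beta> (lap G u))"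
   by (rule sqint_le[OF L(1) U_cont[OF smooth_on_mult[OF Uo word_lap(2) smooth_on_iter_pderiv[OF u]] L(2)] L(1) _ U_cont[OF smooth_on_iter_pderiv[OF u] L(2)]])
    (use Bs in \<open>auto simp: power_mult_distrib intro!: mult_right_mono\<close>)
 qed simp
next
 case (add S T)
 show ?case
 proof (rule lap_bounded_le[OF lap_bounded_add[OF lap_bounded_cmult[OF add.IH(1), of 2] lap_bounded_cmult[OF add.IH(2), of 2]]])
  fix u :: "real^'n => real" assume u: "smooth_on U u"
  show "sqint L (\<lambda>x. S u x + T u x) \<le> 2 * sqint L (S u) + 2 * sqint L (T u)"
   by (rule sqint_add_le[OF L(1) U_cont[OF ops_smooth[OF add.hyps(1) u] L(2)] U_cont[OF ops_smooth[OF add.hyps(2) u] L(2)]])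
 qed auto
next
 case (cong S T)
 show ?case
 proof (rule lap_bounded_le[OF cong.IH])
  fix u :: "real^'n => real" assume u: "smooth_on U u"
  have "sqint L (T u) = sqint L (S u)" unfolding sqint_def
   by (rule Bochner_Integration.integral_cong[OF refl]) (use cong.hyps(2)[OF u] L(2) in \<open>auto simp: indicator_def\<close>)
  then show "sqint L (T u) \<le> sqint L (S u)" by simp
 qed
qed

lemma lap_bounded_word:
 "length \<beta> \<le> k ==> compact L ==> L \<subseteq> U ==> lap_bounded (\<lambda>u. sqint L (iter_pderiv \<beta> u))"
proof (induction k arbitrary: \<beta> L)
 case 0
 have "sqint L u \<le> 1 * (\<Sum>j\<le>0. sqint L ((lap G ^^ j) u))" for u by simp
 then have "lap_bounded (sqint L)" unfolding lap_bounded_def using 0(2,3)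
  by (intro exI[of _ 1] exI[of _ 0] exI[of _ L]) simp
 then show ?case using 0(1) by simp
next
 case (Suc k)
 show ?case
 proof (cases "length \<beta> \<le> k")
  case True then show ?thesis using Suc by blast
 next
  case False
  then obtain i \<alpha> where \<beta>: "\<beta> = i # \<alpha>" and len: "length \<alpha> = k" using Suc.prems(1) by (cases \<beta>) auto
  obtain F g where Fg: "(\<forall>p. ops U G (length \<alpha>) (F p)) \<and> ops U G (length \<alpha>) g \<and>
    (\<forall>u. smooth_on U u \<longrightarrow> (\<forall>x\<in>U. LL (iter_pderiv \<alpha> u) x = (\<Sum>p\<in>UNIV. pderiv_at p (F p u) x) + g u x))"
   using Lop_word[of \<alpha>] by (elim exE)
  have F: "ops U G k (F p)" for p using Fg len by simp
  have g: "ops U G k g" using Fg len by simp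
  have eq: "LL (iter_pderiv \<alpha> u) x = (\<Sum>p\<in>UNIV. pderiv_at p (F p u) x) + g u x" if "smooth_on U u" "x \<in> U" for u x
   using Fg that by simp
  obtain C K' where C: "C \<ge> 0" "compact K'" "K' \<subseteq> U"
   "\<forall>w F g q. smooth_on U w \<longrightarrow> (\<forall>p. smooth_on U (F p)) \<longrightarrow> smooth_on U g \<longrightarrow>
    (\<forall>x\<in>U. LL w x = (\<Sum>p\<in>UNIV. pderiv_at p (F p) x) + g x) \<longrightarrow>
    sqint L (pderiv_at q w) \<le> C * (sqint K' w + (\<Sum>p\<in>UNIV. sqint K' (F p)) + sqint K' g)"
   using caccioppoli[OF G Suc.prems(2,3)] by (elim exE conjE) (rule that)
  have bd: "lap_bounded (\<lambda>u. sqint K' (T u))" if "ops U G k T" for T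
   by (rule lap_bounded_ops[OF that Suc.IH C(2,3)])
  have "lap_bounded (\<lambda>u. C * (sqint K' (iter_pderiv \<alpha> u) + (\<Sum>p\<in>UNIV. sqint K' (F p u)) + sqint K' (g u)))"
   by (rule lap_bounded_cmult[OF lap_bounded_add[OF lap_bounded_add[OF bd[OF ops_word1] lap_bounded_sum[OF finite bd[OF F]]] bd[OF g]] C(1)])
    (simp add: len)
  then show ?thesis
  proof (rule lap_bounded_le)
   fix u :: "real^'n => real" assume u: "smooth_on U u"
   show "sqint L (iter_pderiv \<beta> u) \<le> C * (sqint K' (iter_pderiv \<alpha> u) + (\<Sum>p\<in>UNIV. sqint K' (F p u)) + sqint K' (g u))"
    unfolding \<beta> iter_pderiv_simps
    by (rule C(4)[rule_format, OF smooth_on_iter_pderiv[OF u] ops_smooth[OF F u] ops_smooth[OF g u] eq[OF u]])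
  qed
 qed
qed

end

subsection \<open>From \<open>L\<^sup>2\<close> bounds to pointwise bounds\<close>

lemma test_on_iter_pderiv: "test_on U h ==> test_on U (iter_pderiv \<beta> h)"
 by (induction \<beta>) (auto intro: test_on_pderiv)

lemma iter_pderiv_zero_outside:
 fixes f :: "real^'n => real"
 assumes "closed K" "!!x. x \<notin> K ==> f x = 0"
 shows "x \<notin> K ==> iter_pderiv \<beta> f x = 0"
proof (induction \<beta> arbitrary: x)
 case (Cons i \<beta>)
 show ?case using pderiv_at_zero_outside[OF assms(1) Cons.IH Cons.prems] by simp
qed (simp add: assms)

lemma sup_bound_one_direction:
 fixes w :: "real^'n => real"
 assumes w: "test_on UNIV w"
 shows "ennreal ((w x)\<^sup>2) \<le> (\<integral>\<^sup>+t. ennreal ((w (x + t *\<^sub>R axis i 1))\<^sup>2) + ennreal ((pderiv_at i w (x + t *\<^sub>R axis i 1))\<^sup>2) \<partial>lborel)"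
proof -
 let ?e = "axis i 1 :: real^'n"
 define v where "v t = w (x + t *\<^sub>R ?e)" for t
 define v' where "v' t = pderiv_at i w (x + t *\<^sub>R ?e)" for t
 obtain K where K: "compact K" "!!x. x \<notin> K ==> w x = 0" using w unfolding test_on_def by blast
 have sm: "smooth_on UNIV w" using w by (rule test_on_smooth)
 obtain B where B: "!!y. y \<in> K ==> norm y \<le> B" using compact_imp_bounded[OF K(1)] unfolding bounded_iff by blast
 define R where "R = \<bar>B\<bar> + norm x + 1"
 have R: "R > 0" by (simp add: R_def add_nonneg_pos)
 have "x + R *\<^sub>R ?e \<notin> K"
 proof
  assume "x + R *\<^sub>R ?e \<in> K"
  then have "norm (x + R *\<^sub>R ?e) \<le> B" by (rule B)
  moreover have "norm (R *\<^sub>R ?e) \<le> norm (x + R *\<^sub>R ?e) + norm x"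
   using norm_triangle_ineq4[of "x + R *\<^sub>R ?e" x] by simp
  moreover have "norm (R *\<^sub>R ?e) = R" using R by simp
  ultimately show False unfolding R_def by linarith
 qed
 then have vR: "v R = 0" using K(2) by (simp add: v_def)
 have dv: "(v has_real_derivative v' t) (at t)" for t
  unfolding v_def[abs_def] v'_def by (rule differentiable_has_line_derivative) (rule smooth_on_differentiable[OF sm UNIV_I])
 have cv: "continuous_on UNIV v'"
  unfolding v'_def by (rule continuous_on_compose2[OF smooth_on_continuous_on[OF smooth_on_pderiv[OF sm]]]) (auto intro!: continuous_intros)
 have cv0: "continuous_on UNIV v" using dv DERIV_continuous_on by blast
 define q where "q t = (v t)\<^sup>2 + (v' t)\<^sup>2" for t
 have cq: "continuous_on {0..R} q" unfolding q_def
  by (intro continuous_intros continuous_on_subset[OF cv] continuous_on_subset[OF cv0]) auto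
 have ftc: "((\<lambda>t. - (2 * (v t * v' t))) has_integral (- ((v R)\<^sup>2) - (- ((v 0)\<^sup>2)))) {0..R}"
 proof (rule fundamental_theorem_of_calculus)
  show "((\<lambda>t. - ((v t)\<^sup>2)) has_vector_derivative - (2 * (v t * v' t))) (at t within {0..R})" for t
   unfolding has_real_derivative_iff_has_vector_derivative[symmetric]
   by (rule has_field_derivative_at_within) (auto intro!: derivative_eq_intros dv)
 qed (use R in auto)
 have qi: "(q has_integral integral {0..R} q) {0..R}"
  using integrable_continuous_real[OF cq] by (rule integrable_integral)
 have "(v 0)\<^sup>2 \<le> integral {0..R} q"
 proof -
  have "- (2 * (v t * v' t)) \<le> q t" for t
   using zero_le_power2[of "v t + v' t"] by (simp add: q_def power2_sum)
  then show ?thesis using has_integral_le[OF ftc qi] vR by simp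
 qed
 also have "ennreal (integral {0..R} q) = (\<integral>\<^sup>+t. ennreal (if t \<in> {0..R} then q t else 0) \<partial>lborel)"
 proof (rule nn_integral_has_integral_lborel[symmetric])
  show "((\<lambda>t. if t \<in> {0..R} then q t else 0) has_integral integral {0..R} q) UNIV"
   using qi by (simp only: has_integral_restrict_UNIV)
  have "(\<lambda>t. indicator {0..R} t *\<^sub>R q t) \<in> borel_measurable borel"
   by (rule borel_measurable_continuous_on_indicator[OF _ cq]) auto
  moreover have "(\<lambda>t. indicator {0..R} t *\<^sub>R q t) = (\<lambda>t. if t \<in> {0..R} then q t else 0)" by (auto simp: indicator_def)
  ultimately show "(\<lambda>t. if t \<in> {0..R} then q t else 0) \<in> borel_measurable borel" by simp
 qed (simp add: q_def)
 also have "\<dots> \<le> (\<integral>\<^sup>+t. ennreal ((v t)\<^sup>2) + ennreal ((v' t)\<^sup>2) \<partial>lborel)"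
  by (intro nn_integral_mono) (simp add: q_def)
 finally show ?thesis by (simp add: v_def v'_def ennreal_leI)
qed

lemma nn_integral_sum_list:
 "(!!\<beta>. \<beta> \<in> set W ==> g \<beta> \<in> borel_measurable M) ==>
  (\<integral>\<^sup>+t. (\<Sum>\<beta>\<leftarrow>W. g \<beta> t) \<partial>M) = (\<Sum>\<beta>\<leftarrow>W. \<integral>\<^sup>+t. g \<beta> t \<partial>M) \<and> (\<lambda>t. \<Sum>\<beta>\<leftarrow>W. g \<beta> t) \<in> borel_measurable M"
 by (induction W) (auto simp: nn_integral_add)

lemma sobolev_partial:
 assumes "finite J" "J \<subseteq> (Basis :: (real^'n) set)"
 shows "\<exists>W :: 'n list list. \<forall>w x. test_on UNIV w \<longrightarrow>
  ennreal ((w x)\<^sup>2) \<le> (\<integral>\<^sup>+f. (\<Sum>\<beta>\<leftarrow>W. ennreal ((iter_pderiv \<beta> w (x + (\<Sum>b\<in>J. f b *\<^sub>R b)))\<^sup>2)) \<partial>Pi\<^sub>M J (\<lambda>_. lborel))"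
 using assms
proof (induction J rule: finite_induct)
 case empty
 interpret product_sigma_finite "\<lambda>_::real^'n. lborel :: real measure" ..
 show ?case by (rule exI[of _ "[[]]"]) (simp add: PiM_empty nn_integral_count_space_finite)
next
 case (insert b J)
 interpret product_sigma_finite "\<lambda>_::real^'n. lborel :: real measure" ..
 obtain W :: "'n list list" where W: "!!w x. test_on UNIV w ==>
  ennreal ((w x)\<^sup>2) \<le> (\<integral>\<^sup>+f. (\<Sum>\<beta>\<leftarrow>W. ennreal ((iter_pderiv \<beta> w (x + (\<Sum>b\<in>J. f b *\<^sub>R b)))\<^sup>2)) \<partial>Pi\<^sub>M J (\<lambda>_. lborel))"
  using insert by blast
 obtain i where b: "b = axis i 1" using insert(4) by (auto simp: Basis_vec_def)
 let ?W = "W @ map ((#) i) W"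
 show ?case
 proof (rule exI[of _ ?W], intro allI impI)
  fix w :: "real^'n => real" and x assume w: "test_on UNIV w"
  have mw[measurable]: "iter_pderiv \<beta> w \<in> borel_measurable borel" for \<beta>
   by (rule test_on_measurable[OF test_on_iter_pderiv[OF w]])
  define g where "g V z = (\<Sum>\<beta>\<leftarrow>V. ennreal ((iter_pderiv \<beta> w z)\<^sup>2))" for V z
  have mg[measurable]: "g V \<in> borel_measurable borel" for V
   unfolding g_def by (rule nn_integral_sum_list[THEN conjunct2]) measurable
  have split: "g ?W z = (\<Sum>\<beta>\<leftarrow>W. ennreal ((iter_pderiv \<beta> w z)\<^sup>2) + ennreal ((iter_pderiv (i # \<beta>) w z)\<^sup>2))" for z
   by (simp add: g_def sum_list_addf o_def)
  have step: "g W z \<le> (\<integral>\<^sup>+t. g ?W (z + t *\<^sub>R b) \<partial>lborel)" for z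
  proof -
   have "g W z \<le> (\<Sum>\<beta>\<leftarrow>W. \<integral>\<^sup>+t. ennreal ((iter_pderiv \<beta> w (z + t *\<^sub>R b))\<^sup>2) + ennreal ((iter_pderiv (i # \<beta>) w (z + t *\<^sub>R b))\<^sup>2) \<partial>lborel)"
    unfolding g_def b
    by (intro sum_list_mono) (simp only: iter_pderiv_simps sup_bound_one_direction[OF test_on_iter_pderiv[OF w]])
   also have "\<dots> = (\<integral>\<^sup>+t. g ?W (z + t *\<^sub>R b) \<partial>lborel)"
    unfolding split by (rule nn_integral_sum_list[THEN conjunct1, symmetric]) measurable
   finally show ?thesis .
  qed
  have "ennreal ((w x)\<^sup>2) \<le> (\<integral>\<^sup>+f. g W (x + (\<Sum>b\<in>J. f b *\<^sub>R b)) \<partial>Pi\<^sub>M J (\<lambda>_. lborel))"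
   using W[OF w] by (simp add: g_def)
  also have "\<dots> \<le> (\<integral>\<^sup>+f. (\<integral>\<^sup>+t. g ?W (x + (\<Sum>b\<in>J. f b *\<^sub>R b) + t *\<^sub>R b) \<partial>lborel) \<partial>Pi\<^sub>M J (\<lambda>_. lborel))"
   by (intro nn_integral_mono step)
  also have "\<dots> = (\<integral>\<^sup>+f. (\<integral>\<^sup>+t. g ?W (x + (\<Sum>c\<in>insert b J. (f(b := t)) c *\<^sub>R c)) \<partial>lborel) \<partial>Pi\<^sub>M J (\<lambda>_. lborel))"
  proof (intro nn_integral_cong)
   fix f :: "real^'n => real" and t
   have "(\<Sum>c\<in>J. (f(b := t)) c *\<^sub>R c) = (\<Sum>c\<in>J. f c *\<^sub>R c)"
    by (rule sum.cong[OF refl]) (use insert(2) in auto)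
   then show "g ?W (x + (\<Sum>b\<in>J. f b *\<^sub>R b) + t *\<^sub>R b) = g ?W (x + (\<Sum>c\<in>insert b J. (f(b := t)) c *\<^sub>R c))"
    using insert(1,2) by (simp add: add.assoc add.commute[of "t *\<^sub>R b"])
  qed
  also have "\<dots> = (\<integral>\<^sup>+f. g ?W (x + (\<Sum>c\<in>insert b J. f c *\<^sub>R c)) \<partial>Pi\<^sub>M (insert b J) (\<lambda>_. lborel))"
   by (rule product_nn_integral_insert[symmetric]) (use insert in \<open>auto intro!: measurable_compose[OF _ mg] borel_measurable_add borel_measurable_sum borel_measurable_scaleR\<close>)
  finally show "ennreal ((w x)\<^sup>2) \<le> (\<integral>\<^sup>+f. (\<Sum>\<beta>\<leftarrow>?W. ennreal ((iter_pderiv \<beta> w (x + (\<Sum>b\<in>insert b J. f b *\<^sub>R b)))\<^sup>2)) \<partial>Pi\<^sub>M (insert b J) (\<lambda>_. lborel))"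
   by (simp only: g_def)
 qed
qed

lemma sobolev_sup_bound:
 "\<exists>W :: 'n::finite list list. \<forall>w x. test_on UNIV w \<longrightarrow> ((w :: real^'n => real) x)\<^sup>2 \<le> (\<Sum>\<beta>\<leftarrow>W. \<integral>y. (iter_pderiv \<beta> w y)\<^sup>2 \<partial>lborel)"
proof -
 obtain W :: "'n list list" where W: "!!w x. test_on UNIV w ==>
  ennreal ((w x)\<^sup>2) \<le> (\<integral>\<^sup>+f. (\<Sum>\<beta>\<leftarrow>W. ennreal ((iter_pderiv \<beta> w (x + (\<Sum>b\<in>(Basis::(real^'n) set). f b *\<^sub>R b)))\<^sup>2)) \<partial>Pi\<^sub>M Basis (\<lambda>_. lborel))"
  using sobolev_partial[OF finite_Basis order_refl] by blast
 show ?thesis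
 proof (rule exI[of _ W], intro allI impI)
  fix w :: "real^'n => real" and x assume w: "test_on UNIV w"
  have mw[measurable]: "iter_pderiv \<beta> w \<in> borel_measurable borel" for \<beta>
   by (rule test_on_measurable[OF test_on_iter_pderiv[OF w]])
  define g where "g z = (\<Sum>\<beta>\<leftarrow>W. ennreal ((iter_pderiv \<beta> w z)\<^sup>2))" for z
  have mg[measurable]: "g \<in> borel_measurable borel"
   unfolding g_def by (rule nn_integral_sum_list[THEN conjunct2]) measurable
  have "ennreal ((w x)\<^sup>2) \<le> (\<integral>\<^sup>+f. g (x + (\<Sum>b\<in>(Basis::(real^'n) set). f b *\<^sub>R b)) \<partial>Pi\<^sub>M Basis (\<lambda>_. lborel))"
   using W[OF w] by (simp add: g_def)
  also have "\<dots> = (\<integral>\<^sup>+y. g (x + y) \<partial>distr (Pi\<^sub>M Basis (\<lambda>_. lborel)) borel (\<lambda>f. \<Sum>b\<in>(Basis::(real^'n) set). f b *\<^sub>R b))"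
   by (subst nn_integral_distr) auto
  also have "\<dots> = (\<integral>\<^sup>+y. g (x + y) \<partial>lborel)" by (simp add: lborel_eq[symmetric])
  also have "\<dots> = (\<integral>\<^sup>+z. g z \<partial>distr lborel borel ((+) x))" by (subst nn_integral_distr) auto
  also have "\<dots> = (\<integral>\<^sup>+z. g z \<partial>lborel)" by (simp add: lborel_distr_plus)
  also have "\<dots> = (\<Sum>\<beta>\<leftarrow>W. \<integral>\<^sup>+z. ennreal ((iter_pderiv \<beta> w z)\<^sup>2) \<partial>lborel)"
   unfolding g_def by (rule nn_integral_sum_list[THEN conjunct1]) measurable
  also have "\<dots> = (\<Sum>\<beta>\<leftarrow>W. ennreal (\<integral>z. (iter_pderiv \<beta> w z)\<^sup>2 \<partial>lborel))"
  proof (intro arg_cong[of _ _ sum_list] map_cong refl)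
   fix \<beta>
   have t: "test_on UNIV (iter_pderiv \<beta> w)" by (rule test_on_iter_pderiv[OF w])
   have "integrable lborel (\<lambda>z. iter_pderiv \<beta> w z * iter_pderiv \<beta> w z)"
    by (rule test_on_integrable[OF test_on_mult[OF open_UNIV test_on_smooth[OF t] t]])
   then show "(\<integral>\<^sup>+z. ennreal ((iter_pderiv \<beta> w z)\<^sup>2) \<partial>lborel) = ennreal (\<integral>z. (iter_pderiv \<beta> w z)\<^sup>2 \<partial>lborel)"
    by (intro nn_integral_eq_integral) (auto simp: power2_eq_square)
  qed
  also have "\<dots> = ennreal (\<Sum>\<beta>\<leftarrow>W. \<integral>z. (iter_pderiv \<beta> w z)\<^sup>2 \<partial>lborel)"
  proof (induction W)
   case (Cons a W)
   have "0 \<le> (\<Sum>\<beta>\<leftarrow>W. \<integral>z. (iter_pderiv \<beta> w z)\<^sup>2 \<partial>lborel)" by (induction W) simp_all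
   then show ?case using Cons by simp
  qed simp
  finally have le: "ennreal ((w x)\<^sup>2) \<le> ennreal (\<Sum>\<beta>\<leftarrow>W. \<integral>z. (iter_pderiv \<beta> w z)\<^sup>2 \<partial>lborel)" .
  have "0 \<le> (\<Sum>\<beta>\<leftarrow>W. \<integral>z. (iter_pderiv \<beta> w z)\<^sup>2 \<partial>lborel)" by (induction W) simp_all
  with le show "(w x)\<^sup>2 \<le> (\<Sum>\<beta>\<leftarrow>W. \<integral>z. (iter_pderiv \<beta> w z)\<^sup>2 \<partial>lborel)"
   by (simp only: ennreal_le_iff)
 qed
qed

text \<open>Interior regularity in the form of a pointwise a priori estimate.\<close>

lemma interior_sup_estimate:
 fixes \<beta> :: "'n::finite list"
 assumes G: "metric_on U G" and K: "compact K" "K \<subseteq> U"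
 shows "\<exists>C m K'. C \<ge> 0 \<and> compact K' \<and> K' \<subseteq> U \<and> (\<forall>u. smooth_on U u \<longrightarrow>
  (\<forall>x\<in>K. (iter_pderiv \<beta> u x)\<^sup>2 \<le> C * (\<Sum>j\<le>m. sqint K' ((lap G ^^ j) u))))"
proof -
 have Uo: "open U" by (rule U_open[OF G])
 obtain c where c: "test_on U c" "!!x. x \<in> K ==> c x = (1::real)" by (rule smooth_cutoff[OF Uo K]) (rule that)
 obtain L where L: "compact L" "L \<subseteq> U" "!!x. x \<notin> L ==> c x = 0" using c(1) unfolding test_on_def by blast
 define T where "T u x = c x * iter_pderiv \<beta> u x" for u :: "real^'n => real" and x
 have "ops U G (length \<beta>) T" unfolding T_def[abs_def] by (rule ops.word[OF order_refl test_on_smooth[OF c(1)]])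
 then have opsT: "ops U G (length \<gamma> + length \<beta>) (\<lambda>u. iter_pderiv \<gamma> (T u))" for \<gamma>
  by (induction \<gamma>) (use ops_pderiv[OF G] in auto)
 have lb: "lap_bounded U G (\<lambda>u. sqint L (iter_pderiv \<gamma> (T u)))" for \<gamma>
  by (rule lap_bounded_ops[OF G opsT lap_bounded_word[OF G] L(1,2)])
 obtain W :: "'n list list" where W: "!!w x. test_on UNIV w ==> (w x)\<^sup>2 \<le> (\<Sum>\<gamma>\<leftarrow>W. \<integral>y. (iter_pderiv \<gamma> w y)\<^sup>2 \<partial>lborel)"
  using sobolev_sup_bound by blast
 have "lap_bounded U G (\<lambda>u. \<Sum>\<gamma>\<leftarrow>W. sqint L (iter_pderiv \<gamma> (T u)))"
  by (induction W) (simp_all add: lap_bounded_zero[OF G] lap_bounded_add[OF G] lb)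
 then obtain C m K' where C: "C \<ge> 0" "compact K'" "K' \<subseteq> U"
  and le: "!!u. smooth_on U u ==> (\<Sum>\<gamma>\<leftarrow>W. sqint L (iter_pderiv \<gamma> (T u))) \<le> C * (\<Sum>j\<le>m. sqint K' ((lap G ^^ j) u))"
  unfolding lap_bounded_def[OF G] by (elim exE conjE) (rule that, auto)
 have "(iter_pderiv \<beta> u x)\<^sup>2 \<le> C * (\<Sum>j\<le>m. sqint K' ((lap G ^^ j) u))" if u: "smooth_on U u" and x: "x \<in> K" for u x
 proof -
  have "test_on U (\<lambda>x. iter_pderiv \<beta> u x * c x)" by (rule test_on_mult[OF Uo smooth_on_iter_pderiv[OF u] c(1)])
  then have t: "test_on UNIV (T u)" unfolding T_def by (simp add: mult.commute test_on_subset)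
  have z: "iter_pderiv \<gamma> (T u) y = 0" if "y \<notin> L" for \<gamma> y
   by (rule iter_pderiv_zero_outside[OF compact_imp_closed[OF L(1)] _ that]) (simp add: T_def L(3))
  have eq: "(\<integral>y. (iter_pderiv \<gamma> (T u) y)\<^sup>2 \<partial>lborel) = sqint L (iter_pderiv \<gamma> (T u))" for \<gamma>
   unfolding sqint_def by (rule Bochner_Integration.integral_cong[OF refl]) (use z in \<open>auto simp: indicator_def\<close>)
  have "(iter_pderiv \<beta> u x)\<^sup>2 = (T u x)\<^sup>2" using c(2)[OF x] by (simp add: T_def)
  also have "\<dots> \<le> (\<Sum>\<gamma>\<leftarrow>W. sqint L (iter_pderiv \<gamma> (T u)))" using W[OF t, of x] by (simp only: eq)
  also have "\<dots> \<le> C * (\<Sum>j\<le>m. sqint K' ((lap G ^^ j) u))" by (rule le[OF u])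
  finally show ?thesis .
 qed
 with C show ?thesis by (intro exI[of _ C] exI[of _ m] exI[of _ K']) simp
qed

section \<open>Calculus on closed Riemannian manifolds\<close>

lemma lap_cong:
 assumes "open W" "x \<in> W" "!!y. y \<in> W ==> f y = g y"
 shows "lap G f x = lap G g x"
proof -
 have d: "pderiv_at j f y = pderiv_at j g y" if "y \<in> W" for j y
  by (rule pderiv_at_cong[OF assms(1) that assms(3)])
 have "pderiv_at i (\<lambda>y. sqrt (det (G y)) * (\<Sum>j\<in>UNIV. matrix_inv (G y) $ i $ j * pderiv_at j f y)) x =
  pderiv_at i (\<lambda>y. sqrt (det (G y)) * (\<Sum>j\<in>UNIV. matrix_inv (G y) $ i $ j * pderiv_at j g y)) x" for i
  by (rule pderiv_at_cong[OF assms(1,2)]) (simp add: d)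
 then show ?thesis by (simp add: lap_def)
qed

context
 fixes U :: "(real^'n) set" and G :: "real^'n => real^'n^'n"
 assumes G: "metric_on U G"
begin

abbreviation "flux i f y \<equiv> sqrt (det (G y)) * (\<Sum>j\<in>UNIV. matrix_inv (G y) $ i $ j * pderiv_at j f y)"

lemma flux_differentiable: "smooth_on U f ==> x \<in> U ==> (\<lambda>y. flux i f y) differentiable (at x)"
 by (rule smooth_on_differentiable[OF smooth_on_flux[OF G]])

lemma lap_mult:
 assumes f: "smooth_on U f" and h: "smooth_on U h" and x: "x \<in> U"
 shows "lap G (\<lambda>y. f y * h y) x = f x * lap G h x + h x * lap G f x + 2 * gam G f h x"
proof -
 note Uo = metric_open[OF G]
 have fl: "flux i (\<lambda>y. f y * h y) y = f y * flux i h y + h y * flux i f y" if "y \<in> U" for i y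
 proof -
  have "pderiv_at j (\<lambda>y. f y * h y) y = f y * pderiv_at j h y + pderiv_at j f y * h y" for j
   by (rule pderiv_at_mult[OF smooth_on_differentiable[OF f that] smooth_on_differentiable[OF h that]])
  then show ?thesis by (simp add: algebra_simps sum.distrib sum_distrib_left)
 qed
 have dfl: "pderiv_at i (\<lambda>y. flux i (\<lambda>y. f y * h y) y) x =
  (f x * pderiv_at i (\<lambda>y. flux i h y) x + pderiv_at i f x * flux i h x) + (h x * pderiv_at i (\<lambda>y. flux i f y) x + pderiv_at i h x * flux i f x)" for i
 proof -
  have "pderiv_at i (\<lambda>y. flux i (\<lambda>y. f y * h y) y) x = pderiv_at i (\<lambda>y. f y * flux i h y + h y * flux i f y) x"
   by (rule pderiv_at_cong[OF Uo x fl])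
  also have "\<dots> = pderiv_at i (\<lambda>y. f y * flux i h y) x + pderiv_at i (\<lambda>y. h y * flux i f y) x"
   by (rule pderiv_at_add[OF smooth_on_differentiable[OF smooth_on_mult[OF Uo f smooth_on_flux[OF G h]] x]
      smooth_on_differentiable[OF smooth_on_mult[OF Uo h smooth_on_flux[OF G f]] x]])
  finally show ?thesis
   by (simp only: pderiv_at_mult[OF smooth_on_differentiable[OF f x] flux_differentiable[OF h x]]
     pderiv_at_mult[OF smooth_on_differentiable[OF h x] flux_differentiable[OF f x]])
 qed
 have s: "(\<Sum>i\<in>UNIV. pderiv_at i a x * flux i b x) = sqrt (det (G x)) * gam G b a x" for a b
  unfolding gam_sum[OF G] by (simp add: sum_distrib_left sum_distrib_right mult_ac)
 have "sqrt (det (G x)) * lap G (\<lambda>y. f y * h y) x = f x * (\<Sum>i\<in>UNIV. pderiv_at i (\<lambda>y. flux i h y) x) + (\<Sum>i\<in>UNIV. pderiv_at i f x * flux i h x)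
   + (h x * (\<Sum>i\<in>UNIV. pderiv_at i (\<lambda>y. flux i f y) x) + (\<Sum>i\<in>UNIV. pderiv_at i h x * flux i f x))"
  unfolding lap_flux[OF G x] dfl by (simp only: sum.distrib sum_distrib_left)
 also have "\<dots> = sqrt (det (G x)) * (f x * lap G h x + h x * lap G f x + 2 * gam G f h x)"
  unfolding s lap_flux[OF G x, symmetric] gam_sym[OF G x, of h f] by (simp add: algebra_simps)
 finally show ?thesis using metric_det_pos[OF G x] by simp
qed

lemma lap_add:
 assumes f: "smooth_on U f" and h: "smooth_on U h" and x: "x \<in> U"
 shows "lap G (\<lambda>y. f y + h y) x = lap G f x + lap G h x"
proof -
 note Uo = metric_open[OF G]
 have fl: "flux i (\<lambda>y. f y + h y) y = flux i f y + flux i h y" if "y \<in> U" for i y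
 proof -
  have "pderiv_at j (\<lambda>y. f y + h y) y = pderiv_at j f y + pderiv_at j h y" for j
   by (rule pderiv_at_add[OF smooth_on_differentiable[OF f that] smooth_on_differentiable[OF h that]])
  then show ?thesis by (simp add: algebra_simps sum.distrib)
 qed
 have "pderiv_at i (\<lambda>y. flux i (\<lambda>y. f y + h y) y) x = pderiv_at i (\<lambda>y. flux i f y) x + pderiv_at i (\<lambda>y. flux i h y) x" for i
  using pderiv_at_cong[OF Uo x fl] pderiv_at_add[OF flux_differentiable[OF f x] flux_differentiable[OF h x]] by simp
 then show ?thesis by (simp add: lap_def sum.distrib algebra_simps)
qed

lemma lap_const: "x \<in> U ==> lap G (\<lambda>y. c) x = 0"
 by (simp add: lap_def)

end

locale closed_manifold =
 fixes M :: "('a::t2_space, 'n::finite) riemannian"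
 assumes closed: "closed_riemannian_manifold M"
begin

abbreviation "SF \<equiv> smooth_functions M"
abbreviation "\<Delta> \<equiv> laplacian M"

definition im :: "('a, 'n) chart => (real^'n) set" where "im c = coord c ` cdom c"
definition met :: "('a, 'n) chart => real^'n => real^'n^'n" where "met c x = gram M c (param c x)"

lemma compact_M: "compact (UNIV :: 'a set)" and connected_M: "connected (UNIV :: 'a set)"
 using closed by (auto simp: closed_riemannian_manifold_def)

lemma chart_cover: obtains c where "c \<in> atlas M" "p \<in> cdom c"
 using closed unfolding closed_riemannian_manifold_def by blast

context
 fixes c :: "('a, 'n) chart"
 assumes c: "c \<in> atlas M"
begin

lemma is_chart: "is_chart c" using closed c by (auto simp: closed_riemannian_manifold_def)

lemma open_cdom: "open (cdom c)" and open_im: "open (im c)" and inj_coord: "inj_on (coord c) (cdom c)"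
 using is_chart by (auto simp: is_chart_def im_def)

lemma hom: "homeomorphism (cdom c) (im c) (coord c) (param c)"
 using is_chart by (auto simp: is_chart_def im_def)

lemma cont_coord: "continuous_on (cdom c) (coord c)" and cont_param: "continuous_on (im c) (param c)"
 using hom by (auto simp: homeomorphism_def)

lemma param_coord [simp]: "p \<in> cdom c ==> param c (coord c p) = p"
 using hom by (auto simp: homeomorphism_def)
lemma coord_param [simp]: "x \<in> im c ==> coord c (param c x) = x"
 using hom by (auto simp: homeomorphism_def)
lemma coord_in [simp]: "p \<in> cdom c ==> coord c p \<in> im c" by (simp add: im_def)
lemma param_in [simp]: "x \<in> im c ==> param c x \<in> cdom c"
 using hom by (auto simp: homeomorphism_def)

lemma coord_image: assumes "W \<subseteq> cdom c" shows "coord c ` W = im c \<inter> param c -` W"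
proof
 show "coord c ` W \<subseteq> im c \<inter> param c -` W" using assms by auto
 show "im c \<inter> param c -` W \<subseteq> coord c ` W"
 proof
  fix x assume "x \<in> im c \<inter> param c -` W"
  then show "x \<in> coord c ` W" by (intro image_eqI[of _ _ "param c x"]) auto
 qed
qed

lemma open_coord_image: assumes "open W" "W \<subseteq> cdom c" shows "open (coord c ` W)"
 using continuous_on_open_vimage[OF open_im] cont_param assms(1)
 unfolding coord_image[OF assms(2)] by (metis Int_commute)

lemma metric_on_met: "metric_on (im c) (met c)"
proof -
 have "smooth_on (im c) (met c)"
  using closed c unfolding closed_riemannian_manifold_def im_def met_def[abs_def] o_def by blast
 moreover have "transpose (met c x) = met c x" "v \<noteq> 0 ==> v \<bullet> (met c x *v v) > 0" if "x \<in> im c" for x v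
  using closed c param_in[OF that] unfolding closed_riemannian_manifold_def met_def by blast+
 ultimately show ?thesis using open_im by (auto simp: metric_on_def)
qed

end

lemma SF_iff: "f \<in> SF \<longleftrightarrow> (\<forall>c\<in>atlas M. smooth_on (im c) (\<lambda>x. f (param c x)))"
 by (simp add: smooth_functions_def im_def o_def)

lemma SF_smooth: "f \<in> SF ==> c \<in> atlas M ==> smooth_on (im c) (\<lambda>x. f (param c x))"
 by (simp add: SF_iff)

lemma SF_const [simp]: "(\<lambda>p. k) \<in> SF" by (simp add: SF_iff)
lemma SF_add: "f \<in> SF ==> h \<in> SF ==> (\<lambda>p. f p + h p) \<in> SF"
 by (auto simp: SF_iff intro!: smooth_on_add open_im)
lemma SF_mult: "f \<in> SF ==> h \<in> SF ==> (\<lambda>p. f p * h p) \<in> SF"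
 by (auto simp: SF_iff intro!: smooth_on_mult open_im)
lemma SF_cmult: "f \<in> SF ==> (\<lambda>p. k * f p) \<in> SF"
 by (rule SF_mult[OF SF_const])
lemma SF_minus: "f \<in> SF ==> (\<lambda>p. - f p) \<in> SF"
 using SF_cmult[of f "-1"] by simp
lemma SF_diff: "f \<in> SF ==> h \<in> SF ==> (\<lambda>p. f p - h p) \<in> SF"
 using SF_add[OF _ SF_minus, of f h] by simp
lemma SF_sum: "finite A ==> (!!a. a \<in> A ==> f a \<in> SF) ==> (\<lambda>p. \<Sum>a\<in>A. f a p) \<in> SF"
 by (induction A rule: finite_induct) (auto intro: SF_add)
lemma SF_exp: "f \<in> SF ==> (\<lambda>p. exp (f p)) \<in> SF"
 by (auto simp: SF_iff intro!: smooth_on_exp open_im)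

lemma SF_continuous: assumes "f \<in> SF" shows "continuous_on UNIV f"
proof -
 have "isCont f p" for p
 proof -
  obtain c where c: "c \<in> atlas M" "p \<in> cdom c" by (rule chart_cover)
  have "continuous_on (cdom c) (\<lambda>q. f (param c (coord c q)))"
   by (rule continuous_on_compose2[OF smooth_on_continuous_on[OF SF_smooth[OF assms c(1)]] cont_coord[OF c(1)]])
    (auto simp: im_def)
  then have "continuous_on (cdom c) f" by (rule continuous_on_eq) (simp add: param_coord[OF c(1)])
  then show ?thesis using open_cdom[OF c(1)] c(2) continuous_on_eq_continuous_at by blast
 qed
 then show ?thesis by (simp add: continuous_at_imp_continuous_on)
qed

end

text \<open>An isometry of open sets is an isometry of domains in every pair of charts.\<close>

lemma (in closed_manifold) isometry_in_charts:
 fixes N :: "('b::t2_space, 'n) riemannian" and F :: "'a => 'b"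
 assumes N: "closed_riemannian_manifold N"
  and ST: "open S" "open T" and F: "diffeo_on M N S T F" "pulls_back_metric_on M N S F"
  and c: "c \<in> atlas M" and d: "d \<in> atlas N"
 shows "domain_isometry (coord c ` {p \<in> cdom c \<inter> S. F p \<in> cdom d}) (met c)
   (coord d ` {q \<in> cdom d \<inter> T. the_inv_into S F q \<in> cdom c}) (closed_manifold.met N d)
   (coord d \<circ> F \<circ> param c) (coord c \<circ> the_inv_into S F \<circ> param d)"
proof -
 interpret N: closed_manifold N using N by unfold_locales
 let ?I = "the_inv_into S F"
 let ?P = "{p \<in> cdom c \<inter> S. F p \<in> cdom d}" and ?Q = "{q \<in> cdom d \<inter> T. ?I q \<in> cdom c}"
 let ?U = "coord c ` ?P" and ?V = "coord d ` ?Q"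
 have bij: "bij_betw F S T" and sF: "smooth_map_on M N S F" and sI: "smooth_map_on N M T ?I"
  using F(1) by (auto simp: diffeo_on_def)
 have I1: "?I (F p) = p" "F p \<in> T" if "p \<in> S" for p
  using bij that by (auto simp: bij_betw_def the_inv_into_f_f)
 have I2: "F (?I q) = q" "?I q \<in> S" if "q \<in> T" for q
  using bij that by (auto simp: bij_betw_def f_the_inv_into_f intro: the_inv_into_into)
 have oP: "open ?P"
 proof -
  have "open (S \<inter> F -` cdom d)"
   using continuous_on_open_vimage[OF ST(1)] sF N.open_cdom[OF d] unfolding smooth_map_on_def by (metis Int_commute)
  moreover have "?P = cdom c \<inter> (S \<inter> F -` cdom d)" by auto
  ultimately show ?thesis using open_cdom[OF c] by auto
 qed
 have oQ: "open ?Q"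
 proof -
  have "open (T \<inter> ?I -` cdom c)"
   using continuous_on_open_vimage[OF ST(2)] sI open_cdom[OF c] unfolding smooth_map_on_def by (metis Int_commute)
  moreover have "?Q = cdom d \<inter> (T \<inter> ?I -` cdom c)" by auto
  ultimately show ?thesis using N.open_cdom[OF d] by auto
 qed
 have UI: "?U \<subseteq> im c" "?V \<subseteq> N.im d" by (auto simp: im_def N.im_def)
 have Uo: "open ?U" using open_coord_image[OF c oP] by auto
 have Vo: "open ?V" using N.open_coord_image[OF d oQ] by auto
 have sub: "metric_on W G'" if "metric_on W' G'" "open W" "W \<subseteq> W'" for W W' :: "(real^'n) set" and G'
  using that unfolding metric_on_def by (auto intro: smooth_on_subset)
 show ?thesis
  unfolding domain_isometry_def
 proof (intro conjI ballI)
  show "metric_on ?U (met c)" by (rule sub[OF metric_on_met[OF c] Uo UI(1)])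
  show "metric_on ?V (N.met d)" by (rule sub[OF N.metric_on_met[OF d] Vo UI(2)])
  show "smooth_on ?U (coord d \<circ> F \<circ> param c)" using sF c d by (simp add: smooth_map_on_def)
  show "smooth_on ?V (coord c \<circ> ?I \<circ> param d)" using sI c d by (simp add: smooth_map_on_def)
 next
  fix x assume "x \<in> ?U"
  then obtain p where p: "p \<in> cdom c" "p \<in> S" "F p \<in> cdom d" "x = coord c p" by auto
  have Fp: "(coord d \<circ> F \<circ> param c) x = coord d (F p)" using p by (simp add: param_coord[OF c])
  show "(coord d \<circ> F \<circ> param c) x \<in> ?V" unfolding Fp using p I1[OF p(2)] by auto
  show "(coord c \<circ> ?I \<circ> param d) ((coord d \<circ> F \<circ> param c) x) = x"
   unfolding Fp using p I1[OF p(2)] by (simp add: N.param_coord[OF d])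
  have 1: "met c x = gram M c p" using p by (simp add: met_def param_coord[OF c])
  have 2: "N.met d (coord d (F p)) = gram N d (F p)" using p by (simp add: N.met_def N.param_coord[OF d])
  have "p \<in> cdom c \<inter> S" using p by simp
  note pull = F(2)[unfolded pulls_back_metric_on_def Let_def, rule_format, OF c d this p(3), folded p(4)]
  show "met c x = transpose (jacobian (coord d \<circ> F \<circ> param c) (at x)) **
    N.met d ((coord d \<circ> F \<circ> param c) x) ** jacobian (coord d \<circ> F \<circ> param c) (at x)"
   unfolding Fp 1 2 by (rule pull)
 next
  fix y assume "y \<in> ?V"
  then obtain q where q: "q \<in> cdom d" "q \<in> T" "?I q \<in> cdom c" "y = coord d q" by auto
  have Iq: "(coord c \<circ> ?I \<circ> param d) y = coord c (?I q)" using q by (simp add: N.param_coord[OF d])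
  show "(coord c \<circ> ?I \<circ> param d) y \<in> ?U" unfolding Iq using q I2[OF q(2)] by auto
  show "(coord d \<circ> F \<circ> param c) ((coord c \<circ> ?I \<circ> param d) y) = y"
   unfolding Iq using q I2[OF q(2)] by (simp add: param_coord[OF c])
 qed
qed

context closed_manifold
begin

lemma lap_isometry:
 fixes N :: "('b::t2_space, 'n) riemannian" and F :: "'a => 'b"
 assumes N: "closed_riemannian_manifold N"
  and ST: "open S" "open T" and F: "diffeo_on M N S T F" "pulls_back_metric_on M N S F"
  and c: "c \<in> atlas M" and d: "d \<in> atlas N"
  and g: "g \<in> smooth_functions N" and eq: "!!p. p \<in> S ==> f p = g (F p)"
  and p: "p \<in> cdom c" "p \<in> S" "F p \<in> cdom d"
 shows "lap (met c) (\<lambda>x. f (param c x)) (coord c p) = lap (closed_manifold.met N d) (\<lambda>y. g (param d y)) (coord d (F p))"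
proof -
 interpret N: closed_manifold N using N by unfold_locales
 note iso = isometry_in_charts[OF N ST F c d]
 let ?U = "coord c ` {p \<in> cdom c \<inter> S. F p \<in> cdom d}" and ?phi = "coord d \<circ> F \<circ> param c"
 let ?V = "coord d ` {q \<in> cdom d \<inter> T. the_inv_into S F q \<in> cdom c}"
 have x: "coord c p \<in> ?U" using p by auto
 have gs: "smooth_on ?V (\<lambda>y. g (param d y))"
  by (rule smooth_on_subset[OF N.SF_smooth[OF g d]]) (auto simp: N.im_def)
 have "lap (met c) (\<lambda>x. f (param c x)) (coord c p) = lap (met c) (\<lambda>x. g (param d (?phi x))) (coord c p)"
  by (rule lap_cong[OF iso_open(1)[OF iso] x]) (auto simp: param_coord[OF c] N.param_coord[OF d] eq)
 also have "\<dots> = lap (N.met d) (\<lambda>y. g (param d y)) (?phi (coord c p))"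
  by (rule lap_compose[OF iso gs x])
 finally show ?thesis using p by (simp add: param_coord[OF c])
qed

lemma identity_isometry: "diffeo_on M M UNIV UNIV (\<lambda>p. p)" "pulls_back_metric_on M M UNIV (\<lambda>p. p)"
proof -
 have "the_inv_into UNIV (\<lambda>p::'a. p) = (\<lambda>p. p)"
  by (rule ext) (metis UNIV_I inj_on_id2 the_inv_into_f_f)
 then show "diffeo_on M M UNIV UNIV (\<lambda>p. p)" "pulls_back_metric_on M M UNIV (\<lambda>p. p)"
  using closed by (auto simp: closed_riemannian_manifold_def diffeo_on_def bij_betw_def)
qed

lemma laplacian_in_chart:
 assumes c: "c \<in> atlas M" and p: "p \<in> cdom c" and f: "f \<in> SF"
 shows "\<Delta> f p = lap (met c) (\<lambda>x. f (param c x)) (coord c p)"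
proof -
 define c0 where "c0 = (SOME c. c \<in> atlas M \<and> p \<in> cdom c)"
 have c0: "c0 \<in> atlas M \<and> p \<in> cdom c0" unfolding c0_def by (rule someI[of _ c]) (use c p in simp)
 have "\<Delta> f p = lap (met c0) (\<lambda>x. f (param c0 x)) (coord c0 p)"
  by (simp add: laplacian_def c0_def[symmetric] laplacian_in_def lap_def met_def o_def Let_def)
 also have "\<dots> = lap (met c) (\<lambda>x. f (param c x)) (coord c p)"
  by (rule lap_isometry[OF closed open_UNIV open_UNIV identity_isometry _ c f]) (use c0 p in auto)
 finally show ?thesis .
qed

lemma laplacian_isometry:
 fixes N :: "('b::t2_space, 'n) riemannian" and F :: "'a => 'b"
 assumes N: "closed_riemannian_manifold N"
  and ST: "open S" "open T" and F: "diffeo_on M N S T F" "pulls_back_metric_on M N S F"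
  and f: "f \<in> SF" and g: "g \<in> smooth_functions N" and eq: "!!p. p \<in> S ==> f p = g (F p)" and p: "p \<in> S"
 shows "\<Delta> f p = laplacian N g (F p)"
proof -
 interpret N: closed_manifold N using N by unfold_locales
 obtain c where c: "c \<in> atlas M" "p \<in> cdom c" by (rule chart_cover)
 obtain d where d: "d \<in> atlas N" "F p \<in> cdom d" by (rule N.chart_cover)
 show ?thesis
  unfolding laplacian_in_chart[OF c f] N.laplacian_in_chart[OF d g]
  by (rule lap_isometry[OF N ST F c(1) d(1) g eq c(2) p d(2)])
qed

lemma SF_laplacian: assumes "f \<in> SF" shows "\<Delta> f \<in> SF"
 unfolding SF_iff
proof
 fix c assume c: "c \<in> atlas M"
 show "smooth_on (im c) (\<lambda>x. \<Delta> f (param c x))"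
  by (rule smooth_on_cong[OF open_im[OF c] _ smooth_on_lap[OF metric_on_met[OF c] SF_smooth[OF assms c]]])
   (simp add: laplacian_in_chart[OF c param_in[OF c] assms] coord_param[OF c])
qed

lemma laplacian_local:
 assumes f: "f \<in> SF" "g \<in> SF" and W: "open W" "p \<in> W" "!!q. q \<in> W ==> f q = g q"
 shows "\<Delta> f p = \<Delta> g p"
proof -
 obtain c where c: "c \<in> atlas M" "p \<in> cdom c" by (rule chart_cover)
 have o: "open (coord c ` (cdom c \<inter> W))" using open_coord_image[OF c(1)] open_cdom[OF c(1)] W by (simp add: open_Int)
 show ?thesis unfolding laplacian_in_chart[OF c f(1)] laplacian_in_chart[OF c f(2)]
  by (rule lap_cong[OF o]) (use W c in \<open>auto simp: param_coord[OF c(1)]\<close>)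
qed

lemma laplacian_add: assumes "f \<in> SF" "g \<in> SF" shows "\<Delta> (\<lambda>p. f p + g p) p = \<Delta> f p + \<Delta> g p"
proof -
 obtain c where c: "c \<in> atlas M" "p \<in> cdom c" by (rule chart_cover)
 show ?thesis unfolding laplacian_in_chart[OF c assms(1)] laplacian_in_chart[OF c assms(2)] laplacian_in_chart[OF c SF_add[OF assms]]
  by (rule lap_add[OF metric_on_met[OF c(1)] SF_smooth[OF assms(1) c(1)] SF_smooth[OF assms(2) c(1)] coord_in[OF c]])
qed

lemma laplacian_const: "\<Delta> (\<lambda>p. k) p = 0"
proof -
 obtain c where c: "c \<in> atlas M" "p \<in> cdom c" by (rule chart_cover)
 show ?thesis unfolding laplacian_in_chart[OF c SF_const] by (rule lap_const[OF metric_on_met[OF c(1)] coord_in[OF c]])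
qed

text \<open>The gradient product \<open>g(\<nabla>f, \<nabla>h)\<close>, defined as carre du champ of the Laplacian.\<close>

definition Gam :: "('a => real) => ('a => real) => 'a => real" where
 "Gam f h p = (\<Delta> (\<lambda>p. f p * h p) p - f p * \<Delta> h p - h p * \<Delta> f p) / 2"

lemma laplacian_mult: "\<Delta> (\<lambda>p. f p * h p) p = f p * \<Delta> h p + h p * \<Delta> f p + 2 * Gam f h p"
proof -
 have "2 * (d / 2) = d" for d :: real by simp
 from this[of "\<Delta> (\<lambda>p. f p * h p) p - f p * \<Delta> h p - h p * \<Delta> f p"] show ?thesis
  unfolding Gam_def by linarith
qed

lemma Gam_in_chart:
 assumes c: "c \<in> atlas M" "p \<in> cdom c" and f: "f \<in> SF" and h: "h \<in> SF"
 shows "Gam f h p = gam (met c) (\<lambda>x. f (param c x)) (\<lambda>x. h (param c x)) (coord c p)"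
 unfolding Gam_def laplacian_in_chart[OF c f] laplacian_in_chart[OF c h] laplacian_in_chart[OF c SF_mult[OF f h]]
  lap_mult[OF metric_on_met[OF c(1)] SF_smooth[OF f c(1)] SF_smooth[OF h c(1)] coord_in[OF c]]
 by (simp add: param_coord[OF c])

lemma laplacian_cmult: assumes "f \<in> SF" shows "\<Delta> (\<lambda>p. k * f p) p = k * \<Delta> f p"
proof -
 obtain c where c: "c \<in> atlas M" "p \<in> cdom c" by (rule chart_cover)
 have "Gam (\<lambda>p. k) f p = 0"
  unfolding Gam_in_chart[OF c SF_const assms] by (simp add: gam_def grad_def zero_vec_def[symmetric])
 then show ?thesis unfolding laplacian_mult[of "\<lambda>p. k"] by (simp add: laplacian_const)
qed

lemma laplacian_minus: "f \<in> SF ==> \<Delta> (\<lambda>p. - f p) p = - \<Delta> f p"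
 using laplacian_cmult[of f "-1" p] by simp

lemma laplacian_diff: "f \<in> SF ==> g \<in> SF ==> \<Delta> (\<lambda>p. f p - g p) p = \<Delta> f p - \<Delta> g p"
 using laplacian_add[OF _ SF_minus, of f g p] laplacian_minus[of g p] by simp

lemma laplacian_sum:
 "finite A ==> (!!a. a \<in> A ==> f a \<in> SF) ==> \<Delta> (\<lambda>p. \<Sum>a\<in>A. f a p) p = (\<Sum>a\<in>A. \<Delta> (f a) p)"
 by (induction A rule: finite_induct) (simp_all add: laplacian_const laplacian_add SF_sum)

lemma SF_Gam: "f \<in> SF ==> h \<in> SF ==> Gam f h \<in> SF"
proof -
 assume fh: "f \<in> SF" "h \<in> SF"
 have "(\<lambda>p. (1/2) * (\<Delta> (\<lambda>p. f p * h p) p - f p * \<Delta> h p - h p * \<Delta> f p)) \<in> SF"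
  by (intro SF_cmult SF_diff SF_laplacian SF_mult fh)
 then show ?thesis by (simp add: Gam_def[abs_def])
qed

lemma Gam_sym: "Gam f h p = Gam h f p"
 by (simp add: Gam_def mult.commute)

lemma Gam_nonneg: assumes "f \<in> SF" shows "Gam f f p \<ge> 0"
proof -
 obtain c where c: "c \<in> atlas M" "p \<in> cdom c" by (rule chart_cover)
 show ?thesis unfolding Gam_in_chart[OF c assms assms] by (rule gam_nonneg[OF metric_on_met[OF c(1)] coord_in[OF c]])
qed

lemma Gam_add: assumes "f \<in> SF" "g \<in> SF" "h \<in> SF" shows "Gam (\<lambda>p. f p + g p) h p = Gam f h p + Gam g h p"
proof -
 have "(\<lambda>p. (f p + g p) * h p) = (\<lambda>p. f p * h p + g p * h p)" by (simp add: algebra_simps)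
 then show ?thesis using assms by (simp add: Gam_def laplacian_add SF_mult algebra_simps add_divide_distrib diff_divide_distrib)
qed

lemma Gam_cmult: assumes "f \<in> SF" "h \<in> SF" shows "Gam (\<lambda>p. k * f p) h p = k * Gam f h p"
proof -
 have "(\<lambda>p. (k * f p) * h p) = (\<lambda>p. k * (f p * h p))" by (simp add: algebra_simps)
 then show ?thesis using assms by (simp add: Gam_def laplacian_cmult SF_mult algebra_simps diff_divide_distrib)
qed

lemma Gam_mult:
 assumes f: "f \<in> SF" and g: "g \<in> SF" and h: "h \<in> SF"
 shows "Gam (\<lambda>p. f p * g p) h p = f p * Gam g h p + g p * Gam f h p"
proof -
 obtain c where c: "c \<in> atlas M" "p \<in> cdom c" by (rule chart_cover)
 have d: "(\<lambda>x. f (param c x)) differentiable (at (coord c p))" "(\<lambda>x. g (param c x)) differentiable (at (coord c p))"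
  using smooth_on_differentiable[OF SF_smooth[OF f c(1)] coord_in[OF c]] smooth_on_differentiable[OF SF_smooth[OF g c(1)] coord_in[OF c]] by auto
 show ?thesis
  unfolding Gam_in_chart[OF c SF_mult[OF f g] h] Gam_in_chart[OF c f h] Gam_in_chart[OF c g h]
  unfolding gam_sum[OF metric_on_met[OF c(1)]] pderiv_at_mult[OF d]
  by (simp add: param_coord[OF c] algebra_simps sum.distrib sum_distrib_left)
qed

lemma Gam_exp:
 assumes f: "f \<in> SF" and h: "h \<in> SF"
 shows "Gam (\<lambda>p. exp (f p)) h p = exp (f p) * Gam f h p"
proof -
 obtain c where c: "c \<in> atlas M" "p \<in> cdom c" by (rule chart_cover)
 have d: "(\<lambda>x. f (param c x)) differentiable (at (coord c p))"
  using smooth_on_differentiable[OF SF_smooth[OF f c(1)] coord_in[OF c]] by auto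
 show ?thesis
  unfolding Gam_in_chart[OF c SF_exp[OF f] h] Gam_in_chart[OF c f h]
  unfolding gam_sum[OF metric_on_met[OF c(1)]] pderiv_at_chain1[OF d DERIV_exp]
  by (simp add: param_coord[OF c] mult_ac sum_distrib_left)
qed

text \<open>Cauchy--Schwarz in the form used for energy estimates.\<close>

lemma Gam_le:
 assumes f: "f \<in> SF" and h: "h \<in> SF" and L: "L \<ge> 0" "Gam h h p \<le> L\<^sup>2"
 shows "2 * \<bar>u * Gam f h p\<bar> \<le> L * (u\<^sup>2 + Gam f f p)"
proof -
 have q: "0 \<le> Gam f f p + 2 * t * Gam f h p + t\<^sup>2 * Gam h h p" for t
 proof -
  have th: "(\<lambda>p. t * h p) \<in> SF" by (rule SF_cmult[OF h])
  have s: "(\<lambda>p. f p + t * h p) \<in> SF" by (rule SF_add[OF f th])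
  have a: "Gam g (\<lambda>p. f p + t * h p) p = Gam g f p + t * Gam g h p" if "g \<in> SF" for g
   unfolding Gam_sym[of g] using Gam_add[OF f th that] Gam_cmult[OF h that] by simp
  have "0 \<le> Gam (\<lambda>p. f p + t * h p) (\<lambda>p. f p + t * h p) p" by (rule Gam_nonneg[OF s])
  also have "\<dots> = Gam f f p + t * Gam f h p + t * (Gam h f p + t * Gam h h p)"
   unfolding Gam_add[OF f th s] Gam_cmult[OF h s] a[OF f] a[OF h] ..
  finally show ?thesis by (simp add: Gam_sym[of h f] power2_eq_square algebra_simps)
 qed
 show ?thesis
 proof (cases "L = 0")
  case True
  then have H: "Gam h h p = 0" using L Gam_nonneg[OF h, of p] by simp
  have "Gam f h p = 0"
  proof (rule ccontr)
   assume nz: "Gam f h p \<noteq> 0"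
   have "0 \<le> Gam f f p + 2 * (- (Gam f f p + 1) / (2 * Gam f h p)) * Gam f h p"
    using q[of "- (Gam f f p + 1) / (2 * Gam f h p)"] H by simp
   with nz show False by (simp add: field_simps)
  qed
  then show ?thesis using True by simp
 next
  case False
  then have Lp: "L > 0" using L by simp
  have "2 * s * u * Gam f h p \<le> L * (u\<^sup>2 + Gam f f p)" if s: "s = 1 \<or> s = -1" for s :: real
  proof -
   have "0 \<le> Gam f f p + 2 * (- s * u / L) * Gam f h p + (- s * u / L)\<^sup>2 * Gam h h p" by (rule q)
   also have "\<dots> \<le> Gam f f p + 2 * (- s * u / L) * Gam f h p + (- s * u / L)\<^sup>2 * L\<^sup>2"
    using L(2) by (intro add_left_mono mult_left_mono) auto
   also have "(- s * u / L)\<^sup>2 * L\<^sup>2 = u\<^sup>2" using Lp s by (auto simp: power_divide)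
   finally have "0 \<le> Gam f f p + u\<^sup>2 - (2 * s * u * Gam f h p) / L" by (simp add: field_simps)
   then have "(2 * s * u * Gam f h p) / L \<le> u\<^sup>2 + Gam f f p" by simp
   then show ?thesis using Lp by (simp add: pos_divide_le_eq mult.commute)
  qed
  from this[of 1] this[of "-1"] show ?thesis by (simp add: abs_if)
 qed
qed

end

subsection \<open>The Riemannian volume measure\<close>

context closed_manifold
begin

definition pm :: "('a, 'n) chart => real^'n => 'a" where
 "pm c x = (if x \<in> im c then param c x else undefined)"

definition nu :: "('a, 'n) chart => 'a measure" where
 "nu c = distr (vol (im c) (met c)) borel (pm c)"

lemma pm_measurable: assumes c: "c \<in> atlas M" shows "pm c \<in> borel \<rightarrow>\<^sub>M borel"
proof -
 have "param c \<in> borel_measurable (restrict_space borel (im c))"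
  by (rule borel_measurable_continuous_on_restrict[OF cont_param[OF c]])
 then show ?thesis unfolding pm_def[abs_def]
  using open_im[OF c] by (subst measurable_If_restrict_space_iff) (auto simp: borel_open)
qed

lemma pm_measurable_vol: assumes c: "c \<in> atlas M" shows "pm c \<in> vol (im c) (met c) \<rightarrow>\<^sub>M borel"
 using pm_measurable[OF c] by (simp add: measurable_def sets_vol[OF metric_on_met[OF c]])

lemma sets_nu [simp]: "sets (nu c) = sets borel" "space (nu c) = UNIV" by (simp_all add: nu_def)

lemma emeasure_nu:
 assumes c: "c \<in> atlas M" and B: "B \<in> sets borel"
 shows "emeasure (nu c) B = (\<integral>\<^sup>+x. ennreal (indicator (im c) x * sqrt (det (met c x))) * indicator B (pm c x) \<partial>lborel)"
proof -
 have "emeasure (nu c) B = (\<integral>\<^sup>+p. indicator B p \<partial>nu c)" using B by simp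
 also have "\<dots> = (\<integral>\<^sup>+x. indicator B (pm c x) \<partial>vol (im c) (met c))"
  unfolding nu_def using B by (intro nn_integral_distr pm_measurable_vol[OF c]) auto
 also have "\<dots> = (\<integral>\<^sup>+x. ennreal (indicator (im c) x * sqrt (det (met c x))) * indicator B (pm c x) \<partial>lborel)"
  by (rule nn_integral_vol[OF metric_on_met[OF c]]) (use pm_measurable[OF c] B in measurable)
 finally show ?thesis .
qed

lemma emeasure_nu_chart:
 assumes c: "c \<in> atlas M" and B: "B \<in> sets borel" "B \<subseteq> cdom c"
 shows "emeasure (nu c) B = (\<integral>\<^sup>+x\<in>coord c ` B. ennreal (sqrt (det (gram M c (param c x)))) \<partial>lborel)"
 unfolding emeasure_nu[OF c B(1)] coord_image[OF c B(2)]
 by (intro nn_integral_cong) (auto simp: indicator_def pm_def met_def)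

lemma emeasure_nu_Int:
 assumes c: "c \<in> atlas M" and B: "B \<in> sets borel"
 shows "emeasure (nu c) (B \<inter> cdom c) = emeasure (nu c) B"
 unfolding emeasure_nu[OF c B] emeasure_nu[OF c sets.Int[OF B borel_open[OF open_cdom[OF c]]]]
 by (intro nn_integral_cong) (auto simp: indicator_def pm_def param_in[OF c])

end

text \<open>Isometries preserve volume; with the identity map this is the independence of the chart.\<close>

lemma (in closed_manifold) emeasure_nu_isometry:
 fixes N :: "('b::t2_space, 'n) riemannian" and F :: "'a => 'b"
 assumes N: "closed_riemannian_manifold N"
  and ST: "open S" "open T" and F: "diffeo_on M N S T F" "pulls_back_metric_on M N S F"
  and c: "c \<in> atlas M" and d: "d \<in> atlas N"
  and A: "A \<in> sets borel" "A \<subseteq> cdom c \<inter> S" and B: "B \<in> sets borel" "B \<subseteq> cdom d \<inter> T"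
  and AB: "!!p. p \<in> S ==> p \<in> A \<longleftrightarrow> F p \<in> B"
 shows "emeasure (nu c) A = emeasure (closed_manifold.nu N d) B"
proof -
 interpret N: closed_manifold N using N by unfold_locales
 note iso = isometry_in_charts[OF N ST F c d]
 let ?I = "the_inv_into S F"
 let ?U = "coord c ` {p \<in> cdom c \<inter> S. F p \<in> cdom d}" and ?V = "coord d ` {q \<in> cdom d \<inter> T. ?I q \<in> cdom c}"
 let ?ph = "phi0 ?U (coord d \<circ> F \<circ> param c)"
 note mU = iso_metric(1)[OF iso] and mV = iso_metric(2)[OF iso]
 have bij: "bij_betw F S T" using F(1) by (auto simp: diffeo_on_def)
 have I2: "F (?I q) = q" "?I q \<in> S" if "q \<in> T" for q
  using bij that by (auto simp: bij_betw_def f_the_inv_into_f intro: the_inv_into_into)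
 have mA: "pm c -` A \<in> sets borel" using measurable_sets_borel[OF pm_measurable[OF c] A(1)] .
 have mB: "N.pm d -` B \<in> sets borel" using measurable_sets_borel[OF N.pm_measurable[OF d] B(1)] .
 have UV: "?U \<subseteq> im c" "?V \<subseteq> N.im d" by (auto simp: im_def N.im_def)
 have xU: "x \<in> ?U" if "x \<in> im c" "param c x \<in> A" for x
 proof -
  have "param c x \<in> {p \<in> cdom c \<inter> S. F p \<in> cdom d}" using that A(2) B(2) AB[of "param c x"] by auto
  then have "coord c (param c x) \<in> ?U" by (rule imageI)
  then show ?thesis using that by (simp add: coord_param[OF c])
 qed
 have yV: "y \<in> ?V" if "y \<in> N.im d" "param d y \<in> B" for y
 proof -
  have q: "param d y \<in> T" "param d y \<in> cdom d" using that B(2) by auto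
  have "?I (param d y) \<in> A" using AB[OF I2(2)[OF q(1)]] I2(1)[OF q(1)] that by simp
  then have "param d y \<in> {q \<in> cdom d \<inter> T. ?I q \<in> cdom c}" using q A(2) by auto
  then have "coord d (param d y) \<in> ?V" by (rule imageI)
  then show ?thesis using that by (simp add: N.coord_param[OF d])
 qed
 have volE: "emeasure (vol W G) C = (\<integral>\<^sup>+x. ennreal (indicator W x * sqrt (det (G x))) * indicator C x \<partial>lborel)"
  if "metric_on W G" "C \<in> sets borel" for W :: "(real^'n) set" and G C
  unfolding vol_def using borel_measurable_rho[OF that(1)] that(2) by (subst emeasure_density) auto
 have "emeasure (N.nu d) B = emeasure (vol ?V (N.met d)) (N.pm d -` B)"
  unfolding N.emeasure_nu[OF d B(1)] volE[OF mV mB]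
  by (intro nn_integral_cong) (use yV UV in \<open>auto simp: indicator_def N.pm_def split: if_splits\<close>)
 also have "\<dots> = emeasure (distr (vol ?U (met c)) borel ?ph) (N.pm d -` B)"
  by (simp only: iso_vol[OF iso])
 also have "\<dots> = emeasure (vol ?U (met c)) (?ph -` (N.pm d -` B))"
 proof -
  have "?ph \<in> vol ?U (met c) \<rightarrow>\<^sub>M borel"
   unfolding measurable_cong_sets[OF sets_vol(1)[OF mU] refl] by (rule phi0_measurable[OF iso])
  from emeasure_distr[OF this mB] show ?thesis unfolding sets_vol(2)[OF mU] Int_UNIV_right .
 qed
 also have "\<dots> = emeasure (nu c) A"
  unfolding emeasure_nu[OF c A(1)] volE[OF mU measurable_sets_borel[OF phi0_measurable[OF iso] mB]]
 proof (intro nn_integral_cong)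
  fix x
  show "ennreal (indicator ?U x * sqrt (det (met c x))) * indicator (?ph -` (N.pm d -` B)) x =
   ennreal (indicator (im c) x * sqrt (det (met c x))) * indicator A (pm c x)"
  proof (cases "x \<in> ?U")
   case True
   then obtain p where p: "p \<in> cdom c" "p \<in> S" "F p \<in> cdom d" "x = coord c p" by auto
   have "?ph x = (coord d \<circ> F \<circ> param c) x" unfolding phi0_def[OF iso] using True by (rule if_P)
   then have "?ph x = coord d (F p)" using p by (simp add: param_coord[OF c])
   then have "N.pm d (?ph x) = F p" using p by (simp add: N.pm_def N.coord_in[OF d] N.param_coord[OF d])
   moreover have "pm c x = p" using p by (simp add: pm_def coord_in[OF c] param_coord[OF c])
   ultimately show ?thesis using True UV AB[OF p(2)] by (auto simp: indicator_def)
  next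
   case False
   then have "\<not> (x \<in> im c \<and> pm c x \<in> A)" using xU[of x] by (auto simp: pm_def)
   then show ?thesis using False by (auto simp: indicator_def)
  qed
 qed
 finally show ?thesis ..
qed

context closed_manifold
begin

lemma emeasure_nu_unique:
 assumes "c \<in> atlas M" "d \<in> atlas M" "B \<in> sets borel" "B \<subseteq> cdom c" "B \<subseteq> cdom d"
 shows "emeasure (nu c) B = emeasure (nu d) B"
 by (rule emeasure_nu_isometry[OF closed open_UNIV open_UNIV identity_isometry assms(1,2)]) (use assms in auto)

lemma finite_chart_partition:
 "\<exists>n (cs :: nat => ('a, 'n) chart) (E :: nat => 'a set).
   (\<forall>i<n. cs i \<in> atlas M \<and> E i \<subseteq> cdom (cs i) \<and> E i \<in> sets borel) \<and>
   disjoint_family_on E {..<n} \<and> (\<Union>i<n. E i) = UNIV"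
proof -
 have op: "open B" if "B \<in> cdom ` atlas M" for B using that open_cdom by auto
 have cov: "UNIV \<subseteq> \<Union> (cdom ` atlas M)"
 proof
  fix p obtain c where "c \<in> atlas M" "p \<in> cdom c" by (rule chart_cover)
  then show "p \<in> \<Union> (cdom ` atlas M)" by auto
 qed
 obtain C where C: "C \<subseteq> cdom ` atlas M" "finite C" "UNIV \<subseteq> \<Union>C"
  by (rule compactE[OF compact_M cov op]) (assumption, rule that)
 obtain D where D: "D \<subseteq> atlas M" "finite D" "C = cdom ` D" using finite_subset_image[OF C(2,1)] by auto
 obtain cl where cl: "set cl = D" using finite_list[OF D(2)] by blast
 let ?n = "length cl"
 define E where "E i = cdom (cl ! i) - (\<Union>j<i. cdom (cl ! j))" for i
 have at: "cl ! i \<in> atlas M" if "i < ?n" for i using that cl D(1) nth_mem by blast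
 have "E i \<in> sets borel" if "i < ?n" for i
 proof -
  have "open (cdom (cl ! j))" if "j < i" for j using open_cdom[OF at[of j]] that \<open>i < ?n\<close> by simp
  then have "open (\<Union>j<i. cdom (cl ! j))" by (intro open_UN) auto
  then show ?thesis unfolding E_def using open_cdom[OF at[OF that]] by (intro sets.Diff borel_open)
 qed
 moreover have "disjoint_family_on E {..<?n}"
  unfolding disjoint_family_on_def
 proof (intro ballI impI)
  fix i j :: nat assume "i \<noteq> j"
  then have "i < j \<or> j < i" by auto
  then show "E i \<inter> E j = {}" by (auto simp: E_def)
 qed
 moreover have "(\<Union>i<?n. E i) = UNIV"
 proof -
  have "p \<in> (\<Union>i<?n. E i)" for p
  proof -
   obtain B where B: "B \<in> C" "p \<in> B" using C(3) by blast
   then obtain c where c: "c \<in> D" "p \<in> cdom c" using D(3) by auto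
   then obtain i where "i < ?n" "cl ! i = c" using cl by (metis in_set_conv_nth)
   with c have "\<exists>i. i < ?n \<and> p \<in> cdom (cl ! i)" by auto
   then obtain i where i: "i < ?n" "p \<in> cdom (cl ! i)" and least: "!!j. j < i ==> \<not> (j < ?n \<and> p \<in> cdom (cl ! j))"
    unfolding exists_least_iff[of "\<lambda>i. i < ?n \<and> p \<in> cdom (cl ! i)"] by auto
   have "p \<notin> cdom (cl ! j)" if "j < i" for j using least[OF that] that i(1) by auto
   then have "p \<in> E i" using i(2) by (simp add: E_def)
   then show ?thesis using i(1) by (intro UN_I[of i]) simp_all
  qed
  then show ?thesis by blast
 qed
 moreover have "E i \<subseteq> cdom (cl ! i)" for i by (auto simp: E_def)
 ultimately show ?thesis
  by (intro exI[of _ ?n] exI[of _ "(!) cl"] exI[of _ E]) (use at in blast)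
qed

lemma riem_volume_works:
 "sets (riem_volume M) = sets borel"
 "c \<in> atlas M ==> B \<in> sets borel ==> B \<subseteq> cdom c ==> emeasure (riem_volume M) B = emeasure (nu c) B"
proof -
 obtain n :: nat and cs :: "nat => ('a, 'n) chart" and E :: "nat => 'a set" where
  csE: "\<forall>i<n. cs i \<in> atlas M \<and> E i \<subseteq> cdom (cs i) \<and> E i \<in> sets borel"
  and Ed: "disjoint_family_on E {..<n}" and EU: "(\<Union>i<n. E i) = UNIV"
  using finite_chart_partition by (elim exE conjE) (rule that)
 have cs: "cs i \<in> atlas M" and Ec: "E i \<subseteq> cdom (cs i)" and Eb: "E i \<in> sets borel" if "i < n" for i
  using csE that by auto
 define m where "m B = (\<Sum>i<n. emeasure (nu (cs i)) (B \<inter> E i))" for B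
 define mu where "mu = measure_of (UNIV :: 'a set) (sets borel) m"
 have smu: "sets mu = sets borel"
  unfolding mu_def by (simp add: sets_measure_of_conv) (metis sets.sigma_sets_eq space_borel)
 have emu: "emeasure mu B = m B" if "B \<in> sets borel" for B
 proof (rule emeasure_measure_of[OF mu_def])
  show "sets borel \<subseteq> Pow (UNIV :: 'a set)" by simp
  show "B \<in> sets mu" using that smu by simp
  show "positive (sets mu) m" by (simp add: positive_def m_def)
  show "countably_additive (sets mu) m"
   unfolding countably_additive_def smu
  proof (intro allI impI)
   fix A :: "nat => 'a set" assume A: "range A \<subseteq> sets borel" "disjoint_family A" "\<Union> (range A) \<in> sets borel"
   have "(\<Sum>k. m (A k)) = (\<Sum>i<n. \<Sum>k. emeasure (nu (cs i)) (A k \<inter> E i))"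
    unfolding m_def by (rule suminf_sum) simp
   also have "\<dots> = (\<Sum>i<n. emeasure (nu (cs i)) (\<Union>k. A k \<inter> E i))"
   proof (rule sum.cong[OF refl])
    fix i assume "i \<in> {..<n}"
    then show "(\<Sum>k. emeasure (nu (cs i)) (A k \<inter> E i)) = emeasure (nu (cs i)) (\<Union>k. A k \<inter> E i)"
     using A Eb by (intro suminf_emeasure) (auto simp: disjoint_family_on_def)
   qed
   also have "\<dots> = m (\<Union> (range A))" unfolding m_def by (intro sum.cong refl arg_cong2[where f = emeasure]) auto
   finally show "(\<Sum>k. m (A k)) = m (\<Union> (range A))" .
  qed
 qed
 have split: "emeasure L B = (\<Sum>i<n. emeasure L (B \<inter> E i))" if "sets L = sets borel" "B \<in> sets borel" for L :: "'a measure" and B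
 proof -
  have "(\<Sum>i<n. emeasure L (B \<inter> E i)) = emeasure L (\<Union>i<n. B \<inter> E i)"
   using Ed Eb that by (intro sum_emeasure) (auto simp: disjoint_family_on_def)
  also have "(\<Union>i<n. B \<inter> E i) = B" using EU by auto
  finally show ?thesis ..
 qed
 have chart: "emeasure mu B = emeasure (nu c) B" if c: "c \<in> atlas M" and B: "B \<in> sets borel" "B \<subseteq> cdom c" for c B
 proof -
  have "emeasure mu B = (\<Sum>i<n. emeasure (nu c) (B \<inter> E i))"
   unfolding emu[OF B(1)] m_def
  proof (rule sum.cong[OF refl])
   fix i assume "i \<in> {..<n}"
   then show "emeasure (nu (cs i)) (B \<inter> E i) = emeasure (nu c) (B \<inter> E i)"
    using c cs Ec Eb B by (intro emeasure_nu_unique) auto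
  qed
  then show ?thesis using split[of "nu c" B] B by simp
 qed
 let ?P = "\<lambda>\<mu>. sets \<mu> = sets borel \<and>
   (\<forall>c\<in>atlas M. \<forall>B\<in>sets borel. B \<subseteq> cdom c \<longrightarrow>
    emeasure \<mu> B = (\<integral>\<^sup>+x\<in>coord c ` B. ennreal (sqrt (det (gram M c (param c x)))) \<partial>lborel))"
 have Pmu: "?P mu" using smu chart emeasure_nu_chart by simp
 have uniq: "\<mu> = mu" if P: "?P \<mu>" for \<mu>
 proof (rule measure_eqI)
  show "sets \<mu> = sets mu" using P smu by simp
  fix B assume "B \<in> sets \<mu>"
  then have B: "B \<in> sets borel" using P by simp
  have "emeasure \<mu> (B \<inter> E i) = emeasure mu (B \<inter> E i)" if "i < n" for i
  proof -
   have s: "B \<inter> E i \<in> sets borel" "B \<inter> E i \<subseteq> cdom (cs i)" using B Eb[OF that] Ec[OF that] by auto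
   show ?thesis
    using P[THEN conjunct2, rule_format, OF cs[OF that] s] Pmu[THEN conjunct2, rule_format, OF cs[OF that] s] by (rule trans[OF _ sym])
  qed
  then show "emeasure \<mu> B = emeasure mu B"
   using split[of \<mu> B] split[of mu B] P smu B by simp
 qed
 have "riem_volume M = mu"
  unfolding riem_volume_def using Pmu uniq by (rule the_equality)
 then show "sets (riem_volume M) = sets borel"
  "c \<in> atlas M ==> B \<in> sets borel ==> B \<subseteq> cdom c ==> emeasure (riem_volume M) B = emeasure (nu c) B"
  using smu chart by auto
qed

abbreviation "RV \<equiv> riem_volume M"

lemma space_RV [simp]: "space RV = UNIV"
 using sets_eq_imp_space_eq[OF riem_volume_works(1)] by simp

lemma measurable_RV [simp]: "measurable RV N = measurable borel N"
 by (rule measurable_cong_sets[OF riem_volume_works(1) refl])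

lemma density_RV_chart:
 assumes c: "c \<in> atlas M" shows "density RV (\<lambda>p. ennreal (indicator (cdom c) p)) = nu c"
proof (rule measure_eqI)
 fix B assume "B \<in> sets (density RV (\<lambda>p. ennreal (indicator (cdom c) p)))"
 then have B: "B \<in> sets borel" by (simp add: riem_volume_works)
 have o: "cdom c \<in> sets borel" using open_cdom[OF c] by auto
 have "emeasure (density RV (\<lambda>p. ennreal (indicator (cdom c) p))) B = (\<integral>\<^sup>+p. indicator (B \<inter> cdom c) p \<partial>RV)"
 proof -
  have "emeasure (density RV (\<lambda>p. ennreal (indicator (cdom c) p))) B = (\<integral>\<^sup>+p. ennreal (indicator (cdom c) p) * indicator B p \<partial>RV)"
   by (rule emeasure_density) (use B o in \<open>simp_all add: riem_volume_works\<close>)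
  also have "\<dots> = (\<integral>\<^sup>+p. indicator (B \<inter> cdom c) p \<partial>RV)" by (intro nn_integral_cong) (auto simp: indicator_def)
  finally show ?thesis .
 qed
 also have "\<dots> = emeasure RV (B \<inter> cdom c)" using B o by (intro nn_integral_indicator) (auto simp: riem_volume_works)
 also have "\<dots> = emeasure (nu c) B" using riem_volume_works(2)[OF c, of "B \<inter> cdom c"] B o emeasure_nu_Int[OF c B] by auto
 finally show "emeasure (density RV (\<lambda>p. ennreal (indicator (cdom c) p))) B = emeasure (nu c) B" .
qed (simp add: riem_volume_works)

lemma integral_RV_chart:
 fixes w :: "'a => real"
 assumes c: "c \<in> atlas M" and w: "w \<in> borel_measurable borel" "!!p. p \<notin> cdom c ==> w p = 0"
 shows "(\<integral>p. w p \<partial>RV) = (\<integral>x. w (pm c x) \<partial>vol (im c) (met c))"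
proof -
 have "(\<integral>p. w p \<partial>RV) = (\<integral>p. indicator (cdom c) p *\<^sub>R w p \<partial>RV)"
  by (rule Bochner_Integration.integral_cong[OF refl]) (use w(2) in \<open>auto simp: indicator_def\<close>)
 also have "\<dots> = (\<integral>p. w p \<partial>density RV (\<lambda>p. ennreal (indicator (cdom c) p)))"
  using w(1) open_cdom[OF c] by (intro integral_density[symmetric]) (auto simp: borel_open)
 also have "\<dots> = (\<integral>x. w (pm c x) \<partial>vol (im c) (met c))"
  unfolding density_RV_chart[OF c] nu_def by (rule integral_distr[OF pm_measurable_vol[OF c] w(1)])
 finally show ?thesis .
qed

lemma finite_RV: "finite_measure RV"
proof (rule finite_measureI)
 have "\<exists>W. open W \<and> p \<in> W \<and> emeasure RV W < \<infinity>" for p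
 proof -
  obtain c where c: "c \<in> atlas M" "p \<in> cdom c" by (rule chart_cover)
  obtain r where r: "r > 0" "cball (coord c p) r \<subseteq> im c"
   using open_im[OF c(1)] coord_in[OF c] by (meson open_contains_cball)
  let ?B = "ball (coord c p) r"
  define W where "W = cdom c \<inter> coord c -` ?B"
  have W: "open W" unfolding W_def using continuous_on_open_vimage[OF open_cdom[OF c(1)]] cont_coord[OF c(1)] open_ball by (metis Int_commute)
  obtain D where D: "D \<ge> 0" "!!x. x \<in> cball (coord c p) r ==> \<bar>sqrt (det (met c x))\<bar> \<le> D"
   using smooth_bounded_compact[OF metric_on_met[OF c(1)] smooth_on_rho[OF metric_on_met[OF c(1)]] compact_cball r(2)] by blast
  have Wb: "W \<in> sets borel" "W \<subseteq> cdom c" using W by (auto simp: W_def)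
  have "emeasure RV W = (\<integral>\<^sup>+x\<in>coord c ` W. ennreal (sqrt (det (gram M c (param c x)))) \<partial>lborel)"
   using riem_volume_works(2)[OF c(1) Wb] emeasure_nu_chart[OF c(1) Wb] by simp
  also have "\<dots> \<le> (\<integral>\<^sup>+x. ennreal D * indicator ?B x \<partial>lborel)"
  proof (intro nn_integral_mono)
   fix x
   show "ennreal (sqrt (det (gram M c (param c x)))) * indicator (coord c ` W) x \<le> ennreal D * indicator ?B x"
   proof (cases "x \<in> coord c ` W")
    case True
    then have x: "x \<in> ?B" by (auto simp: W_def)
    then have "sqrt (det (gram M c (param c x))) \<le> D" using D(2)[of x] by (auto simp: met_def)
    then show ?thesis using True x by (simp add: ennreal_leI)
   qed simp
  qed
  also have "\<dots> = ennreal D * emeasure lborel ?B" by (rule nn_integral_cmult_indicator) simp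
  also have "\<dots> < \<infinity>" using emeasure_lborel_ball_finite[of "coord c p" r] by (simp add: ennreal_mult_less_top)
  finally show ?thesis using W c r by (intro exI[of _ W]) (auto simp: W_def)
 qed
 then obtain W where W: "!!p. open (W p) \<and> p \<in> W p \<and> emeasure RV (W p) < \<infinity>" by metis
 have opW: "open (W p)" if "p \<in> UNIV" for p using W by blast
 have covW: "UNIV \<subseteq> (\<Union>p\<in>UNIV. W p)" using W by blast
 obtain D where "D \<subseteq> UNIV" and D: "finite D" "UNIV \<subseteq> (\<Union>p\<in>D. W p)"
  by (rule compactE_image[OF compact_M opW covW]) (assumption, rule that)
 have "emeasure RV (space RV) \<le> emeasure RV (\<Union>p\<in>D. W p)"
  using D W by (intro emeasure_mono) (auto simp: riem_volume_works)
 also have "\<dots> \<le> (\<Sum>p\<in>D. emeasure RV (W p))"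
  using D W by (intro emeasure_subadditive_finite) (auto simp: riem_volume_works)
 also have "\<dots> < \<infinity>" using D(1) by (induction D rule: finite_induct) (use W in auto)
 finally show "emeasure RV (space RV) \<noteq> \<infinity>" by simp
qed

sublocale RV: finite_measure RV by (rule finite_RV)

lemma integrable_continuous: assumes "continuous_on UNIV (f :: 'a => real)" shows "integrable RV f"
proof -
 have "compact (f ` UNIV)" by (rule compact_continuous_image[OF assms compact_M])
 then obtain B where "!!p. norm (f p) \<le> B" using compact_imp_bounded bounded_pos by (metis imageI UNIV_I)
 moreover have "f \<in> borel_measurable RV" using borel_measurable_continuous_onI[OF assms] by simp
 ultimately show ?thesis by (intro RV.integrable_const_bound) auto
qed

lemma SF_integrable [simp]: "f \<in> SF ==> integrable RV f"
 by (rule integrable_continuous[OF SF_continuous])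

lemma SF_measurable: "f \<in> SF ==> f \<in> borel_measurable borel"
 by (rule borel_measurable_continuous_onI[OF SF_continuous])

lemma continuous_integral_zero:
 assumes f: "continuous_on UNIV (f :: 'a => real)" "!!p. 0 \<le> f p" "(\<integral>p. f p \<partial>RV) = 0"
 shows "f p = 0"
proof (rule ccontr)
 assume "f p \<noteq> 0"
 then have fp: "f p > 0" using f(2)[of p] by simp
 have "AE q in RV. f q = 0"
  using integral_nonneg_eq_0_iff_AE[OF integrable_continuous[OF f(1)]] f(2,3) by simp
 obtain c where c: "c \<in> atlas M" "p \<in> cdom c" by (rule chart_cover)
 define W where "W = cdom c \<inter> f -` {0<..}"
 have "open (f -` {0<..})" using f(1) by (intro open_vimage open_greaterThan) auto
 then have W: "open W" "W \<subseteq> cdom c" "p \<in> W" using open_cdom[OF c(1)] c fp by (auto simp: W_def)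
 have Wb: "W \<in> sets borel" using W by auto
 have "AE q in RV. q \<notin> W" using \<open>AE q in RV. f q = 0\<close> by eventually_elim (auto simp: W_def)
 then have "emeasure RV W = 0" using Wb by (subst (asm) AE_iff_measurable[OF _ refl]) (auto simp: riem_volume_works)
 then have z: "(\<integral>\<^sup>+x\<in>coord c ` W. ennreal (sqrt (det (met c x))) \<partial>lborel) = 0"
  using riem_volume_works(2)[OF c(1) Wb W(2)] emeasure_nu_chart[OF c(1) Wb W(2)] by (simp add: met_def)
 have oW: "open (coord c ` W)" by (rule open_coord_image[OF c(1) W(1,2)])
 have sub: "coord c ` W \<subseteq> im c" using W(2) by (auto simp: im_def)
 have meas: "(\<lambda>x. ennreal (sqrt (det (met c x))) * indicator (coord c ` W) x) \<in> borel_measurable lborel"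
 proof -
  have "(\<lambda>x. indicator (coord c ` W) x * ennreal (indicator (im c) x * sqrt (det (met c x)))) \<in> borel_measurable borel"
   by (intro borel_measurable_times_ennreal borel_measurable_indicator borel_open oW
     measurable_compose[OF borel_measurable_rho[OF metric_on_met[OF c(1)]] measurable_ennreal])
  moreover have "indicator (coord c ` W) x * ennreal (indicator (im c) x * sqrt (det (met c x))) =
   ennreal (sqrt (det (met c x))) * indicator (coord c ` W) x" for x
   using sub by (cases "x \<in> coord c ` W") auto
  ultimately show ?thesis by simp
 qed
 have "AE x in lborel. x \<notin> coord c ` W"
  using z meas
 proof (subst (asm) nn_integral_0_iff_AE)
  assume "AE x in lborel. ennreal (sqrt (det (met c x))) * indicator (coord c ` W) x = 0"
  then show ?thesis
  proof eventually_elim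
   case (elim x)
   then show ?case using sub metric_det_pos[OF metric_on_met[OF c(1)], of x] by (auto simp: indicator_def split: if_splits)
  qed
 qed auto
 then have "emeasure lborel (coord c ` W) = 0" using oW by (subst (asm) AE_iff_measurable[OF _ refl]) auto
 moreover obtain r where r: "r > 0" "ball (coord c p) r \<subseteq> coord c ` W" using oW W(3) by (meson imageI open_contains_ball)
 ultimately have "emeasure lborel (ball (coord c p) r) = 0"
  using emeasure_mono[OF r(2), of lborel] oW by auto
 then show False using content_ball_pos[OF r(1), of "coord c p"] by (simp add: measure_def)
qed

end

subsection \<open>Cutoffs, localisation and Green's formula\<close>

context closed_manifold
begin

abbreviation "TF \<equiv> test_functions M"
abbreviation "spt f \<equiv> closure {p. f p \<noteq> (0::real)}"

lemma spt_zero: "p \<notin> spt f ==> f p = 0" using closure_subset[of "{p. f p \<noteq> 0}"] by auto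

lemma spt_le: "closed K ==> (!!p. p \<notin> K ==> f p = 0) ==> spt f \<subseteq> K"
 by (rule closure_minimal) auto

lemma TF_iff: "f \<in> TF S \<longleftrightarrow> f \<in> SF \<and> spt f \<subseteq> S" by (simp add: test_functions_def)

lemma TF_SF: "f \<in> TF S ==> f \<in> SF" by (simp add: TF_iff)

lemma TF_mono_support: "f \<in> TF S ==> h \<in> SF ==> spt h \<subseteq> spt f ==> h \<in> TF S" by (auto simp: TF_iff)

lemma spt_mult: "spt (\<lambda>p. f p * h p) \<subseteq> spt h"
proof (rule spt_le[OF closed_closure])
 fix p assume "p \<notin> spt h"
 then have "h p = 0" by (rule spt_zero)
 then show "f p * h p = 0" by simp
qed

lemma TF_mult: "f \<in> SF ==> h \<in> TF S ==> (\<lambda>p. f p * h p) \<in> TF S"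
 using spt_mult[of f h] SF_mult by (auto simp: TF_iff)

lemma TF_add: assumes "f \<in> TF S" "h \<in> TF S" shows "(\<lambda>p. f p + h p) \<in> TF S"
proof -
 have "spt (\<lambda>p. f p + h p) \<subseteq> spt f \<union> spt h"
 proof (rule spt_le)
  show "closed (spt f \<union> spt h)" by (intro closed_Un closed_closure)
  fix p assume p: "p \<notin> spt f \<union> spt h"
  have "f p = 0" "h p = 0" by (rule spt_zero, use p in simp)+
  then show "f p + h p = 0" by simp
 qed
 then show ?thesis using assms SF_add by (auto simp: TF_iff)
qed

lemma TF_cmult: "f \<in> TF S ==> (\<lambda>p. k * f p) \<in> TF S" by (rule TF_mult[OF SF_const])

lemma TF_zero: "(\<lambda>p. 0) \<in> TF S" by (simp add: TF_iff)

lemma spt_laplacian: assumes "f \<in> SF" shows "spt (\<Delta> f) \<subseteq> spt f"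
proof (rule spt_le[OF closed_closure])
 fix p assume p: "p \<notin> spt f"
 have "\<Delta> f p = \<Delta> (\<lambda>q. 0) p"
 proof (rule laplacian_local[OF assms SF_const])
  show "open (- spt f)" by (intro open_Compl closed_closure)
  show "p \<in> - spt f" using p by simp
  show "f q = 0" if "q \<in> - spt f" for q by (rule spt_zero) (use that in simp)
 qed
 then show "\<Delta> f p = 0" by (simp add: laplacian_const)
qed

lemma TF_laplacian: "f \<in> TF S ==> \<Delta> f \<in> TF S"
 using TF_mono_support[OF _ SF_laplacian spt_laplacian] TF_SF by blast

lemma Gam_zero: assumes f: "f \<in> SF" and h: "h \<in> SF" and W: "open W" "p \<in> W" "!!q. q \<in> W ==> h q = 0"
 shows "Gam f h p = 0"
proof -
 have "\<Delta> (\<lambda>q. f q * h q) p = \<Delta> (\<lambda>q. 0) p" by (rule laplacian_local[OF SF_mult[OF f h] SF_const W(1,2)]) (simp add: W)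
 moreover have "\<Delta> h p = \<Delta> (\<lambda>q. 0) p" by (rule laplacian_local[OF h SF_const W])
 ultimately show ?thesis using W by (simp add: Gam_def laplacian_const)
qed

lemma compact_subset_M: "closed K ==> compact (K :: 'a set)"
 using compact_Int_closed[OF compact_M] by auto

definition loc :: "('a, 'n) chart => ('a => real) => real^'n => real" where
 "loc c h x = (if x \<in> im c then h (param c x) else 0)"

lemma test_on_loc:
 assumes c: "c \<in> atlas M" and h: "h \<in> TF (cdom c)"
 shows "test_on (im c) (loc c h)"
proof -
 let ?K = "coord c ` spt h"
 have sp: "spt h \<subseteq> cdom c" and hS: "h \<in> SF" using h by (auto simp: TF_iff)
 have K: "compact ?K"
  by (rule compact_continuous_image[OF continuous_on_subset[OF cont_coord[OF c] sp] compact_subset_M[OF closed_closure]])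
 have Kc: "?K \<subseteq> im c" using sp by (auto simp: im_def)
 have z: "loc c h x = 0" if "x \<notin> ?K" for x
 proof (cases "x \<in> im c")
  case True
  have "param c x \<notin> spt h"
  proof
   assume "param c x \<in> spt h"
   then have "coord c (param c x) \<in> ?K" by (rule imageI)
   with that True show False by (simp add: coord_param[OF c])
  qed
  then have "h (param c x) = 0" by (rule spt_zero)
  then show ?thesis using True by (simp add: loc_def)
 qed (simp add: loc_def)
 have "smooth_on UNIV (loc c h)"
 proof (rule smooth_on_local)
  fix x
  have 1: "smooth_on (im c) (loc c h)"
   by (rule smooth_on_cong[OF open_im[OF c] _ SF_smooth[OF hS c]]) (simp add: loc_def)
  have 2: "smooth_on (- ?K) (loc c h)"
   by (rule smooth_on_cong[of _ "\<lambda>_. 0"]) (use z open_Compl[OF compact_imp_closed[OF K]] in auto)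
  show "\<exists>V. x \<in> V \<and> smooth_on V (loc c h)"
  proof (cases "x \<in> im c")
   case True then show ?thesis using 1 by blast
  next
   case False then have "x \<in> - ?K" using Kc by blast
   then show ?thesis using 2 by blast
  qed
 qed
 then show ?thesis using K Kc z unfolding test_on_def by blast
qed

lemma green_chart:
 assumes c: "c \<in> atlas M" and f: "f \<in> SF" and h: "h \<in> TF (cdom c)"
 shows "(\<integral>p. \<Delta> f p * h p \<partial>RV) = - (\<integral>p. Gam f h p \<partial>RV)"
proof -
 let ?f = "\<lambda>x. f (param c x)"
 note m = metric_on_met[OF c]
 have hS: "h \<in> SF" and sp: "spt h \<subseteq> cdom c" using h by (auto simp: TF_iff)
 have t: "test_on (im c) (loc c h)" by (rule test_on_loc[OF c h])
 have fs: "smooth_on (im c) ?f" by (rule SF_smooth[OF f c])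
 have hz: "h p = 0" if "p \<notin> cdom c" for p by (rule spt_zero) (use sp that in blast)
 have gz: "Gam f h p = 0" if "p \<notin> cdom c" for p
 proof (rule Gam_zero[OF f hS])
  show "open (- spt h)" by (intro open_Compl closed_closure)
  show "p \<in> - spt h" using that sp by blast
  show "h q = 0" if "q \<in> - spt h" for q by (rule spt_zero) (use that in simp)
 qed
 have mb: "(\<lambda>x. w (pm c x)) \<in> borel_measurable (vol (im c) (met c))" if "w \<in> SF" for w
  by (rule measurable_compose[OF pm_measurable_vol[OF c] SF_measurable[OF that]])
 have ml: "w \<in> borel_measurable (vol (im c) (met c))" if "test_on (im c) w" for w
  using test_on_measurable[OF that] by (simp add: measurable_def sets_vol[OF m])
 have "(\<integral>p. \<Delta> f p * h p \<partial>RV) = (\<integral>x. \<Delta> f (pm c x) * h (pm c x) \<partial>vol (im c) (met c))"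
  by (rule integral_RV_chart[OF c SF_measurable[OF SF_mult[OF SF_laplacian[OF f] hS]]]) (simp add: hz)
 also have "\<dots> = (\<integral>x. lap (met c) ?f x * loc c h x \<partial>vol (im c) (met c))"
 proof (rule integral_cong_AE)
  show "AE x in vol (im c) (met c). \<Delta> f (pm c x) * h (pm c x) = lap (met c) ?f x * loc c h x"
   using AE_vol[OF m]
   by eventually_elim (simp add: pm_def loc_def laplacian_in_chart[OF c _ f] param_in[OF c] coord_param[OF c])
 qed (use mb[OF SF_mult[OF SF_laplacian[OF f] hS]] ml[OF test_on_mult[OF open_im[OF c] smooth_on_lap[OF m fs] t]] in simp_all)
 also have "\<dots> = - (\<integral>x. gam (met c) ?f (loc c h) x \<partial>vol (im c) (met c))"
  by (rule integral_lap_vol[OF m fs t])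
 also have "(\<integral>x. gam (met c) ?f (loc c h) x \<partial>vol (im c) (met c)) = (\<integral>x. Gam f h (pm c x) \<partial>vol (im c) (met c))"
 proof (rule integral_cong_AE)
  show "AE x in vol (im c) (met c). gam (met c) ?f (loc c h) x = Gam f h (pm c x)"
   using AE_vol[OF m]
  proof eventually_elim
   case (elim x)
   have "grad (loc c h) x = grad (\<lambda>x. h (param c x)) x"
    unfolding grad_def using pderiv_at_cong[OF open_im[OF c] elim, of "loc c h" "\<lambda>x. h (param c x)"]
    by (simp add: loc_def)
   then show ?case using elim
    by (simp add: Gam_in_chart[OF c _ f hS] pm_def param_in[OF c] coord_param[OF c] gam_def)
  qed
 qed (use mb[OF SF_Gam[OF f hS]] ml[OF test_on_gam[OF m fs t]] in simp_all)
 also have "\<dots> = (\<integral>p. Gam f h p \<partial>RV)"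
  by (rule integral_RV_chart[OF c SF_measurable[OF SF_Gam[OF f hS]] gz, symmetric])
 finally show ?thesis .
qed

lemma bump_at:
 assumes W: "open W" "p \<in> W"
 shows "\<exists>b V. b \<in> TF W \<and> (\<forall>q. 0 \<le> b q \<and> b q \<le> 1) \<and> open V \<and> p \<in> V \<and> (\<forall>q\<in>V. b q = 1)"
proof -
 obtain c where c: "c \<in> atlas M" "p \<in> cdom c" by (rule chart_cover)
 note cc = c(1)
 let ?D = "coord c ` (cdom c \<inter> W)"
 have oD: "open ?D" using open_coord_image[OF cc] open_cdom[OF cc] W by (simp add: open_Int)
 have pD: "coord c p \<in> ?D" using c W by auto
 obtain b0 :: "real^'n => real" and r where b0: "r > 0" "smooth_on UNIV b0" "!!y. 0 \<le> b0 y" "!!y. b0 y \<le> 1"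
   "!!y. y \<in> ball (coord c p) r ==> b0 y = 1" "!!y. y \<notin> cball (coord c p) (2*r) ==> b0 y = 0" "cball (coord c p) (2*r) \<subseteq> ?D"
  by (rule smooth_bump[OF oD pD]) (rule that)
 define b where "b q = (if q \<in> cdom c then b0 (coord c q) else 0)" for q
 let ?B = "cball (coord c p) (2*r)"
 have Bim: "?B \<subseteq> im c" using b0(7) by (auto simp: im_def)
 define K where "K = param c ` ?B"
 have K: "compact K" unfolding K_def
  by (rule compact_continuous_image[OF continuous_on_subset[OF cont_param[OF cc] Bim]]) simp
 have KW: "K \<subseteq> cdom c \<inter> W"
 proof
  fix q assume "q \<in> K"
  then obtain x where x: "x \<in> ?B" "q = param c x" by (auto simp: K_def)
  then obtain q' where "q' \<in> cdom c \<inter> W" "x = coord c q'" using b0(7) by blast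
  then show "q \<in> cdom c \<inter> W" using x by (simp add: param_coord[OF cc])
 qed
 have z: "b q = 0" if "q \<notin> K" for q
 proof (cases "q \<in> cdom c")
  case True
  have "coord c q \<notin> ?B"
  proof
   assume "coord c q \<in> ?B"
   then have "param c (coord c q) \<in> K" unfolding K_def by (rule imageI)
   with that True show False by (simp add: param_coord[OF cc])
  qed
  then show ?thesis using b0(6) by (simp add: b_def)
 qed (simp add: b_def)
 have "b \<in> SF"
  unfolding SF_iff
 proof
  fix d assume d: "d \<in> atlas M"
  let ?U = "coord d ` {p \<in> cdom d \<inter> UNIV. p \<in> cdom c}"
  note iso = isometry_in_charts[OF closed open_UNIV open_UNIV identity_isometry d cc]
  have "smooth_on ?U (\<lambda>x. b0 ((coord c \<circ> (\<lambda>p. p) \<circ> param d) x))"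
   by (rule smooth_on_compose[OF iso_open(1)[OF iso] iso_smooth(1)[OF iso] subset_UNIV b0(2)])
  then have s1: "smooth_on ?U (\<lambda>x. b (param d x))"
   by (rule smooth_on_cong[OF iso_open(1)[OF iso], rotated]) (auto simp: b_def param_coord[OF d])
  let ?V = "coord d ` (cdom d - K)"
  have oV: "open ?V" using open_coord_image[OF d] open_cdom[OF d] compact_imp_closed[OF K] by (simp add: open_Diff)
  have s2: "smooth_on ?V (\<lambda>x. b (param d x))"
   by (rule smooth_on_cong[OF oV, of "\<lambda>_. 0"]) (auto simp: z param_coord[OF d])
  show "smooth_on (im d) (\<lambda>x. b (param d x))"
  proof (rule smooth_on_local)
   fix x assume "x \<in> im d"
   then obtain q where q: "q \<in> cdom d" "x = coord d q" by (auto simp: im_def)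
   show "\<exists>V. x \<in> V \<and> smooth_on V (\<lambda>x. b (param d x))"
   proof (cases "q \<in> K")
    case True
    then have "q \<in> {p \<in> cdom d \<inter> UNIV. p \<in> cdom c}" using KW q by auto
    then have "x \<in> ?U" unfolding q(2) by (rule imageI)
    then show ?thesis using s1 by (intro exI[of _ ?U] conjI)
   next
    case False
    then have "x \<in> ?V" unfolding q(2) using q(1) by (intro imageI) simp
    then show ?thesis using s2 by (intro exI[of _ ?V] conjI)
   qed
  qed
 qed
 moreover have "spt b \<subseteq> K" by (rule spt_le[OF compact_imp_closed[OF K] z])
 then have "spt b \<subseteq> W" using KW by blast
 ultimately have "b \<in> TF W" by (simp add: TF_iff)
 moreover have "\<forall>q. 0 \<le> b q \<and> b q \<le> 1" using b0(3,4) by (simp add: b_def)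
 moreover define V where "V = cdom c \<inter> coord c -` ball (coord c p) r"
 moreover have "open V"
  unfolding V_def using continuous_on_open_vimage[OF open_cdom[OF cc]] cont_coord[OF cc] open_ball by (metis Int_commute)
 moreover have "p \<in> V" using c b0(1) by (simp add: V_def)
 moreover have "\<forall>q\<in>V. b q = 1" using b0(5) by (simp add: V_def b_def)
 ultimately show ?thesis by (intro exI[of _ b] exI[of _ V] conjI)
qed

text \<open>Partitions of unity as an induction principle: an additive property of smooth functions may be
checked on functions with small support.\<close>

lemma localise:
 assumes loc: "!!p. \<exists>W. open W \<and> p \<in> W \<and> (\<forall>b\<in>TF W. P (\<lambda>q. b q * f q))"
  and add: "!!g h. g \<in> SF ==> h \<in> SF ==> P g ==> P h ==> P (\<lambda>q. g q + h q)" and f: "f \<in> SF"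
 shows "P f"
proof -
 have "\<exists>b V. b \<in> SF \<and> open V \<and> p \<in> V \<and> (\<forall>q\<in>V. b q = 1) \<and> (\<forall>g\<in>SF. P (\<lambda>q. (g q * b q) * f q))" for p
 proof -
  obtain W where W: "open W" "p \<in> W" "\<forall>b\<in>TF W. P (\<lambda>q. b q * f q)" using loc by blast
  obtain b V where b: "b \<in> TF W" "open V" "p \<in> V" "\<forall>q\<in>V. b q = 1" using bump_at[OF W(1,2)] by blast
  have "P (\<lambda>q. (g q * b q) * f q)" if "g \<in> SF" for g using W(3) TF_mult[OF that b(1)] by simp
  then show ?thesis using b TF_SF[OF b(1)] by blast
 qed
 then obtain b V where bV: "!!p. b p \<in> SF \<and> open (V p) \<and> p \<in> V p \<and> (\<forall>q\<in>V p. b p q = 1) \<and> (\<forall>g\<in>SF. P (\<lambda>q. (g q * b p q) * f q))"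
  by metis
 have opV: "open (V p)" if "p \<in> UNIV" for p using bV by blast
 have cov: "UNIV \<subseteq> (\<Union>p\<in>UNIV. V p)" using bV by blast
 obtain D where "D \<subseteq> UNIV" and D: "finite D" "UNIV \<subseteq> (\<Union>p\<in>D. V p)"
  by (rule compactE_image[OF compact_M opV cov]) (assumption, rule that)
 have bS: "b p \<in> SF" for p using bV by blast
 have bP: "P (\<lambda>q. (g q * b p q) * f q)" if "g \<in> SF" for g p using bV[of p] that by simp
 have piS: "(\<lambda>q. \<Prod>p\<in>D. 1 - b p q) \<in> SF" if "finite D" for D
  using that by (induction D rule: finite_induct) (auto intro!: SF_mult SF_diff bS)
 have "P (\<lambda>q. (1 - (\<Prod>p\<in>D. 1 - b p q)) * f q)" if "finite D" for D
  using that
 proof (induction D rule: finite_induct)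
  case empty
  have "P (\<lambda>q. (0 * b undefined q) * f q)" by (rule bP[of "\<lambda>_. 0", OF SF_const])
  then show ?case by simp
 next
  case (insert p D)
  have 1: "P (\<lambda>q. ((\<Prod>p\<in>D. 1 - b p q) * b p q) * f q)" by (rule bP[OF piS[OF insert(1)]])
  have "P (\<lambda>q. (1 - (\<Prod>p\<in>D. 1 - b p q)) * f q + ((\<Prod>p\<in>D. 1 - b p q) * b p q) * f q)"
   by (rule add[OF _ _ insert.IH 1]) (intro SF_mult SF_diff SF_const piS insert bS f)+
  moreover have "(\<lambda>q. (1 - (\<Prod>p\<in>D. 1 - b p q)) * f q + ((\<Prod>p\<in>D. 1 - b p q) * b p q) * f q)
    = (\<lambda>q. (1 - (\<Prod>p\<in>insert p D. 1 - b p q)) * f q)"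
   using insert by (auto simp: algebra_simps)
  ultimately show ?case by simp
 qed
 then have "P (\<lambda>q. (1 - (\<Prod>p\<in>D. 1 - b p q)) * f q)" using D by simp
 moreover have "(\<Prod>p\<in>D. 1 - b p q) = 0" for q
 proof -
  obtain p where "p \<in> D" "q \<in> V p" using D(2) by blast
  then show ?thesis using bV[of p] D(1) by (intro prod_zero) auto
 qed
 ultimately show ?thesis by simp
qed

lemma cutoff:
 assumes K: "closed K" "K \<subseteq> W" and W: "open W"
 shows "\<exists>b V. b \<in> TF W \<and> open V \<and> K \<subseteq> V \<and> (\<forall>q\<in>V. b q = 1)"
proof -
 have "\<exists>b V. p \<in> W \<longrightarrow> b \<in> TF W \<and> open V \<and> p \<in> V \<and> (\<forall>q\<in>V. b q = 1)" for p using bump_at[OF W, of p] by blast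
 then obtain b V where bV: "!!p. p \<in> W \<longrightarrow> b p \<in> TF W \<and> open (V p) \<and> p \<in> V p \<and> (\<forall>q\<in>V p. b p q = 1)"
  by metis
 have opV: "open (V p)" if "p \<in> K" for p using bV K that by blast
 have cov: "K \<subseteq> (\<Union>p\<in>K. V p)" using bV K by blast
 obtain D where DK: "D \<subseteq> K" and D: "finite D" "K \<subseteq> (\<Union>p\<in>D. V p)"
  by (rule compactE_image[OF compact_subset_M[OF K(1)] opV cov]) (assumption, rule that)
 have DW: "D \<subseteq> W" using DK K by blast
 have "(\<lambda>q. 1 - (\<Prod>p\<in>D. 1 - b p q)) \<in> TF W"
  using D(1) DW
 proof (induction D rule: finite_induct)
  case empty then show ?case by (simp add: TF_zero)
 next
  case (insert p D)
  have b: "b p \<in> TF W" using bV insert by blast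
  have ih: "(\<lambda>q. 1 - (\<Prod>p\<in>D. 1 - b p q)) \<in> TF W" using insert by blast
  have "(\<lambda>q. (1 - b p q) * (1 - (\<Prod>p\<in>D. 1 - b p q)) + b p q) \<in> TF W"
   by (intro TF_add TF_mult ih b SF_diff SF_const TF_SF[OF b])
  moreover have "(\<lambda>q. (1 - b p q) * (1 - (\<Prod>p\<in>D. 1 - b p q)) + b p q) = (\<lambda>q. 1 - (\<Prod>p\<in>insert p D. 1 - b p q))"
   using insert by (auto simp: algebra_simps)
  ultimately show ?case by simp
 qed
 moreover have "open (\<Union>p\<in>D. V p)" using opV DK by (intro open_UN) auto
 moreover have "\<forall>q\<in>(\<Union>p\<in>D. V p). 1 - (\<Prod>p\<in>D. 1 - b p q) = 1"
 proof
  fix q assume "q \<in> (\<Union>p\<in>D. V p)"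
  then obtain p where "p \<in> D" "q \<in> V p" by blast
  then have "(\<Prod>p\<in>D. 1 - b p q) = 0" using bV[of p] D(1) DW by (intro prod_zero) auto
  then show "1 - (\<Prod>p\<in>D. 1 - b p q) = 1" by simp
 qed
 ultimately show ?thesis using D(2) by blast
qed

lemma green:
 assumes f: "f \<in> SF" and h: "h \<in> SF"
 shows "(\<integral>p. \<Delta> f p * h p \<partial>RV) = - (\<integral>p. Gam f h p \<partial>RV)"
proof (rule localise[of "\<lambda>h. (\<integral>p. \<Delta> f p * h p \<partial>RV) = - (\<integral>p. Gam f h p \<partial>RV)", OF _ _ h])
 fix p
 obtain c where c: "c \<in> atlas M" "p \<in> cdom c" by (rule chart_cover)
 have "(\<integral>p. \<Delta> f p * (b p * h p) \<partial>RV) = - (\<integral>p. Gam f (\<lambda>p. b p * h p) p \<partial>RV)" if "b \<in> TF (cdom c)" for b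
 proof -
  have "(\<lambda>p. h p * b p) \<in> TF (cdom c)" by (rule TF_mult[OF h that])
  then have "(\<lambda>p. b p * h p) \<in> TF (cdom c)" by (simp add: mult.commute)
  from green_chart[OF c(1) f this] show ?thesis .
 qed
 then show "\<exists>W. open W \<and> p \<in> W \<and> (\<forall>b\<in>TF W. (\<integral>p. \<Delta> f p * (b p * h p) \<partial>RV) = - (\<integral>p. Gam f (\<lambda>q. b q * h q) p \<partial>RV))"
  using c open_cdom by blast
next
 fix g h assume gh: "g \<in> SF" "h \<in> SF" "(\<integral>p. \<Delta> f p * g p \<partial>RV) = - (\<integral>p. Gam f g p \<partial>RV)" "(\<integral>p. \<Delta> f p * h p \<partial>RV) = - (\<integral>p. Gam f h p \<partial>RV)"
 have 1: "integrable RV (\<lambda>p. \<Delta> f p * g p)" "integrable RV (\<lambda>p. \<Delta> f p * h p)"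
  by (intro SF_integrable SF_mult SF_laplacian f gh)+
 have 2: "integrable RV (\<lambda>p. Gam f g p)" "integrable RV (\<lambda>p. Gam f h p)"
  using SF_integrable SF_Gam f gh by auto
 have G: "Gam f (\<lambda>q. g q + h q) p = Gam f g p + Gam f h p" for p
  unfolding Gam_sym[of f] by (rule Gam_add[OF gh(1,2) f])
 show "(\<integral>p. \<Delta> f p * (g p + h p) \<partial>RV) = - (\<integral>p. Gam f (\<lambda>q. g q + h q) p \<partial>RV)"
  unfolding G distrib_left using 1 2 gh(3,4) by simp
qed

lemma l2_laplacian_sym:
 assumes "f \<in> SF" "h \<in> SF" shows "l2_inner M (\<Delta> f) h = l2_inner M f (\<Delta> h)"
 using green[OF assms] green[OF assms(2,1)] by (simp add: l2_inner_def Gam_sym[of h f] mult.commute)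

end

section \<open>Eigenfunction expansions\<close>

context closed_manifold
begin

abbreviation "ip f h \<equiv> l2_inner M f h"

lemma ip_sym: "ip f h = ip h f" by (simp add: l2_inner_def mult.commute)

lemma ip_nonneg: "0 \<le> ip f f" by (simp add: l2_inner_def)

lemma SF_mult_integrable: "f \<in> SF ==> h \<in> SF ==> integrable RV (\<lambda>p. f p * h p)"
 by (rule SF_integrable[OF SF_mult])

lemma ip_add: "f \<in> SF ==> g \<in> SF ==> h \<in> SF ==> ip (\<lambda>p. f p + g p) h = ip f h + ip g h"
 using SF_mult_integrable[of f h] SF_mult_integrable[of g h] by (simp add: l2_inner_def distrib_right)

lemma ip_cmult: "ip (\<lambda>p. k * f p) h = k * ip f h"
 by (simp add: l2_inner_def mult.assoc)

lemma ip_cmult_right: "ip f (\<lambda>p. k * h p) = k * ip f h"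
 by (simp add: l2_inner_def mult.left_commute)

lemma ip_add_right: "f \<in> SF ==> g \<in> SF ==> h \<in> SF ==> ip h (\<lambda>p. f p + g p) = ip h f + ip h g"
 using SF_mult_integrable[of h f] SF_mult_integrable[of h g] by (simp add: l2_inner_def distrib_left)

lemma ip_diff: "f \<in> SF ==> g \<in> SF ==> h \<in> SF ==> ip (\<lambda>p. f p - g p) h = ip f h - ip g h"
 using SF_mult_integrable[of f h] SF_mult_integrable[of g h] by (simp add: l2_inner_def left_diff_distrib)

lemma ip_sum: "finite A ==> (!!a. a \<in> A ==> f a \<in> SF) ==> h \<in> SF ==> ip (\<lambda>p. \<Sum>a\<in>A. f a p) h = (\<Sum>a\<in>A. ip (f a) h)"
proof (induction A rule: finite_induct)
 case (insert a A)
 have "ip (\<lambda>p. f a p + (\<Sum>a\<in>A. f a p)) h = ip (f a) h + ip (\<lambda>p. \<Sum>a\<in>A. f a p) h"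
  by (rule ip_add) (use insert SF_sum in auto)
 then show ?case using insert by simp
qed (simp add: l2_inner_def)

lemma ip_cauchy_schwarz:
 assumes f: "f \<in> SF" and h: "h \<in> SF" shows "(ip f h)\<^sup>2 \<le> ip f f * ip h h"
proof -
 have q: "0 \<le> ip f f + 2 * t * ip f h + t\<^sup>2 * ip h h" for t
 proof -
  have th: "(\<lambda>p. t * h p) \<in> SF" by (rule SF_cmult[OF h])
  have s: "(\<lambda>p. f p + t * h p) \<in> SF" by (rule SF_add[OF f th])
  have "0 \<le> ip (\<lambda>p. f p + t * h p) (\<lambda>p. f p + t * h p)" by (rule ip_nonneg)
  also have "\<dots> = ip f (\<lambda>p. f p + t * h p) + t * ip h (\<lambda>p. f p + t * h p)"
   using ip_add[OF f th s] ip_cmult by simp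
  also have "ip f (\<lambda>p. f p + t * h p) = ip f f + t * ip f h"
   using ip_add_right[OF f th f] ip_cmult_right[of f t h] by simp
  also have "ip h (\<lambda>p. f p + t * h p) = ip f h + t * ip h h"
   using ip_add_right[OF f th h] ip_cmult_right[of h t h] ip_sym[of h f] by simp
  finally show ?thesis by (simp add: power2_eq_square algebra_simps)
 qed
 show ?thesis
 proof (cases "ip h h = 0")
  case True
  have "ip f h = 0"
  proof (rule ccontr)
   assume nz: "ip f h \<noteq> 0"
   have "0 \<le> ip f f + 2 * (- (ip f f + 1) / (2 * ip f h)) * ip f h"
    using q[of "- (ip f f + 1) / (2 * ip f h)"] True by simp
   with nz show False by (simp add: field_simps)
  qed
  then show ?thesis using True by simp
 next
  case False
  then have pos: "ip h h > 0" using ip_nonneg[of h] by simp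
  have "0 \<le> ip f f + 2 * (- ip f h / ip h h) * ip f h + (- ip f h / ip h h)\<^sup>2 * ip h h" by (rule q)
  also have "\<dots> = ip f f - (ip f h)\<^sup>2 / ip h h" using pos by (simp add: power2_eq_square field_simps)
  finally show ?thesis using pos by (simp add: field_simps)
 qed
qed

lemma ip_zero_imp: assumes "f \<in> SF" "ip f f = 0" shows "f p = 0"
proof -
 have "f p * f p = 0"
  by (rule continuous_integral_zero[OF SF_continuous[OF SF_mult[OF assms(1,1)]]]) (use assms(2) in \<open>auto simp: l2_inner_def\<close>)
 then show ?thesis by simp
qed

lemma SF_lap_pow: "f \<in> SF ==> (\<Delta> ^^ j) f \<in> SF"
 by (induction j) (auto intro: SF_laplacian)

lemma lap_pow_in_chart:
 assumes c: "c \<in> atlas M" and f: "f \<in> SF" and x: "x \<in> im c"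
 shows "(lap (met c) ^^ j) (\<lambda>x. f (param c x)) x = (\<Delta> ^^ j) f (param c x)"
 using x
proof (induction j arbitrary: x)
 case (Suc j)
 have "(lap (met c) ^^ Suc j) (\<lambda>x. f (param c x)) x = lap (met c) (\<lambda>x. (\<Delta> ^^ j) f (param c x)) x"
  using lap_cong[OF open_im[OF c] Suc.prems Suc.IH] by simp
 also have "\<dots> = (\<Delta> ^^ Suc j) f (param c x)"
  using laplacian_in_chart[OF c param_in[OF c Suc.prems] SF_lap_pow[OF f, of j]] Suc.prems by (simp add: coord_param[OF c])
 finally show ?case .
qed simp

lemma sqint_le_ip:
 assumes c: "c \<in> atlas M" and K: "compact K" "K \<subseteq> im c"
 shows "\<exists>D\<ge>0. \<forall>w\<in>SF. sqint K (\<lambda>x. w (param c x)) \<le> D * ip w w"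
proof -
 note m = metric_on_met[OF c]
 have "sqrt (det (met c x)) \<noteq> 0" if "x \<in> im c" for x using metric_det_pos[OF m that] by simp
 then have "smooth_on (im c) (\<lambda>x. inverse (sqrt (det (met c x))))"
  by (rule smooth_on_inverse[OF open_im[OF c] smooth_on_rho[OF m]])
 then obtain D where D: "D \<ge> 0" "!!x. x \<in> K ==> \<bar>inverse (sqrt (det (met c x)))\<bar> \<le> D"
  using smooth_bounded_compact[OF m _ K] by blast
 have "sqint K (\<lambda>x. w (param c x)) \<le> D * ip w w" if w: "w \<in> SF" for w
 proof -
  have wm: "(\<lambda>p. ennreal ((w p)\<^sup>2)) \<in> borel_measurable borel" using SF_measurable[OF w] by measurable
  have int: "integrable lborel (\<lambda>x. indicator K x * (w (param c x))\<^sup>2)"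
   by (rule sqint_integrable[OF K(1) continuous_on_subset[OF smooth_on_continuous_on[OF SF_smooth[OF w c]] K(2)]])
  have "ennreal (sqint K (\<lambda>x. w (param c x))) = (\<integral>\<^sup>+x. ennreal (indicator K x * (w (param c x))\<^sup>2) \<partial>lborel)"
   unfolding sqint_def by (rule nn_integral_eq_integral[symmetric, OF int]) auto
  also have "\<dots> \<le> (\<integral>\<^sup>+x. ennreal D * (ennreal (indicator (im c) x * sqrt (det (met c x))) * ennreal ((w (pm c x))\<^sup>2)) \<partial>lborel)"
  proof (intro nn_integral_mono)
   fix x
   show "ennreal (indicator K x * (w (param c x))\<^sup>2) \<le> ennreal D * (ennreal (indicator (im c) x * sqrt (det (met c x))) * ennreal ((w (pm c x))\<^sup>2))"
   proof (cases "x \<in> K")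
    case True
    then have xi: "x \<in> im c" using K by auto
    have pos: "sqrt (det (met c x)) > 0" using metric_det_pos[OF m xi] by simp
    have "1 \<le> D * sqrt (det (met c x))" using D(2)[OF True] pos by (simp add: field_simps)
    then have "1 * (w (param c x))\<^sup>2 \<le> (D * sqrt (det (met c x))) * (w (param c x))\<^sup>2" by (rule mult_right_mono) simp
    then have "ennreal ((w (param c x))\<^sup>2) \<le> ennreal (D * (sqrt (det (met c x)) * (w (param c x))\<^sup>2))" by (simp add: mult.assoc ennreal_leI)
    then show ?thesis using True xi D(1) pos by (simp add: pm_def ennreal_mult)
   qed simp
  qed
  also have "\<dots> = ennreal D * (\<integral>\<^sup>+x. ennreal (indicator (im c) x * sqrt (det (met c x))) * ennreal ((w (pm c x))\<^sup>2) \<partial>lborel)"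
   using borel_measurable_rho[OF m] measurable_compose[OF pm_measurable[OF c] wm]
   by (intro nn_integral_cmult) auto
  also have "(\<integral>\<^sup>+x. ennreal (indicator (im c) x * sqrt (det (met c x))) * ennreal ((w (pm c x))\<^sup>2) \<partial>lborel) = (\<integral>\<^sup>+x. ennreal ((w (pm c x))\<^sup>2) \<partial>vol (im c) (met c))"
   by (rule nn_integral_vol[OF m, symmetric]) (rule measurable_compose[OF pm_measurable[OF c] wm])
  also have "\<dots> = (\<integral>\<^sup>+p. ennreal ((w p)\<^sup>2) \<partial>nu c)"
   unfolding nu_def by (rule nn_integral_distr[symmetric, OF pm_measurable_vol[OF c]]) (use wm in simp)
  also have "\<dots> = (\<integral>\<^sup>+p. ennreal (indicator (cdom c) p) * ennreal ((w p)\<^sup>2) \<partial>RV)"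
   unfolding density_RV_chart[OF c, symmetric] using wm borel_open[OF open_cdom[OF c]] by (intro nn_integral_density) auto
  also have "\<dots> \<le> (\<integral>\<^sup>+p. ennreal ((w p)\<^sup>2) \<partial>RV)"
   by (intro nn_integral_mono) (auto simp: indicator_def)
  also have "\<dots> = ennreal (ip w w)"
   unfolding l2_inner_def using SF_mult_integrable[OF w w]
   by (subst nn_integral_eq_integral) (auto simp: power2_eq_square)
  finally have "ennreal (sqint K (\<lambda>x. w (param c x))) \<le> ennreal D * ennreal (ip w w)" by (simp add: mult_left_mono)
  then show ?thesis using D(1) ip_nonneg[of w] by (simp add: ennreal_mult[symmetric])
 qed
 with D(1) show ?thesis by blast
qed

definition hnorm2 :: "nat => ('a => real) => real" where
 "hnorm2 m f = (\<Sum>j\<le>m. ip ((\<Delta> ^^ j) f) ((\<Delta> ^^ j) f))"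

lemma hnorm2_nonneg: "0 \<le> hnorm2 m f" unfolding hnorm2_def by (intro sum_nonneg ip_nonneg)

lemma hnorm2_mono: "m \<le> m' ==> hnorm2 m f \<le> hnorm2 m' f"
 unfolding hnorm2_def by (intro sum_mono2) (auto simp: ip_nonneg)

lemma pderiv_le_hnorm2:
 assumes c: "c \<in> atlas M" and K: "compact K" "K \<subseteq> cdom c"
 shows "\<exists>C m. C \<ge> 0 \<and> (\<forall>f\<in>SF. \<forall>p\<in>K. (iter_pderiv is (f \<circ> param c) (coord c p))\<^sup>2 \<le> C * hnorm2 m f)"
proof -
 have K': "compact (coord c ` K)" by (rule compact_continuous_image[OF continuous_on_subset[OF cont_coord[OF c] K(2)] K(1)])
 have K'i: "coord c ` K \<subseteq> im c" using K(2) by (auto simp: im_def)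
 obtain C m L where C: "C \<ge> 0" "compact L" "L \<subseteq> im c" and est: "!!u x. smooth_on (im c) u ==> x \<in> coord c ` K ==>
   (iter_pderiv is u x)\<^sup>2 \<le> C * (\<Sum>j\<le>m. sqint L ((lap (met c) ^^ j) u))"
  using interior_sup_estimate[OF metric_on_met[OF c] K' K'i, of "is"] by (elim exE conjE) (rule that, auto)
 obtain D where D: "D \<ge> 0" "!!w. w \<in> SF ==> sqint L (\<lambda>x. w (param c x)) \<le> D * ip w w"
  using sqint_le_ip[OF c C(2,3)] by blast
 have "(iter_pderiv is (f \<circ> param c) (coord c p))\<^sup>2 \<le> (C * D) * hnorm2 m f" if f: "f \<in> SF" and p: "p \<in> K" for f p
 proof -
  have fs: "smooth_on (im c) (f \<circ> param c)" using SF_smooth[OF f c] by (simp add: o_def)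
  have "(iter_pderiv is (f \<circ> param c) (coord c p))\<^sup>2 \<le> C * (\<Sum>j\<le>m. sqint L ((lap (met c) ^^ j) (f \<circ> param c)))"
   by (rule est[OF fs]) (use p in simp)
  also have "\<dots> \<le> C * (\<Sum>j\<le>m. D * ip ((\<Delta> ^^ j) f) ((\<Delta> ^^ j) f))"
  proof (intro mult_left_mono sum_mono C(1))
   fix j
   have "sqint L ((lap (met c) ^^ j) (f \<circ> param c)) = sqint L (\<lambda>x. (\<Delta> ^^ j) f (param c x))"
    unfolding sqint_def
   proof (rule Bochner_Integration.integral_cong[OF refl])
    fix x
    show "indicator L x * ((lap (met c) ^^ j) (f \<circ> param c) x)\<^sup>2 = indicator L x * ((\<Delta> ^^ j) f (param c x))\<^sup>2"
     using lap_pow_in_chart[OF c f, of x j] C(3) by (cases "x \<in> L") (auto simp: o_def)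
   qed
   then show "sqint L ((lap (met c) ^^ j) (f \<circ> param c)) \<le> D * ip ((\<Delta> ^^ j) f) ((\<Delta> ^^ j) f)"
    using D(2)[OF SF_lap_pow[OF f]] by simp
  qed
  finally show ?thesis by (simp add: hnorm2_def sum_distrib_left mult.assoc)
 qed
 then show ?thesis using C(1) D(1) by (intro exI[of _ "C * D"] exI[of _ m]) simp
qed

text \<open>Elliptic regularity makes every distribution continuous for the norms \<open>hnorm2\<close>.\<close>

lemma distribution_bound:
 assumes u: "u \<in> distributions M"
 shows "\<exists>C m. C \<ge> 0 \<and> (\<forall>f\<in>SF. \<bar>u f\<bar> \<le> C * sqrt (hnorm2 m f))"
proof -
 have "\<exists>\<K> N C. finite \<K> \<and> (\<forall>(c, K)\<in>\<K>. c \<in> atlas M \<and> compact K \<and> K \<subseteq> cdom c) \<and>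
    (\<forall>\<psi>\<in>smooth_functions M. \<forall>B\<ge>0.
      (\<forall>(c, K)\<in>\<K>. \<forall>p\<in>K. \<forall>is. length is \<le> N \<longrightarrow>
        \<bar>iter_pderiv is (\<psi> \<circ> param c) (coord c p)\<bar> \<le> B)
      \<longrightarrow> \<bar>u \<psi>\<bar> \<le> C * B)"
  using u unfolding distributions_def mem_Collect_eq by (elim conjE)
 then obtain \<K> N C0 where fin: "finite \<K>" and K0: "\<forall>(c, K)\<in>\<K>. c \<in> atlas M \<and> compact K \<and> K \<subseteq> cdom c"
  and bd0: "\<forall>\<psi>\<in>smooth_functions M. \<forall>B\<ge>0. (\<forall>(c, K)\<in>\<K>. \<forall>p\<in>K. \<forall>is. length is \<le> N \<longrightarrow>
        \<bar>iter_pderiv is (\<psi> \<circ> param c) (coord c p)\<bar> \<le> B) \<longrightarrow> \<bar>u \<psi>\<bar> \<le> C0 * B"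
  by (elim exE conjE) (rule that)
 have KK: "c \<in> atlas M \<and> compact K \<and> K \<subseteq> cdom c" if "(c, K) \<in> \<K>" for c K using K0 that by auto
 define I where "I = \<K> \<times> {is :: 'n list. set is \<subseteq> UNIV \<and> length is \<le> N}"
 have finI: "finite I" unfolding I_def
  by (intro finite_cartesian_product fin finite_lists_length_le finite)
 have "\<forall>t\<in>I. \<exists>C m. C \<ge> 0 \<and> (\<forall>f\<in>SF. \<forall>p\<in>snd (fst t). (iter_pderiv (snd t) (f \<circ> param (fst (fst t))) (coord (fst (fst t)) p))\<^sup>2 \<le> C * hnorm2 m f)"
 proof
  fix t assume "t \<in> I"
  then have "(fst (fst t), snd (fst t)) \<in> \<K>" by (auto simp: I_def)
  from KK[OF this] show "\<exists>C m. C \<ge> 0 \<and> (\<forall>f\<in>SF. \<forall>p\<in>snd (fst t). (iter_pderiv (snd t) (f \<circ> param (fst (fst t))) (coord (fst (fst t)) p))\<^sup>2 \<le> C * hnorm2 m f)"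
   by (intro pderiv_le_hnorm2) auto
 qed
 then obtain C m where C: "!!t. t \<in> I ==> C t \<ge> 0" and est: "!!t f p. t \<in> I ==> f \<in> SF ==> p \<in> snd (fst t) ==>
   (iter_pderiv (snd t) (f \<circ> param (fst (fst t))) (coord (fst (fst t)) p))\<^sup>2 \<le> C t * hnorm2 (m t) f"
  by metis
 define CC where "CC = (\<Sum>t\<in>I. C t)"
 define mm where "mm = (\<Sum>t\<in>I. m t)"
 have CC: "CC \<ge> 0" unfolding CC_def using C by (simp add: sum_nonneg)
 have "\<bar>u f\<bar> \<le> (\<bar>C0\<bar> * sqrt CC) * sqrt (hnorm2 mm f)" if f: "f \<in> SF" for f
 proof -
  let ?B = "sqrt (CC * hnorm2 mm f)"
  have B: "?B \<ge> 0" using CC hnorm2_nonneg by simp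
  have "\<bar>u f\<bar> \<le> C0 * ?B"
  proof (rule mp[OF bspec[OF bd0 f, THEN spec, THEN mp, OF B]], clarify)
   fix c K p and "is" :: "'n list" assume cK: "(c, K) \<in> \<K>" and p: "p \<in> K" and l: "length is \<le> N"
   let ?t = "((c, K), is)"
   have t: "?t \<in> I" using cK l by (simp add: I_def)
   have "(iter_pderiv is (f \<circ> param c) (coord c p))\<^sup>2 \<le> C ?t * hnorm2 (m ?t) f"
    using est[OF t f] p by simp
   also have "\<dots> \<le> CC * hnorm2 mm f"
   proof (rule mult_mono)
    show "C ?t \<le> CC" unfolding CC_def using t C finI by (intro member_le_sum) auto
    show "hnorm2 (m ?t) f \<le> hnorm2 mm f"
     unfolding mm_def using t finI by (intro hnorm2_mono member_le_sum) auto
   qed (use CC hnorm2_nonneg in auto)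
   finally show "\<bar>iter_pderiv is (f \<circ> param c) (coord c p)\<bar> \<le> ?B"
    using real_le_rsqrt[of "\<bar>iter_pderiv is (f \<circ> param c) (coord c p)\<bar>"] by simp
  qed
  also have "\<dots> \<le> \<bar>C0\<bar> * ?B" using B by (intro mult_right_mono) auto
  finally show ?thesis by (simp add: real_sqrt_mult mult.assoc)
 qed
 then show ?thesis using CC by (intro exI[of _ "\<bar>C0\<bar> * sqrt CC"] exI[of _ mm]) auto
qed

end

locale spectral = closed_manifold M for M :: "('a::t2_space, 'n::finite) riemannian" +
 fixes e :: "nat => 'a => real" and l :: "nat => real"
 assumes basis: "laplace_eigenbasis M e l"
begin

lemma l0: "l 0 = 0" and l1: "0 < l 1" and l_mono: "mono l"
 using basis by (auto simp: laplace_eigenbasis_def)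

lemma l_pos: "0 < k ==> l 1 \<le> l k" "0 < k ==> 0 < l k"
proof -
 assume "0 < k"
 then show "l 1 \<le> l k" using l_mono by (auto simp: mono_def)
 then show "0 < l k" using l1 by simp
qed

lemma l_nonneg: "0 \<le> l k" using l0 l_pos(2)[of k] by (cases "k = 0") auto

lemma e_SF: "e k \<in> SF" using basis by (auto simp: laplace_eigenbasis_def)

lemma laplacian_e: "\<Delta> (e k) p = - l k * e k p"
 using basis unfolding laplace_eigenbasis_def by (metis minus_minus mult_minus_left)

lemma e_orth: "ip (e j) (e k) = (if j = k then 1 else 0)" using basis by (auto simp: laplace_eigenbasis_def)

definition co :: "('a => real) => nat => real" where "co f k = ip f (e k)"

definition ps :: "('a => real) => nat => 'a => real" where "ps f n p = (\<Sum>k<n. co f k * e k p)"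

lemma ps_SF: "ps f n \<in> SF" unfolding ps_def[abs_def] by (intro SF_sum SF_cmult e_SF) auto

lemma co_e: "co (e j) k = (if j = k then 1 else 0)" by (simp add: co_def e_orth)

lemma co_add: "f \<in> SF ==> h \<in> SF ==> co (\<lambda>p. f p + h p) k = co f k + co h k"
 unfolding co_def by (rule ip_add[OF _ _ e_SF])
lemma co_diff: "f \<in> SF ==> h \<in> SF ==> co (\<lambda>p. f p - h p) k = co f k - co h k"
 unfolding co_def by (rule ip_diff[OF _ _ e_SF])
lemma co_cmult: "co (\<lambda>p. c * f p) k = c * co f k" unfolding co_def by (rule ip_cmult)

lemma co_laplacian: assumes "f \<in> SF" shows "co (\<Delta> f) k = - l k * co f k"
proof -
 have "co (\<Delta> f) k = ip f (\<Delta> (e k))" unfolding co_def by (rule l2_laplacian_sym[OF assms e_SF])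
 also have "\<Delta> (e k) = (\<lambda>p. - l k * e k p)" by (rule ext) (rule laplacian_e)
 finally show ?thesis unfolding ip_cmult_right by (simp add: co_def)
qed

lemma ps_converges: assumes f: "f \<in> SF" shows "(\<lambda>n. ip (\<lambda>p. f p - ps f n p) (\<lambda>p. f p - ps f n p)) \<longlonglongrightarrow> 0"
proof -
 have "f \<in> borel_measurable RV" "integrable RV (\<lambda>p. (f p)\<^sup>2)"
  using SF_measurable[OF f] SF_mult_integrable[OF f f] by (simp_all add: power2_eq_square)
 then have "(\<lambda>n. \<integral>p. (f p - (\<Sum>k<n. ip f (e k) * e k p))\<^sup>2 \<partial>RV) \<longlonglongrightarrow> 0"
  using basis unfolding laplace_eigenbasis_def by blast
 then show ?thesis by (simp add: l2_inner_def ps_def co_def power2_eq_square)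
qed

lemma ip_ps: "h \<in> SF ==> ip (ps f n) h = (\<Sum>k<n. co f k * co h k)"
proof -
 assume h: "h \<in> SF"
 have "ip (ps f n) h = (\<Sum>k<n. ip (\<lambda>p. co f k * e k p) h)"
  unfolding ps_def[abs_def] by (rule ip_sum[OF _ SF_cmult[OF e_SF] h]) simp
 then show ?thesis unfolding ip_cmult co_def using ip_sym[of h] by (simp only:)
qed

lemma parseval: assumes f: "f \<in> SF" and h: "h \<in> SF" shows "(\<lambda>k. co f k * co h k) sums ip f h"
proof -
 let ?d = "\<lambda>n p. f p - ps f n p"
 have dS: "?d n \<in> SF" for n by (rule SF_diff[OF f ps_SF])
 have "(\<lambda>n. (ip (?d n) h)\<^sup>2) \<longlonglongrightarrow> 0"
 proof (rule tendsto_sandwich[of "\<lambda>_. 0"])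
  show "\<forall>\<^sub>F n in sequentially. (ip (?d n) h)\<^sup>2 \<le> ip (?d n) (?d n) * ip h h"
   using ip_cauchy_schwarz[OF dS h] by simp
  show "(\<lambda>n. ip (?d n) (?d n) * ip h h) \<longlonglongrightarrow> 0"
   using tendsto_mult_right[OF ps_converges[OF f], of "ip h h"] by simp
 qed auto
 then have "(\<lambda>n. ip (?d n) h) \<longlonglongrightarrow> 0" by simp
 then have "(\<lambda>n. ip f h - ip (?d n) h) \<longlonglongrightarrow> ip f h - 0" by (intro tendsto_intros)
 moreover have "ip f h - ip (?d n) h = (\<Sum>k<n. co f k * co h k)" for n
  using ip_diff[OF f ps_SF h] ip_ps[OF h] by simp
 ultimately show ?thesis by (simp add: sums_def)
qed

lemma co_sq_summable: "f \<in> SF ==> summable (\<lambda>k. (co f k)\<^sup>2)"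
 using parseval[of f f] by (simp add: sums_iff power2_eq_square)

lemma co_sq_suminf: "f \<in> SF ==> (\<Sum>k. (co f k)\<^sup>2) = ip f f"
 using parseval[of f f] by (simp add: sums_iff power2_eq_square)

lemma co_const: "k > 0 ==> co (\<lambda>p. c) k = 0"
proof -
 assume k: "k > 0"
 have "co (\<Delta> (\<lambda>p. c)) k = - l k * co (\<lambda>p. c) k" by (rule co_laplacian[OF SF_const])
 moreover have "\<Delta> (\<lambda>p. c) = (\<lambda>p. 0)" using laplacian_const by auto
 ultimately show ?thesis using l_pos(2)[OF k] by (simp add: co_def l2_inner_def)
qed

definition \<kappa> :: real where "\<kappa> = co (\<lambda>p. 1) 0"

lemma e0_const: "\<kappa> * e 0 p = 1" and kappa_nz: "\<kappa> \<noteq> 0"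
proof -
 let ?d = "\<lambda>p. 1 - \<kappa> * e 0 p"
 have dS: "?d \<in> SF" by (intro SF_diff SF_cmult e_SF SF_const)
 have "ps (\<lambda>p. 1) (Suc n) = (\<lambda>p. \<kappa> * e 0 p)" for n
 proof (rule ext)
  fix p
  have "ps (\<lambda>p. 1) (Suc n) p = (\<Sum>k\<in>{0}. co (\<lambda>p. 1) k * e k p)"
   unfolding ps_def by (rule sum.mono_neutral_right) (use co_const in auto)
  then show "ps (\<lambda>p. 1) (Suc n) p = \<kappa> * e 0 p" by (simp add: \<kappa>_def)
 qed
 then have "(\<lambda>n. ip ?d ?d) \<longlonglongrightarrow> 0"
  using LIMSEQ_Suc[OF ps_converges[OF SF_const[of 1]]] by simp
 then have "ip ?d ?d = 0" by (simp add: LIMSEQ_const_iff)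
 then have "?d p = 0" for p by (rule ip_zero_imp[OF dS])
 then show "\<kappa> * e 0 p = 1" for p by (metis eq_iff_diff_eq_0)
 then show "\<kappa> \<noteq> 0" by (metis mult_zero_left zero_neq_one)
qed

lemma co_zero_eq: "co f 0 = inverse \<kappa> * (\<integral>p. f p \<partial>RV)"
proof -
 have "e 0 = (\<lambda>p. inverse \<kappa>)"
 proof (rule ext)
  show "e 0 p = inverse \<kappa>" for p using e0_const[of p] kappa_nz by (simp add: field_simps)
 qed
 then show ?thesis by (simp add: co_def l2_inner_def mult.commute)
qed

lemma co_lap_pow: "f \<in> SF ==> co ((\<Delta> ^^ j) f) k = (- l k) ^ j * co f k"
 by (induction j) (simp_all add: co_laplacian SF_lap_pow)

lemma ps_lap: "f \<in> SF ==> \<Delta> (ps f n) = ps (\<Delta> f) n"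
proof (rule ext)
 fix p assume f: "f \<in> SF"
 have "\<Delta> (ps f n) p = (\<Sum>k<n. co f k * \<Delta> (e k) p)"
  unfolding ps_def[abs_def] by (subst laplacian_sum) (auto intro!: SF_cmult e_SF simp: laplacian_cmult[OF e_SF])
 then show "\<Delta> (ps f n) p = ps (\<Delta> f) n p" by (simp add: ps_def laplacian_e co_laplacian[OF f] mult_ac)
qed

lemma lap_pow_remainder: "f \<in> SF ==> (\<Delta> ^^ j) (\<lambda>p. f p - ps f n p) = (\<lambda>p. (\<Delta> ^^ j) f p - ps ((\<Delta> ^^ j) f) n p)"
proof (induction j)
 case (Suc j)
 have S: "(\<Delta> ^^ j) f \<in> SF" by (rule SF_lap_pow[OF Suc.prems])
 show ?case
 proof (rule ext)
  fix p
  have "(\<Delta> ^^ Suc j) (\<lambda>p. f p - ps f n p) p = \<Delta> (\<lambda>p. (\<Delta> ^^ j) f p - ps ((\<Delta> ^^ j) f) n p) p"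
   using Suc by simp
  also have "\<dots> = \<Delta> ((\<Delta> ^^ j) f) p - \<Delta> (ps ((\<Delta> ^^ j) f) n) p" by (rule laplacian_diff[OF S ps_SF])
  finally show "(\<Delta> ^^ Suc j) (\<lambda>p. f p - ps f n p) p = (\<Delta> ^^ Suc j) f p - ps ((\<Delta> ^^ Suc j) f) n p"
   by (simp add: ps_lap[OF S])
 qed
qed simp

lemma dist_linear:
 assumes u: "u \<in> distributions M"
 shows "f \<in> SF ==> h \<in> SF ==> u (\<lambda>p. f p + h p) = u f + u h" "f \<in> SF ==> u (\<lambda>p. c * f p) = c * u f"
  "f \<notin> SF ==> u f = 0"
 using u by (auto simp: distributions_def)

lemma dist_diff: assumes u: "u \<in> distributions M" and "f \<in> SF" "h \<in> SF" shows "u (\<lambda>p. f p - h p) = u f - u h"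
 using dist_linear(1)[OF u assms(2) SF_minus[OF assms(3)]] dist_linear(2)[OF u assms(3), of "-1"] by simp

lemma dist_ps: assumes u: "u \<in> distributions M" shows "u (ps f n) = (\<Sum>k<n. co f k * u (e k))"
proof (induction n)
 case 0
 have "u (\<lambda>p. 0 * e 0 p) = 0 * u (e 0)" by (rule dist_linear(2)[OF u e_SF])
 then show ?case by (simp add: ps_def[abs_def])
next
 case (Suc n)
 have "ps f (Suc n) = (\<lambda>p. ps f n p + co f n * e n p)" by (simp add: ps_def fun_eq_iff)
 then show ?case using dist_linear(1)[OF u ps_SF SF_cmult[OF e_SF], of f n "co f n" n] dist_linear(2)[OF u e_SF] Suc by simp
qed

text \<open>Distributions are determined by their Fourier coefficients.\<close>

lemma distribution_expansion:
 assumes u: "u \<in> distributions M" and f: "f \<in> SF"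
 shows "(\<lambda>k. co f k * u (e k)) sums u f"
proof -
 obtain C m where C: "C \<ge> 0" "!!f. f \<in> SF ==> \<bar>u f\<bar> \<le> C * sqrt (hnorm2 m f)" using distribution_bound[OF u] by blast
 let ?d = "\<lambda>n p. f p - ps f n p"
 have dS: "?d n \<in> SF" for n by (rule SF_diff[OF f ps_SF])
 have "(\<lambda>n. hnorm2 m (?d n)) \<longlonglongrightarrow> (\<Sum>j\<le>m. 0)"
  unfolding hnorm2_def lap_pow_remainder[OF f] by (intro tendsto_sum ps_converges SF_lap_pow f)
 then have "(\<lambda>n. C * sqrt (hnorm2 m (?d n))) \<longlonglongrightarrow> C * sqrt 0" by (intro tendsto_intros) simp
 then have "(\<lambda>n. u (?d n)) \<longlonglongrightarrow> 0"
  by (intro Lim_null_comparison[of "\<lambda>n. u (?d n)" "\<lambda>n. C * sqrt (hnorm2 m (?d n))"]) (use C(2)[OF dS] in auto)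
 then have "(\<lambda>n. u f - u (?d n)) \<longlonglongrightarrow> u f - 0" by (intro tendsto_intros)
 moreover have "u f - u (?d n) = (\<Sum>k<n. co f k * u (e k))" for n
  using dist_diff[OF u f ps_SF] dist_ps[OF u] by simp
 ultimately show ?thesis by (simp add: sums_def)
qed

end

lemma l2_seq_product:
 fixes a b :: "nat => real"
 assumes a: "summable (\<lambda>k. (a k)\<^sup>2)" and b: "summable (\<lambda>k. (b k)\<^sup>2)"
 shows "summable (\<lambda>k. \<bar>a k * b k\<bar>)" "summable (\<lambda>k. a k * b k)"
  "\<bar>\<Sum>k. a k * b k\<bar> \<le> sqrt (\<Sum>k. (a k)\<^sup>2) * sqrt (\<Sum>k. (b k)\<^sup>2)"
proof -
 have le: "\<bar>a k * b k\<bar> \<le> (a k)\<^sup>2 + (b k)\<^sup>2" for k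
 proof -
  have "0 \<le> (\<bar>a k\<bar> - \<bar>b k\<bar>)\<^sup>2" "0 \<le> (a k)\<^sup>2 + (b k)\<^sup>2" by simp_all
  moreover have "0 \<le> \<bar>a k\<bar> * \<bar>b k\<bar>" by simp
  ultimately show ?thesis unfolding power2_diff power2_abs abs_mult by linarith
 qed
 show s: "summable (\<lambda>k. \<bar>a k * b k\<bar>)"
  by (rule summable_comparison_test[OF _ summable_add[OF a b]]) (use le in auto)
 then show s': "summable (\<lambda>k. a k * b k)" by (rule summable_rabs_cancel)
 have "(\<Sum>k<n. a k * b k)\<^sup>2 \<le> (\<Sum>k. (a k)\<^sup>2) * (\<Sum>k. (b k)\<^sup>2)" for n
 proof -
  have "(\<Sum>k<n. a k * b k)\<^sup>2 \<le> (\<Sum>k<n. (a k)\<^sup>2) * (\<Sum>k<n. (b k)\<^sup>2)" by (rule Cauchy_Schwarz_ineq_sum)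
  also have "\<dots> \<le> (\<Sum>k. (a k)\<^sup>2) * (\<Sum>k. (b k)\<^sup>2)"
   by (intro mult_mono sum_le_suminf a b suminf_nonneg sum_nonneg) auto
  finally show ?thesis .
 qed
 moreover have "(\<lambda>n. (\<Sum>k<n. a k * b k)\<^sup>2) \<longlonglongrightarrow> (\<Sum>k. a k * b k)\<^sup>2"
  by (intro tendsto_power summable_LIMSEQ s')
 ultimately have "(\<Sum>k. a k * b k)\<^sup>2 \<le> (\<Sum>k. (a k)\<^sup>2) * (\<Sum>k. (b k)\<^sup>2)"
  by (intro LIMSEQ_le_const2) auto
 then show "\<bar>\<Sum>k. a k * b k\<bar> \<le> sqrt (\<Sum>k. (a k)\<^sup>2) * sqrt (\<Sum>k. (b k)\<^sup>2)"
  by (simp add: real_sqrt_mult[symmetric] real_le_rsqrt)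
qed

lemma (in closed_manifold) compact_chart_cover:
 "\<exists>\<K>. finite \<K> \<and> (\<forall>(c, K)\<in>\<K>. c \<in> atlas M \<and> compact K \<and> K \<subseteq> cdom c) \<and> (\<forall>p. \<exists>(c, K)\<in>\<K>. p \<in> K)"
proof -
 have "\<exists>c K W. c \<in> atlas M \<and> compact K \<and> K \<subseteq> cdom c \<and> open W \<and> p \<in> W \<and> W \<subseteq> K" for p
 proof -
  obtain c where c: "c \<in> atlas M" "p \<in> cdom c" by (rule chart_cover)
  obtain r where r: "r > 0" "cball (coord c p) r \<subseteq> im c"
   using open_im[OF c(1)] coord_in[OF c] by (meson open_contains_cball)
  let ?K = "param c ` cball (coord c p) r"
  let ?W = "cdom c \<inter> coord c -` ball (coord c p) r"
  have "compact ?K" by (rule compact_continuous_image[OF continuous_on_subset[OF cont_param[OF c(1)] r(2)] compact_cball])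
  moreover have "?K \<subseteq> cdom c" using r(2) param_in[OF c(1)] by auto
  moreover have "open ?W" using continuous_on_open_vimage[OF open_cdom[OF c(1)]] cont_coord[OF c(1)] open_ball by (metis Int_commute)
  moreover have "p \<in> ?W" using c r by simp
  moreover have "?W \<subseteq> ?K"
  proof
   fix q assume "q \<in> ?W"
   then have "q \<in> cdom c" "coord c q \<in> cball (coord c p) r" by auto
   then show "q \<in> ?K" by (intro image_eqI[of _ _ "coord c q"]) (simp_all add: param_coord[OF c(1)])
  qed
  ultimately show ?thesis using c(1) by blast
 qed
 then obtain c K W where cKW: "!!p. c p \<in> atlas M \<and> compact (K p) \<and> K p \<subseteq> cdom (c p) \<and> open (W p) \<and> p \<in> W p \<and> W p \<subseteq> K p"
  by metis
 have opW: "open (W p)" if "p \<in> UNIV" for p using cKW by blast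
 have cov: "UNIV \<subseteq> (\<Union>p\<in>UNIV. W p)" using cKW by blast
 obtain D where "D \<subseteq> UNIV" and D: "finite D" "UNIV \<subseteq> (\<Union>p\<in>D. W p)"
  by (rule compactE_image[OF compact_M opW cov]) (assumption, rule that)
 have "\<exists>(c, K)\<in>(\<lambda>p. (c p, K p)) ` D. q \<in> K" for q
 proof -
  obtain p where "p \<in> D" "q \<in> W p" using D(2) by blast
  then show ?thesis using cKW[of p] by auto
 qed
 then show ?thesis using D(1) cKW by (intro exI[of _ "(\<lambda>p. (c p, K p)) ` D"]) auto
qed

context spectral
begin

definition ser :: "(nat => real) => ('a => real) => real" where
 "ser u = (\<lambda>\<psi>. if \<psi> \<in> SF then (\<Sum>k. u k * co \<psi> k) else 0)"

lemma ser_e: "ser u (e j) = u j"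
proof -
 have "(\<Sum>k. u k * co (e j) k) = (\<Sum>k\<in>{j}. u k * co (e j) k)" by (rule suminf_finite) (auto simp: co_e)
 then show ?thesis by (simp add: ser_def e_SF co_e)
qed

lemma ser_distribution:
 assumes u: "summable (\<lambda>k. (u k)\<^sup>2)" shows "ser u \<in> distributions M"
proof -
 have s: "summable (\<lambda>k. u k * co \<psi> k)" if "\<psi> \<in> SF" for \<psi> by (rule l2_seq_product(2)[OF u co_sq_summable[OF that]])
 have add: "ser u (\<lambda>p. \<psi> p + \<eta> p) = ser u \<psi> + ser u \<eta>" if "\<psi> \<in> SF" "\<eta> \<in> SF" for \<psi> \<eta>
  using that suminf_add[OF s[OF that(1)] s[OF that(2)]] by (simp add: ser_def SF_add co_add distrib_left)
 have cm: "ser u (\<lambda>p. a * \<psi> p) = a * ser u \<psi>" if "\<psi> \<in> SF" for a \<psi>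
  using that suminf_mult[OF s[OF that], of a] by (simp add: ser_def SF_cmult co_cmult mult.left_commute)
 obtain \<K> where K: "finite \<K>" "\<forall>(c, K)\<in>\<K>. c \<in> atlas M \<and> compact K \<and> K \<subseteq> cdom c" "\<forall>p. \<exists>(c, K)\<in>\<K>. p \<in> K"
  using compact_chart_cover by blast
 let ?C = "sqrt (\<Sum>k. (u k)\<^sup>2) * sqrt (measure RV UNIV)"
 have bd: "\<bar>ser u \<psi>\<bar> \<le> ?C * B" if psi: "\<psi> \<in> SF" and B: "B \<ge> 0"
  and h: "\<forall>(c, K)\<in>\<K>. \<forall>p\<in>K. \<forall>is. length is \<le> 0 \<longrightarrow> \<bar>iter_pderiv is (\<psi> \<circ> param c) (coord c p)\<bar> \<le> B" for \<psi> B
 proof -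
  have pB: "\<bar>\<psi> p\<bar> \<le> B" for p
  proof -
   obtain c K where cK: "(c, K) \<in> \<K>" "p \<in> K" using K(3) by blast
   then have "c \<in> atlas M" "p \<in> cdom c" using K(2) by auto
   moreover have "\<bar>iter_pderiv [] (\<psi> \<circ> param c) (coord c p)\<bar> \<le> B" using h cK by fastforce
   ultimately show ?thesis by (simp add: param_coord)
  qed
  have "ip \<psi> \<psi> \<le> (\<integral>p. B * B \<partial>RV)" unfolding l2_inner_def
  proof (rule integral_mono[OF SF_mult_integrable[OF psi psi]])
   show "integrable RV (\<lambda>p. B * B)" by simp
   show "\<psi> p * \<psi> p \<le> B * B" for p using abs_le_square_iff[of "\<psi> p" B] pB[of p] B by (simp add: power2_eq_square)
  qed
  then have "ip \<psi> \<psi> \<le> measure RV UNIV * B\<^sup>2" by (simp add: power2_eq_square)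
  then have "sqrt (ip \<psi> \<psi>) \<le> sqrt (measure RV UNIV) * B"
   using B real_sqrt_le_mono[of "ip \<psi> \<psi>" "measure RV UNIV * B\<^sup>2"] by (simp add: real_sqrt_mult)
  moreover have "\<bar>ser u \<psi>\<bar> \<le> sqrt (\<Sum>k. (u k)\<^sup>2) * sqrt (ip \<psi> \<psi>)"
   using l2_seq_product(3)[OF u co_sq_summable[OF psi]] psi by (simp add: ser_def co_sq_suminf)
  moreover have "0 \<le> sqrt (\<Sum>k. (u k)\<^sup>2)" using u by (simp add: suminf_nonneg)
  ultimately have "\<bar>ser u \<psi>\<bar> \<le> sqrt (\<Sum>k. (u k)\<^sup>2) * (sqrt (measure RV UNIV) * B)"
   using mult_left_mono order_trans by blast
  then show ?thesis by (simp only: mult.assoc)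
 qed
 have bd': "\<exists>\<K> N C. finite \<K> \<and> (\<forall>(c, K)\<in>\<K>. c \<in> atlas M \<and> compact K \<and> K \<subseteq> cdom c) \<and>
    (\<forall>\<psi>\<in>smooth_functions M. \<forall>B\<ge>0.
      (\<forall>(c, K)\<in>\<K>. \<forall>p\<in>K. \<forall>is. length is \<le> N \<longrightarrow>
        \<bar>iter_pderiv is (\<psi> \<circ> param c) (coord c p)\<bar> \<le> B)
      \<longrightarrow> \<bar>ser u \<psi>\<bar> \<le> C * B)"
  by (rule exI[of _ \<K>], rule exI[of _ 0], rule exI[of _ ?C]) (intro conjI K(1,2) ballI allI impI, rule bd, assumption+)
 show ?thesis unfolding distributions_def mem_Collect_eq
  by (intro conjI bd' allI ballI impI add cm) (simp add: ser_def)
qed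

lemma dist_of_ser: "f \<in> SF ==> dist_of M f = ser (co f)"
 using parseval by (auto simp: dist_of_def ser_def fun_eq_iff sums_iff)

lemma dist_of_distribution: "f \<in> SF ==> dist_of M f \<in> distributions M"
 unfolding dist_of_ser by (rule ser_distribution[OF co_sq_summable])

lemma dist_of_e: "f \<in> SF ==> dist_of M f (e k) = co f k" by (simp add: dist_of_ser ser_e)

lemma dist_at_one: assumes "u \<in> distributions M" shows "u (\<lambda>p. 1) = \<kappa> * u (e 0)"
proof -
 have "(\<lambda>p. 1) = (\<lambda>p. \<kappa> * e 0 p)" by (rule ext) (simp only: e0_const)
 then show ?thesis using dist_linear(2)[OF assms e_SF, of \<kappa> 0] by simp
qed

lemma mean_zero_iff: "u \<in> distributions M ==> mean_zero u \<longleftrightarrow> u (e 0) = 0"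
 using kappa_nz by (simp add: mean_zero_def dist_at_one)

lemma frac_laplacian_e: "frac_laplacian M e l r u (e j) = l j powr r * u (e j)"
proof -
 have "(\<Sum>k. l k powr r * u (e k) * ip (e k) (e j)) = (\<Sum>k\<in>{j}. l k powr r * u (e k) * ip (e k) (e j))"
  by (rule suminf_finite) (auto simp: e_orth)
 then show ?thesis by (simp add: frac_laplacian_def e_SF e_orth)
qed

lemma neg_laplacian_eq_frac:
 assumes u: "u \<in> distributions M" shows "neg_laplacian_dist M u = frac_laplacian M e l 1 u"
proof (rule ext)
 fix \<psi>
 show "neg_laplacian_dist M u \<psi> = frac_laplacian M e l 1 u \<psi>"
 proof (cases "\<psi> \<in> SF")
  case True
  have "(\<lambda>k. co (\<lambda>p. - \<Delta> \<psi> p) k * u (e k)) sums u (\<lambda>p. - \<Delta> \<psi> p)"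
   by (rule distribution_expansion[OF u SF_minus[OF SF_laplacian[OF True]]])
  moreover have "co (\<lambda>p. - \<Delta> \<psi> p) k = l k * co \<psi> k" for k
   using co_cmult[of "-1" "\<Delta> \<psi>" k] co_laplacian[OF True, of k] by simp
  ultimately show ?thesis using True l_nonneg
   by (simp add: neg_laplacian_dist_def frac_laplacian_def sums_iff co_def ip_sym[of \<psi>] mult_ac)
 qed (simp add: neg_laplacian_dist_def frac_laplacian_def)
qed

definition sol :: "real => 'a functional => nat => real" where "sol r f k = l k powr (- r) * f (e k)"

lemma sol_summable:
 assumes r: "r > 0" and f: "f \<in> sobolev M e l (- r)"
 shows "summable (\<lambda>k. (1 + l k) powr r * \<bar>sol r f k\<bar>\<^sup>2)" "summable (\<lambda>k. (sol r f k)\<^sup>2)"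
proof -
 let ?B = "(1 + l 1) / l 1"
 have sf: "summable (\<lambda>k. ?B powr (2 * r) * ((1 + l k) powr (- r) * \<bar>f (e k)\<bar>\<^sup>2))"
  using f by (intro summable_mult) (simp add: sobolev_def)
 have le: "(1 + l k) powr r * \<bar>sol r f k\<bar>\<^sup>2 \<le> ?B powr (2 * r) * ((1 + l k) powr (- r) * \<bar>f (e k)\<bar>\<^sup>2)" for k
 proof (cases "k = 0")
  case True then show ?thesis by (simp add: sol_def l0)
 next
  case False
  then have lk: "0 < l k" "l 1 \<le> l k" using l_pos by auto
  have "(1 + l k) / l k \<le> ?B" using lk l1 by (simp add: field_simps)
  then have "((1 + l k) / l k) powr (2 * r) \<le> ?B powr (2 * r)" using lk r by (intro powr_mono2) auto
  moreover have "((1 + l k) / l k) powr (2 * r) = (1 + l k) powr r * (1 + l k) powr r * (l k powr (- r))\<^sup>2"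
  proof -
   have "((1 + l k) / l k) powr r = (1 + l k) powr r * l k powr (- r)"
    unfolding powr_divide powr_minus by (rule divide_inverse)
   then show ?thesis unfolding mult_2 powr_add power2_eq_square by (simp only: mult_ac)
  qed
  moreover have "(1 + l k) powr r * (1 + l k) powr (- r) = 1" using lk by (simp add: powr_add[symmetric])
  ultimately have "(1 + l k) powr r * (l k powr (- r))\<^sup>2 \<le> ?B powr (2 * r) * (1 + l k) powr (- r)"
  proof -
   have "(1 + l k) powr r * (l k powr (- r))\<^sup>2 = ((1 + l k) / l k) powr (2 * r) * (1 + l k) powr (- r)"
    using \<open>((1 + l k) / l k) powr (2 * r) = _\<close> \<open>(1 + l k) powr r * (1 + l k) powr (- r) = 1\<close>
    by (simp add: mult_ac)
   also have "\<dots> \<le> ?B powr (2 * r) * (1 + l k) powr (- r)"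
    by (rule mult_right_mono[OF \<open>((1 + l k) / l k) powr (2 * r) \<le> _\<close>]) simp
   finally show ?thesis .
  qed
  then have "((1 + l k) powr r * (l k powr (- r))\<^sup>2) * \<bar>f (e k)\<bar>\<^sup>2 \<le> (?B powr (2 * r) * (1 + l k) powr (- r)) * \<bar>f (e k)\<bar>\<^sup>2"
   by (rule mult_right_mono) simp
  then show ?thesis by (simp add: sol_def power_mult_distrib mult.assoc)
 qed
 show 1: "summable (\<lambda>k. (1 + l k) powr r * \<bar>sol r f k\<bar>\<^sup>2)"
  by (rule summable_comparison_test[OF _ sf]) (use le in auto)
 have "(sol r f k)\<^sup>2 \<le> (1 + l k) powr r * \<bar>sol r f k\<bar>\<^sup>2" for k
  using mult_right_mono[of 1 "(1 + l k) powr r" "(sol r f k)\<^sup>2"] l_nonneg[of k] r by (simp add: ge_one_powr_ge_zero)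
 then show "summable (\<lambda>k. (sol r f k)\<^sup>2)"
  by (intro summable_comparison_test[OF _ 1]) auto
qed

lemma frac_source_solution:
 assumes r: "r > 0" and f: "f \<in> sobolev M e l (- r)" "mean_zero f"
 shows "(THE u. u \<in> sobolev M e l r \<and> frac_laplacian M e l r u = f \<and> mean_zero u) = ser (sol r f)"
proof -
 have fd: "f \<in> distributions M" using f by (simp add: sobolev_def)
 have f0: "f (e 0) = 0" using f(2) mean_zero_iff[OF fd] by simp
 have sd: "ser (sol r f) \<in> distributions M" by (rule ser_distribution[OF sol_summable(2)[OF r f(1)]])
 show ?thesis
 proof (rule the_equality, intro conjI)
  show "ser (sol r f) \<in> sobolev M e l r" using sd sol_summable(1)[OF r f(1)] by (simp add: sobolev_def ser_e)
  show "mean_zero (ser (sol r f))" using mean_zero_iff[OF sd] by (simp add: ser_e sol_def l0)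
  show "frac_laplacian M e l r (ser (sol r f)) = f"
  proof (rule ext)
   fix \<psi>
   show "frac_laplacian M e l r (ser (sol r f)) \<psi> = f \<psi>"
   proof (cases "\<psi> \<in> SF")
    case True
    have "l k powr r * ser (sol r f) (e k) * ip (e k) \<psi> = co \<psi> k * f (e k)" for k
    proof (cases "k = 0")
     case False
     then have "l k powr r * l k powr (- r) = 1" using l_pos(2)[of k] by (simp add: powr_add[symmetric])
     then show ?thesis by (simp add: ser_e sol_def co_def ip_sym[of \<psi>] mult.assoc[symmetric])
    qed (simp add: f0 ser_e sol_def l0)
    then show ?thesis using distribution_expansion[OF fd True] True by (simp add: frac_laplacian_def sums_iff)
   next
    case False
    then show ?thesis using dist_linear(3)[OF fd] by (simp add: frac_laplacian_def)
   qed
  qed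
 next
  fix u assume u: "u \<in> sobolev M e l r \<and> frac_laplacian M e l r u = f \<and> mean_zero u"
  then have ud: "u \<in> distributions M" by (simp add: sobolev_def)
  have uk: "u (e k) = sol r f k" for k
  proof (cases "k = 0")
   case True then show ?thesis using u mean_zero_iff[OF ud] by (simp add: sol_def l0)
  next
   case False
   have "f (e k) = l k powr r * u (e k)" using u frac_laplacian_e[of r u k] by simp
   moreover have "l k powr (- r) * l k powr r = 1" using False l_pos(2)[of k] by (simp add: powr_add[symmetric])
   ultimately show ?thesis by (simp add: sol_def mult.assoc[symmetric])
  qed
  show "u = ser (sol r f)"
  proof (rule ext)
   fix \<psi>
   show "u \<psi> = ser (sol r f) \<psi>"
   proof (cases "\<psi> \<in> SF")
    case True
    then show ?thesis using distribution_expansion[OF ud True] by (simp add: ser_def uk sums_iff mult.commute)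
   next
    case False
    then show ?thesis using dist_linear(3)[OF ud] by (simp add: ser_def)
   qed
  qed
 qed
qed

lemma frac_source_to_solution_eq:
 assumes "r > 0" "f \<in> sobolev M e l (- r)" "mean_zero f"
 shows "frac_source_to_solution M e l r S f = restrict_dist M S (ser (sol r f))"
 by (simp add: frac_source_to_solution_def frac_source_solution[OF assms])

lemma local_source_to_solution_eq:
 assumes "f \<in> sobolev M e l (-1)" "mean_zero f"
 shows "local_source_to_solution M e l S f = restrict_dist M S (ser (sol 1 f))"
proof -
 have "(v \<in> sobolev M e l 1 \<and> neg_laplacian_dist M v = f \<and> mean_zero v) \<longleftrightarrow>
  (v \<in> sobolev M e l 1 \<and> frac_laplacian M e l 1 v = f \<and> mean_zero v)" for v
  using neg_laplacian_eq_frac[of v] by (auto simp: sobolev_def)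
 then show ?thesis using frac_source_solution[of 1 f] assms by (simp add: local_source_to_solution_def)
qed

lemma dist_of_sobolev: assumes "f \<in> SF" "r \<ge> 0" shows "dist_of M f \<in> sobolev M e l (- r)"
proof -
 have "(1 + l k) powr (- r) * \<bar>co f k\<bar>\<^sup>2 \<le> (co f k)\<^sup>2" for k
 proof -
  have "(1 + l k) powr (- r) \<le> 1"
   using ge_one_powr_ge_zero[of "1 + l k" r] l_nonneg[of k] assms(2) by (simp add: powr_minus inverse_le_1_iff)
  then show ?thesis using mult_right_mono[of "(1 + l k) powr (- r)" 1 "(co f k)\<^sup>2"] by simp
 qed
 then have "summable (\<lambda>k. (1 + l k) powr (- r) * \<bar>co f k\<bar>\<^sup>2)"
  by (intro summable_comparison_test[OF _ co_sq_summable[OF assms(1)]]) auto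
 then show ?thesis using assms(1) by (simp add: sobolev_def dist_of_distribution dist_of_e)
qed

lemma sobolev_tendsto_const: "sobolev_tendsto M e l r (\<lambda>m. f) (dist_of M f)"
 by (simp add: sobolev_tendsto_def sobolev_norm_def)

lemma dist_of_sobolev_tilde: "f \<in> TF S ==> r \<ge> 0 ==> dist_of M f \<in> sobolev_tilde M e l (- r) S"
 unfolding sobolev_tilde_def using dist_of_sobolev[OF TF_SF] sobolev_tendsto_const
 by (intro CollectI conjI exI[of _ "\<lambda>m. f"]) auto

lemma mean_zero_dist_of: "f \<in> SF ==> mean_zero (dist_of M f) \<longleftrightarrow> co f 0 = 0"
 by (simp add: mean_zero_iff dist_of_distribution dist_of_e)

text \<open>The inverse of the eigenvalues gains two orders, which dominates the weight of the norm of order \<open>- 1\<close>.\<close>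

lemma sobolev_limit:
 assumes f: "f \<in> sobolev M e l (-1)" and h: "!!m. h m \<in> SF" and lim: "sobolev_tendsto M e l (-1) h f"
 shows "(\<lambda>m. co (h m) 0) \<longlonglongrightarrow> f (e 0)"
  "\<psi> \<in> SF ==> (\<lambda>m. \<Sum>k. l k powr (-1) * co (h m) k * co \<psi> k) \<longlonglongrightarrow> (\<Sum>k. sol 1 f k * co \<psi> k)"
proof -
 define d where "d m k = f (e k) - co (h m) k" for m k
 define N where "N m = sqrt (\<Sum>k. (1 + l k) powr (-1) * (d m k)\<^sup>2)" for m
 have Nlim: "N \<longlonglongrightarrow> 0"
  using lim by (simp add: sobolev_tendsto_def sobolev_norm_def N_def[abs_def] d_def dist_of_e[OF h])
 have sum_f: "summable (\<lambda>k. (1 + l k) powr (-1) * (f (e k))\<^sup>2)" using f by (simp add: sobolev_def)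
 have sum_h: "summable (\<lambda>k. (1 + l k) powr (-1) * (co (h m) k)\<^sup>2)" for m
  using dist_of_sobolev[OF h, of 1 m] by (simp add: sobolev_def dist_of_e[OF h])
 have sum_d: "summable (\<lambda>k. (1 + l k) powr (-1) * (d m k)\<^sup>2)" for m
 proof (rule summable_comparison_test[OF _ summable_add[OF summable_mult[OF sum_f, of 2] summable_mult[OF sum_h[of m], of 2]]])
  have "(d m k)\<^sup>2 \<le> 2 * (f (e k))\<^sup>2 + 2 * (co (h m) k)\<^sup>2" for k
   using zero_le_power2[of "f (e k) + co (h m) k"] unfolding d_def power2_diff power2_sum by simp
  then have "(1 + l k) powr (-1) * (d m k)\<^sup>2 \<le> (1 + l k) powr (-1) * (2 * (f (e k))\<^sup>2 + 2 * (co (h m) k)\<^sup>2)" for k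
   by (rule mult_left_mono) simp
  then show "\<exists>N. \<forall>n\<ge>N. norm ((1 + l n) powr - 1 * (d m n)\<^sup>2) \<le> 2 * ((1 + l n) powr - 1 * (f (e n))\<^sup>2) + 2 * ((1 + l n) powr - 1 * (co (h m) n)\<^sup>2)"
   by (intro exI[of _ 0]) (simp add: distrib_left mult_ac)
 qed
 have Nnn: "N m \<ge> 0" for m unfolding N_def by (intro real_sqrt_ge_zero suminf_nonneg sum_d) simp
 have N2: "(N m)\<^sup>2 = (\<Sum>k. (1 + l k) powr (-1) * (d m k)\<^sup>2)" for m
  unfolding N_def by (intro real_sqrt_pow2 suminf_nonneg sum_d) simp
 have "\<bar>d m 0\<bar> \<le> N m" for m
 proof -
  have "(\<Sum>k\<in>{0}. (1 + l k) powr (-1) * (d m k)\<^sup>2) \<le> (N m)\<^sup>2"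
   unfolding N2 by (rule sum_le_suminf[OF sum_d]) auto
  then have "(d m 0)\<^sup>2 \<le> (N m)\<^sup>2" by (simp add: l0)
  then show ?thesis using Nnn[of m] abs_le_square_iff[of "d m 0" "N m"] by simp
 qed
 then have "(\<lambda>m. d m 0) \<longlonglongrightarrow> 0" by (intro Lim_null_comparison[OF _ Nlim]) auto
 then have "(\<lambda>m. f (e 0) - d m 0) \<longlonglongrightarrow> f (e 0) - 0" by (intro tendsto_intros)
 then show "(\<lambda>m. co (h m) 0) \<longlonglongrightarrow> f (e 0)" by (simp add: d_def)
 assume psi: "\<psi> \<in> SF"
 define b where "b k = sqrt (1 + l k) * (l k powr (-1) * co \<psi> k)" for k
 define a where "a m k = d m k / sqrt (1 + l k)" for m k
 have pos: "1 + l k > 0" for k using l_nonneg[of k] by simp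
 have ab: "a m k * b k = l k powr (-1) * d m k * co \<psi> k" for m k using pos[of k] by (simp add: a_def b_def)
 have a2: "(a m k)\<^sup>2 = (1 + l k) powr (-1) * (d m k)\<^sup>2" for m k
  unfolding a_def power_divide real_sqrt_pow2[OF less_imp_le[OF pos]] powr_minus
  using pos[of k] by (simp add: divide_inverse mult.commute)
 have sb: "summable (\<lambda>k. (b k)\<^sup>2)"
 proof (rule summable_comparison_test[OF _ summable_mult[OF co_sq_summable[OF psi], of "(1 + l 1) / l 1 * (1 / l 1)"]])
  have "(b k)\<^sup>2 \<le> (1 + l 1) / l 1 * (1 / l 1) * (co \<psi> k)\<^sup>2" for k
  proof (cases "k = 0")
   case True then show ?thesis using l1 by (simp add: b_def l0)
  next
   case False
   then have lk: "0 < l k" "l 1 \<le> l k" using l_pos by auto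
   have "(b k)\<^sup>2 = ((1 + l k) / l k * (1 / l k)) * (co \<psi> k)\<^sup>2"
    unfolding b_def power_mult_distrib real_sqrt_pow2[OF less_imp_le[OF pos]] powr_minus
    using lk by (simp add: power2_eq_square divide_inverse)
   also have "\<dots> \<le> ((1 + l 1) / l 1 * (1 / l 1)) * (co \<psi> k)\<^sup>2"
   proof (rule mult_right_mono[OF mult_mono])
    show "(1 + l k) / l k \<le> (1 + l 1) / l 1" using lk l1 by (simp add: field_simps)
    show "1 / l k \<le> 1 / l 1" using lk l1 by (simp add: field_simps)
   qed (use lk l1 in auto)
   finally show ?thesis .
  qed
  then show "\<exists>N. \<forall>n\<ge>N. norm ((b n)\<^sup>2) \<le> (1 + l 1) / l 1 * (1 / l 1) * (co \<psi> n)\<^sup>2" by simp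
 qed
 have sa: "summable (\<lambda>k. (a m k)\<^sup>2)" for m unfolding a2 by (rule sum_d)
 define A where "A m = (\<Sum>k. l k powr (-1) * d m k * co \<psi> k)" for m
 define B where "B = sqrt (\<Sum>k. (b k)\<^sup>2)"
 define X where "X = (\<Sum>k. sol 1 f k * co \<psi> k)"
 have bound: "\<bar>A m\<bar> \<le> N m * B" for m
  using l2_seq_product(3)[OF sa sb, of m] unfolding ab a2 by (simp add: N_def A_def B_def)
 have "(\<lambda>m. N m * B) \<longlonglongrightarrow> 0 * B" by (rule tendsto_mult_right[OF Nlim])
 then have Nl: "(\<lambda>m. N m * B) \<longlonglongrightarrow> 0" by simp
 have "A \<longlonglongrightarrow> 0" by (rule Lim_null_comparison[OF _ Nl]) (simp add: bound)
 then have "(\<lambda>m. X - A m) \<longlonglongrightarrow> X - 0" by (rule tendsto_diff[OF tendsto_const])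
 moreover have "X - A m = (\<Sum>k. l k powr (-1) * co (h m) k * co \<psi> k)" for m
 proof -
  have s1: "summable (\<lambda>k. sol 1 f k * co \<psi> k)"
   by (rule l2_seq_product(2)[OF sol_summable(2)[OF zero_less_one f] co_sq_summable[OF psi]])
  have s2: "summable (\<lambda>k. l k powr (-1) * d m k * co \<psi> k)" using l2_seq_product(2)[OF sa sb, of m] unfolding ab .
  have e: "sol 1 f k * co \<psi> k - l k powr (-1) * d m k * co \<psi> k = l k powr (-1) * co (h m) k * co \<psi> k" for k
   by (simp add: sol_def d_def left_diff_distrib right_diff_distrib)
  show ?thesis unfolding X_def A_def suminf_diff[OF s1 s2] e ..
 qed
 ultimately show "(\<lambda>m. \<Sum>k. l k powr (-1) * co (h m) k * co \<psi> k) \<longlonglongrightarrow> (\<Sum>k. sol 1 f k * co \<psi> k)"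
  by (simp add: X_def)
qed

end

section \<open>Finite propagation speed\<close>

context spectral
begin

abbreviation "comb n x \<equiv> (\<lambda>p. \<Sum>k<n. x k * e k p)"

lemma comb_SF: "comb n x \<in> SF" by (intro SF_sum SF_cmult e_SF) auto

text \<open>Symmetric bilinear forms on smooth functions along a path in the span of the eigenfunctions.\<close>

lemma DERIV_bilinear_comb:
 assumes add: "!!f g h. f \<in> SF ==> g \<in> SF ==> h \<in> SF ==> \<beta> (\<lambda>p. f p + g p) h = \<beta> f h + \<beta> g h"
  and cm: "!!c f h. f \<in> SF ==> h \<in> SF ==> \<beta> (\<lambda>p. c * f p) h = c * \<beta> f h"
  and sym: "!!f h. \<beta> f h = \<beta> h f"
  and d: "!!k. ((\<lambda>t. b t k) has_real_derivative b' t k) (at t)"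
 shows "((\<lambda>t. \<beta> (comb n (b t)) (comb n (b t))) has_real_derivative 2 * \<beta> (comb n (b t)) (comb n (b' t))) (at t)"
proof -
 have left: "\<beta> (comb n x) h = (\<Sum>k<n. x k * \<beta> (e k) h)" if h: "h \<in> SF" for x h
 proof (induction n)
  case 0
  have "\<beta> (\<lambda>p. 0 * e 0 p) h = 0 * \<beta> (e 0) h" by (rule cm[OF e_SF h])
  then show ?case by simp
 next
  case (Suc n)
  have "\<beta> (comb (Suc n) x) h = \<beta> (comb n x) h + \<beta> (\<lambda>p. x n * e n p) h"
   using add[OF comb_SF[of x n] SF_cmult[OF e_SF[of n], of "x n"] h] by simp
  then show ?case using Suc cm[OF e_SF h] by simp
 qed
 have full: "\<beta> (comb n x) (comb n y) = (\<Sum>j<n. \<Sum>k<n. x j * y k * \<beta> (e j) (e k))" for x y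
 proof -
  have "\<beta> (comb n x) (comb n y) = (\<Sum>j<n. x j * \<beta> (comb n y) (e j))"
   unfolding left[OF comb_SF] by (intro sum.cong refl arg_cong2[where f = "(*)"] sym)
  also have "\<dots> = (\<Sum>j<n. x j * (\<Sum>k<n. y k * \<beta> (e j) (e k)))"
   unfolding left[OF e_SF] by (intro sum.cong refl arg_cong2[where f = "(*)"] sym)
  finally show ?thesis by (simp add: sum_distrib_left mult.assoc)
 qed
 have "((\<lambda>t. \<Sum>j<n. \<Sum>k<n. b t j * b t k * \<beta> (e j) (e k)) has_real_derivative
   (\<Sum>j<n. \<Sum>k<n. (b' t j * b t k + b' t k * b t j) * \<beta> (e j) (e k))) (at t)"
  by (intro DERIV_sum DERIV_cmult_right DERIV_mult d)
 moreover have "(\<Sum>j<n. \<Sum>k<n. (b' t j * b t k + b' t k * b t j) * \<beta> (e j) (e k)) = 2 * \<beta> (comb n (b t)) (comb n (b' t))"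
 proof -
  have "(\<Sum>j<n. \<Sum>k<n. b' t j * b t k * \<beta> (e j) (e k)) = \<beta> (comb n (b' t)) (comb n (b t))" by (simp add: full)
  moreover have "(\<Sum>j<n. \<Sum>k<n. b' t k * b t j * \<beta> (e j) (e k)) = \<beta> (comb n (b t)) (comb n (b' t))"
   unfolding full by (simp add: mult.commute)
  ultimately show ?thesis using sym[of "comb n (b' t)" "comb n (b t)"]
   by (simp add: distrib_right sum.distrib)
 qed
 ultimately show ?thesis by (simp add: full)
qed

lemma laplacian_comb: "\<Delta> (comb n x) p = (\<Sum>k<n. - l k * x k * e k p)"
proof -
 have "\<Delta> (comb n x) p = (\<Sum>k<n. \<Delta> (\<lambda>p. x k * e k p) p)" by (rule laplacian_sum) (auto intro: SF_cmult e_SF)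
 then show ?thesis by (simp add: laplacian_cmult[OF e_SF] laplacian_e mult_ac)
qed

definition sn :: "real => nat => real" where
 "sn t k = (if l k = 0 then t else sin (t * sqrt (l k)) / sqrt (l k))"

lemma sn_DERIV: "((\<lambda>t. sn t k) has_real_derivative cos (t * sqrt (l k))) (at t)"
proof (cases "l k = 0")
 case True then show ?thesis by (simp add: sn_def)
next
 case False
 have "((\<lambda>t. sin (t * c) / c) has_real_derivative cos (t * c)) (at t)" if "c \<noteq> 0" for c
  using that by (auto intro!: derivative_eq_intros)
 from this[of "sqrt (l k)"] show ?thesis using False by (simp add: sn_def)
qed

lemma cos_DERIV: "((\<lambda>t. cos (t * sqrt (l k))) has_real_derivative - l k * sn t k) (at t)"
proof (cases "l k = 0")
 case False
 have "((\<lambda>t. cos (t * sqrt (l k))) has_real_derivative - sin (t * sqrt (l k)) * sqrt (l k)) (at t)"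
  by (auto intro!: derivative_eq_intros)
 moreover have "- sin (t * sqrt (l k)) * sqrt (l k) = - l k * sn t k"
  using False real_sqrt_mult_self[of "l k"] l_nonneg[of k] by (simp add: sn_def field_simps)
 ultimately show ?thesis by simp
qed simp

text \<open>The energy of a wave with the weight \<open>exp (2 \<alpha> \<chi>)\<close> grows at most like \<open>exp (2 \<alpha> L t)\<close> when \<open>L\<close>
 bounds the gradient of \<open>\<chi>\<close>.  Only finite combinations of eigenfunctions are considered, so that
 the energy may be differentiated term by term.\<close>

lemma weighted_energy:
 assumes ct: "ct \<in> SF" and L: "L \<ge> 0" "!!p. Gam ct ct p \<le> L\<^sup>2" and \<alpha>: "\<alpha> \<ge> 0" and t: "t \<ge> 0"
 shows "(\<integral>p. (comb n (\<lambda>k. cos (t * sqrt (l k)) * x k) p)\<^sup>2 * exp (2 * \<alpha> * ct p) \<partial>RV)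
  \<le> exp (2 * \<alpha> * L * t) * (\<integral>p. (comb n x p)\<^sup>2 * exp (2 * \<alpha> * ct p) \<partial>RV)"
proof -
 define \<phi> where "\<phi> = (\<lambda>p. exp (2 * \<alpha> * ct p))"
 have ac: "(\<lambda>p. 2 * \<alpha> * ct p) \<in> SF" by (rule SF_cmult[OF ct])
 have phi: "\<phi> \<in> SF" unfolding \<phi>_def by (rule SF_exp[OF ac])
 define B1 where "B1 f g = (\<integral>p. f p * g p * \<phi> p \<partial>RV)" for f g
 define B2 where "B2 f g = (\<integral>p. Gam f g p * \<phi> p \<partial>RV)" for f g
 have i1: "integrable RV (\<lambda>p. f p * g p * \<phi> p)" if "f \<in> SF" "g \<in> SF" for f g
  by (intro SF_integrable SF_mult that phi)
 have i2: "integrable RV (\<lambda>p. Gam f g p * \<phi> p)" if "f \<in> SF" "g \<in> SF" for f g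
  using SF_mult_integrable[OF SF_Gam[OF that] phi] .
 define u where "u t = comb n (\<lambda>k. sn t k * x k)" for t
 define v where "v t = comb n (\<lambda>k. cos (t * sqrt (l k)) * x k)" for t
 define w where "w t = comb n (\<lambda>k. - l k * sn t k * x k)" for t
 have S: "u t \<in> SF" "v t \<in> SF" "w t \<in> SF" for t unfolding u_def v_def w_def by (rule comb_SF)+
 have lapu: "\<Delta> (u t) = w t" for t
  unfolding u_def w_def by (rule ext, subst laplacian_comb) (simp add: mult.assoc)
 have d1: "((\<lambda>t. B1 (v t) (v t)) has_real_derivative 2 * B1 (v t) (w t)) (at t)" for t
  unfolding v_def w_def
 proof (rule DERIV_bilinear_comb)
  show "((\<lambda>t. cos (t * sqrt (l k)) * x k) has_real_derivative - l k * sn t k * x k) (at t)" for k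
   by (rule DERIV_cmult_right[OF cos_DERIV])
  show "B1 (\<lambda>p. f p + g p) h = B1 f h + B1 g h" if "f \<in> SF" "g \<in> SF" "h \<in> SF" for f g h
   using i1[OF that(1,3)] i1[OF that(2,3)] by (simp add: B1_def distrib_right)
 qed (simp_all add: B1_def mult.assoc mult.left_commute)
 have d2: "((\<lambda>t. B2 (u t) (u t)) has_real_derivative 2 * B2 (u t) (v t)) (at t)" for t
  unfolding u_def v_def
 proof (rule DERIV_bilinear_comb)
  show "((\<lambda>t. sn t k * x k) has_real_derivative cos (t * sqrt (l k)) * x k) (at t)" for k
   by (rule DERIV_cmult_right[OF sn_DERIV])
  show "B2 (\<lambda>p. f p + g p) h = B2 f h + B2 g h" if "f \<in> SF" "g \<in> SF" "h \<in> SF" for f g h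
   using i2[OF that(1,3)] i2[OF that(2,3)] by (simp add: B2_def Gam_add[OF that] distrib_right)
  show "B2 (\<lambda>p. c * f p) h = c * B2 f h" if "f \<in> SF" "h \<in> SF" for c f h
   by (simp add: B2_def Gam_cmult[OF that] mult.assoc)
  show "B2 f h = B2 h f" for f h by (simp add: B2_def Gam_sym[of f h])
 qed
 define E where "E t = B1 (v t) (v t) + B2 (u t) (u t)" for t
 have Eq: "E t = (\<integral>p. ((v t p)\<^sup>2 + Gam (u t) (u t) p) * \<phi> p \<partial>RV)" for t
  using i1[OF S(2,2)[of t]] i2[OF S(1,1)[of t]] by (simp add: E_def B1_def B2_def power2_eq_square distrib_right)
 have dE: "(E has_real_derivative 2 * B1 (v t) (w t) + 2 * B2 (u t) (v t)) (at t)" for t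
  unfolding E_def[abs_def] by (rule DERIV_add[OF d1 d2])
 have flux: "2 * B1 (v t) (w t) + 2 * B2 (u t) (v t) \<le> 2 * \<alpha> * L * E t" for t
 proof -
  have vphi: "(\<lambda>p. v t p * \<phi> p) \<in> SF" by (rule SF_mult[OF S(2) phi])
  have "B1 (v t) (w t) = (\<integral>p. \<Delta> (u t) p * (v t p * \<phi> p) \<partial>RV)" by (simp add: B1_def lapu mult_ac)
  also have "\<dots> = - (\<integral>p. Gam (u t) (\<lambda>p. v t p * \<phi> p) p \<partial>RV)" by (rule green[OF S(1) vphi])
  also have "(\<integral>p. Gam (u t) (\<lambda>p. v t p * \<phi> p) p \<partial>RV) = (\<integral>p. v t p * (\<phi> p * (2 * \<alpha> * Gam ct (u t) p)) + Gam (u t) (v t) p * \<phi> p \<partial>RV)"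
  proof (rule Bochner_Integration.integral_cong[OF refl])
   fix p
   have "Gam \<phi> (u t) p = \<phi> p * (2 * \<alpha> * Gam ct (u t) p)"
    unfolding \<phi>_def Gam_exp[OF ac S(1)] Gam_cmult[OF ct S(1)] ..
   then show "Gam (u t) (\<lambda>p. v t p * \<phi> p) p = v t p * (\<phi> p * (2 * \<alpha> * Gam ct (u t) p)) + Gam (u t) (v t) p * \<phi> p"
    unfolding Gam_sym[of "u t" "\<lambda>p. v t p * \<phi> p"] Gam_mult[OF S(2) phi S(1)] Gam_sym[of "u t" "v t"] by simp
  qed
  also have "\<dots> = (\<integral>p. v t p * (\<phi> p * (2 * \<alpha> * Gam ct (u t) p)) \<partial>RV) + B2 (u t) (v t)"
   unfolding B2_def
   by (rule Bochner_Integration.integral_add[OF SF_integrable i2[OF S(1,2)]])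
    (intro SF_mult SF_cmult SF_Gam S phi ct)
  finally have "2 * B1 (v t) (w t) + 2 * B2 (u t) (v t) = - 2 * (\<integral>p. v t p * (\<phi> p * (2 * \<alpha> * Gam ct (u t) p)) \<partial>RV)"
   by linarith
  also have "\<dots> = (\<integral>p. - 2 * (v t p * (\<phi> p * (2 * \<alpha> * Gam ct (u t) p))) \<partial>RV)"
   by (rule Bochner_Integration.integral_mult_right_zero[symmetric])
  also have "\<dots> \<le> (\<integral>p. 2 * \<alpha> * L * (((v t p)\<^sup>2 + Gam (u t) (u t) p) * \<phi> p) \<partial>RV)"
  proof (rule integral_mono)
   show "integrable RV (\<lambda>p. - 2 * (v t p * (\<phi> p * (2 * \<alpha> * Gam ct (u t) p))))"
    by (intro SF_integrable SF_mult SF_cmult SF_const SF_Gam S phi ct)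
   show "integrable RV (\<lambda>p. 2 * \<alpha> * L * (((v t p)\<^sup>2 + Gam (u t) (u t) p) * \<phi> p))"
    unfolding power2_eq_square by (intro SF_integrable SF_mult SF_add SF_const SF_Gam S phi)
   fix p
   have "2 * \<bar>v t p * Gam (u t) ct p\<bar> \<le> L * ((v t p)\<^sup>2 + Gam (u t) (u t) p)" by (rule Gam_le[OF S(1) ct L])
   then have "- 2 * (v t p * Gam ct (u t) p) \<le> L * ((v t p)\<^sup>2 + Gam (u t) (u t) p)"
    unfolding Gam_sym[of "u t" ct] by linarith
   moreover have "0 \<le> 2 * \<alpha> * \<phi> p" using \<alpha> by (simp add: \<phi>_def)
   ultimately have "(2 * \<alpha> * \<phi> p) * (- 2 * (v t p * Gam ct (u t) p)) \<le> (2 * \<alpha> * \<phi> p) * (L * ((v t p)\<^sup>2 + Gam (u t) (u t) p))"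
    by (rule mult_left_mono)
   then show "- 2 * (v t p * (\<phi> p * (2 * \<alpha> * Gam ct (u t) p))) \<le> 2 * \<alpha> * L * (((v t p)\<^sup>2 + Gam (u t) (u t) p) * \<phi> p)"
    by (simp add: mult_ac)
  qed
  finally show ?thesis by (simp add: Eq)
 qed
 define Q where "Q t = E t * exp (- (2 * \<alpha> * L * t))" for t
 have "Q t \<le> Q 0"
 proof (rule DERIV_nonpos_imp_nonincreasing[OF t])
  fix s assume "0 \<le> s" "s \<le> t"
  have "(Q has_real_derivative (E s * (exp (- (2 * \<alpha> * L * s)) * (- (2 * \<alpha> * L))) + (2 * B1 (v s) (w s) + 2 * B2 (u s) (v s)) * exp (- (2 * \<alpha> * L * s)))) (at s)"
   unfolding Q_def[abs_def]
   by (rule derivative_eq_intros dE refl)+ (simp add: algebra_simps)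
  moreover have "E s * (exp (- (2 * \<alpha> * L * s)) * (- (2 * \<alpha> * L))) + (2 * B1 (v s) (w s) + 2 * B2 (u s) (v s)) * exp (- (2 * \<alpha> * L * s)) \<le> 0"
   using mult_right_mono[OF flux[of s], of "exp (- (2 * \<alpha> * L * s))"] by (simp add: mult_ac)
  ultimately show "\<exists>y. (Q has_real_derivative y) (at s) \<and> y \<le> 0" by blast
 qed
 then have "E t * (exp (- (2 * \<alpha> * L * t)) * exp (2 * \<alpha> * L * t)) \<le> E 0 * exp (2 * \<alpha> * L * t)"
  unfolding Q_def using mult_right_mono[of "E t * exp (- (2 * \<alpha> * L * t))" "E 0" "exp (2 * \<alpha> * L * t)"] by (simp add: mult.assoc)
 then have Et: "E t \<le> exp (2 * \<alpha> * L * t) * E 0" by (simp add: exp_minus_inverse mult.commute)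
 have "B2 (u t) (u t) \<ge> 0" unfolding B2_def by (intro Bochner_Integration.integral_nonneg mult_nonneg_nonneg Gam_nonneg S) (simp add: \<phi>_def)
 then have "B1 (v t) (v t) \<le> E t" by (simp add: E_def)
 moreover have "E 0 = B1 (comb n x) (comb n x)"
 proof -
  have "sn 0 k = 0" for k by (simp add: sn_def)
  then have u0: "u 0 = (\<lambda>p. 0)" by (simp add: u_def)
  have v0: "v 0 = comb n x" by (simp add: v_def)
  have "Gam (\<lambda>p. 0) (\<lambda>p. 0) p = 0" for p by (simp add: Gam_def laplacian_const)
  then show ?thesis by (simp add: E_def u0 v0 B2_def)
 qed
 ultimately have "B1 (v t) (v t) \<le> exp (2 * \<alpha> * L * t) * B1 (comb n x) (comb n x)" using Et by simp
 then show ?thesis by (simp add: B1_def v_def \<phi>_def power2_eq_square)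
qed

definition wave :: "('a => real) => ('a => real) => real => real" where
 "wave f h t = (\<Sum>k. cos (t * sqrt (l k)) * (co f k * co h k))"

lemma co_prod_summable: "f \<in> SF ==> h \<in> SF ==> summable (\<lambda>k. \<bar>co f k * co h k\<bar>)"
 by (rule l2_seq_product(1)[OF co_sq_summable co_sq_summable])

lemma wave_summable: assumes "f \<in> SF" "h \<in> SF" shows "summable (\<lambda>k. cos (t * sqrt (l k)) * (co f k * co h k))"
proof (rule summable_comparison_test[OF _ co_prod_summable[OF assms]])
 have "\<bar>cos (t * sqrt (l k))\<bar> * \<bar>co f k * co h k\<bar> \<le> 1 * \<bar>co f k * co h k\<bar>" for k by (rule mult_right_mono) auto
 then show "\<exists>N. \<forall>n\<ge>N. norm (cos (t * sqrt (l n)) * (co f n * co h n)) \<le> \<bar>co f n * co h n\<bar>" by (simp add: abs_mult)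
qed

text \<open>The weight is \<open>1\<close> on the support of \<open>f\<close> and \<open>exp (2 \<alpha>)\<close> on that of \<open>h\<close>; the weighted energy bounds the wave by
\<open>exp (\<alpha> (L t - 1))\<close>, and \<open>\<alpha>\<close> tends to infinity.\<close>

lemma finite_speed:
 assumes f: "f \<in> SF" and h: "h \<in> SF" and disj: "spt f \<inter> spt h = {}"
 shows "\<exists>c>0. \<forall>t. 0 \<le> t \<and> t < c \<longrightarrow> wave f h t = 0"
proof -
 have "spt h \<subseteq> - spt f" using disj by blast
 then obtain ct V where ct: "ct \<in> TF (- spt f)" "open V" "spt h \<subseteq> V" "\<forall>q\<in>V. ct q = 1"
  using cutoff[of "spt h" "- spt f"] by (metis closed_closure open_Compl)
 have ctS: "ct \<in> SF" using ct(1) by (rule TF_SF)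
 have ctf: "ct p = 0" if "p \<in> spt f" for p
  by (rule spt_zero) (use ct(1) that in \<open>auto simp: TF_iff\<close>)
 have cth: "ct p = 1" if "p \<in> spt h" for p using ct that by blast
 have bounded: "\<exists>B\<ge>0. \<forall>p. \<bar>w p\<bar> \<le> B" if "w \<in> SF" for w
 proof -
  have "compact (w ` UNIV)" by (rule compact_continuous_image[OF SF_continuous[OF that] compact_M])
  then obtain B where "B > 0" "\<forall>y\<in>w ` UNIV. norm y \<le> B" using compact_imp_bounded bounded_pos by blast
  then show ?thesis by (intro exI[of _ B]) auto
 qed
 obtain L2 where L2: "L2 \<ge> 0" "!!p. \<bar>Gam ct ct p\<bar> \<le> L2" using bounded[OF SF_Gam[OF ctS ctS]] by blast
 define L where "L = L2 + 1"
 have L: "L > 0" using L2 by (simp add: L_def)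
 have GL: "Gam ct ct p \<le> L\<^sup>2" for p
 proof -
  have "Gam ct ct p \<le> L * 1" using L2(2)[of p] by (simp add: L_def)
  also have "\<dots> \<le> L * L" using L L2 by (intro mult_left_mono) (auto simp: L_def)
  finally show ?thesis by (simp add: power2_eq_square)
 qed
 define w where "w n t = comb n (\<lambda>k. cos (t * sqrt (l k)) * co f k)" for n t
 have wS: "w n t \<in> SF" for n t unfolding w_def by (rule comb_SF)
 have wlim: "(\<lambda>n. ip (w n t) h) \<longlonglongrightarrow> wave f h t" for t
 proof -
  have "ip (w n t) h = (\<Sum>k<n. cos (t * sqrt (l k)) * (co f k * co h k))" for n
  proof -
   have "ip (w n t) h = (\<Sum>k<n. ip (\<lambda>p. (cos (t * sqrt (l k)) * co f k) * e k p) h)"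
    unfolding w_def by (rule ip_sum[OF _ SF_cmult[OF e_SF] h]) simp
   also have "\<dots> = (\<Sum>k<n. (cos (t * sqrt (l k)) * co f k) * co h k)"
    unfolding ip_cmult co_def using ip_sym[of h] by (simp only:)
   finally show ?thesis by (simp add: mult.assoc)
  qed
  then show ?thesis unfolding wave_def using summable_LIMSEQ[OF wave_summable[OF f h, of t]] by simp
 qed
 have key: "(wave f h t)\<^sup>2 \<le> exp (2 * \<alpha> * (L * t - 1)) * (2 * ip f f * ip h h)" if t: "t \<ge> 0" and \<alpha>: "\<alpha> \<ge> 0" for t \<alpha>
 proof -
  have es: "(\<lambda>p. exp (c * ct p)) \<in> SF" for c by (rule SF_exp[OF SF_cmult[OF ctS]])
  obtain B where B: "B \<ge> 0" "!!p. \<bar>exp (2 * \<alpha> * ct p)\<bar> \<le> B" using bounded[OF es] by blast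
  let ?d = "\<lambda>n p. f p - ps f n p"
  have dS: "?d n \<in> SF" for n by (rule SF_diff[OF f ps_SF])
  have step: "(ip (w n t) h)\<^sup>2 \<le> exp (2 * \<alpha> * (L * t - 1)) * ((2 * ip f f + 2 * B * ip (?d n) (?d n)) * ip h h)" for n
  proof -
   let ?a = "\<lambda>p. w n t p * exp (\<alpha> * ct p)" and ?b = "\<lambda>p. h p * exp (- \<alpha> * ct p)"
   have aS: "?a \<in> SF" by (rule SF_mult[OF wS es])
   have bS: "?b \<in> SF" by (rule SF_mult[OF h es])
   have ab: "ip (w n t) h = ip ?a ?b"
   proof -
    have "w n t p * exp (\<alpha> * ct p) * (h p * exp (- \<alpha> * ct p)) = w n t p * h p" for p
     using exp_minus_inverse[of "\<alpha> * ct p"] by (simp add: algebra_simps)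
    then show ?thesis unfolding l2_inner_def by (simp only:)
   qed
   have aa: "ip ?a ?a \<le> exp (2 * \<alpha> * L * t) * (2 * ip f f + 2 * B * ip (?d n) (?d n))"
   proof -
    have "ip ?a ?a = (\<integral>p. (w n t p)\<^sup>2 * exp (2 * \<alpha> * ct p) \<partial>RV)"
    proof -
     have "exp (\<alpha> * ct p) * exp (\<alpha> * ct p) = exp (2 * \<alpha> * ct p)" for p by (simp add: exp_add[symmetric])
     then have "w n t p * exp (\<alpha> * ct p) * (w n t p * exp (\<alpha> * ct p)) = (w n t p)\<^sup>2 * exp (2 * \<alpha> * ct p)" for p
      by (metis (no_types, lifting) mult.assoc mult.left_commute power2_eq_square)
     then show ?thesis by (simp add: l2_inner_def)
    qed
    also have "\<dots> \<le> exp (2 * \<alpha> * L * t) * (\<integral>p. (ps f n p)\<^sup>2 * exp (2 * \<alpha> * ct p) \<partial>RV)"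
     using weighted_energy[OF ctS less_imp_le[OF L] GL \<alpha> t, of "co f" n] by (simp add: w_def ps_def)
    also have "(\<integral>p. (ps f n p)\<^sup>2 * exp (2 * \<alpha> * ct p) \<partial>RV) \<le> (\<integral>p. 2 * (f p * f p) + 2 * B * (?d n p * ?d n p) \<partial>RV)"
    proof (rule integral_mono)
     show "integrable RV (\<lambda>p. (ps f n p)\<^sup>2 * exp (2 * \<alpha> * ct p))"
      unfolding power2_eq_square by (intro SF_integrable SF_mult ps_SF es)
     show "integrable RV (\<lambda>p. 2 * (f p * f p) + 2 * B * (?d n p * ?d n p))"
      by (intro SF_integrable SF_add SF_cmult SF_mult f dS)
     fix p
     let ?e = "exp (2 * \<alpha> * ct p)"
     have "(ps f n p)\<^sup>2 \<le> 2 * (f p)\<^sup>2 + 2 * (?d n p)\<^sup>2"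
      using zero_le_power2[of "2 * f p - ps f n p"] by (simp add: power2_eq_square algebra_simps)
     then have "(ps f n p)\<^sup>2 * ?e \<le> (2 * (f p)\<^sup>2 + 2 * (?d n p)\<^sup>2) * ?e" by (rule mult_right_mono) simp
     moreover have "(f p)\<^sup>2 * ?e = (f p)\<^sup>2"
     proof (cases "p \<in> spt f")
      case True then show ?thesis using ctf by simp
     next
      case False
      then have "f p = 0" by (rule spt_zero)
      then show ?thesis by simp
     qed
     moreover have "(?d n p)\<^sup>2 * ?e \<le> (?d n p)\<^sup>2 * B" using B(2)[of p] by (intro mult_left_mono) auto
     moreover have "(2 * (f p)\<^sup>2 + 2 * (?d n p)\<^sup>2) * ?e = 2 * ((f p)\<^sup>2 * ?e) + 2 * ((?d n p)\<^sup>2 * ?e)"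
      by (simp only: distrib_right mult.assoc)
     ultimately have "(ps f n p)\<^sup>2 * ?e \<le> 2 * (f p)\<^sup>2 + 2 * ((?d n p)\<^sup>2 * B)" by linarith
     then show "(ps f n p)\<^sup>2 * ?e \<le> 2 * (f p * f p) + 2 * B * (?d n p * ?d n p)"
      by (simp only: power2_eq_square mult_ac)
    qed
    also have "\<dots> = 2 * ip f f + 2 * B * ip (?d n) (?d n)"
     unfolding l2_inner_def using SF_mult_integrable[OF f f] SF_mult_integrable[OF dS dS, of n n] by simp
    finally show ?thesis by (simp add: mult_left_mono)
   qed
   have bb: "ip ?b ?b = exp (- 2 * \<alpha>) * ip h h"
   proof -
    have "h p * exp (- \<alpha> * ct p) * (h p * exp (- \<alpha> * ct p)) = exp (- 2 * \<alpha>) * (h p * h p)" for p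
    proof (cases "p \<in> spt h")
     case True
     have "exp (- \<alpha>) * exp (- \<alpha>) = exp (- 2 * \<alpha>)" by (simp add: exp_add[symmetric])
     then show ?thesis using cth[OF True] by (simp add: mult_ac)
    next
     case False
     then have "h p = 0" by (rule spt_zero)
     then show ?thesis by simp
    qed
    then show ?thesis unfolding l2_inner_def by (simp only: Bochner_Integration.integral_mult_right_zero)
   qed
   have "(ip (w n t) h)\<^sup>2 \<le> ip ?a ?a * ip ?b ?b" unfolding ab by (rule ip_cauchy_schwarz[OF aS bS])
   also have "\<dots> \<le> (exp (2 * \<alpha> * L * t) * (2 * ip f f + 2 * B * ip (?d n) (?d n))) * ip ?b ?b"
    by (rule mult_right_mono[OF aa ip_nonneg])
   also have "\<dots> = (exp (2 * \<alpha> * L * t) * exp (- 2 * \<alpha>)) * ((2 * ip f f + 2 * B * ip (?d n) (?d n)) * ip h h)"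
    unfolding bb by (simp add: mult_ac)
   also have "exp (2 * \<alpha> * L * t) * exp (- 2 * \<alpha>) = exp (2 * \<alpha> * (L * t - 1))"
    unfolding exp_add[symmetric] by (simp add: algebra_simps)
   finally show ?thesis .
  qed
  have "(\<lambda>n. (ip (w n t) h)\<^sup>2) \<longlonglongrightarrow> (wave f h t)\<^sup>2" by (intro tendsto_power wlim)
  moreover have "(\<lambda>n. exp (2 * \<alpha> * (L * t - 1)) * ((2 * ip f f + 2 * B * ip (?d n) (?d n)) * ip h h))
    \<longlonglongrightarrow> exp (2 * \<alpha> * (L * t - 1)) * ((2 * ip f f + 2 * B * 0) * ip h h)"
   by (intro tendsto_intros ps_converges f)
  ultimately have "(wave f h t)\<^sup>2 \<le> exp (2 * \<alpha> * (L * t - 1)) * ((2 * ip f f + 2 * B * 0) * ip h h)"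
   by (rule LIMSEQ_le) (use step in blast)
  then show ?thesis by simp
 qed
 have "wave f h t = 0" if t: "0 \<le> t" "t < 1 / L" for t
 proof -
  have neg: "L * t - 1 < 0" using t L by (simp add: field_simps)
  have "((\<lambda>n. exp (real n * (2 * (L * t - 1))) * (2 * ip f f * ip h h)) \<longlongrightarrow> 0 * (2 * ip f f * ip h h)) sequentially"
  proof (intro tendsto_mult_right)
   have "(\<lambda>n. exp (2 * (L * t - 1)) ^ n) \<longlonglongrightarrow> 0" by (rule LIMSEQ_power_zero) (use neg in simp)
   then show "(\<lambda>n. exp (real n * (2 * (L * t - 1)))) \<longlonglongrightarrow> 0" by (simp add: exp_of_nat_mult)
  qed
  then have lim: "(\<lambda>n. exp (real n * (2 * (L * t - 1))) * (2 * ip f f * ip h h)) \<longlonglongrightarrow> 0" by (simp only: mult_zero_left)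
  have "(wave f h t)\<^sup>2 \<le> 0"
  proof (rule LIMSEQ_le_const[OF lim], intro exI allI impI)
   fix n :: nat
   have "2 * real n * (L * t - 1) = real n * (2 * (L * t - 1))" by simp
   then show "(wave f h t)\<^sup>2 \<le> exp (real n * (2 * (L * t - 1))) * (2 * ip f f * ip h h)"
    using key[OF t(1), of "real n"] by (simp only: of_nat_0_le_iff simp_thms)
  qed
  then show ?thesis by simp
 qed
 then show ?thesis using L by (intro exI[of _ "1 / L"]) auto
qed

end

section \<open>Cosine series and negative powers of their frequencies\<close>

lemma integrable_of_has_integral:
 fixes f :: "real => real"
 assumes [measurable]: "f \<in> borel_measurable borel" "S \<in> sets borel"
  and nn: "!!x. x \<in> S ==> 0 \<le> f x" and I: "(f has_integral I) S"
 shows "integrable lborel (\<lambda>x. indicator S x * f x)"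
proof (rule integrableI_nonneg)
 show "AE x in lborel. 0 \<le> indicator S x * f x" using nn by (auto simp: indicator_def)
 show "(\<integral>\<^sup>+ x. ennreal (indicator S x * f x) \<partial>lborel) < \<infinity>"
  using nn_integral_has_integral_lebesgue[OF nn I] by simp
qed measurable

text \<open>The Taylor polynomial has degree \<open>2 n\<close>, because the coefficient of order \<open>2 n + 1\<close> vanishes.\<close>

definition cos_rest :: "nat => real => real" where
 "cos_rest n t = cos t - (\<Sum>i<2 * n + 2. cos_coeff i * t ^ i)"

lemma cos_taylor_le: "\<bar>cos t - (\<Sum>i<N. cos_coeff i * t ^ i)\<bar> \<le> \<bar>t :: real\<bar> ^ N"
proof -
 obtain r where r: "cos t = (\<Sum>m<N. cos_coeff m * t ^ m) + (cos (r + 1/2 * real N * pi) / fact N) * t ^ N"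
  using Maclaurin_cos_expansion[of t N] by (elim exE conjE) (rule that)
 have "\<bar>cos (r + 1/2 * real N * pi) / fact N\<bar> \<le> 1 / 1"
  unfolding abs_divide by (rule frac_le) (simp_all add: fact_ge_1)
 then have "\<bar>(cos (r + 1/2 * real N * pi) / fact N) * t ^ N\<bar> \<le> 1 * \<bar>t\<bar> ^ N"
  unfolding abs_mult power_abs by (intro mult_right_mono) auto
 then show ?thesis using r by simp
qed

lemma cos_rest_le: "\<bar>cos_rest n t\<bar> \<le> \<bar>t\<bar> ^ (2 * n + 2)" "\<bar>cos_rest n t\<bar> \<le> 2 * \<bar>t\<bar> ^ (2 * n)"
proof -
 show "\<bar>cos_rest n t\<bar> \<le> \<bar>t\<bar> ^ (2 * n + 2)" unfolding cos_rest_def by (rule cos_taylor_le)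
 have "cos_coeff (2 * n + 1) = 0" by (simp add: cos_coeff_def)
 then have e: "cos_rest n t = (cos t - (\<Sum>i<2 * n. cos_coeff i * t ^ i)) - cos_coeff (2 * n) * t ^ (2 * n)"
  by (simp add: cos_rest_def)
 have "\<bar>cos_coeff (2 * n)\<bar> \<le> 1" by (simp add: cos_coeff_def fact_ge_1)
 then have "\<bar>cos_coeff (2 * n) * t ^ (2 * n)\<bar> \<le> 1 * \<bar>t\<bar> ^ (2 * n)"
  unfolding abs_mult power_abs by (intro mult_right_mono) auto
 then show "\<bar>cos_rest n t\<bar> \<le> 2 * \<bar>t\<bar> ^ (2 * n)" unfolding e using cos_taylor_le[of t "2 * n"] by linarith
qed

lemma cos_rest_measurable [measurable]: "cos_rest n \<in> borel_measurable borel"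
 unfolding cos_rest_def[abs_def] by measurable

definition mellin_kernel :: "real => nat => real => real" where
 "mellin_kernel s n t = indicator {0<..} t * (t powr (2 * s - 3 - 2 * real n) * cos_rest n t)"

lemma mellin_kernel_integrable:
 assumes s: "0 < s" "s < 1" shows "integrable lborel (mellin_kernel s n)"
proof -
 let ?g = "\<lambda>t::real. indicator {0..1} t * t powr (2 * s - 1)" and ?h = "\<lambda>t::real. indicator {1..} t * t powr (2 * s - 3)"
 have "integrable lborel ?g"
  by (rule integrable_of_has_integral[OF _ _ _ has_integral_powr_from_0]) (use s in auto)
 moreover have "integrable lborel ?h"
  by (rule integrable_of_has_integral[OF _ _ _ has_integral_powr_to_inf]) (use s in auto)
 ultimately have igh: "integrable lborel (\<lambda>t. ?g t + 2 * ?h t)"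
  by (intro Bochner_Integration.integrable_add integrable_mult_right)
 have nle: "norm (mellin_kernel s n t) \<le> norm (?g t + 2 * ?h t)" for t
 proof (cases "t > 0")
  case True
  let ?p = "2 * s - 3 - 2 * real n"
  have k: "\<bar>mellin_kernel s n t\<bar> = t powr ?p * \<bar>cos_rest n t\<bar>" using True by (simp add: mellin_kernel_def abs_mult)
  have pw: "t powr ?p * t ^ j = t powr (?p + real j)" for j using True by (simp add: powr_add powr_realpow)
  show ?thesis
  proof (cases "t \<le> 1")
   case le: True
   have "\<bar>mellin_kernel s n t\<bar> \<le> t powr ?p * t ^ (2 * n + 2)"
    unfolding k using cos_rest_le(1)[of n t] True by (intro mult_left_mono) auto
   also have "\<dots> = t powr (2 * s - 1)" unfolding pw by simp
   also have "\<dots> = ?g t" using le True by simp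
   also have "\<dots> \<le> norm (?g t + 2 * ?h t)" by simp
   finally show ?thesis by simp
  next
   case False
   have "\<bar>mellin_kernel s n t\<bar> \<le> t powr ?p * (2 * t ^ (2 * n))"
    unfolding k using cos_rest_le(2)[of n t] True by (intro mult_left_mono) auto
   also have "\<dots> = 2 * (t powr ?p * t ^ (2 * n))" by simp
   also have "\<dots> = 2 * t powr (2 * s - 3)" unfolding pw by simp
   finally show ?thesis using False by (simp add: indicator_def)
  qed
 qed (simp add: mellin_kernel_def)
 have "mellin_kernel s n \<in> borel_measurable lborel" unfolding mellin_kernel_def[abs_def] by measurable
 then show ?thesis by (rule Bochner_Integration.integrable_bound[OF igh]) (rule AE_I2[OF nle])
qed

lemma mellin_kernel_scaled:
 fixes \<omega> :: real and n :: nat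
 assumes s: "0 < s" "s < 1" and \<omega>: "\<omega> > 0"
 defines "p \<equiv> 2 * s - 3 - 2 * real n"
 shows "integrable lborel (\<lambda>t. indicator {0<..} t * (t powr p * cos_rest n (t * \<omega>)))"
  "(\<integral>t. indicator {0<..} t * (t powr p * cos_rest n (t * \<omega>)) \<partial>lborel) = \<omega> powr (- p - 1) * (\<integral>t. mellin_kernel s n t \<partial>lborel)"
  "(\<integral>t. \<bar>indicator {0<..} t * (t powr p * cos_rest n (t * \<omega>))\<bar> \<partial>lborel) = \<omega> powr (- p - 1) * (\<integral>t. \<bar>mellin_kernel s n t\<bar> \<partial>lborel)"
proof -
 have e: "indicator {0<..} t * (t powr p * cos_rest n (t * \<omega>)) = \<omega> powr (- p) * mellin_kernel s n (0 + \<omega> * t)" for t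
 proof (cases "t > 0")
  case True
  have "\<omega> powr (- p) * (\<omega> powr p * t powr p * cos_rest n (\<omega> * t)) = (\<omega> powr (- p) * \<omega> powr p) * (t powr p * cos_rest n (\<omega> * t))" by simp
  also have "\<omega> powr (- p) * \<omega> powr p = 1" using \<omega> by (simp add: powr_add[symmetric])
  finally show ?thesis using True \<omega> by (simp add: mellin_kernel_def p_def[symmetric] powr_mult mult.commute[of t])
 next
  case False
  then show ?thesis using \<omega> by (simp add: mellin_kernel_def zero_less_mult_iff)
 qed
 have i: "integrable lborel (mellin_kernel s n)" by (rule mellin_kernel_integrable[OF s])
 show "integrable lborel (\<lambda>t. indicator {0<..} t * (t powr p * cos_rest n (t * \<omega>)))"
  unfolding e using \<omega> by (intro integrable_mult_right lborel_integrable_real_affine[OF i]) simp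
 have c: "\<omega> powr (- p) / \<omega> = \<omega> powr (- p - 1)" using \<omega> by (simp add: powr_diff)
 have "(\<integral>t. mellin_kernel s n t \<partial>lborel) = \<omega> * (\<integral>t. mellin_kernel s n (0 + \<omega> * t) \<partial>lborel)"
  using lborel_integral_real_affine[of \<omega> "mellin_kernel s n" 0] \<omega> by simp
 then show "(\<integral>t. indicator {0<..} t * (t powr p * cos_rest n (t * \<omega>)) \<partial>lborel) = \<omega> powr (- p - 1) * (\<integral>t. mellin_kernel s n t \<partial>lborel)"
  unfolding e c[symmetric] using \<omega> by simp
 have "(\<integral>t. \<bar>mellin_kernel s n t\<bar> \<partial>lborel) = \<omega> * (\<integral>t. \<bar>mellin_kernel s n (0 + \<omega> * t)\<bar> \<partial>lborel)"
  using lborel_integral_real_affine[of \<omega> "\<lambda>t. \<bar>mellin_kernel s n t\<bar>" 0] \<omega> by simp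
 then show "(\<integral>t. \<bar>indicator {0<..} t * (t powr p * cos_rest n (t * \<omega>))\<bar> \<partial>lborel) = \<omega> powr (- p - 1) * (\<integral>t. \<bar>mellin_kernel s n t\<bar> \<partial>lborel)"
  unfolding e c[symmetric] using \<omega> by (simp add: abs_mult)
qed

lemma laplace_cos:
 fixes \<alpha> b :: real
 assumes \<alpha>: "\<alpha> > 0"
 shows "integrable lborel (\<lambda>t. indicator {0<..} t * exp (- \<alpha> * t))"
  "(\<integral>t. indicator {0<..} t * (exp (- \<alpha> * t) * cos (t * b)) \<partial>lborel) = \<alpha> / (\<alpha>\<^sup>2 + b\<^sup>2)"
proof -
 have i: "integrable lborel (\<lambda>t::real. indicator {0..} t * exp (- \<alpha> * t))"
  using has_integral_exp_minus_to_infinity[OF \<alpha>, of 0]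
  by (intro integrable_of_has_integral) auto
 show i0: "integrable lborel (\<lambda>t::real. indicator {0<..} t * exp (- \<alpha> * t))"
  by (rule Bochner_Integration.integrable_bound[OF i]) (auto simp: indicator_def)
 have i1: "integrable lborel (\<lambda>t::real. indicator {0<..} t * (exp (- \<alpha> * t) * cos (t * b)))"
  by (rule Bochner_Integration.integrable_bound[OF i0]) (auto simp: indicator_def abs_mult mult_left_le)
 have nz: "\<alpha>\<^sup>2 + b\<^sup>2 > 0" using \<alpha> by (simp add: add_pos_nonneg)
 define F where "F t = exp (- \<alpha> * t) * (b * sin (t * b) - \<alpha> * cos (t * b)) / (\<alpha>\<^sup>2 + b\<^sup>2)" for t
 have dF: "(F has_real_derivative exp (- \<alpha> * t) * cos (t * b)) (at t)" for t
 proof -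
  have "(F has_real_derivative (exp (- \<alpha> * t) * (- \<alpha>) * (b * sin (t * b) - \<alpha> * cos (t * b)) +
    exp (- \<alpha> * t) * (b * (cos (t * b) * b) + \<alpha> * (sin (t * b) * b))) / (\<alpha>\<^sup>2 + b\<^sup>2)) (at t)"
   unfolding F_def[abs_def] using nz by (auto intro!: derivative_eq_intros)
  moreover have "exp (- \<alpha> * t) * (- \<alpha>) * (b * sin (t * b) - \<alpha> * cos (t * b)) +
    exp (- \<alpha> * t) * (b * (cos (t * b) * b) + \<alpha> * (sin (t * b) * b)) = (exp (- \<alpha> * t) * cos (t * b)) * (\<alpha>\<^sup>2 + b\<^sup>2)"
   by (simp add: algebra_simps power2_eq_square)
  moreover have "(exp (- \<alpha> * t) * cos (t * b)) * (\<alpha>\<^sup>2 + b\<^sup>2) / (\<alpha>\<^sup>2 + b\<^sup>2) = exp (- \<alpha> * t) * cos (t * b)"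
   by (rule nonzero_mult_div_cancel_right) (use nz in linarith)
  ultimately show ?thesis by (simp only:)
 qed
 have "(LBINT t=ereal 0..\<infinity>. exp (- \<alpha> * t) * cos (t * b)) = 0 - F 0"
 proof (rule interval_integral_FTC_integrable)
  show "ereal 0 < \<infinity>" by simp
  show "(F has_vector_derivative exp (- \<alpha> * t) * cos (t * b)) (at t)" for t
   using dF by (simp add: has_real_derivative_iff_has_vector_derivative)
  show "isCont (\<lambda>t. exp (- \<alpha> * t) * cos (t * b)) t" for t by (intro continuous_intros)
  have "einterval (ereal 0) \<infinity> = {0<..}" by (auto simp: einterval_def)
  then show "set_integrable lborel (einterval (ereal 0) \<infinity>) (\<lambda>t. exp (- \<alpha> * t) * cos (t * b))"
   using i1 by (simp add: set_integrable_def)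
  have "(F \<longlongrightarrow> F 0) (at_right 0)" using DERIV_isCont[OF dF] by (simp add: isCont_def filterlim_at_split)
  then show "((F \<circ> real_of_ereal) \<longlongrightarrow> F 0) (at_right (ereal 0))" by (simp add: ereal_tendsto_simps)
  have "(F \<longlongrightarrow> 0) at_top"
  proof (rule Lim_null_comparison)
   show "\<forall>\<^sub>F t in at_top. norm (F t) \<le> exp (- \<alpha> * t) * ((\<bar>b\<bar> + \<alpha>) / (\<alpha>\<^sup>2 + b\<^sup>2))"
   proof (rule always_eventually, rule allI)
    fix t
    have "\<bar>b * sin (t * b) - \<alpha> * cos (t * b)\<bar> \<le> \<bar>b\<bar> * \<bar>sin (t * b)\<bar> + \<alpha> * \<bar>cos (t * b)\<bar>"
     using abs_triangle_ineq4[of "b * sin (t * b)" "\<alpha> * cos (t * b)"] \<alpha> by (simp add: abs_mult)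
    also have "\<dots> \<le> \<bar>b\<bar> * 1 + \<alpha> * 1" using \<alpha> by (intro add_mono mult_left_mono) auto
    finally show "norm (F t) \<le> exp (- \<alpha> * t) * ((\<bar>b\<bar> + \<alpha>) / (\<alpha>\<^sup>2 + b\<^sup>2))"
     using nz by (simp add: F_def abs_mult divide_right_mono)
   qed
   have "LIM t at_top. - \<alpha> * t :> at_bot"
    using \<alpha> by (intro filterlim_tendsto_neg_mult_at_bot[OF tendsto_const]) (auto simp: filterlim_ident)
   then have "((\<lambda>t. exp (- \<alpha> * t)) \<longlongrightarrow> 0) at_top" by (rule filterlim_compose[OF exp_at_bot])
   from tendsto_mult_right[OF this, of "(\<bar>b\<bar> + \<alpha>) / (\<alpha>\<^sup>2 + b\<^sup>2)"]
   show "((\<lambda>t. exp (- \<alpha> * t) * ((\<bar>b\<bar> + \<alpha>) / (\<alpha>\<^sup>2 + b\<^sup>2))) \<longlongrightarrow> 0) at_top" by simp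
  qed
  then show "((F \<circ> real_of_ereal) \<longlongrightarrow> 0) (at_left \<infinity>)" by (simp add: ereal_tendsto_simps)
 qed
 moreover have "(LBINT t=ereal 0..\<infinity>. exp (- \<alpha> * t) * cos (t * b)) = (\<integral>t. indicator {0<..} t * (exp (- \<alpha> * t) * cos (t * b)) \<partial>lborel)"
  by (simp add: interval_lebesgue_integral_def einterval_def set_lebesgue_integral_def greaterThan_def)
 moreover have "0 - F 0 = \<alpha> / (\<alpha>\<^sup>2 + b\<^sup>2)" by (simp add: F_def)
 ultimately show "(\<integral>t. indicator {0<..} t * (exp (- \<alpha> * t) * cos (t * b)) \<partial>lborel) = \<alpha> / (\<alpha>\<^sup>2 + b\<^sup>2)" by simp
qed

lemma integral_superposition:
 fixes g :: "nat => real => real"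
 assumes "!!k. integrable lborel (g k)" "!!t. summable (\<lambda>k. \<bar>g k t\<bar>)" "summable (\<lambda>k. \<integral>t. \<bar>g k t\<bar> \<partial>lborel)"
 shows "integrable lborel (\<lambda>t. \<Sum>k. g k t)" "(\<integral>t. (\<Sum>k. g k t) \<partial>lborel) = (\<Sum>k. \<integral>t. g k t \<partial>lborel)"
 by (rule integrable_suminf integral_suminf; use assms in simp)+

locale cosine_series =
 fixes l a :: "nat => real" and \<mu> :: real
 assumes mu: "\<mu> > 0" and l_nn: "!!k. 0 \<le> l k" and gap: "!!k. a k \<noteq> 0 ==> \<mu> \<le> l k"
  and rapid: "!!n. summable (\<lambda>k. l k ^ n * \<bar>a k\<bar>)"
  and null: "!!n. (\<lambda>k. l k ^ n * a k) sums 0"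
begin

definition W :: "real => real" where "W t = (\<Sum>k. cos (t * sqrt (l k)) * a k)"

lemma summable_abs: "summable (\<lambda>k. \<bar>a k\<bar>)" using rapid[of 0] by simp

lemma terms_summable: "summable (\<lambda>k. \<bar>cos (t * sqrt (l k)) * a k\<bar>)" "summable (\<lambda>k. cos (t * sqrt (l k)) * a k)"
proof -
 have "\<bar>cos (t * sqrt (l k)) * a k\<bar> \<le> 1 * \<bar>a k\<bar>" for k unfolding abs_mult by (rule mult_right_mono) auto
 then show "summable (\<lambda>k. \<bar>cos (t * sqrt (l k)) * a k\<bar>)"
  by (intro summable_comparison_test[OF _ summable_abs]) auto
 then show "summable (\<lambda>k. cos (t * sqrt (l k)) * a k)" by (rule summable_rabs_cancel)
qed

lemma W_bounded: "\<bar>W t\<bar> \<le> (\<Sum>k. \<bar>a k\<bar>)"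
proof -
 have "\<bar>W t\<bar> \<le> (\<Sum>k. \<bar>cos (t * sqrt (l k)) * a k\<bar>)" unfolding W_def by (rule summable_rabs[OF terms_summable(1)])
 also have "\<dots> \<le> (\<Sum>k. \<bar>a k\<bar>)"
 proof (rule suminf_le[OF _ terms_summable(1) summable_abs])
  show "\<bar>cos (t * sqrt (l k)) * a k\<bar> \<le> \<bar>a k\<bar>" for k
   using mult_right_mono[of "\<bar>cos (t * sqrt (l k))\<bar>" 1 "\<bar>a k\<bar>"] by (simp add: abs_mult)
 qed
 finally show ?thesis .
qed

lemma W_measurable [measurable]: "W \<in> borel_measurable borel" unfolding W_def[abs_def] by measurable

lemma laplace_W:
 assumes \<alpha>: "\<alpha> > 0"
 shows "(\<integral>t. indicator {0<..} t * (exp (- \<alpha> * t) * W t) \<partial>lborel) = (\<Sum>k. \<alpha> / (\<alpha>\<^sup>2 + l k) * a k)"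
proof -
 let ?E = "\<lambda>t::real. indicator {0<..} t * exp (- \<alpha> * t) :: real"
 let ?g = "\<lambda>k t. ?E t * (cos (t * sqrt (l k)) * a k)"
 have ie: "integrable lborel ?E" by (rule laplace_cos(1)[OF \<alpha>])
 have le: "\<bar>?g k t\<bar> \<le> ?E t * \<bar>a k\<bar>" for k t
 proof -
  have "?E t * (\<bar>cos (t * sqrt (l k))\<bar> * \<bar>a k\<bar>) \<le> ?E t * (1 * \<bar>a k\<bar>)" by (intro mult_left_mono mult_right_mono) auto
  then show ?thesis by (simp add: abs_mult)
 qed
 have ig: "integrable lborel (?g k)" for k
  by (rule Bochner_Integration.integrable_bound[OF integrable_mult_left[OF ie, of "\<bar>a k\<bar>"]]) (use le in \<open>auto simp: abs_mult\<close>)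
 have "(\<integral>t. (\<Sum>k. ?g k t) \<partial>lborel) = (\<Sum>k. \<integral>t. ?g k t \<partial>lborel)"
 proof (rule integral_superposition(2)[OF ig])
  show "summable (\<lambda>k. \<bar>?g k t\<bar>)" for t
   by (rule summable_comparison_test[OF _ summable_mult[OF summable_abs, of "?E t"]]) (use le in auto)
  have "(\<integral>t. \<bar>?g k t\<bar> \<partial>lborel) \<le> (\<integral>t. ?E t * \<bar>a k\<bar> \<partial>lborel)" for k
   by (rule integral_mono[OF integrable_abs[OF ig] integrable_mult_left[OF ie] le])
  then have "norm (\<integral>t. \<bar>?g k t\<bar> \<partial>lborel) \<le> (\<integral>t. ?E t \<partial>lborel) * \<bar>a k\<bar>" for k by simp
  then show "summable (\<lambda>k. \<integral>t. \<bar>?g k t\<bar> \<partial>lborel)"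
   by (intro summable_comparison_test[OF _ summable_mult[OF summable_abs]]) blast
 qed
 moreover have "(\<Sum>k. ?g k t) = indicator {0<..} t * (exp (- \<alpha> * t) * W t)" for t
  unfolding W_def using suminf_mult[OF terms_summable(2), of "?E t" t] by (simp add: mult.assoc)
 moreover have "(\<integral>t. ?g k t \<partial>lborel) = \<alpha> / (\<alpha>\<^sup>2 + l k) * a k" for k
 proof -
  have "(\<integral>t. ?g k t \<partial>lborel) = (\<integral>t. indicator {0<..} t * (exp (- \<alpha> * t) * cos (t * sqrt (l k))) * a k \<partial>lborel)"
   by (simp add: mult_ac)
  then show ?thesis using laplace_cos(2)[OF \<alpha>, of "sqrt (l k)"] l_nn[of k] by simp
 qed
 ultimately show ?thesis by simp
qed

text \<open>Subtracting Taylor polynomials from the cosines makes the integrals converge, and it does not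
 change the sum, because the moments of all integral orders vanish.\<close>

lemma mellin_W:
 assumes s: "0 < s" "s < 1"
 shows "integrable lborel (\<lambda>t. indicator {0<..} t * (t powr (2 * s - 3 - 2 * real n) * W t))"
  "(\<integral>t. indicator {0<..} t * (t powr (2 * s - 3 - 2 * real n) * W t) \<partial>lborel)
   = (\<Sum>k. l k powr (real n + 1 - s) * a k) * (\<integral>t. mellin_kernel s n t \<partial>lborel)"
proof -
 define p where "p = 2 * s - 3 - 2 * real n"
 define g where "g k t = indicator {0<..} t * (t powr p * cos_rest n (t * sqrt (l k))) * a k" for k t
 have ex: "sqrt (l k) powr (- p - 1) = l k powr (real n + 1 - s)" if "l k > 0" for k
 proof -
  have e: "1 / 2 * (- p - 1) = real n + 1 - s" by (simp add: p_def field_simps)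
  show ?thesis unfolding powr_half_sqrt[OF less_imp_le[OF that], symmetric] powr_powr e ..
 qed
 have pos: "a k = 0 \<or> l k > 0" for k using gap[of k] mu by linarith
 have sr: "summable (\<lambda>k. l k powr (real n + 1 - s) * \<bar>a k\<bar>)"
 proof (rule summable_comparison_test[OF _ summable_add[OF rapid[of 0] rapid[of "n + 1"]]])
  have "l k powr (real n + 1 - s) \<le> 1 + l k ^ (n + 1)" for k
  proof (cases "l k \<le> 1")
   case True
   then have "l k powr (real n + 1 - s) \<le> 1" using l_nn[of k] s by (intro powr_le1) auto
   then show ?thesis using l_nn[of k] zero_le_power[OF l_nn[of k], of "n + 1"] by linarith
  next
   case False
   then have "l k powr (real n + 1 - s) \<le> l k powr (real (n + 1))" using s by (intro powr_mono) auto
   then show ?thesis using False powr_realpow[of "l k" "n + 1"] by linarith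
  qed
  then have "l k powr (real n + 1 - s) * \<bar>a k\<bar> \<le> (1 + l k ^ (n + 1)) * \<bar>a k\<bar>" for k by (rule mult_right_mono) simp
  then show "\<exists>N. \<forall>k\<ge>N. norm (l k powr (real n + 1 - s) * \<bar>a k\<bar>) \<le> l k ^ 0 * \<bar>a k\<bar> + l k ^ (n + 1) * \<bar>a k\<bar>"
   by (simp add: distrib_right)
 qed
 have ig: "integrable lborel (g k)" for k
 proof (cases "a k = 0")
  case False
  then have "sqrt (l k) > 0" using pos[of k] by simp
  then show ?thesis unfolding g_def p_def by (intro integrable_mult_left mellin_kernel_scaled(1)[OF s])
 qed (simp add: g_def[abs_def])
 have int: "(\<integral>t. g k t \<partial>lborel) = l k powr (real n + 1 - s) * a k * (\<integral>t. mellin_kernel s n t \<partial>lborel)"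
  and inta: "(\<integral>t. \<bar>g k t\<bar> \<partial>lborel) = l k powr (real n + 1 - s) * \<bar>a k\<bar> * (\<integral>t. \<bar>mellin_kernel s n t\<bar> \<partial>lborel)" for k
 proof -
  have "(\<integral>t. g k t \<partial>lborel) = l k powr (real n + 1 - s) * a k * (\<integral>t. mellin_kernel s n t \<partial>lborel) \<and>
   (\<integral>t. \<bar>g k t\<bar> \<partial>lborel) = l k powr (real n + 1 - s) * \<bar>a k\<bar> * (\<integral>t. \<bar>mellin_kernel s n t\<bar> \<partial>lborel)"
  proof (cases "a k = 0")
   case False
   then have lk: "l k > 0" "sqrt (l k) > 0" using pos[of k] by simp_all
   show ?thesis
    using mellin_kernel_scaled(2,3)[OF s lk(2), of n] ex[OF lk(1)]
    unfolding g_def abs_mult[of _ "a k"] p_def[symmetric] by simp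
  qed (simp add: g_def)
  then show "(\<integral>t. g k t \<partial>lborel) = l k powr (real n + 1 - s) * a k * (\<integral>t. mellin_kernel s n t \<partial>lborel)"
   "(\<integral>t. \<bar>g k t\<bar> \<partial>lborel) = l k powr (real n + 1 - s) * \<bar>a k\<bar> * (\<integral>t. \<bar>mellin_kernel s n t\<bar> \<partial>lborel)" by blast+
 qed
 have sg: "summable (\<lambda>k. \<bar>g k t\<bar>)" for t
 proof (rule summable_comparison_test[OF _ summable_mult[OF rapid[of "n + 1"], of "t powr p * \<bar>t\<bar> ^ (2 * n + 2)"]])
  have "\<bar>g k t\<bar> \<le> t powr p * \<bar>t\<bar> ^ (2 * n + 2) * (l k ^ (n + 1) * \<bar>a k\<bar>)" for k
  proof -
   have sq: "sqrt (l k) ^ (2 * n + 2) = l k ^ (n + 1)"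
    using power_mult[of "sqrt (l k)" 2 "n + 1"] l_nn[of k] by simp
   have "\<bar>t * sqrt (l k)\<bar> ^ (2 * n + 2) = \<bar>t\<bar> ^ (2 * n + 2) * l k ^ (n + 1)"
    unfolding abs_mult power_mult_distrib sq[symmetric] using l_nn[of k] by simp
   then have "\<bar>cos_rest n (t * sqrt (l k))\<bar> \<le> \<bar>t\<bar> ^ (2 * n + 2) * l k ^ (n + 1)"
    using cos_rest_le(1)[of n "t * sqrt (l k)"] by (simp only:)
   then have "t powr p * \<bar>cos_rest n (t * sqrt (l k))\<bar> * \<bar>a k\<bar> \<le> t powr p * (\<bar>t\<bar> ^ (2 * n + 2) * l k ^ (n + 1)) * \<bar>a k\<bar>"
    by (intro mult_right_mono mult_left_mono) auto
   moreover have "\<bar>g k t\<bar> \<le> t powr p * \<bar>cos_rest n (t * sqrt (l k))\<bar> * \<bar>a k\<bar>"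
    by (simp add: g_def abs_mult indicator_def)
   ultimately show ?thesis by (simp only: mult.assoc)
  qed
  then show "\<exists>N. \<forall>k\<ge>N. norm \<bar>g k t\<bar> \<le> t powr p * \<bar>t\<bar> ^ (2 * n + 2) * (l k ^ (n + 1) * \<bar>a k\<bar>)" by simp
 qed
 have sum: "(\<Sum>k. g k t) = indicator {0<..} t * (t powr p * W t)" for t
 proof -
  have "(\<lambda>k. cos_coeff i * t ^ i * (sqrt (l k) ^ i * a k)) sums (cos_coeff i * t ^ i * 0)" for i
  proof (cases "even i")
   case True
   then obtain j where j: "i = 2 * j" by (elim evenE)
   have "sqrt (l k) ^ i = l k ^ j" for k unfolding j power_mult using l_nn[of k] by simp
   then have "(\<lambda>k. sqrt (l k) ^ i * a k) sums 0" using null[of j] by simp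
   then show ?thesis by (rule sums_mult)
  qed (simp add: cos_coeff_def)
  then have "(\<lambda>k. \<Sum>i<2 * n + 2. cos_coeff i * t ^ i * (sqrt (l k) ^ i * a k)) sums (\<Sum>i<2 * n + 2. cos_coeff i * t ^ i * 0)"
   by (rule sums_sum)
  then have "(\<lambda>k. cos (t * sqrt (l k)) * a k - (\<Sum>i<2 * n + 2. cos_coeff i * t ^ i * (sqrt (l k) ^ i * a k))) sums (W t - 0)"
   using terms_summable(2)[of t] unfolding W_def by (intro sums_diff) (simp_all add: summable_sums)
  moreover have "cos_rest n (t * sqrt (l k)) * a k =
    cos (t * sqrt (l k)) * a k - (\<Sum>i<2 * n + 2. cos_coeff i * t ^ i * (sqrt (l k) ^ i * a k))" for k
   unfolding cos_rest_def left_diff_distrib sum_distrib_right power_mult_distrib mult.assoc ..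
  ultimately have "(\<lambda>k. cos_rest n (t * sqrt (l k)) * a k) sums W t" by (simp only: diff_zero)
  then have "(\<lambda>k. (indicator {0<..} t * t powr p) * (cos_rest n (t * sqrt (l k)) * a k)) sums ((indicator {0<..} t * t powr p) * W t)"
   by (rule sums_mult)
  then show ?thesis unfolding g_def by (simp add: sums_iff mult.assoc)
 qed
 have s1: "summable (\<lambda>k. \<integral>t. \<bar>g k t\<bar> \<partial>lborel)" unfolding inta by (rule summable_mult2[OF sr])
 show "integrable lborel (\<lambda>t. indicator {0<..} t * (t powr (2 * s - 3 - 2 * real n) * W t))"
  using integral_superposition(1)[OF ig sg s1] unfolding sum p_def .
 have "summable (\<lambda>k. l k powr (real n + 1 - s) * a k)"
  by (rule summable_rabs_cancel) (use sr in \<open>simp add: abs_mult\<close>)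
 then show "(\<integral>t. indicator {0<..} t * (t powr (2 * s - 3 - 2 * real n) * W t) \<partial>lborel)
   = (\<Sum>k. l k powr (real n + 1 - s) * a k) * (\<integral>t. mellin_kernel s n t \<partial>lborel)"
  using integral_superposition(2)[OF ig sg s1] unfolding sum int p_def[symmetric] by (simp add: suminf_mult2[symmetric])
qed

lemma resolvent_limit: "(\<lambda>j. \<Sum>k. 1 / ((1 / real (Suc j))\<^sup>2 + l k) * a k) \<longlonglongrightarrow> (\<Sum>k. a k / l k)"
proof -
 have le: "\<bar>1 / (x + l k) * a k\<bar> \<le> 1 / \<mu> * \<bar>a k\<bar>" if "x \<ge> 0" for x k
 proof (cases "a k = 0")
  case False
  then have "\<mu> \<le> x + l k" using gap[of k] that by simp
  then have "1 / (x + l k) \<le> 1 / \<mu>" using mu by (intro divide_left_mono) auto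
  moreover have "1 / (x + l k) \<ge> 0" using \<open>\<mu> \<le> x + l k\<close> mu by simp
  ultimately show ?thesis unfolding abs_mult by (intro mult_right_mono) auto
 qed simp
 have s1: "summable (\<lambda>k. 1 / (x + l k) * a k)" if "x \<ge> 0" for x
  by (rule summable_comparison_test[OF _ summable_mult[OF summable_abs, of "1 / \<mu>"]]) (use le[OF that] in auto)
 define C where "C = 1 / \<mu> * (1 / \<mu>) * (\<Sum>k. \<bar>a k\<bar>)"
 have d: "\<bar>(\<Sum>k. 1 / (x + l k) * a k) - (\<Sum>k. a k / l k)\<bar> \<le> x * C" if x: "x \<ge> 0" for x
 proof -
  have eq: "(\<Sum>k. 1 / (x + l k) * a k) - (\<Sum>k. a k / l k) = (\<Sum>k. 1 / (x + l k) * a k - 1 / (0 + l k) * a k)"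
   using suminf_diff[OF s1[OF x] s1[of 0]] by simp
  have b: "\<bar>1 / (x + l k) * a k - 1 / (0 + l k) * a k\<bar> \<le> x * (1 / \<mu> * (1 / \<mu>)) * \<bar>a k\<bar>" for k
  proof (cases "a k = 0")
   case False
   then have m: "\<mu> \<le> l k" "0 < l k" using gap[of k] mu by auto
   define z where "z = 1 / (x + l k) * (1 / l k)"
   have "1 / (x + l k) - 1 / (0 + l k) = - (x * z)" using m x by (simp add: z_def field_simps)
   moreover have "z \<le> 1 / \<mu> * (1 / \<mu>)" unfolding z_def using m x mu by (intro mult_mono divide_left_mono) auto
   then have "x * z \<le> x * (1 / \<mu> * (1 / \<mu>))" using x by (rule mult_left_mono)
   moreover have "0 \<le> x * z" using m x by (simp add: z_def)
   ultimately have "\<bar>1 / (x + l k) - 1 / (0 + l k)\<bar> \<le> x * (1 / \<mu> * (1 / \<mu>))" by linarith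
   then have "\<bar>1 / (x + l k) - 1 / (0 + l k)\<bar> * \<bar>a k\<bar> \<le> x * (1 / \<mu> * (1 / \<mu>)) * \<bar>a k\<bar>" by (rule mult_right_mono) simp
   then show ?thesis by (simp only: left_diff_distrib[symmetric] abs_mult)
  qed simp
  have sb: "summable (\<lambda>k. x * (1 / \<mu> * (1 / \<mu>)) * \<bar>a k\<bar>)" by (rule summable_mult[OF summable_abs])
  have sd: "summable (\<lambda>k. \<bar>1 / (x + l k) * a k - 1 / (0 + l k) * a k\<bar>)"
   by (rule summable_comparison_test[OF _ sb]) (use b in auto)
  have "\<bar>\<Sum>k. 1 / (x + l k) * a k - 1 / (0 + l k) * a k\<bar> \<le> (\<Sum>k. \<bar>1 / (x + l k) * a k - 1 / (0 + l k) * a k\<bar>)" by (rule summable_rabs[OF sd])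
  also have "\<dots> \<le> (\<Sum>k. x * (1 / \<mu> * (1 / \<mu>)) * \<bar>a k\<bar>)" by (rule suminf_le[OF b sd sb])
  also have "\<dots> = x * C" unfolding C_def using suminf_mult[OF summable_abs, of "x * (1 / \<mu> * (1 / \<mu>))"] by (simp add: mult.assoc)
  finally show ?thesis unfolding eq .
 qed
 have "(\<lambda>j. (1 / real (Suc j))\<^sup>2 * C) \<longlonglongrightarrow> 0\<^sup>2 * C"
  using LIMSEQ_inverse_real_of_nat by (intro tendsto_mult_right tendsto_power) (simp add: inverse_eq_divide)
 then have l0: "(\<lambda>j. (1 / real (Suc j))\<^sup>2 * C) \<longlonglongrightarrow> 0" by simp
 have "(\<lambda>j. (\<Sum>k. 1 / ((1 / real (Suc j))\<^sup>2 + l k) * a k) - (\<Sum>k. a k / l k)) \<longlonglongrightarrow> 0"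
  by (rule Lim_null_comparison[OF _ l0]) (use d in auto)
 then show ?thesis by (rule LIM_zero_cancel)
qed

end

text \<open>In the variable \<open>y = t\<^sup>-\<^sup>2\<close> the kernel \<open>exp (- \<alpha> t)\<close> becomes this function, up to the factor
 \<open>t\<^sup>2\<^sup>s\<^sup>-\<^sup>3\<close>.  It is continuous up to \<open>y = 0\<close>, hence a uniform limit of polynomials on bounded intervals.\<close>

lemma kernel_continuous:
 fixes \<alpha> s Y :: real
 assumes \<alpha>: "\<alpha> > 0" and s: "0 < s" "s < 1"
 shows "continuous_on {0..Y} (\<lambda>y. if y = 0 then 0 else y powr (s - 3 / 2) * exp (- \<alpha> / sqrt y))" (is "continuous_on _ ?\<kappa>")
proof -
 have bd: "\<bar>?\<kappa> y\<bar> \<le> 256 / \<alpha> ^ 4 * y powr (s + 1 / 2)" if y: "y > 0" for y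
 proof -
  have "(\<alpha> / (4 * sqrt y)) ^ 4 \<le> exp (\<alpha> / (4 * sqrt y)) ^ 4"
  proof (rule power_mono)
   show "\<alpha> / (4 * sqrt y) \<le> exp (\<alpha> / (4 * sqrt y))" using exp_ge_add_one_self[of "\<alpha> / (4 * sqrt y)"] by linarith
  qed (use \<alpha> y in simp)
  also have "\<dots> = exp (\<alpha> / sqrt y)" by (simp add: exp_of_nat_mult[symmetric])
  finally have e: "exp (- \<alpha> / sqrt y) \<le> 1 / (\<alpha> / (4 * sqrt y)) ^ 4"
   using \<alpha> y by (simp add: exp_minus field_simps)
  have "sqrt y ^ 4 = y\<^sup>2" using y power_mult[of "sqrt y" 2 2] by simp
  then have "1 / (\<alpha> / (4 * sqrt y)) ^ 4 = 256 / \<alpha> ^ 4 * y\<^sup>2" by (simp add: power_divide power_mult_distrib)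
  then have le: "y powr (s - 3 / 2) * exp (- \<alpha> / sqrt y) \<le> y powr (s - 3 / 2) * (256 / \<alpha> ^ 4 * y\<^sup>2)"
   using e by (intro mult_left_mono) auto
  have "y powr (s - 3 / 2) * y\<^sup>2 = y powr (s - 3 / 2 + 2)" using y powr_realpow[of y 2] unfolding powr_add by simp
  also have "s - 3 / 2 + 2 = s + 1 / 2" by simp
  finally have p2: "y powr (s - 3 / 2) * y\<^sup>2 = y powr (s + 1 / 2)" .
  have "y powr (s - 3 / 2) * (256 / \<alpha> ^ 4 * y\<^sup>2) = 256 / \<alpha> ^ 4 * (y powr (s - 3 / 2) * y\<^sup>2)" by (simp only: mult_ac)
  then have "y powr (s - 3 / 2) * exp (- \<alpha> / sqrt y) \<le> 256 / \<alpha> ^ 4 * y powr (s + 1 / 2)"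
   using le unfolding p2 by (simp only:)
  then show ?thesis using y by simp
 qed
 have "isCont (\<lambda>y. 256 / \<alpha> ^ 4 * \<bar>y\<bar> powr (s + 1 / 2)) 0"
  unfolding isCont_def using s by (intro tendsto_intros) (auto intro!: tendsto_eq_intros)
 then have l0: "((\<lambda>y. 256 / \<alpha> ^ 4 * \<bar>y\<bar> powr (s + 1 / 2)) \<longlongrightarrow> 0) (at 0 within {0..Y})"
  unfolding isCont_def using tendsto_within_subset[OF _ subset_UNIV[of "{0..Y}"]] s by fastforce
 show ?thesis unfolding continuous_on_def
 proof
  fix x assume x: "x \<in> {0..Y}"
  show "(?\<kappa> \<longlongrightarrow> ?\<kappa> x) (at x within {0..Y})"
  proof (cases "x = 0")
   case True
   have "(?\<kappa> \<longlongrightarrow> 0) (at 0 within {0..Y})"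
   proof (rule Lim_null_comparison[OF _ l0])
    show "\<forall>\<^sub>F y in at 0 within {0..Y}. norm (?\<kappa> y) \<le> 256 / \<alpha> ^ 4 * \<bar>y\<bar> powr (s + 1 / 2)"
     unfolding eventually_at_filter using bd by (intro always_eventually) auto
   qed
   then show ?thesis using True by simp
  next
   case False
   then have xp: "x > 0" using x by simp
   have "isCont (\<lambda>y. y powr (s - 3 / 2) * exp (- \<alpha> / sqrt y)) x" using xp by (intro continuous_intros) auto
   then have "((\<lambda>y. y powr (s - 3 / 2) * exp (- \<alpha> / sqrt y)) \<longlongrightarrow> ?\<kappa> x) (at x)" using xp by (simp add: isCont_def)
   moreover have "\<forall>\<^sub>F y in at x. y powr (s - 3 / 2) * exp (- \<alpha> / sqrt y) = ?\<kappa> y"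
    using eventually_at_in_open'[of "{0<..}" x] xp by (auto elim!: eventually_mono)
   ultimately have "(?\<kappa> \<longlongrightarrow> ?\<kappa> x) (at x)" by (rule Lim_transform_eventually)
   then show ?thesis by (rule tendsto_within_subset) simp
  qed
 qed
qed

text \<open>The moments on the left are those of the measure that \<open>w\<close> defines in the variable \<open>y = t\<^sup>-\<^sup>2\<close>;
 since \<open>w\<close> vanishes near \<open>0\<close>, that measure lives on a bounded interval, where moments determine it.\<close>

lemma vanishing_moments_laplace:
 fixes w :: "real => real"
 assumes s: "0 < s" "s < 1" and [measurable]: "w \<in> borel_measurable borel"
  and bd: "!!t. \<bar>w t\<bar> \<le> B" and c: "c > 0" "!!t. 0 \<le> t ==> t < c ==> w t = 0"
  and int: "!!n. integrable lborel (\<lambda>t. indicator {0<..} t * (t powr (2 * s - 3 - 2 * real n) * w t))"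
  and mom: "!!n. (\<integral>t. indicator {0<..} t * (t powr (2 * s - 3 - 2 * real n) * w t) \<partial>lborel) = 0"
  and \<alpha>: "\<alpha> > 0"
 shows "(\<integral>t. indicator {0<..} t * (exp (- \<alpha> * t) * w t) \<partial>lborel) = 0" (is "?I = 0")
proof -
 let ?Y = "c powr (-2)"
 define \<kappa> where "\<kappa> y = (if y = 0 then 0 else y powr (s - 3 / 2) * exp (- \<alpha> / sqrt y))" for y
 have ck: "continuous_on {0..?Y} \<kappa>" unfolding \<kappa>_def[abs_def] by (rule kernel_continuous[OF \<alpha> s])
 let ?h = "\<lambda>t::real. indicator {c..} t * t powr (2 * s - 3)"
 have ih: "integrable lborel ?h"
  by (rule integrable_of_has_integral[OF _ _ _ has_integral_powr_to_inf]) (use s c in auto)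
 have B: "B \<ge> 0" using bd[of 0] by linarith
 define C where "C = B * (\<integral>t. ?h t \<partial>lborel)"
 have small: "\<bar>?I\<bar> \<le> \<epsilon> * C" if eps: "\<epsilon> > 0" for \<epsilon>
 proof -
  obtain g where g: "real_polynomial_function g" "!!y. y \<in> {0..?Y} ==> \<bar>\<kappa> y - g y\<bar> < \<epsilon>"
   using Stone_Weierstrass_real_polynomial_function[OF compact_Icc ck eps] by metis
  obtain q N where q: "g = (\<lambda>y. \<Sum>i\<le>N. q i * y ^ i)" using real_polynomial_function_imp_sum[OF g(1)] by metis
  let ?m = "\<lambda>i t. q i * (indicator {0<..} t * (t powr (2 * s - 3 - 2 * real i) * w t))"
  let ?e = "\<lambda>t. indicator {0<..} t * (exp (- \<alpha> * t) * w t)"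
  define E P where "E = ?e" and "P t = (\<Sum>i\<le>N. ?m i t)" for t
  have ie: "integrable lborel E" unfolding E_def
  proof (rule Bochner_Integration.integrable_bound[OF integrable_mult_left[OF laplace_cos(1)[OF \<alpha>], of B]])
   have "norm (?e t) \<le> norm (indicator {0<..} t * exp (- \<alpha> * t) * B)" for t
    using mult_left_mono[OF bd[of t], of "exp (- \<alpha> * t)"] B by (simp add: indicator_def abs_mult)
   then show "AE t in lborel. norm (?e t) \<le> norm (indicator {0<..} t * exp (- \<alpha> * t) * B)" by (rule AE_I2)
  qed measurable
  have im: "integrable lborel P"
   unfolding P_def[abs_def] by (intro Bochner_Integration.integrable_sum integrable_mult_right int)
  have "(\<integral>t. P t \<partial>lborel) = (\<Sum>i\<le>N. \<integral>t. ?m i t \<partial>lborel)"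
   unfolding P_def by (rule Bochner_Integration.integral_sum) (intro integrable_mult_right int)
  also have "\<dots> = 0" using mom by simp
  finally have "integral\<^sup>L lborel E = (\<integral>t. E t - P t \<partial>lborel)"
   using Bochner_Integration.integral_diff[OF ie im] by simp
  also have "\<bar>\<dots>\<bar> \<le> (\<integral>t. \<bar>E t - P t\<bar> \<partial>lborel)" by (rule integral_abs_bound)
  also have "\<dots> \<le> (\<integral>t. \<epsilon> * B * ?h t \<partial>lborel)"
  proof (rule integral_mono)
   show "integrable lborel (\<lambda>t. \<bar>E t - P t\<bar>)"
    by (rule integrable_abs[OF Bochner_Integration.integrable_diff[OF ie im]])
   show "integrable lborel (\<lambda>t. \<epsilon> * B * ?h t)" by (rule integrable_mult_right[OF ih])
   fix t :: real
   show "\<bar>E t - P t\<bar> \<le> \<epsilon> * B * ?h t"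
   proof (cases "c \<le> t")
    case True
    then have t: "t > 0" using c(1) by simp
    define y where "y = t powr (-2)"
    have y: "y > 0" "y \<in> {0..?Y}" using t True c(1) by (auto simp: y_def intro!: powr_mono2')
    have "sqrt y = t powr (- 1)" using t by (simp add: y_def powr_half_sqrt[symmetric] powr_powr)
    then have sy: "sqrt y = 1 / t" using t by (simp add: powr_minus_divide)
    have "t powr (2 * s - 3) * y powr (s - 3 / 2) = 1"
     using t by (simp add: y_def powr_powr powr_add[symmetric] field_simps)
    then have 1: "exp (- \<alpha> * t) = t powr (2 * s - 3) * \<kappa> y"
     using y(1) by (simp add: \<kappa>_def sy mult.assoc[symmetric])
    have 2: "t powr (2 * s - 3 - 2 * real i) = t powr (2 * s - 3) * y ^ i" for i
    proof -
     have "y ^ i = y powr (real i)" using y(1) by (simp add: powr_realpow)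
     also have "\<dots> = t powr (- (2 * real i))" unfolding y_def powr_powr by simp
     finally show ?thesis by (simp add: powr_add[symmetric])
    qed
    have "E t - P t = t powr (2 * s - 3) * (\<kappa> y - g y) * w t"
    proof -
     have "P t = t powr (2 * s - 3) * g y * w t"
      unfolding P_def q 2 using t by (simp add: sum_distrib_left sum_distrib_right mult_ac)
     moreover have "E t = t powr (2 * s - 3) * \<kappa> y * w t" unfolding E_def 1 using t by simp
     ultimately show ?thesis by (simp add: algebra_simps)
    qed
    moreover have "\<bar>t powr (2 * s - 3) * (\<kappa> y - g y) * w t\<bar> \<le> t powr (2 * s - 3) * \<epsilon> * B"
     unfolding abs_mult using g(2)[OF y(2)] bd[of t] eps by (intro mult_mono) auto
    ultimately show ?thesis using True by (simp add: mult_ac)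
   next
    case False
    then have "t \<le> 0 \<or> w t = 0" using c(2)[of t] by linarith
    then have "E t = 0" "P t = 0" by (auto simp: E_def P_def)
    then show ?thesis using False by simp
   qed
  qed
  also have "\<dots> = \<epsilon> * C" by (simp add: C_def)
  finally show ?thesis unfolding E_def .
 qed
 have "C \<ge> 0" unfolding C_def using B by (intro mult_nonneg_nonneg Bochner_Integration.integral_nonneg) auto
 show ?thesis
 proof (rule ccontr)
  assume nz: "?I \<noteq> 0"
  let ?d = "\<bar>?I\<bar> / (2 * (C + 1))"
  have "?d > 0" using nz \<open>C \<ge> 0\<close> by simp
  from small[OF this] have "\<bar>?I\<bar> \<le> \<bar>?I\<bar> * (C / (2 * (C + 1)))" by simp
  moreover have "C / (2 * (C + 1)) < 1" using \<open>C \<ge> 0\<close> by simp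
  then have "\<bar>?I\<bar> * (C / (2 * (C + 1))) < \<bar>?I\<bar> * 1" using nz by (intro mult_strict_left_mono) auto
  ultimately show False by simp
 qed
qed

lemma inverse_sums_agree:
 assumes A: "cosine_series l1 a1 \<mu>1" and B: "cosine_series l2 a2 \<mu>2" and s: "0 < s" "s < 1"
  and c: "c > 0" "!!t. 0 \<le> t ==> t < c ==> (\<Sum>k. cos (t * sqrt (l1 k)) * a1 k) = (\<Sum>k. cos (t * sqrt (l2 k)) * a2 k)"
  and ag: "!!n. (\<Sum>k. l1 k powr (real n + 1 - s) * a1 k) = (\<Sum>k. l2 k powr (real n + 1 - s) * a2 k)"
 shows "(\<Sum>k. a1 k / l1 k) = (\<Sum>k. a2 k / l2 k)"
proof -
 interpret A: cosine_series l1 a1 \<mu>1 by (rule A)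
 interpret B: cosine_series l2 a2 \<mu>2 by (rule B)
 have res: "(\<Sum>k. 1 / (\<alpha>\<^sup>2 + l1 k) * a1 k) = (\<Sum>k. 1 / (\<alpha>\<^sup>2 + l2 k) * a2 k)" if \<alpha>: "\<alpha> > 0" for \<alpha>
 proof -
  have split: "indicator {0<..} t * (x * (A.W t - B.W t)) = indicator {0<..} t * (x * A.W t) - indicator {0<..} t * (x * B.W t)" for t x :: real
   by (simp add: right_diff_distrib)
  have ex: "integrable lborel (\<lambda>t. indicator {0<..} t * (exp (- \<alpha> * t) * V t))"
   if [measurable]: "V \<in> borel_measurable borel" and V: "!!t. \<bar>V t\<bar> \<le> K" for V :: "real => real" and K
  proof (rule Bochner_Integration.integrable_bound[OF integrable_mult_left[OF laplace_cos(1)[OF \<alpha>], of K]])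
   show "AE t in lborel. norm (indicator {0<..} t * (exp (- \<alpha> * t) * V t)) \<le> norm (indicator {0<..} t * exp (- \<alpha> * t) * K)"
    using V by (auto simp: indicator_def abs_mult intro!: mult_left_mono intro: order_trans[OF _ abs_ge_self])
  qed measurable
  have "(\<integral>t. indicator {0<..} t * (exp (- \<alpha> * t) * (A.W t - B.W t)) \<partial>lborel) = 0"
  proof (rule vanishing_moments_laplace[OF s _ _ c(1) _ _ _ \<alpha>])
   show "\<bar>A.W t - B.W t\<bar> \<le> (\<Sum>k. \<bar>a1 k\<bar>) + (\<Sum>k. \<bar>a2 k\<bar>)" for t using A.W_bounded[of t] B.W_bounded[of t] by linarith
   show "A.W t - B.W t = 0" if "0 \<le> t" "t < c" for t using c(2)[OF that] by (simp add: A.W_def B.W_def)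
   show "integrable lborel (\<lambda>t. indicator {0<..} t * (t powr (2 * s - 3 - 2 * real n) * (A.W t - B.W t)))" for n
    unfolding split by (intro Bochner_Integration.integrable_diff A.mellin_W(1) B.mellin_W(1) s)
   show "(\<integral>t. indicator {0<..} t * (t powr (2 * s - 3 - 2 * real n) * (A.W t - B.W t)) \<partial>lborel) = 0" for n
    unfolding split Bochner_Integration.integral_diff[OF A.mellin_W(1)[OF s] B.mellin_W(1)[OF s]]
     A.mellin_W(2)[OF s] B.mellin_W(2)[OF s] ag by simp
  qed measurable
  then have "(\<Sum>k. \<alpha> / (\<alpha>\<^sup>2 + l1 k) * a1 k) = (\<Sum>k. \<alpha> / (\<alpha>\<^sup>2 + l2 k) * a2 k)"
   unfolding split Bochner_Integration.integral_diff[OF ex[OF A.W_measurable A.W_bounded] ex[OF B.W_measurable B.W_bounded]]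
    A.laplace_W[OF \<alpha>] B.laplace_W[OF \<alpha>] by simp
  moreover have "summable (\<lambda>k. 1 / (\<alpha>\<^sup>2 + l k) * a k)" if "cosine_series l a \<mu>" for l a \<mu>
  proof -
   interpret C: cosine_series l a \<mu> by (rule that)
   have "\<bar>1 / (\<alpha>\<^sup>2 + l k) * a k\<bar> \<le> 1 / \<alpha>\<^sup>2 * \<bar>a k\<bar>" for k
    unfolding abs_mult using C.l_nn[of k] \<alpha> by (intro mult_right_mono) (auto simp: frac_le)
   then show ?thesis by (intro summable_comparison_test[OF _ summable_mult[OF C.summable_abs, of "1 / \<alpha>\<^sup>2"]]) auto
  qed
  note this[OF A] this[OF B]
  ultimately show ?thesis
   using suminf_mult[of "\<lambda>k. 1 / (\<alpha>\<^sup>2 + l1 k) * a1 k" \<alpha>] suminf_mult[of "\<lambda>k. 1 / (\<alpha>\<^sup>2 + l2 k) * a2 k" \<alpha>] \<alpha> by simp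
 qed
 have "(\<Sum>k. 1 / ((1 / real (Suc j))\<^sup>2 + l1 k) * a1 k) = (\<Sum>k. 1 / ((1 / real (Suc j))\<^sup>2 + l2 k) * a2 k)" for j
  by (rule res) simp
 then show ?thesis using LIMSEQ_unique[OF A.resolvent_limit] B.resolvent_limit by simp
qed

section \<open>Transplantation along an isometry\<close>

locale isometric_pieces = A: closed_manifold M + B: closed_manifold N
 for M :: "('a::t2_space, 'n::finite) riemannian" and N :: "('b::t2_space, 'n) riemannian" +
 fixes S :: "'a set" and T :: "'b set" and F :: "'a => 'b"
 assumes opS: "open S" and opT: "open T" and F: "diffeo_on M N S T F" and Fmet: "pulls_back_metric_on M N S F"
begin

abbreviation "tr \<equiv> transplant F S T"
abbreviation "Fi \<equiv> the_inv_into S F"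

lemma bij: "bij_betw F S T" using F by (simp add: diffeo_on_def)

lemma F_in: "p \<in> S ==> F p \<in> T" using bij by (auto simp: bij_betw_def)

lemma Fi_F [simp]: "p \<in> S ==> Fi (F p) = p" using bij by (simp add: bij_betw_def the_inv_into_f_f)

lemma F_Fi [simp]: "q \<in> T ==> F (Fi q) = q" using bij by (auto simp: bij_betw_def f_the_inv_into_f)

lemma Fi_in: "q \<in> T ==> Fi q \<in> S" using bij by (auto simp: bij_betw_def intro!: the_inv_into_into)

lemma cont_F: "continuous_on S F" and cont_Fi: "continuous_on T Fi"
 using F by (auto simp: diffeo_on_def smooth_map_on_def)

lemma tr_F [simp]: "p \<in> S ==> tr f (F p) = f p" by (simp add: transplant_def F_in)

lemma tr_outside: "q \<notin> T ==> tr f q = 0" by (simp add: transplant_def)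

lemma tr_diff_cmult: "tr (\<lambda>p. f p - c * h p) = (\<lambda>q. tr f q - c * tr h q)" by (auto simp: transplant_def)

lemma tr_mult: "tr (\<lambda>p. f p * h p) = (\<lambda>q. tr f q * tr h q)" by (auto simp: transplant_def)

lemma spt_tr: assumes "f \<in> A.TF S" shows "B.spt (tr f) \<subseteq> F ` A.spt f" "closed (F ` A.spt f)" "F ` A.spt f \<subseteq> T"
proof -
 have K: "A.spt f \<subseteq> S" using assms by (simp add: A.TF_iff)
 have "compact (A.spt f)" by (rule A.compact_subset_M[OF closed_closure])
 then have "compact (F ` A.spt f)" by (rule compact_continuous_image[OF continuous_on_subset[OF cont_F K]])
 then show 1: "closed (F ` A.spt f)" by (rule compact_imp_closed)
 show "F ` A.spt f \<subseteq> T" using K F_in by blast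
 show "B.spt (tr f) \<subseteq> F ` A.spt f"
 proof (rule B.spt_le[OF 1])
  fix q assume q: "q \<notin> F ` A.spt f"
  show "tr f q = 0"
  proof (cases "q \<in> T")
   case True
   then have "Fi q \<notin> A.spt f" using q by (metis F_Fi image_eqI)
   then have "f (Fi q) = 0" by (rule A.spt_zero)
   then show ?thesis by (simp add: transplant_def)
  qed (simp add: tr_outside)
 qed
qed

lemma tr_TF: assumes f: "f \<in> A.TF S" shows "tr f \<in> B.TF T"
proof -
 have fS: "f \<in> A.SF" using f by (rule A.TF_SF)
 have "smooth_on (B.im d) (\<lambda>y. tr f (param d y))" if d: "d \<in> atlas N" for d
 proof (rule smooth_on_local)
  fix y assume y: "y \<in> B.im d"
  let ?q = "param d y"
  have qd: "?q \<in> cdom d" by (rule B.param_in[OF d y])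
  show "\<exists>V. y \<in> V \<and> smooth_on V (\<lambda>y. tr f (param d y))"
  proof (cases "?q \<in> T")
   case True
   obtain c where c: "c \<in> atlas M" "Fi ?q \<in> cdom c" by (rule A.chart_cover)
   let ?V = "coord d ` {q \<in> cdom d \<inter> T. Fi q \<in> cdom c}" and ?U = "coord c ` {p \<in> cdom c \<inter> S. F p \<in> cdom d}"
   have iso: "domain_isometry ?U (A.met c) ?V (B.met d) (coord d \<circ> F \<circ> param c) (coord c \<circ> Fi \<circ> param d)"
    by (rule A.isometry_in_charts[OF B.closed opS opT F Fmet c(1) d])
   have V: "open ?V" using iso_metric(2)[OF iso] by (simp add: metric_on_def)
   have "?U \<subseteq> A.im c" by (auto simp: A.coord_in[OF c(1)])
   then have fU: "smooth_on ?U (\<lambda>x. f (param c x))" by (rule smooth_on_subset[OF A.SF_smooth[OF fS c(1)]])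
   have sm: "smooth_on ?V (\<lambda>z. f (param c ((coord c \<circ> Fi \<circ> param d) z)))"
    using iso by (intro smooth_on_compose[OF V _ _ fU]) (auto simp only: domain_isometry_def image_subset_iff)
   have eq: "f (param c ((coord c \<circ> Fi \<circ> param d) z)) = tr f (param d z)" if "z \<in> ?V" for z
    using that by (auto simp: B.param_coord[OF d] A.param_coord[OF c(1)] transplant_def)
   have sV: "smooth_on ?V (\<lambda>y. tr f (param d y))"
    by (rule smooth_on_cong[where f = "\<lambda>z. f (param c ((coord c \<circ> Fi \<circ> param d) z))", OF V eq sm])
   have "y = coord d ?q" using y by (simp add: B.coord_param[OF d])
   moreover have "?q \<in> {q \<in> cdom d \<inter> T. Fi q \<in> cdom c}" using True qd c(2) by simp
   ultimately have yV: "y \<in> ?V" by (rule image_eqI)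
   show ?thesis by (rule exI[where x = ?V], rule conjI[OF yV sV])
  next
   case False
   let ?V = "coord d ` (cdom d \<inter> - (F ` A.spt f))"
   have "open (cdom d \<inter> - (F ` A.spt f))" by (rule open_Int[OF B.open_cdom[OF d] open_Compl[OF spt_tr(2)[OF f]]])
   then have V: "open ?V" by (rule B.open_coord_image[OF d _ Int_lower1])
   have z: "0 = tr f (param d z)" if z: "z \<in> ?V" for z
   proof -
    obtain q where q: "q \<in> cdom d" "q \<notin> F ` A.spt f" "z = coord d q" using z by (elim imageE IntE ComplE) (rule that)
    then have "q \<notin> B.spt (tr f)" using subsetD[OF spt_tr(1)[OF f]] by (elim contrapos_nn)
    then have "tr f q = 0" by (rule B.spt_zero)
    then show ?thesis using q by (simp add: B.param_coord[OF d])
   qed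
   have sV: "smooth_on ?V (\<lambda>y. tr f (param d y))"
    by (rule smooth_on_cong[where f = "\<lambda>z. 0", OF V z smooth_on_const])
   have "y = coord d ?q" using y by (simp add: B.coord_param[OF d])
   moreover have "?q \<in> cdom d \<inter> - (F ` A.spt f)"
    using False qd spt_tr(3)[OF f] by blast
   ultimately have yV: "y \<in> ?V" by (rule image_eqI)
   show ?thesis by (rule exI[where x = ?V], rule conjI[OF yV sV])
  qed
 qed
 then show ?thesis unfolding B.TF_iff B.SF_iff using subset_trans[OF spt_tr(1)[OF f] spt_tr(3)[OF f]] by (intro conjI ballI)
qed

lemma tr_laplacian: assumes f: "f \<in> A.TF S" shows "tr (A.\<Delta> f) = B.\<Delta> (tr f)"
proof (rule ext)
 fix q
 have g: "tr f \<in> B.SF" by (rule B.TF_SF[OF tr_TF[OF f]])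
 show "tr (A.\<Delta> f) q = B.\<Delta> (tr f) q"
 proof (cases "q \<in> T")
  case True
  have "A.\<Delta> f (Fi q) = B.\<Delta> (tr f) (F (Fi q))"
   by (rule A.laplacian_isometry[OF B.closed opS opT F Fmet A.TF_SF[OF f] g _ Fi_in[OF True]]) simp
  then show ?thesis using True by (simp add: transplant_def)
 next
  case False
  then have "q \<notin> B.spt (B.\<Delta> (tr f))" using spt_tr[OF f] B.spt_laplacian[OF g] by blast
  then have "B.\<Delta> (tr f) q = 0" by (rule B.spt_zero)
  then show ?thesis using False by (simp add: tr_outside)
 qed
qed

lemma tr_lap_pow: assumes "f \<in> A.TF S" shows "(A.\<Delta> ^^ j) f \<in> A.TF S \<and> tr ((A.\<Delta> ^^ j) f) = (B.\<Delta> ^^ j) (tr f)"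
 by (induction j) (use assms in \<open>auto simp: tr_laplacian A.TF_laplacian\<close>)

text \<open>On a set that both charts cover, the volume measures correspond; partitions of unity globalise this.\<close>

lemma integral_tr: assumes f: "f \<in> A.TF S" shows "(\<integral>q. tr f q \<partial>B.RV) = (\<integral>p. f p \<partial>A.RV)"
proof -
 define P where "P f \<longleftrightarrow> f \<in> A.TF S \<and> (\<integral>q. tr f q \<partial>B.RV) = (\<integral>p. f p \<partial>A.RV)" for f
 have "P f"
 proof (rule A.localise[where P = P])
  show "f \<in> A.SF" by (rule A.TF_SF[OF f])
  show "P (\<lambda>q. g q + h q)" if "P g" "P h" for g h
  proof -
   have t: "g \<in> A.TF S" "h \<in> A.TF S" using that by (simp_all add: P_def)
   have "tr (\<lambda>p. g p + h p) = (\<lambda>q. tr g q + tr h q)" by (auto simp: transplant_def)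
   moreover have "integrable B.RV (tr g)" "integrable B.RV (tr h)" "integrable A.RV g" "integrable A.RV h"
    by (rule B.SF_integrable[OF B.TF_SF[OF tr_TF[OF t(1)]]] B.SF_integrable[OF B.TF_SF[OF tr_TF[OF t(2)]]]
      A.SF_integrable[OF A.TF_SF[OF t(1)]] A.SF_integrable[OF A.TF_SF[OF t(2)]])+
   ultimately show ?thesis using that A.TF_add[OF t] by (simp add: P_def)
  qed
 next
  fix p
  show "\<exists>W. open W \<and> p \<in> W \<and> (\<forall>b\<in>A.TF W. P (\<lambda>q. b q * f q))"
  proof (cases "p \<in> S")
   case False
   then have pf: "p \<notin> A.spt f" using f by (auto simp: A.TF_iff)
   show ?thesis
   proof (intro exI[of _ "- A.spt f"] conjI ballI)
    show "open (- A.spt f)" by (rule open_Compl[OF closed_closure])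
    show "p \<in> - A.spt f" using pf by simp
    fix b assume b: "b \<in> A.TF (- A.spt f)"
    have "b q * f q = 0" for q
    proof (cases "q \<in> A.spt f")
     case True
     then have "q \<notin> A.spt b" using b by (auto simp: A.TF_iff)
     then have "b q = 0" by (rule A.spt_zero)
     then show ?thesis by simp
    next
     case False
     then have "f q = 0" by (rule A.spt_zero)
     then show ?thesis by simp
    qed
    then have e: "(\<lambda>q. b q * f q) = (\<lambda>q. 0)" by (rule ext)
    show "P (\<lambda>q. b q * f q)" unfolding e using A.TF_zero by (simp add: P_def transplant_def)
   qed
  next
   case True
   obtain c where c: "c \<in> atlas M" "p \<in> cdom c" by (rule A.chart_cover)
   obtain d where d: "d \<in> atlas N" "F p \<in> cdom d" by (rule B.chart_cover)
   define W where "W = cdom c \<inter> (F -` cdom d \<inter> S)"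
   have "open (F -` cdom d \<inter> S)" using iffD1[OF continuous_on_open_vimage[OF opS] cont_F] B.open_cdom[OF d(1)] by blast
   then have W: "open W" unfolding W_def by (rule open_Int[OF A.open_cdom[OF c(1)]])
   have WS: "W \<subseteq> S" "W \<subseteq> cdom c" "F ` W \<subseteq> cdom d" "F ` W \<subseteq> T" using F_in by (auto simp: W_def)
   have "F ` W = Fi -` W \<inter> T"
   proof (rule set_eqI)
    fix q
    have "q \<in> F ` W" if "q \<in> T" "Fi q \<in> W" using that by (intro image_eqI[of _ _ "Fi q"]) simp_all
    moreover have "q \<in> T \<and> Fi q \<in> W" if qW: "q \<in> F ` W"
    proof -
     from qW obtain x where x: "q = F x" "x \<in> W" by (rule imageE)
     then have "x \<in> S" using WS(1) by blast
     then show ?thesis using x F_in by simp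
    qed
    ultimately show "q \<in> F ` W \<longleftrightarrow> q \<in> Fi -` W \<inter> T" by blast
   qed
   moreover have "open (Fi -` W \<inter> T)" using iffD1[OF continuous_on_open_vimage[OF opT] cont_Fi] W by blast
   ultimately have FW: "open (F ` W)" by (simp only:)
   define H where "H x = (if x \<in> W then F x else F p)" for x
   have "F \<in> borel_measurable (restrict_space borel W)"
    by (rule borel_measurable_continuous_on_restrict[OF continuous_on_subset[OF cont_F WS(1)]])
   then have H: "H \<in> borel \<rightarrow>\<^sub>M borel" unfolding H_def[abs_def]
    using W by (subst measurable_If_restrict_space_iff) (auto simp: borel_open)
   have mW: "W \<in> sets borel" "F ` W \<in> sets borel" using W FW by auto
   have sA: "sets (density A.RV (indicator W)) = sets borel" by (simp add: A.riem_volume_works(1))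
   have mH: "H \<in> density A.RV (indicator W) \<rightarrow>\<^sub>M borel"
    unfolding measurable_cong_sets[OF sA refl] by (rule H)
   have push: "distr (density A.RV (indicator W)) borel H = density B.RV (indicator (F ` W))"
   proof (rule measure_eqI)
    show "sets (distr (density A.RV (indicator W)) borel H) = sets (density B.RV (indicator (F ` W)))"
     by (simp add: B.riem_volume_works(1))
    fix X assume "X \<in> sets (distr (density A.RV (indicator W)) borel H)"
    then have X: "X \<in> sets borel" by simp
    have HX: "H -` X \<in> sets borel" using measurable_sets[OF H X] by simp
    have "emeasure (distr (density A.RV (indicator W)) borel H) X = emeasure (density A.RV (indicator W)) (H -` X)"
     using emeasure_distr[OF mH, of X] X by simp
    also have "\<dots> = emeasure A.RV (W \<inter> H -` X)"
     using HX mW by (subst emeasure_restricted) (auto simp: A.riem_volume_works(1))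
    also have "\<dots> = emeasure (A.nu c) (W \<inter> H -` X)"
     using HX mW WS by (intro A.riem_volume_works(2)[OF c(1)]) auto
    also have "\<dots> = emeasure (B.nu d) (F ` W \<inter> X)"
    proof (rule A.emeasure_nu_isometry[OF B.closed opS opT F Fmet c(1) d(1)])
     show "q \<in> W \<inter> H -` X \<longleftrightarrow> F q \<in> F ` W \<inter> X" if "q \<in> S" for q
     proof -
      have "F q \<in> F ` W \<longleftrightarrow> q \<in> W" using bij that WS(1) by (intro inj_on_image_mem_iff[of F S]) (simp_all add: bij_betw_def)
      then show ?thesis by (simp add: H_def conj_commute cong: conj_cong)
     qed
     show "W \<inter> H -` X \<in> sets borel" "F ` W \<inter> X \<in> sets borel" using HX X mW by (simp_all add: sets.Int)
     show "W \<inter> H -` X \<subseteq> cdom c \<inter> S" "F ` W \<inter> X \<subseteq> cdom d \<inter> T" using WS by blast+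
    qed
    also have "\<dots> = emeasure B.RV (F ` W \<inter> X)"
     using X mW WS by (intro B.riem_volume_works(2)[OF d(1), symmetric]) auto
    also have "\<dots> = emeasure (density B.RV (indicator (F ` W))) X"
     using X mW by (subst emeasure_restricted) (auto simp: B.riem_volume_works(1))
    finally show "emeasure (distr (density A.RV (indicator W)) borel H) X = emeasure (density B.RV (indicator (F ` W))) X" .
   qed
   have "P (\<lambda>q. b q * f q)" if b: "b \<in> A.TF W" for b
   proof -
    let ?w = "\<lambda>q. b q * f q"
    have w: "?w \<in> A.TF S" using A.TF_mult[OF A.TF_SF[OF b] f] .
    have w0: "?w q = 0" if "q \<notin> W" for q
    proof -
     have "q \<notin> A.spt b" using that b by (auto simp: A.TF_iff)
     then have "b q = 0" by (rule A.spt_zero)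
     then show ?thesis by simp
    qed
    have tw0: "tr ?w q = 0" if q: "q \<notin> F ` W" for q
    proof (cases "q \<in> T")
     case True
     then have "Fi q \<notin> W" using q by (metis F_Fi image_eqI)
     then show ?thesis using w0 by (simp add: transplant_def)
    qed (simp add: tr_outside)
    have mw: "?w \<in> borel_measurable borel" "tr ?w \<in> borel_measurable borel"
     using A.SF_measurable[OF A.TF_SF[OF w]] B.SF_measurable[OF B.TF_SF[OF tr_TF[OF w]]] .
    have "(\<integral>q. tr ?w q \<partial>B.RV) = (\<integral>q. indicator (F ` W) q * tr ?w q \<partial>B.RV)"
     by (rule Bochner_Integration.integral_cong) (auto simp: indicator_def tw0)
    also have "\<dots> = (\<integral>q. tr ?w q \<partial>density B.RV (indicator (F ` W)))"
     using mw mW integral_density[of "tr ?w" B.RV "indicator (F ` W)"] by (simp add: ennreal_indicator)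
    also have "\<dots> = (\<integral>q. tr ?w (H q) \<partial>density A.RV (indicator W))"
     unfolding push[symmetric] by (rule integral_distr[OF mH mw(2)])
    also have "\<dots> = (\<integral>q. indicator W q * tr ?w (H q) \<partial>A.RV)"
     using mw mW H integral_density[of "\<lambda>q. tr ?w (H q)" A.RV "indicator W"]
      measurable_compose[OF H mw(2)] by (simp add: ennreal_indicator)
    also have "\<dots> = (\<integral>q. ?w q \<partial>A.RV)"
    proof (rule Bochner_Integration.integral_cong[OF refl])
     fix q show "indicator W q * tr ?w (H q) = ?w q"
     proof (cases "q \<in> W")
      case True then show ?thesis using WS(1) tr_F[of q ?w] by (auto simp: H_def)
     qed (use w0 in simp)
    qed
    finally show ?thesis using w by (simp add: P_def)
   qed
   note loc = this
   have pW: "p \<in> W" using True c(2) d(2) by (simp add: W_def)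
   show ?thesis
   proof (intro exI[of _ W] conjI ballI)
    fix b assume b: "b \<in> A.TF W"
    show "P (\<lambda>q. b q * f q)" by (rule loc[OF b])
   qed (rule W pW)+
  qed
 qed
 then show ?thesis by (simp add: P_def)
qed

lemma ip_tr: assumes "f \<in> A.TF S" "h \<in> A.TF S" shows "B.ip (tr f) (tr h) = A.ip f h"
 using integral_tr[OF A.TF_mult[OF A.TF_SF[OF assms(1)] assms(2)]] by (simp add: l2_inner_def tr_mult)

end

section \<open>From the fractional to the local potentials\<close>

lemma (in closed_manifold) test_function_nonzero_mean:
 assumes W: "open W" "p \<in> W" shows "\<exists>b. b \<in> TF W \<and> (\<integral>q. b q \<partial>RV) \<noteq> 0"
proof -
 obtain b V where b: "b \<in> TF W" "\<forall>q. 0 \<le> b q \<and> b q \<le> 1" "open V" "p \<in> V" "\<forall>q\<in>V. b q = 1"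
  using bump_at[OF W] by (elim exE conjE) (rule that)
 have "(\<integral>q. b q \<partial>RV) \<noteq> 0"
 proof
  assume z: "(\<integral>q. b q \<partial>RV) = 0"
  have "b p = 0" by (rule continuous_integral_zero[OF SF_continuous[OF TF_SF[OF b(1)]] _ z]) (simp add: b(2))
  then show False using b(4,5) by simp
 qed
 then show ?thesis using b(1) by (intro exI[of _ b] conjI)
qed

lemma (in closed_manifold) TF_diff_cmult:
 assumes "f \<in> TF S" "h \<in> TF S" shows "(\<lambda>p. f p - c * h p) \<in> TF S"
 using TF_add[OF assms(1) TF_cmult[OF assms(2), of "- c"]] by simp

lemma (in closed_manifold) multiplication_bounded:
 assumes c: "c \<in> SF"
 shows "\<exists>m\<ge>0. \<forall>d\<in>SF. sqrt (ip (\<lambda>p. c p * d p) (\<lambda>p. c p * d p)) \<le> m * sqrt (ip d d)"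
proof -
 have "compact (c ` UNIV)" by (rule compact_continuous_image[OF SF_continuous[OF c] compact_M])
 then have "bounded (c ` UNIV)" by (rule compact_imp_bounded)
 then obtain m where m': "\<forall>x\<in>c ` UNIV. norm x \<le> m" unfolding bounded_iff by (rule exE)
 have m: "\<bar>c p\<bar> \<le> m" for p using m' by simp
 have m0: "m \<ge> 0" using m[of undefined] by linarith
 have "sqrt (ip (\<lambda>p. c p * d p) (\<lambda>p. c p * d p)) \<le> m * sqrt (ip d d)" if d: "d \<in> SF" for d
 proof -
  have i: "integrable RV (\<lambda>p. (c p * d p) * (c p * d p))"
   by (rule SF_mult_integrable[OF SF_mult[OF c d] SF_mult[OF c d]])
  have i2: "integrable RV (\<lambda>p. m\<^sup>2 * (d p * d p))" by (rule integrable_mult_right[OF SF_mult_integrable[OF d d]])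
  have le: "(c p * d p) * (c p * d p) \<le> m\<^sup>2 * (d p * d p)" for p
  proof -
   have "(c p)\<^sup>2 \<le> m\<^sup>2" using abs_le_square_iff[of "c p" m] m[of p] m0 by simp
   then have "(c p)\<^sup>2 * (d p * d p) \<le> m\<^sup>2 * (d p * d p)" by (rule mult_right_mono) (rule zero_le_square)
   then show ?thesis by (simp add: power2_eq_square mult_ac)
  qed
  have "ip (\<lambda>p. c p * d p) (\<lambda>p. c p * d p) \<le> m\<^sup>2 * ip d d"
   using integral_mono[OF i i2 le] unfolding l2_inner_def Bochner_Integration.integral_mult_right_zero .
  then have "sqrt (ip (\<lambda>p. c p * d p) (\<lambda>p. c p * d p)) \<le> sqrt (m\<^sup>2 * ip d d)" by (rule real_sqrt_le_mono)
  also have "\<dots> = m * sqrt (ip d d)" using m0 by (simp add: real_sqrt_mult)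
  finally show ?thesis .
 qed
 then show ?thesis using m0 by (intro exI[of _ m] conjI ballI)
qed

context spectral
begin

lemma co_zero_fun: "co (\<lambda>p. 0) k = 0" by (simp add: co_def l2_inner_def)

definition pot :: "real => ('a => real) => ('a => real) => real" where
 "pot r f h = (\<Sum>k. l k powr (- r) * co f k * co h k)"

lemma pot_eq_ser: "f \<in> SF ==> h \<in> SF ==> ser (sol r (dist_of M f)) h = pot r f h"
 by (simp add: ser_def sol_def pot_def dist_of_e)

lemma pot_sym: "pot r f h = pot r h f" by (simp add: pot_def mult_ac)

lemma pot_coeff_summable: assumes "r > 0" "f \<in> SF" shows "summable (\<lambda>k. (l k powr (- r) * co f k)\<^sup>2)"
proof -
 have "summable (\<lambda>k. (sol r (dist_of M f) k)\<^sup>2)"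
  by (rule sol_summable(2)[OF assms(1) dist_of_sobolev]) (use assms in auto)
 then show ?thesis by (simp add: sol_def dist_of_e[OF assms(2)])
qed

lemma pot_summable: "r > 0 ==> f \<in> SF ==> h \<in> SF ==> summable (\<lambda>k. l k powr (- r) * co f k * co h k)"
 by (rule l2_seq_product(2)[OF pot_coeff_summable co_sq_summable])

lemma pot_bounded:
 assumes "r > 0" "f \<in> SF" "h \<in> SF"
 shows "\<bar>pot r f h\<bar> \<le> sqrt (\<Sum>k. (l k powr (- r) * co f k)\<^sup>2) * sqrt (ip h h)"
 using l2_seq_product(3)[OF pot_coeff_summable[OF assms(1,2)] co_sq_summable[OF assms(3)]]
 by (simp add: pot_def co_sq_suminf[OF assms(3)])

lemma pot_diff_cmult:
 assumes r: "r > 0" and f: "f \<in> SF" and g: "g \<in> SF" and h: "h \<in> SF"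
 shows "pot r f (\<lambda>p. g p - c * h p) = pot r f g - c * pot r f h"
proof -
 have cc: "co (\<lambda>p. g p - c * h p) k = co g k - c * co h k" for k
  using co_diff[OF g SF_cmult[OF h]] by (simp add: co_cmult)
 have e: "l k powr (- r) * co f k * co (\<lambda>p. g p - c * h p) k
   = l k powr (- r) * co f k * co g k - c * (l k powr (- r) * co f k * co h k)" for k
  unfolding cc by (simp add: algebra_simps)
 show ?thesis unfolding pot_def e
  suminf_diff[OF pot_summable[OF r f g] summable_mult[OF pot_summable[OF r f h]], symmetric]
  suminf_mult[OF pot_summable[OF r f h], symmetric] ..
qed

text \<open>Applying the Laplacian to the second function cancels the inverse of the eigenvalue; a mean zero
first function has no component along the constants, so that a plain inner product remains.\<close>

lemma pot_laplacian:
 assumes f: "f \<in> SF" "co f 0 = 0" and h: "h \<in> SF" shows "pot 1 f (\<Delta> h) = - ip f h"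
proof -
 have "l k powr (- 1) * co f k * co (\<Delta> h) k = - (co f k * co h k)" for k
 proof (cases "k = 0")
  case False
  then have "l k powr (- 1) * l k = 1" using l_pos(2)[of k] by (simp add: powr_minus)
  then have "(l k powr (- 1) * l k) * (co f k * co h k) = co f k * co h k" by simp
  then show ?thesis by (simp add: co_laplacian[OF h] mult_ac)
 qed (simp add: f)
 then show ?thesis using sums_minus[OF parseval[OF f(1) h]] by (simp add: pot_def sums_iff)
qed

lemma product_cosine_series:
 assumes f: "f \<in> SF" "co f 0 = 0" and h: "h \<in> SF" and disj: "spt f \<inter> spt h = {}"
 shows "cosine_series l (\<lambda>k. co f k * co h k) (l 1)"
proof
 have p: "l k ^ n * (co f k * co h k) = (- 1) ^ n * (co ((\<Delta> ^^ n) f) k * co h k)" for k n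
  unfolding co_lap_pow[OF f(1)] power_minus[of "l k"] by (simp add: mult.assoc[symmetric] power_mult_distrib[symmetric])
 show "l 1 > 0" by (rule l1)
 show "0 \<le> l k" for k by (rule l_nonneg)
 show "l 1 \<le> l k" if "co f k * co h k \<noteq> 0" for k
  using that f(2) l_pos(1)[of k] by (cases "k = 0") auto
 show "summable (\<lambda>k. l k ^ n * \<bar>co f k * co h k\<bar>)" for n
 proof -
  have "l k ^ n * \<bar>co f k * co h k\<bar> = \<bar>co ((\<Delta> ^^ n) f) k * co h k\<bar>" for k
  proof -
   have "l k ^ n * \<bar>co f k * co h k\<bar> = \<bar>l k ^ n * (co f k * co h k)\<bar>" using l_nonneg[of k] by (simp add: abs_mult)
   then show ?thesis unfolding p by (simp add: abs_mult)
  qed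
  then show ?thesis using co_prod_summable[OF SF_lap_pow[OF f(1)] h, of n] by (simp only:)
 qed
 show "(\<lambda>k. l k ^ n * (co f k * co h k)) sums 0" for n
 proof -
  have sp: "spt ((\<Delta> ^^ n) f) \<subseteq> spt f"
  proof (induction n)
   case (Suc n)
   then show ?case using spt_laplacian[OF SF_lap_pow[OF f(1)], of n] by simp
  qed simp
  have "(\<Delta> ^^ n) f p * h p = 0" for p
  proof (cases "p \<in> spt f")
   case True
   then have "p \<notin> spt h" using disj by blast
   then have "h p = 0" by (rule spt_zero)
   then show ?thesis by simp
  next
   case False
   then have "p \<notin> spt ((\<Delta> ^^ n) f)" using sp by blast
   then have "(\<Delta> ^^ n) f p = 0" by (rule spt_zero)
   then show ?thesis by simp
  qed
  then have "ip ((\<Delta> ^^ n) f) h = 0" unfolding l2_inner_def by (simp only: Bochner_Integration.integral_zero)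
  then have "(\<lambda>k. co ((\<Delta> ^^ n) f) k * co h k) sums 0" using parseval[OF SF_lap_pow[OF f(1)] h, of n] by simp
  then have "(\<lambda>k. (- 1) ^ n * (co ((\<Delta> ^^ n) f) k * co h k)) sums ((- 1) ^ n * 0)" by (rule sums_mult)
  then show ?thesis unfolding p by simp
 qed
qed

text \<open>Applying powers of the Laplacian to the source shifts the exponent \<open>- s\<close> by integers, so that one
fractional potential yields all the powers \<open>n + 1 - s\<close>.\<close>

lemma pot_lap_pow:
 assumes s: "s > 0" and f: "f \<in> SF" "co f 0 = 0" and h: "h \<in> SF"
 shows "(\<Sum>k. l k powr (real n + 1 - s) * (co f k * co h k)) = (- 1) ^ Suc n * pot s ((\<Delta> ^^ Suc n) f) h"
proof -
 have t: "l k powr (real n + 1 - s) * (co f k * co h k) = (- 1) ^ Suc n * (l k powr (- s) * co ((\<Delta> ^^ Suc n) f) k * co h k)" for k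
 proof (cases "k = 0")
  case True then show ?thesis unfolding co_lap_pow[OF f(1)] using f(2) by simp
 next
  case False
  then have lk: "l k > 0" using l_pos(2)[of k] by simp
  have "real n + 1 - s = real (Suc n) + - s" by simp
  then have "l k powr (real n + 1 - s) = l k powr (real (Suc n) + - s)" by (simp only:)
  also have "\<dots> = l k ^ Suc n * l k powr (- s)" unfolding powr_add powr_realpow[OF lk] ..
  finally have "l k powr (real n + 1 - s) = (- 1) ^ Suc n * (- l k) ^ Suc n * l k powr (- s)"
   by (simp only: power_mult_distrib[symmetric]) simp
  then show ?thesis unfolding co_lap_pow[OF f(1)] by (simp only: mult_ac)
 qed
 show ?thesis unfolding t pot_def by (rule suminf_mult[OF pot_summable[OF s SF_lap_pow[OF f(1)] h]])
qed

end

locale isometric_spectra = isometric_pieces M N S T F + A: spectral M e1 l1 + B: spectral N e2 l2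
 for M :: "('a::t2_space, 'n::finite) riemannian" and N :: "('b::t2_space, 'n) riemannian"
  and S T F e1 l1 e2 l2 +
 fixes s :: real
 assumes s: "0 < s" "s < 1" and agree: "frac_maps_agree M e1 l1 S N e2 l2 T F s" and proper: "S \<noteq> UNIV"
begin

lemma tr_mean_zero: "f \<in> A.TF S ==> B.co (tr f) 0 = 0 \<longleftrightarrow> A.co f 0 = 0"
 using A.kappa_nz B.kappa_nz by (simp add: A.co_zero_eq B.co_zero_eq integral_tr)

lemma frac_pot_agree:
 assumes f: "f \<in> A.TF S" "A.co f 0 = 0" and h: "h \<in> A.TF S"
 shows "A.pot s f h = B.pot s (tr f) (tr h)"
proof -
 note S = A.TF_SF[OF f(1)] A.TF_SF[OF h] B.TF_SF[OF tr_TF[OF f(1)]] B.TF_SF[OF tr_TF[OF h]]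
 have s0: "s \<ge> 0" using s by simp
 have m: "mean_zero (dist_of M f)" "mean_zero (dist_of N (tr f))"
  using A.mean_zero_dist_of[OF S(1)] B.mean_zero_dist_of[OF S(3)] tr_mean_zero[OF f(1)] f(2) by simp_all
 have ss: "same_source M e1 l1 S N e2 l2 T F (- s) (dist_of M f) (dist_of N (tr f))"
  unfolding same_source_def using f(1) A.sobolev_tendsto_const B.sobolev_tendsto_const by (intro exI[of _ "\<lambda>m. f"]) simp
 have "frac_source_to_solution M e1 l1 s S (dist_of M f) = pullback_dist M F S T (frac_source_to_solution N e2 l2 s T (dist_of N (tr f)))"
  by (rule mp[OF bspec[OF bspec[OF agree[unfolded frac_maps_agree_def] A.dist_of_sobolev_tilde[OF f(1) s0]]
    B.dist_of_sobolev_tilde[OF tr_TF[OF f(1)] s0]] conjI[OF m(1) conjI[OF m(2) ss]]])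
 then have "restrict_dist M S (A.ser (A.sol s (dist_of M f))) h
   = pullback_dist M F S T (restrict_dist N T (B.ser (B.sol s (dist_of N (tr f))))) h"
  unfolding A.frac_source_to_solution_eq[OF s(1) A.dist_of_sobolev[OF S(1) s0] m(1)]
   B.frac_source_to_solution_eq[OF s(1) B.dist_of_sobolev[OF S(3) s0] m(2)] by (rule fun_cong)
 then show ?thesis
  using h tr_TF[OF h] by (simp add: restrict_dist_def pullback_dist_def A.pot_eq_ser[OF S(1,2)] B.pot_eq_ser[OF S(3,4)])
qed

text \<open>For disjoint supports all moments of integral order vanish and the wave does not arrive before a
positive time, on both manifolds; the fractional powers then determine the power \<open>- 1\<close>.\<close>

text \<open>The difference \<open>D\<close> of the two sides vanishes if the second function lives away from the support of
\<open>f\<close>, and on Laplacians. A cutoff of an eigenfunction that equals it near the support of \<open>f\<close> is, up to a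
multiple of its Laplacian, supported away from there, so that only the constant eigenfunction is left.\<close>

lemma pot_agree_disjoint:
 assumes f: "f \<in> A.TF S" "A.co f 0 = 0" and h: "h \<in> A.TF S" and disj: "A.spt f \<inter> A.spt h = {}"
 shows "A.pot 1 f h = B.pot 1 (tr f) (tr h)"
proof -
 note S = A.TF_SF[OF f(1)] A.TF_SF[OF h] B.TF_SF[OF tr_TF[OF f(1)]] B.TF_SF[OF tr_TF[OF h]]
 have f0: "B.co (tr f) 0 = 0" using tr_mean_zero f by simp
 have sub: "A.spt f \<subseteq> S" "A.spt h \<subseteq> S" using f h by (simp_all add: A.TF_iff)
 have im: False if q: "q \<in> F ` A.spt f" "q \<in> F ` A.spt h" for q
 proof -
  from q(1) obtain x where x: "q = F x" "x \<in> A.spt f" by (rule imageE)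
  from q(2) obtain y where y: "q = F y" "y \<in> A.spt h" by (rule imageE)
  have "Fi q = x" unfolding x(1) by (rule Fi_F[OF subsetD[OF sub(1) x(2)]])
  moreover have "Fi q = y" unfolding y(1) by (rule Fi_F[OF subsetD[OF sub(2) y(2)]])
  ultimately have "x = y" by simp
  then have "x \<in> A.spt f \<inter> A.spt h" using x(2) y(2) by (intro IntI) simp_all
  then show False unfolding disj by (rule emptyE)
 qed
 have disj': "B.spt (tr f) \<inter> B.spt (tr h) = {}"
 proof (rule equals0I)
  fix q assume q: "q \<in> B.spt (tr f) \<inter> B.spt (tr h)"
  show False by (rule im[OF subsetD[OF spt_tr(1)[OF f(1)] IntD1[OF q]] subsetD[OF spt_tr(1)[OF h] IntD2[OF q]]])
 qed
 obtain c1 where c1: "c1 > 0" "\<forall>t. 0 \<le> t \<and> t < c1 \<longrightarrow> A.wave f h t = 0"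
  using A.finite_speed[OF S(1,2) disj] by (elim exE conjE) (rule that)
 obtain c2 where c2: "c2 > 0" "\<forall>t. 0 \<le> t \<and> t < c2 \<longrightarrow> B.wave (tr f) (tr h) t = 0"
  using B.finite_speed[OF S(3,4) disj'] by (elim exE conjE) (rule that)
 have main: "(\<Sum>k. A.co f k * A.co h k / l1 k) = (\<Sum>k. B.co (tr f) k * B.co (tr h) k / l2 k)"
 proof (rule inverse_sums_agree[OF A.product_cosine_series[OF S(1) f(2) S(2) disj] B.product_cosine_series[OF S(3) f0 S(4) disj'] s])
  show "min c1 c2 > 0" using c1(1) c2(1) by simp
  show "(\<Sum>k. cos (t * sqrt (l1 k)) * (A.co f k * A.co h k)) = (\<Sum>k. cos (t * sqrt (l2 k)) * (B.co (tr f) k * B.co (tr h) k))"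
   if "0 \<le> t" "t < min c1 c2" for t
  proof -
   have "A.wave f h t = 0" by (rule mp[OF spec[OF c1(2)]]) (use that in simp)
   moreover have "B.wave (tr f) (tr h) t = 0" by (rule mp[OF spec[OF c2(2)]]) (use that in simp)
   ultimately show ?thesis unfolding A.wave_def B.wave_def by (simp only:)
  qed
  show "(\<Sum>k. l1 k powr (real n + 1 - s) * (A.co f k * A.co h k)) = (\<Sum>k. l2 k powr (real n + 1 - s) * (B.co (tr f) k * B.co (tr h) k))" for n
  proof -
   let ?g = "(A.\<Delta> ^^ Suc n) f"
   have g: "?g \<in> A.TF S" "tr ?g = (B.\<Delta> ^^ Suc n) (tr f)" using tr_lap_pow[OF f(1), of "Suc n"] by blast+
   have "A.co ?g 0 = 0" unfolding A.co_lap_pow[OF S(1)] using f(2) by simp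
   from frac_pot_agree[OF g(1) this h] show ?thesis
    unfolding A.pot_lap_pow[OF s(1) S(1) f(2) S(2)] B.pot_lap_pow[OF s(1) S(3) f0 S(4)] g(2) by (simp only:)
  qed
 qed
 have r: "x powr (- 1) * y * z = y * z / x" if "x \<ge> 0" for x y z :: real
  using that by (cases "x = 0") (simp_all add: powr_minus field_simps)
 show ?thesis unfolding A.pot_def B.pot_def r[OF A.l_nonneg] r[OF B.l_nonneg] by (rule main)
qed

lemma pot_agree:
 assumes f: "f \<in> A.TF S" "A.co f 0 = 0" and h: "h \<in> A.TF S" and ne: "S \<noteq> {}"
 shows "A.pot 1 f h = B.pot 1 (tr f) (tr h)"
proof -
 have fS: "f \<in> A.SF" by (rule A.TF_SF[OF f(1)])
 have tS: "tr w \<in> B.SF" if "w \<in> A.TF S" for w by (rule B.TF_SF[OF tr_TF[OF that]])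
 define D where "D w = A.pot 1 f w - B.pot 1 (tr f) (tr w)" for w
 have D_lin: "D (\<lambda>p. v p - c * w p) = D v - c * D w" if "v \<in> A.TF S" "w \<in> A.TF S" for v w c
  unfolding D_def tr_diff_cmult A.pot_diff_cmult[OF zero_less_one fS A.TF_SF[OF that(1)] A.TF_SF[OF that(2)]]
   B.pot_diff_cmult[OF zero_less_one tS[OF f(1)] tS[OF that(1)] tS[OF that(2)]] by (simp add: algebra_simps)
 have D_disj: "D w = 0" if "w \<in> A.TF S" "A.spt f \<inter> A.spt w = {}" for w
  using pot_agree_disjoint[OF f that] by (simp add: D_def)
 have D_lap: "D (A.\<Delta> w) = 0" if w: "w \<in> A.TF S" for w
 proof -
  have "B.co (tr f) 0 = 0" using tr_mean_zero f by simp
  then have "B.pot 1 (tr f) (B.\<Delta> (tr w)) = - A.ip f w"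
   using B.pot_laplacian[OF tS[OF f(1)] _ tS[OF w]] ip_tr[OF f(1) w] by simp
  then show ?thesis unfolding D_def tr_laplacian[OF w] A.pot_laplacian[OF fS f(2) A.TF_SF[OF w]] by simp
 qed
 have K: "closed (A.spt f)" "A.spt f \<subseteq> S" using f(1) by (simp_all add: A.TF_iff)
 obtain ct V where ct: "ct \<in> A.TF S" "open V" "A.spt f \<subseteq> V" "\<forall>q\<in>V. ct q = 1"
  using A.cutoff[OF K opS] by (elim exE conjE) (rule that)
 have ctS: "ct \<in> A.SF" by (rule A.TF_SF[OF ct(1)])
 have cw: "(\<lambda>p. w p * ct p) \<in> A.TF S" if "w \<in> A.SF" for w by (rule A.TF_mult[OF that ct(1)])
 have far: "A.spt f \<inter> A.spt w = {}" if "!!p. p \<in> V ==> w p = 0" for w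
 proof -
  have "A.spt w \<subseteq> - V" by (rule A.spt_le) (use that ct(2) in auto)
  then show ?thesis using ct(3) by blast
 qed
 have De: "D (\<lambda>p. e1 k p * ct p) = 0" if k: "k > 0" for k
 proof -
  let ?w = "\<lambda>p. e1 k p * ct p"
  have w: "?w \<in> A.TF S" by (rule cw[OF A.e_SF])
  have lw: "A.\<Delta> ?w \<in> A.TF S" by (rule A.TF_laplacian[OF w])
  let ?r = "\<lambda>p. A.\<Delta> ?w p - (- l1 k) * ?w p"
  have r: "?r \<in> A.TF S" by (rule A.TF_diff_cmult[OF lw w])
  have rz: "?r p = 0" if p: "p \<in> V" for p
  proof -
   have "A.\<Delta> ?w p = A.\<Delta> (e1 k) p"
    by (rule A.laplacian_local[OF A.TF_SF[OF w] A.e_SF ct(2) p]) (use ct(4) in simp)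
   then show ?thesis using ct(4) p by (simp add: A.laplacian_e)
  qed
  have "D ?r = 0" by (rule D_disj[OF r far]) (rule rz)
  moreover have "D ?r = D (A.\<Delta> ?w) - (- l1 k) * D ?w" by (rule D_lin[OF lw w])
  ultimately show ?thesis using D_lap[OF w] A.l_pos(2)[OF k] by simp
 qed
 define D0 where "D0 = D (\<lambda>p. e1 0 p * ct p)"
 text \<open>By continuity in \<open>L\<^sup>2\<close>, only the mean of the second function can matter.\<close>
 have Dh: "D w = A.co w 0 * D0" if w: "w \<in> A.TF S" for w
 proof -
  have wS: "w \<in> A.SF" by (rule A.TF_SF[OF w])
  have wc: "(\<lambda>p. w p * ct p) \<in> A.TF S" by (rule cw[OF wS])
  have r: "(\<lambda>p. w p - 1 * (w p * ct p)) \<in> A.TF S" by (rule A.TF_diff_cmult[OF w wc])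
  have "D (\<lambda>p. w p - 1 * (w p * ct p)) = 0" by (rule D_disj[OF r far]) (simp add: ct(4))
  then have Dw: "D w = D (\<lambda>p. w p * ct p)" using D_lin[OF w wc, of 1] by simp
  define C where "C = sqrt (\<Sum>k. (l1 k powr (- 1) * A.co f k)\<^sup>2) + sqrt (\<Sum>k. (l2 k powr (- 1) * B.co (tr f) k)\<^sup>2)"
  have Dbd: "\<bar>D v\<bar> \<le> C * sqrt (A.ip v v)" if v: "v \<in> A.TF S" for v
   using A.pot_bounded[OF zero_less_one fS A.TF_SF[OF v]] B.pot_bounded[OF zero_less_one tS[OF f(1)] tS[OF v]]
   unfolding ip_tr[OF v v] D_def C_def distrib_right by linarith
  have ps: "D (\<lambda>p. A.ps w n p * ct p) = (\<Sum>k<n. A.co w k * D (\<lambda>p. e1 k p * ct p))" for n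
  proof (induction n)
   case 0
   have "D (\<lambda>p. 0 - 0 * 0) = D (\<lambda>p. 0) - 0 * D (\<lambda>p. 0)" by (rule D_lin[OF A.TF_zero A.TF_zero])
   moreover have "D (\<lambda>p. 0) = 0" by (rule D_disj[OF A.TF_zero far]) (rule refl)
   ultimately show ?case by (simp add: A.ps_def)
  next
   case (Suc n)
   have pt: "A.ps w (Suc n) p * ct p = A.ps w n p * ct p - (- A.co w n) * (e1 n p * ct p)" for p
    by (simp add: A.ps_def distrib_right)
   have "D (\<lambda>p. A.ps w (Suc n) p * ct p) = D (\<lambda>p. A.ps w n p * ct p - (- A.co w n) * (e1 n p * ct p))"
    by (rule arg_cong[where f = D], rule ext, rule pt)
   also have "\<dots> = D (\<lambda>p. A.ps w n p * ct p) - (- A.co w n) * D (\<lambda>p. e1 n p * ct p)"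
    by (rule D_lin[OF cw[OF A.ps_SF] cw[OF A.e_SF]])
   also have "\<dots> = (\<Sum>k<n. A.co w k * D (\<lambda>p. e1 k p * ct p)) + A.co w n * D (\<lambda>p. e1 n p * ct p)"
    unfolding Suc by (simp only: mult_minus_left diff_minus_eq_add)
   finally show ?case unfolding sum.lessThan_Suc .
  qed
  have psv: "D (\<lambda>p. A.ps w (Suc n) p * ct p) = A.co w 0 * D0" for n
  proof -
   have "(\<Sum>k<n. A.co w (Suc k) * D (\<lambda>p. e1 (Suc k) p * ct p)) = 0"
    by (rule sum.neutral, rule ballI) (simp only: De[OF zero_less_Suc] mult_zero_right)
   then show ?thesis unfolding ps D0_def sum.lessThan_Suc_shift by (simp only: add_0_right)
  qed
  obtain m where m: "m \<ge> 0"
   "\<forall>d\<in>A.SF. sqrt (A.ip (\<lambda>p. ct p * d p) (\<lambda>p. ct p * d p)) \<le> m * sqrt (A.ip d d)"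
   using A.multiplication_bounded[OF ctS] by (elim exE conjE) (rule that)
  let ?d = "\<lambda>n p. w p - A.ps w n p"
  have C0: "C \<ge> 0" unfolding C_def
   by (intro add_nonneg_nonneg real_sqrt_ge_zero suminf_nonneg[OF A.pot_coeff_summable[OF zero_less_one fS]]
     suminf_nonneg[OF B.pot_coeff_summable[OF zero_less_one tS[OF f(1)]]] zero_le_power2)
  have bd: "\<bar>D w - A.co w 0 * D0\<bar> \<le> C * (m * sqrt (A.ip (?d (Suc n)) (?d (Suc n))))" for n
  proof -
   define x u where "x = (\<lambda>p. w p * ct p)" and "u = (\<lambda>p. A.ps w (Suc n) p * ct p)"
   define v where "v = (\<lambda>p. x p - 1 * u p)"
   define dn where "dn = (\<lambda>p. w p - A.ps w (Suc n) p)"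
   have xS: "x \<in> A.TF S" unfolding x_def by (rule wc)
   have uS: "u \<in> A.TF S" unfolding u_def by (rule cw[OF A.ps_SF])
   have v: "v \<in> A.TF S" unfolding v_def by (rule A.TF_diff_cmult[OF xS uS])
   have dnS: "dn \<in> A.SF" unfolding dn_def by (rule A.SF_diff[OF wS A.ps_SF])
   have "D v = D x - 1 * D u" unfolding v_def by (rule D_lin[OF xS uS])
   moreover have "D x = D w" unfolding x_def by (rule Dw[symmetric])
   moreover have "D u = A.co w 0 * D0" unfolding u_def by (rule psv)
   ultimately have Dv: "D v = D w - A.co w 0 * D0" by linarith
   have alg: "y * c - 1 * (z * c) = c * (y - z)" for y z c :: real by (simp add: algebra_simps)
   have "v p = ct p * dn p" for p unfolding v_def x_def u_def dn_def by (rule alg)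
   then have vd: "v = (\<lambda>p. ct p * dn p)" by (rule ext)
   have "sqrt (A.ip v v) \<le> m * sqrt (A.ip dn dn)" unfolding vd by (rule bspec[OF m(2) dnS])
   then have "C * sqrt (A.ip v v) \<le> C * (m * sqrt (A.ip dn dn))" by (rule mult_left_mono[OF _ C0])
   with Dbd[OF v] have "\<bar>D v\<bar> \<le> C * (m * sqrt (A.ip dn dn))" by (rule order_trans)
   then show ?thesis unfolding Dv dn_def .
  qed
  have "(\<lambda>n. A.ip (?d (Suc n)) (?d (Suc n))) \<longlonglongrightarrow> 0" by (rule LIMSEQ_Suc[OF A.ps_converges[OF wS]])
  then have "(\<lambda>n. C * (m * sqrt (A.ip (?d (Suc n)) (?d (Suc n))))) \<longlonglongrightarrow> C * (m * sqrt 0)"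
   by (intro tendsto_mult_left tendsto_real_sqrt)
  then have "\<bar>D w - A.co w 0 * D0\<bar> \<le> C * (m * sqrt 0)" by (rule LIMSEQ_le_const) (rule exI[of _ 0], rule allI, rule impI, rule bd)
  then show ?thesis by simp
 qed
 text \<open>As \<open>S\<close> is not closed, there is a function of nonzero mean on \<open>S\<close> away from the support of \<open>f\<close>.\<close>
 have "A.spt f \<noteq> S"
 proof
  assume "A.spt f = S"
  then have "closed S" using K(1) by simp
  then have "S \<inter> UNIV = {} \<or> - S \<inter> UNIV = {}"
   by (intro connectedD[OF A.connected_M opS] open_Compl) simp_all
  then have "S = {} \<or> S = UNIV" by auto
  then show False using ne proper by blast
 qed
 then obtain p where p: "p \<in> S - A.spt f" using K(2) by blast
 obtain b where b: "b \<in> A.TF (S - A.spt f)" "(\<integral>q. b q \<partial>A.RV) \<noteq> 0"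
  using A.test_function_nonzero_mean[OF open_Diff[OF opS K(1)] p] by (elim exE conjE) (rule that)
 have bsub: "A.spt b \<subseteq> S - A.spt f" using b(1) by (simp add: A.TF_iff)
 have bS: "b \<in> A.TF S" unfolding A.TF_iff by (rule conjI[OF A.TF_SF[OF b(1)] subset_trans[OF bsub Diff_subset]])
 have "A.co b 0 \<noteq> 0" using A.kappa_nz b(2) by (simp add: A.co_zero_eq)
 moreover have "D b = 0" by (rule D_disj[OF bS]) (use bsub in blast)
 ultimately have "D0 = 0" using Dh[OF bS] by simp
 then have "D h = 0" using Dh[OF h] by simp
 then show ?thesis by (simp add: D_def)
qed

text \<open>General sources are limits of test functions, whose means tend to \<open>0\<close> and are corrected with a fixed
function.\<close>

lemma local_maps_agree: "local_maps_agree M e1 l1 S N e2 l2 T F"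
 unfolding local_maps_agree_def
proof (intro ballI impI, elim conjE)
 fix f1 f2
 assume f1: "f1 \<in> sobolev_tilde M e1 l1 (- 1) S" and f2: "f2 \<in> sobolev_tilde N e2 l2 (- 1) T"
  and m: "mean_zero f1" "mean_zero f2" and src: "same_source M e1 l1 S N e2 l2 T F (- 1) f1 f2"
 obtain h where h: "\<forall>m. h m \<in> A.TF S" "sobolev_tendsto M e1 l1 (- 1) h f1" "sobolev_tendsto N e2 l2 (- 1) (\<lambda>m. tr (h m)) f2"
  using src unfolding same_source_def by (elim exE conjE) (rule that)
 have f: "f1 \<in> sobolev M e1 l1 (- 1)" "f2 \<in> sobolev N e2 l2 (- 1)" using f1 f2 by (simp_all add: sobolev_tilde_def)
 have hj: "h j \<in> A.TF S" for j using h(1) by (rule spec)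
 note hS = A.TF_SF[OF hj] B.TF_SF[OF tr_TF[OF hj]]
 have fd: "f1 \<in> distributions M" using f(1) by (simp add: sobolev_def)
 have f10: "f1 (e1 0) = 0" using m(1) A.mean_zero_iff[OF fd] by simp
 have eq: "A.ser (A.sol 1 f1) \<psi> = B.ser (B.sol 1 f2) (tr \<psi>)" if psi: "\<psi> \<in> A.TF S" for \<psi>
 proof (cases "S = {}")
  case True
  have "\<psi> q = 0" for q by (rule A.spt_zero) (use psi True in \<open>simp add: A.TF_iff\<close>)
  then have "\<psi> = (\<lambda>p. 0)" by (rule ext)
  moreover from this have "tr \<psi> = (\<lambda>q. 0)" by (simp add: transplant_def fun_eq_iff)
  ultimately show ?thesis by (simp add: A.ser_def B.ser_def A.co_zero_fun B.co_zero_fun)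
 next
  case False
  then obtain p where p: "p \<in> S" by blast
  obtain b where b: "b \<in> A.TF S" "(\<integral>q. b q \<partial>A.RV) \<noteq> 0"
   using A.test_function_nonzero_mean[OF opS p] by (elim exE conjE) (rule that)
  have b0: "A.co b 0 \<noteq> 0" using A.kappa_nz b(2) by (simp add: A.co_zero_eq)
  note S = A.TF_SF[OF psi] B.TF_SF[OF tr_TF[OF psi]] A.TF_SF[OF b(1)] B.TF_SF[OF tr_TF[OF b(1)]]
  have lA: "(\<lambda>j. A.pot 1 (h j) \<psi>) \<longlonglongrightarrow> A.ser (A.sol 1 f1) \<psi>"
   using A.sobolev_limit(2)[OF f(1) hS(1) h(2) S(1)] S(1) by (simp add: A.pot_def A.ser_def)
  have lB: "(\<lambda>j. B.pot 1 (tr (h j)) (tr \<psi>)) \<longlonglongrightarrow> B.ser (B.sol 1 f2) (tr \<psi>)"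
   using B.sobolev_limit(2)[OF f(2) hS(2) h(3) S(2)] S(2) by (simp add: B.pot_def B.ser_def)
  define c where "c j = A.co (h j) 0 / A.co b 0" for j
  define d where "d = A.pot 1 b \<psi> - B.pot 1 (tr b) (tr \<psi>)"
  have c0: "c \<longlonglongrightarrow> 0"
   unfolding c_def[abs_def] using tendsto_divide[OF A.sobolev_limit(1)[OF f(1) hS(1) h(2)] tendsto_const b0] f10 by simp
  have "A.pot 1 (h j) \<psi> - B.pot 1 (tr (h j)) (tr \<psi>) = c j * d" for j
  proof -
   let ?g = "\<lambda>p. h j p - c j * b p"
   have g: "?g \<in> A.TF S" by (rule A.TF_diff_cmult[OF hj b(1)])
   have "A.co ?g 0 = A.co (h j) 0 - c j * A.co b 0" unfolding A.co_diff[OF hS(1) A.SF_cmult[OF S(3)]] A.co_cmult ..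
   moreover have "c j * A.co b 0 = A.co (h j) 0" using b0 by (simp add: c_def)
   ultimately have "A.co ?g 0 = 0" by simp
   from pot_agree[OF g this psi False] show ?thesis
    unfolding tr_diff_cmult A.pot_sym[of _ _ \<psi>] B.pot_sym[of _ _ "tr \<psi>"] d_def
     A.pot_diff_cmult[OF zero_less_one S(1) hS(1) S(3)] B.pot_diff_cmult[OF zero_less_one S(2) hS(2) S(4)]
    by (simp add: algebra_simps)
  qed
  then have "(\<lambda>j. c j * d) \<longlonglongrightarrow> A.ser (A.sol 1 f1) \<psi> - B.ser (B.sol 1 f2) (tr \<psi>)"
   using tendsto_diff[OF lA lB] by simp
  moreover have "(\<lambda>j. c j * d) \<longlonglongrightarrow> 0 * d" by (rule tendsto_mult_right[OF c0])
  ultimately have "A.ser (A.sol 1 f1) \<psi> - B.ser (B.sol 1 f2) (tr \<psi>) = 0 * d" by (rule LIMSEQ_unique)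
  then show ?thesis by simp
 qed
 show "local_source_to_solution M e1 l1 S f1 = pullback_dist M F S T (local_source_to_solution N e2 l2 T f2)"
  unfolding A.local_source_to_solution_eq[OF f(1) m(1)] B.local_source_to_solution_eq[OF f(2) m(2)]
  using eq tr_TF by (simp add: restrict_dist_def pullback_dist_def fun_eq_iff)
qed

end

theorem theorem4:
  fixes M1 :: "('a::t2_space, 'n::finite) riemannian"
    and M2 :: "('b::t2_space, 'n) riemannian"
    and e1 :: "nat \<Rightarrow> 'a \<Rightarrow> real" and l1 :: "nat \<Rightarrow> real"
    and e2 :: "nat \<Rightarrow> 'b \<Rightarrow> real" and l2 :: "nat \<Rightarrow> real"
    and O1 :: "'a set" and O2 :: "'b set" and \<iota> :: "'a \<Rightarrow> 'b"
    and s :: real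
  assumes "0 < s" and "s < 1"
    and "CARD('n) \<ge> 2"
    and "closed_riemannian_manifold M1" and "closed_riemannian_manifold M2"
    and "laplace_eigenbasis M1 e1 l1" and "laplace_eigenbasis M2 e2 l2"
    and "open O1" and "open O2"
    and "diffeo_on M1 M2 O1 O2 \<iota>" and "pulls_back_metric_on M1 M2 O1 \<iota>"
    and "local_maps_agree M1 e1 l1 O1 M2 e2 l2 O2 \<iota> \<longrightarrow>
           (\<exists>\<Phi>. diffeo_on M1 M2 UNIV UNIV \<Phi> \<and> pulls_back_metric_on M1 M2 UNIV \<Phi>)"
    and "frac_maps_agree M1 e1 l1 O1 M2 e2 l2 O2 \<iota> s"
  shows "\<exists>\<Phi>. diffeo_on M1 M2 UNIV UNIV \<Phi> \<and> pulls_back_metric_on M1 M2 UNIV \<Phi>"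
proof (cases "O1 = UNIV")
 case True
 have "continuous_on UNIV \<iota>" and bij: "bij_betw \<iota> UNIV O2"
  using assms(10) True by (simp_all add: diffeo_on_def smooth_map_on_def)
 then have "compact O2"
  using compact_continuous_image[of UNIV \<iota>] assms(4) by (simp add: closed_riemannian_manifold_def bij_betw_def)
 then have "closed O2" by (rule compact_imp_closed)
 moreover have "connected (UNIV :: 'b set)" using assms(5) by (simp add: closed_riemannian_manifold_def)
 ultimately have "O2 \<inter> UNIV = {} \<or> - O2 \<inter> UNIV = {}"
  by (intro connectedD[of "UNIV :: 'b set"] assms(9) open_Compl) simp_all
 then have "O2 = {} \<or> O2 = UNIV" by auto
 then have "O2 = UNIV" using bij by (auto simp: bij_betw_def)
 then show ?thesis using assms(10,11) True by (intro exI[of _ \<iota>]) simp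
next
 case False
 have "isometric_spectra M1 M2 O1 O2 \<iota> e1 l1 e2 l2 s"
  by (intro isometric_spectra.intro isometric_pieces.intro spectral.intro closed_manifold.intro
    isometric_pieces_axioms.intro spectral_axioms.intro isometric_spectra_axioms.intro assms(1,2,4-11,13) False)
 then show ?thesis by (rule mp[OF assms(12) isometric_spectra.local_maps_agree])
qed

end
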